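(* The \textsc{Optimal Discretization} problem can be solved in time $2^{\mathcal{O}(k^2 \log k)} n^{\mathcal{O}(1)}$, where $k$ is the upper bound on the number of lines and $n$ is the number of input points.
   Context: For $a,b,c\in\mathbb{Q}$, say that $b$ is between $a$ and $c$ if $a<b<c$ or $c<b<a$. The input to \textsc{Optimal Discretization} consists of two finite sets $W_1,W_2\subseteq \mathbb{Q}\times\mathbb{Q}$ and an integer $k$; let $n=|W_1|+|W_2|$. A pair $(X,Y)$ of sets $X,Y\subseteq\mathbb{Q}$ is a separation (of $W_1$ and $W_2$) if for every $(x_1,y_1)\in W_1$ and every $(x_2,y_2)\in W_2$ there is an element of $X$ between $x_1$ and $x_2$ or an element of $Y$ between $y_1$ and $y_2$. (Geometrically: the vertical lines at $x$-coordinates in $X$ and the horizontal lines at $y$-coordinates in $Y$ partition the plane into regions whose closures never contain both a point of $W_1$ and a point of $W_2$.) The decision problem asks whether there exists a separation $(X,Y)$ with $|X|+|Y|\le k$ (and the algorithm is to decide this). *)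

theory Defs
  imports Complex_Main "HOL-Library.Landau_Symbols"
begin

section \<open>Separations\<close>

type_synonym point = "rat \<times> rat"

definition strictly_between :: "rat \<Rightarrow> rat \<Rightarrow> rat \<Rightarrow> bool" where
  "strictly_between a b c \<longleftrightarrow> (a < b \<and> b < c) \<or> (c < b \<and> b < a)"

definition separation :: "point set \<Rightarrow> point set \<Rightarrow> rat set \<Rightarrow> rat set \<Rightarrow> bool" where
  "separation W1 W2 X Y \<longleftrightarrow>
     (\<forall>(x1, y1)\<in>W1. \<forall>(x2, y2)\<in>W2.
        (\<exists>x\<in>X. strictly_between x1 x x2) \<or> (\<exists>y\<in>Y. strictly_between y1 y y2))"

definition optimal_discretization :: "point set \<Rightarrow> point set \<Rightarrow> int \<Rightarrow> bool" where
  "optimal_discretization W1 W2 k \<longleftrightarrow>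
     (\<exists>X Y. finite X \<and> finite Y \<and> separation W1 W2 X Y \<and> int (card X) + int (card Y) \<le> k)"


section \<open>Random access machines\<close>

text \<open>
  The machine is the unit-cost random access machine of Cook and Reckhow: registers hold integers,
  the arithmetic operations are addition and subtraction, and addressing may be indirect. There is
  no multiplication, so that unit cost is polynomially related to Turing machine time.
  The coordinates of the points are held in a separate read-only array of rationals. The program
  can access them only by comparing two array cells, whose indices it has computed in registers;
  such a comparison takes one step. Hence the running time can be measured in the number of points,
  independently of the sizes of numerators and denominators.

  Operands of type \<^typ>\<open>nat\<close> are register numbers, except for the last operand of the two
  jump instructions, which is a position in the program.
\<close>

datatype instr =
    LoadConst nat int
  | Add nat nat nat
  | Sub nat nat nat
  | LoadInd nat nat
  | StoreInd nat nat
  | JumpPos nat nat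
  | JumpLess nat nat nat
  | Accept
  | Reject

type_synonym program = "instr list"

datatype config = Running nat "nat \<Rightarrow> int" | Halted bool

text \<open>Cells outside of the array read as 0.\<close>

definition cell :: "rat list \<Rightarrow> int \<Rightarrow> rat" where
  "cell cs i = (if 0 \<le> i \<and> i < int (length cs) then cs ! nat i else 0)"

text \<open>
  A negative indirect address denotes register 0. A machine that runs off the end of its program
  is stuck there and never halts.
\<close>

fun exec :: "rat list \<Rightarrow> instr \<Rightarrow> nat \<Rightarrow> (nat \<Rightarrow> int) \<Rightarrow> config" where
  "exec cs (LoadConst r c) pc M = Running (Suc pc) (M(r := c))"
| "exec cs (Add r i j) pc M = Running (Suc pc) (M(r := M i + M j))"
| "exec cs (Sub r i j) pc M = Running (Suc pc) (M(r := M i - M j))"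
| "exec cs (LoadInd r i) pc M = Running (Suc pc) (M(r := M (nat (M i))))"
| "exec cs (StoreInd r i) pc M = Running (Suc pc) (M(nat (M r) := M i))"
| "exec cs (JumpPos i l) pc M = Running (if M i > 0 then l else Suc pc) M"
| "exec cs (JumpLess i j l) pc M =
     Running (if cell cs (M i) < cell cs (M j) then l else Suc pc) M"
| "exec cs Accept pc M = Halted True"
| "exec cs Reject pc M = Halted False"

fun step :: "program \<Rightarrow> rat list \<Rightarrow> config \<Rightarrow> config" where
  "step p cs (Running pc M) = (if pc < length p then exec cs (p ! pc) pc M else Running pc M)"
| "step p cs (Halted b) = Halted b"

definition halts_within :: "program \<Rightarrow> rat list \<Rightarrow> (nat \<Rightarrow> int) \<Rightarrow> bool \<Rightarrow> real \<Rightarrow> bool" where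
  "halts_within p cs M b T \<longleftrightarrow> (\<exists>t. real t \<le> T \<and> (step p cs ^^ t) (Running 0 M) = Halted b)"


section \<open>Encoding of the input\<close>

text \<open>The points of both sets are stored one after the other, each as its two coordinates.\<close>

definition input_cells :: "point list \<Rightarrow> point list \<Rightarrow> rat list" where
  "input_cells ws1 ws2 = concat (map (\<lambda>(x, y). [x, y]) (ws1 @ ws2))"

definition input_registers :: "point list \<Rightarrow> point list \<Rightarrow> int \<Rightarrow> nat \<Rightarrow> int" where
  "input_registers ws1 ws2 k =
     (\<lambda>_. 0)(0 := int (length ws1), 1 := int (length ws2), 2 := k)"

text \<open>
  The machine has to give the correct answer within the time bound \<^term>\<open>T\<close> for every order in
  which the points of the two sets are listed. The first argument of \<^term>\<open>T\<close> is the parameter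
  (with a negative \<^term>\<open>k\<close> counted as 0), the second one the number of points.
\<close>

definition solves_optimal_discretization :: "program \<Rightarrow> (nat \<Rightarrow> nat \<Rightarrow> real) \<Rightarrow> bool" where
  "solves_optimal_discretization p T \<longleftrightarrow>
     (\<forall>W1 W2 k ws1 ws2.
        distinct ws1 \<and> set ws1 = W1 \<and> distinct ws2 \<and> set ws2 = W2 \<longrightarrow>
        halts_within p (input_cells ws1 ws2) (input_registers ws1 ws2 k)
          (optimal_discretization W1 W2 k) (T (nat k) (card W1 + card W2)))"

end

theory Submission
 imports Defs
begin

text \<open>
 A vertical strip that contains only few horizontal runs of equal colour is described by coarse
 and fine slabs, which are computed greedily and do not depend on a solution. For a fixed guess of
 \<open>O(k^2)\<close> numbers below \<open>k^O(1)\<close> (in which slabs the lines lie, and how the runs next to each line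
 alternate), the positions of the lines become a binary constraint problem with \<open>O(k)\<close> variables.
 The key point is that every constraint is, up to \<open>k^O(1)\<close> exceptions, monotone: as a line moves, the
 runs of the two colours next to it only grow or shrink, and their extremal points can cross the
 position of another line only \<open>O(k^2)\<close> times.

 Such a constraint problem is solved by contracting intervals of values. Two intervals of
 different variables are red neighbours if the constraint between them is not constant. By double
 counting there is always a pair of consecutive intervals that can be merged with few new red
 neighbours, so there are at most \<open>k^O(k)\<close> red-connected choices of intervals containing a given one,
 and their feasibility is maintained in a table.

 On the machine, the algorithm is a closed term of a small language whose only loops run up to a
 common bound, so that its running time is polynomial in that bound. The bound is the number of
 guesses times the number of points.
\<close>

text \<open>Whether a line cuts the runs of a strip depends on three lines: itself and the two
  borders of the strip. The slabs make this binary. By greediness a strip meets at most two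
  consecutive coarse slabs, and a coarse slab meets a fine slab of the other direction in points of
  one colour. So where both colours alternate inside a strip and a fine row, each border governs the
  points of one colour, and the number of a point's run turns out not to depend on the other border,
  as long as both fit the guess. The obstacle: while one border moves, the fitting positions of the
  other one may jump back and forth. The remedy is to guess also the order in which runs of equal
  colour are met from the slab boundary. It fixes the number of minimal blue-red pairs in a region,
  and when red points are gained and blue ones lost, this conserved number forces all runs of the
  region to shift the same way. The order takes one number per run, strip and row, but the rows of
  one direction share at most \<open>k + 4\<close> lines, so O(k) numbers per strip and O(k^2) in
  all suffice.\<close>

notation iff (infixr "<->" 25)

section \<open>Crossing numbers of chains of runs\<close>

text \<open>The leader of run \<open>e\<close>: its point of least rank, that is, the one that
  enters first when the borders of the strip move away from the slab boundary.\<close>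

definition lead where
 "lead rk S ind e = arg_min rk (%z. z : S & ind z = e)"

text \<open>The points of one fine row on the two sides of a coarse slab boundary. \<open>rk\<close>
  orders each side by distance from that boundary, \<open>v\<close> is the coordinate along the
  strip, \<open>red e\<close> the colour of run number \<open>e\<close>. Run numbers lie strictly
  between \<open>lo\<close> and \<open>hi\<close>, and \<open>ty\<close> is the guessed order of the
  leaders.\<close>

locale two_colours =
 fixes Rd Bl :: "'p set" and v rk :: "'p => nat" and red :: "nat => bool"
  and lo hi :: nat and ty :: "nat => nat"
 assumes red_Suc: "red (Suc e) <-> ~ red e"
  and inj_Rd: "inj_on rk Rd" and inj_Bl: "inj_on rk Bl"
  and disj: "Rd Int Bl = {}" and fin_Rd: "finite Rd" and fin_Bl: "finite Bl"
begin

section \<open>States of a strip and their leaders\<close>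

definition prefix where
 "prefix A C <-> A <= C & (ALL z:A. ALL w:C. rk w < rk z --> w : A)"

text \<open>One admissible pair of borders: \<open>A\<close> and \<open>B\<close> are the points
  they enclose and \<open>ind\<close> numbers the alternating runs. Besides the range of the
  numbers, what is prescribed is the comparison of leaders within one colour.\<close>

definition state where
 "state A B ind <-> prefix A Rd & prefix B Bl & (ALL z:A Un B. lo < ind z & ind z < hi) & (ALL e. lo < e & e < hi --> (EX z:A Un B. ind z = e)) &
  (ALL z:A. red (ind z)) & (ALL z:B. ~ red (ind z)) &
  (ALL z:A Un B. ALL w:A Un B. ind z < ind w --> v z < v w) &
  (ALL e f. lo < e & e < hi & lo < f & f < hi & e ~= f & (red e <-> red f) -->
  (rk (lead rk (A Un B) ind e) < rk (lead rk (A Un B) ind f) <-> ty e < ty f))"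

lemma prefix_linear: "prefix A C ==> prefix B C ==> inj_on rk C ==> A <= B \<or> B <= A"
proof (rule ccontr)
 assume p: "prefix A C" "prefix B C" "inj_on rk C" and "~ ?thesis"
 then obtain a b where ab: "a : A" "a ~: B" "b : B" "b ~: A" by blast
 hence C: "a : C" "b : C" using p unfolding prefix_def by auto
 have "rk a ~= rk b" using ab C p(3) by (auto dest: inj_onD)
 thus False using p(1,2) ab C unfolding prefix_def by (metis linorder_neqE_nat)
qed

lemma prefix_Rd: "state A B ind ==> prefix A Rd" and prefix_Bl: "state A B ind ==> prefix B Bl" by (auto simp: state_def)

lemma ind_range: "state A B ind ==> z : A Un B ==> lo < ind z & ind z < hi" by (auto simp: state_def)

lemma ind_red: "state A B ind ==> z : A ==> red (ind z)"
 and ind_blue: "state A B ind ==> z : B ==> ~ red (ind z)" by (auto simp: state_def)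

lemma red_in: "state A B ind ==> z : A Un B ==> red (ind z) ==> z : A"
 and blue_in: "state A B ind ==> z : A Un B ==> ~ red (ind z) ==> z : B" by (auto simp: state_def)

lemma ind_less: "state A B ind ==> z : A Un B ==> w : A Un B ==> ind z < ind w ==> v z < v w" unfolding state_def by blast

lemma ind_mono: "state A B ind ==> z : A Un B ==> w : A Un B ==> v z <= v w ==> ind z <= ind w" using ind_less by (meson leD leI)

lemma lead:
 assumes "state A B ind" "lo < e" "e < hi"
 shows "lead rk (A Un B) ind e : A Un B" "ind (lead rk (A Un B) ind e) = e"
  "!!z. z : A Un B ==> ind z = e ==> rk (lead rk (A Un B) ind e) <= rk z"
proof -
 obtain z0 where z0: "z0 : A Un B & ind z0 = e" using assms unfolding state_def by blast
 note l = arg_min_nat_lemma[of "%z. z : A Un B & ind z = e" z0 rk, OF z0]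
 from l show "lead rk (A Un B) ind e : A Un B" "ind (lead rk (A Un B) ind e) = e"
  "!!z. z : A Un B ==> ind z = e ==> rk (lead rk (A Un B) ind e) <= rk z" unfolding lead_def by auto
qed

lemma lead_red: "state A B ind ==> lo < e ==> e < hi ==> red e ==> lead rk (A Un B) ind e : A"
 and lead_blue: "state A B ind ==> lo < e ==> e < hi ==> ~ red e ==> lead rk (A Un B) ind e : B" using lead red_in blue_in by metis+

lemma lead_less: "state A B ind ==> lo < e ==> e < f ==> f < hi ==>
  v (lead rk (A Un B) ind e) < v (lead rk (A Un B) ind f)" using lead[of A B ind e] lead[of A B ind f] by (auto intro!: ind_less)

lemma lead_ty: "state A B ind ==> lo < e ==> e < hi ==> lo < f ==> f < hi ==> e ~= f ==> red e <-> red f ==>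
  rk (lead rk (A Un B) ind e) < rk (lead rk (A Un B) ind f) <-> ty e < ty f" unfolding state_def by blast

lemma lead_ty_le:
 assumes "state A B ind" "lo < e" "e < hi" "lo < f" "f < hi" "red e <-> red f" "ty e <= ty f"
 shows "rk (lead rk (A Un B) ind e) <= rk (lead rk (A Un B) ind f)"
 using lead_ty[OF assms(1,4,5,2,3)] assms by (cases "e = f") (auto simp: not_less)

lemma same_colour_eq:
 assumes "state A B ind" "state A' B' ind'" "lo < e" "e < hi"
  "rk (lead rk (A Un B) ind e) = rk (lead rk (A' Un B') ind' e)"
 shows "lead rk (A Un B) ind e = lead rk (A' Un B') ind' e"
proof (cases "red e")
 case True
 thus ?thesis using lead_red[OF assms(1,3,4)] lead_red[OF assms(2,3,4)] assms(5)
  prefix_Rd[OF assms(1)] prefix_Rd[OF assms(2)] inj_Rd unfolding prefix_def by (meson inj_onD subsetD)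
next
 case False
 thus ?thesis using lead_blue[OF assms(1,3,4)] lead_blue[OF assms(2,3,4)] assms(5)
  prefix_Bl[OF assms(1)] prefix_Bl[OF assms(2)] inj_Bl unfolding prefix_def by (meson inj_onD subsetD)
qed

text \<open>Neighbouring runs of the smaller state differ in colour, so their points get different,
  increasing numbers in the larger one. Counting up from \<open>lo\<close> bounds these numbers from
  below, counting down from \<open>hi\<close> bounds them from above.\<close>

lemma nested_ind:
 assumes s1: "state A1 B1 i1" and s2: "state A2 B2 i2" and sub: "A1 <= A2" "B1 <= B2"
  and z: "z : A1 Un B1"
 shows "i1 z = i2 z"
proof -
 have colour: "i2 x ~= i2 y" if "x : A1 Un B1" "y : A1 Un B1" "red (i1 x) ~= red (i1 y)" for x y
  using that s1 s2 sub ind_red ind_blue by (metis Un_iff subsetD)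
 have up: "!!z. z : A1 Un B1 ==> i1 z = e ==> e <= i2 z" for e
 proof (induction e)
  case (Suc e)
  show ?case
  proof (cases "lo < e")
  case True
  obtain w where w: "w : A1 Un B1" "i1 w = e" using True Suc.prems s1 ind_range[OF s1 Suc.prems(1)] unfolding state_def by (metis Suc_lessD)
  have "i2 w <= i2 z" using ind_mono[OF s2, of w z] ind_less[OF s1 w(1) Suc.prems(1)] w Suc.prems sub by auto
  moreover have "i2 w ~= i2 z" using colour[OF w(1) Suc.prems(1)] w Suc.prems red_Suc by auto
  ultimately show ?thesis using Suc.IH[OF w] by linarith
  next
  case False
  thus ?thesis using ind_range[OF s2, of z] Suc.prems sub by force
  qed
 qed simp
 have down: "!!z. z : A1 Un B1 ==> hi - i1 z = e ==> i2 z <= i1 z" for e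
 proof (induction e)
  case 0
  thus ?case using ind_range[OF s1] by force
 next
  case (Suc e)
  have r: "lo < i1 z" "i1 z < hi" using ind_range[OF s1] Suc.prems by blast+
  show ?case
  proof (cases "Suc (i1 z) < hi")
  case True
  obtain w where w: "w : A1 Un B1" "i1 w = Suc (i1 z)" using True r s1 unfolding state_def by (metis less_SucI)
  have "i2 z <= i2 w" using ind_mono[OF s2, of z w] ind_less[OF s1 Suc.prems(1) w(1)] w Suc.prems sub by auto
  moreover have "i2 w ~= i2 z" using colour[OF w(1) Suc.prems(1)] w Suc.prems red_Suc by auto
  moreover have "i2 w <= i1 w" using Suc.IH[OF w(1)] w(2) Suc.prems(2) by linarith
  ultimately show ?thesis using w(2) by linarith
  next
  case False
  thus ?thesis using ind_range[OF s2, of z] Suc.prems sub by force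
  qed
 qed
 show ?thesis using up[OF z refl] down[OF z refl] by simp
qed

text \<open>A point undercutting a leader of the smaller state has smaller rank, so the prefix
  property puts it into the smaller state already.\<close>

lemma nested_lead:
 assumes s1: "state A1 B1 i1" and s2: "state A2 B2 i2" and sub: "A1 <= A2" "B1 <= B2"
  and e: "lo < e" "e < hi"
 shows "lead rk (A1 Un B1) i1 e = lead rk (A2 Un B2) i2 e"
proof -
 let ?a = "lead rk (A1 Un B1) i1 e" and ?b = "lead rk (A2 Un B2) i2 e"
 note l1 = lead[OF s1 e] and l2 = lead[OF s2 e]
 have "rk ?b <= rk ?a" using l2(3)[of ?a] l1 sub nested_ind[OF s1 s2 sub l1(1)] by auto
 moreover have "rk ?a <= rk ?b"
 proof (rule ccontr)
  assume c: "~ ?thesis"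
  have "?b : A1 Un B1"
  proof (cases "red e")
  case True
  thus ?thesis using c lead_red[OF s1 e True] lead_red[OF s2 e True]
  prefix_Rd[OF s1] prefix_Rd[OF s2] unfolding prefix_def by (meson UnI1 not_le subsetD)
  next
  case False
  thus ?thesis using c lead_blue[OF s1 e False] lead_blue[OF s2 e False]
  prefix_Bl[OF s1] prefix_Bl[OF s2] unfolding prefix_def by (meson UnI2 not_le subsetD)
  qed
  thus False using l1(3)[of ?b] nested_ind[OF s1 s2 sub, of ?b] l2(2) c by simp
 qed
 ultimately show ?thesis using same_colour_eq[OF s1 s2 e] by simp
qed

section \<open>Minimal pairs and the shift of leaders\<close>

text \<open>A pair is minimal in the strip \<open>P\<close>, \<open>Q\<close> if it is an earliest way of putting a blue point
 below a red one. The minimal pairs do not depend on the state, and they form a chain.\<close>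

definition mpairs where
 "mpairs P Q = {(b, r). b : Bl & r : Rd & v P < v b & v b < v r & v r < v Q & (ALL z:Rd. v b < v z & v z < v Q --> rk r <= rk z) &
  (ALL z:Bl. v P < v z & v z < v r --> rk b <= rk z)}"

text \<open>\<open>mpairs\<close> expressed by run numbers and \<open>ty\<close> alone; its
  cardinality is therefore the same for all states.\<close>

definition lpairs where
 "lpairs p q = {(b, r). p < b & b < r & r < q & ~ red b & red r & (ALL e. b < e & e < q & red e --> ty r <= ty e) &
  (ALL e. p < e & e < r & ~ red e --> ty b <= ty e)}"

lemma mpairs_less:
 assumes m: "(b, r) : mpairs P Q" "(b', r') : mpairs P Q" and "v b < v b'"
 shows "v r <= v b' & rk r < rk r' & rk b' < rk b"
proof -
 have 1: "rk r <= rk r'" using m assms(3) unfolding mpairs_def by auto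
 have ne: "b ~= b'" using assms(3) by auto
 have 2: "v r <= v b'"
 proof (rule ccontr)
  assume "~ ?thesis"
  hence "rk r' <= rk r" using m unfolding mpairs_def by auto
  hence "r = r'" using 1 m inj_Rd unfolding mpairs_def by (auto dest: inj_onD)
  hence "rk b = rk b'" using m assms(3) unfolding mpairs_def by (auto intro!: antisym)
  thus False using ne m inj_Bl unfolding mpairs_def by (auto dest: inj_onD)
 qed
 have "r ~= r'" using 2 m unfolding mpairs_def by auto
 hence 3: "rk r < rk r'" using 1 m inj_Rd unfolding mpairs_def by (auto dest: inj_onD simp: le_less)
 have "rk b' <= rk b" using m 2 assms(3) unfolding mpairs_def by auto
 hence "rk b' < rk b" using ne m inj_Bl unfolding mpairs_def by (auto dest: inj_onD simp: le_less)
 with 2 3 show ?thesis by simp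
qed

lemma mpairs_linear:
 assumes m: "(b, r) : mpairs P Q" "(b', r') : mpairs P Q" and "(b, r) ~= (b', r')"
 shows "v b < v b' \<or> v b' < v b"
proof (rule ccontr)
 assume "~ ?thesis"
 hence eq: "v b = v b'" by simp
 have "rk r = rk r'" using m eq unfolding mpairs_def by (auto intro!: antisym)
 hence "r = r'" using m inj_Rd unfolding mpairs_def by (auto dest: inj_onD)
 moreover have "rk b = rk b'" using m eq calculation unfolding mpairs_def by (auto intro!: antisym)
 hence "b = b'" using m inj_Bl unfolding mpairs_def by (auto dest: inj_onD)
 ultimately show False using assms by simp
qed

text \<open>Mapping runs to leaders, with \<open>ind\<close> as inverse, identifies label pairs with
  the minimal pairs present. The number of minimal pairs present thus depends on \<open>ty\<close>
  only: it is the conserved quantity behind \<open>leaders_up\<close>.\<close>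

lemma pairs_bij:
 assumes s: "state A B ind" and p: "lo < p" "red p" and q: "q < hi" "~ red q" and pq: "p < q"
 defines "L == lead rk (A Un B) ind"
 shows "bij_betw (%(b, r). (L b, L r)) (lpairs p q) (mpairs (L p) (L q) Int B \<times> A)"
proof (rule bij_betw_byWitness[where f' = "%(b, r). (ind b, ind r)"])
 note ld = lead[OF s, folded L_def]
 have subA: "A <= Rd" and subB: "B <= Bl" using prefix_Rd[OF s] prefix_Bl[OF s] unfolding prefix_def by auto
 have inner: "p < ind z & ind z < q"
  if "z : A Un B" "v (L p) < v z" "v z < v (L q)" "z : A ==> ind z ~= p" "z : B ==> ind z ~= q" for z
 proof -
  have "p <= ind z" using ind_mono[OF s _ that(1), of "L p"] ld[of p] p q pq that by auto
  moreover have "ind z <= q" using ind_mono[OF s that(1), of "L q"] ld[of q] p q pq that by auto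
  moreover have "ind z ~= p" "ind z ~= q" using that(1,4,5) ind_red[OF s, of z] ind_blue[OF s, of z] p q by auto
  ultimately show ?thesis by simp
 qed
 show "ALL a:lpairs p q. (%(b, r). (ind b, ind r)) ((%(b, r). (L b, L r)) a) = a" using ld p q by (auto simp: lpairs_def)
 show "(%(b, r). (L b, L r)) ` lpairs p q <= mpairs (L p) (L q) Int B \<times> A"
 proof clarify
  fix b r assume m: "(b, r) : lpairs p q"
  hence br: "p < b" "b < r" "r < q" "~ red b" "red r" by (auto simp: lpairs_def)
  have rg: "lo < b" "b < hi" "lo < r" "r < hi" using br p q by auto
  have inB: "L b : B" and inA: "L r : A" using lead_blue[OF s, of b] lead_red[OF s, of r] br rg unfolding L_def by auto
  have vals: "v (L p) < v (L b)" "v (L b) < v (L r)" "v (L r) < v (L q)" using lead_less[OF s] br p q unfolding L_def by auto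
  have 1: "rk (L r) <= rk z" if "z : Rd" "v (L b) < v z" "v z < v (L q)" for z
  proof (rule ccontr)
  assume c: "~ ?thesis"
  hence zA: "z : A" using prefix_Rd[OF s] inA that unfolding prefix_def by (meson not_le)
  hence rz: "red (ind z)" using ind_red[OF s] by auto
  have "b <= ind z" using ind_mono[OF s, of "L b" z] ld[of b] rg zA that by auto
  hence "b < ind z" using rz br by (cases "b = ind z") auto
  moreover have "ind z <= q" using ind_mono[OF s, of z "L q"] ld[of q] p q pq zA that by auto
  hence "ind z < q" using rz q by (cases "q = ind z") auto
  ultimately have "ty r <= ty (ind z)" "lo < ind z" "ind z < hi" using m rz rg q unfolding lpairs_def by auto
  hence "rk (L r) <= rk (L (ind z))" using lead_ty_le[OF s, of r "ind z"] rg br rz unfolding L_def by auto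
  also have "... <= rk z" using ld(3)[of "ind z" z] zA ind_range[OF s, of z] by auto
  finally show False using c by simp
  qed
  have 2: "rk (L b) <= rk z" if "z : Bl" "v (L p) < v z" "v z < v (L r)" for z
  proof (rule ccontr)
  assume c: "~ ?thesis"
  hence zB: "z : B" using prefix_Bl[OF s] inB that unfolding prefix_def by (meson not_le)
  hence rz: "~ red (ind z)" using ind_blue[OF s] by auto
  have "p <= ind z" using ind_mono[OF s, of "L p" z] ld[of p] p q pq zB that by auto
  hence "p < ind z" using rz p by (cases "p = ind z") auto
  moreover have "ind z <= r" using ind_mono[OF s, of z "L r"] ld[of r] rg zB that by auto
  hence "ind z < r" using rz br by (cases "r = ind z") auto
  ultimately have "ty b <= ty (ind z)" "lo < ind z" "ind z < hi" using m rz rg p unfolding lpairs_def by auto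
  hence "rk (L b) <= rk (L (ind z))" using lead_ty_le[OF s, of b "ind z"] rg br rz unfolding L_def by auto
  also have "... <= rk z" using ld(3)[of "ind z" z] zB ind_range[OF s, of z] by auto
  finally show False using c by simp
  qed
  show "(L b, L r) : mpairs (L p) (L q) Int B \<times> A" using inA inB vals 1 2 subA subB unfolding mpairs_def by auto
 qed
 have conv: "(ind b, ind r) : lpairs p q & L (ind b) = b & L (ind r) = r"
  if m: "(b, r) : mpairs (L p) (L q)" and bB: "b : B" and rA: "r : A" for b r
 proof -
  have vals: "v (L p) < v b" "v b < v r" "v r < v (L q)" using m unfolding mpairs_def by auto
  have col: "~ red (ind b)" "red (ind r)" using ind_blue[OF s bB] ind_red[OF s rA] by auto
  have "ind b <= ind r" using ind_mono[OF s, of b r] bB rA vals by auto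
  hence less: "ind b < ind r" using col by (cases "ind b = ind r") auto
  have "p <= ind b" using ind_mono[OF s, of "L p" b] ld[of p] p q pq bB vals by auto
  hence pb: "p < ind b" using col p by (cases "p = ind b") auto
  have "ind r <= q" using ind_mono[OF s, of r "L q"] ld[of q] p q pq rA vals by auto
  hence rq: "ind r < q" using col q by (cases "ind r = q") auto
  have rg: "lo < ind b" "ind b < hi" "lo < ind r" "ind r < hi" using ind_range[OF s, of b] ind_range[OF s, of r] bB rA by auto
  have red_case: "rk r <= rk (L e)" if "ind b < e" "e < q" "red e" for e
  proof -
  have "v b < v (L e)" using ind_less[OF s, of b "L e"] ld[of e] bB that rg q by auto
  moreover have "v (L e) < v (L q)" using lead_less[OF s, of e q] that rg q unfolding L_def by auto
  moreover have "L e : Rd" using lead_red[OF s, of e] that rg q subA unfolding L_def by auto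
  ultimately show ?thesis using m unfolding mpairs_def by auto
  qed
  have blue_case: "rk b <= rk (L e)" if "p < e" "e < ind r" "~ red e" for e
  proof -
  have "v (L e) < v r" using ind_less[OF s, of "L e" r] ld[of e] rA that rg p by auto
  moreover have "v (L p) < v (L e)" using lead_less[OF s, of p e] that rg p unfolding L_def by auto
  moreover have "L e : Bl" using lead_blue[OF s, of e] that rg p subB unfolding L_def by auto
  ultimately show ?thesis using m unfolding mpairs_def by auto
  qed
  have "rk (L (ind r)) = rk r" using red_case[of "ind r"] less rq col ld(3)[of "ind r" r] rg rA by (auto intro: antisym)
  hence Lr: "L (ind r) = r" using lead_red[OF s, of "ind r"] rg col rA subA inj_Rd unfolding L_def by (auto dest: inj_onD)
  have "rk (L (ind b)) = rk b" using blue_case[of "ind b"] less pb col ld(3)[of "ind b" b] rg bB by (auto intro: antisym)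
  hence Lb: "L (ind b) = b" using lead_blue[OF s, of "ind b"] rg col bB subB inj_Bl unfolding L_def by (auto dest: inj_onD)
  have "ty (ind r) <= ty e" if "ind b < e" "e < q" "red e" for e
  proof (rule ccontr)
  assume "~ ?thesis"
  hence "rk (L e) < rk (L (ind r))" using lead_ty[OF s, of e "ind r"] that rg q col unfolding L_def by auto
  thus False using red_case[OF that] Lr by simp
  qed
  moreover have "ty (ind b) <= ty e" if "p < e" "e < ind r" "~ red e" for e
  proof (rule ccontr)
  assume "~ ?thesis"
  hence "rk (L e) < rk (L (ind b))" using lead_ty[OF s, of e "ind b"] that rg p col unfolding L_def by auto
  thus False using blue_case[OF that] Lb by simp
  qed
  ultimately show ?thesis using Lr Lb less pb rq col unfolding lpairs_def by auto
 qed
 show "ALL a':mpairs (L p) (L q) Int B \<times> A. (%(b, r). (L b, L r)) ((%(b, r). (ind b, ind r)) a') = a'" using conv by auto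
 show "(%(b, r). (ind b, ind r)) ` (mpairs (L p) (L q) Int B \<times> A) <= lpairs p q" using conv by auto
qed

lemma card_pairs_le:
 assumes s: "state A B ind" and p: "lo < p" "red p" and q: "q < hi" "~ red q" and pq: "p < q"
  and m: "p < m" "m < q"
 defines "L == lead rk (A Un B) ind"
 shows "card {g : mpairs (L p) (L q) Int B \<times> A. v (snd g) <= v (L m)} = card {l : lpairs p q. snd l <= m}"
proof -
 note bij = pairs_bij[OF s p q pq, folded L_def]
 have key: "v (L r) <= v (L m) <-> r <= m" if "(b, r) : lpairs p q" for b r
  using lead_less[OF s, of r m] lead_less[OF s, of m r] that p q m unfolding lpairs_def L_def by (cases "r = m"; cases "r < m") auto
 have "{g : mpairs (L p) (L q) Int B \<times> A. v (snd g) <= v (L m)} =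
  (%(b, r). (L b, L r)) ` {l : lpairs p q. snd l <= m}" unfolding bij_betw_imp_surj_on[OF bij, symmetric] using key by fastforce
 moreover have "inj_on (%(b, r). (L b, L r)) {l : lpairs p q. snd l <= m}" using bij_betw_imp_inj_on[OF bij] by (rule inj_on_subset) auto
 ultimately show ?thesis by (simp add: card_image)
qed

text \<open>Minimal pairs are lost at the bottom and gained at the top, and their number is
  conserved. So the set of pairs present either stays the same or slides up a fixed chain. A change
  of the leader of \<open>x\<close> reveals the second case, and then all leaders between the ends
  move up.\<close>

lemma leaders_up:
 assumes s1: "state A1 B1 i1" and s2: "state A2 B2 i2" and A: "A1 <= A2" and B: "B2 <= B1"
  and p: "lo < p" "red p" and q: "q < hi" "~ red q"
 defines "L1 == lead rk (A1 Un B1) i1" and "L2 == lead rk (A2 Un B2) i2"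
 assumes P: "L1 p = L2 p" and Q: "L1 q = L2 q"
  and x: "p < x" "x < q" "red x" and x_min: "!!e. p < e ==> e < q ==> red e ==> ty x <= ty e"
  and ne: "L1 x ~= L2 x" and m: "p < m" "m < q"
 shows "v (L1 m) < v (L2 m)"
proof (rule ccontr)
 have pq: "p < q" using x by simp
 define G where "G = mpairs (L1 p) (L1 q)"
 define G1 where "G1 = G Int B1 \<times> A1"
 define G2 where "G2 = G Int B2 \<times> A2"
 define w1 where "w1 = v (L1 m)"
 define w2 where "w2 = v (L2 m)"
 note l1 = lead[OF s1, folded L1_def] and l2 = lead[OF s2, folded L2_def]
 note bij1 = pairs_bij[OF s1 p q pq, folded L1_def, folded G_def, folded G1_def]
 have bij2: "bij_betw (%(b, r). (L2 b, L2 r)) (lpairs p q) G2"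
  using pairs_bij[OF s2 p q pq, folded L2_def] P Q unfolding G2_def G_def by simp
 have fin: "finite G" unfolding G_def mpairs_def by (rule finite_subset[of _ "Bl \<times> Rd"]) (use fin_Bl fin_Rd in auto)
 have fin12: "finite G1" "finite G2" using fin unfolding G1_def G2_def by auto
 have rg: "lo < p" "p < hi" "lo < q" "q < hi" "lo < x" "x < hi" "lo < m" "m < hi" using p q x m by auto
 have sub: "A2 <= Rd" "B1 <= Bl" "A1 <= Rd" "B2 <= Bl" using s1 s2 unfolding state_def prefix_def by auto
 have card_eq: "card G1 = card G2" using bij1 bij2 by (metis bij_betw_same_card)
 \<comment> \<open>The leader of \<open>x\<close> is the nearest among the red points of the pairs
   present, so it can change only together with the set of these pairs.\<close>
 obtain b0 where b0: "(b0, x) : lpairs p q"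
 proof -
  have "Suc p < x" using x p red_Suc by (metis Suc_lessI)
  hence "EX e. p < e & e < x & ~ red e" using red_Suc p by blast
  then obtain b where b: "p < b & b < x & ~ red b"
  and bm: "!!e. p < e & e < x & ~ red e ==> ty b <= ty e" using ex_has_least_nat[of "%e. p < e & e < x & ~ red e" _ ty] by blast
  hence "(b, x) : lpairs p q" using x x_min unfolding lpairs_def by auto
  thus ?thesis using that by blast
 qed
 have G12: "G1 ~= G2"
 proof
  assume eq: "G1 = G2"
  have x1: "(L1 b0, L1 x) : G1" using bij1 b0 by (auto dest!: bij_betw_apply)
  have x2: "(L2 b0, L2 x) : G2" using bij2 b0 by (auto dest!: bij_betw_apply)
  have min1: "rk (L1 x) <= rk r" if br: "(b, r) : G1" for b r
  proof -
  obtain b' r' where br': "(b', r') : lpairs p q" "r = L1 r'" using bij1 br unfolding bij_betw_def by auto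
  thus ?thesis using lead_ty_le[OF s1 rg(5,6), of r'] x x_min[of r'] rg unfolding lpairs_def L1_def by auto
  qed
  have min2: "rk (L2 x) <= rk r" if br: "(b, r) : G2" for b r
  proof -
  obtain b' r' where br': "(b', r') : lpairs p q" "r = L2 r'" using bij2 br unfolding bij_betw_def by auto
  thus ?thesis using lead_ty_le[OF s2 rg(5,6), of r'] x x_min[of r'] rg unfolding lpairs_def L2_def by auto
  qed
  have "rk (L1 x) = rk (L2 x)" using min1 min2 x1 x2 eq by (auto intro!: antisym)
  thus False using ne same_colour_eq[OF s1 s2 rg(5,6)] unfolding L1_def L2_def by simp
 qed
 \<comment> \<open>A lost blue point is farther away than every remaining one, and blue ranks fall
   along the chain, so lost pairs lie below all pairs of the second state.\<close>
 have below: "g : G1 - G2 ==> g' : G2 ==> v (snd g) <= v (fst g')" for g g'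
 proof -
  assume a: "g : G1 - G2" "g' : G2"
  obtain b r b' r' where g: "g = (b, r)" "g' = (b', r')" by fastforce
  have b: "b : B1" "b ~: B2" "b' : B2" using a A unfolding g G1_def G2_def by auto
  have "rk b' <= rk b" using b prefix_Bl[OF s2] sub unfolding prefix_def by (meson not_le subsetD)
  moreover have "(b, r) : G" "(b', r') : G" "(b, r) ~= (b', r')" using a b unfolding g G1_def G2_def by auto
  ultimately show ?thesis using mpairs_linear[of b r _ _ b' r'] mpairs_less[of b r _ _ b' r'] mpairs_less[of b' r' _ _ b r]
  unfolding G_def g by fastforce
 qed
 have above: "g : G2 - G1 ==> fst g : B1 & snd g : A2 & snd g ~: A1" for g using B unfolding G1_def G2_def by auto
 have D1: "G1 - G2 ~= {}" using G12 card_eq fin12 by (metis Diff_eq_empty_iff card_subset_eq)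
 assume "~ ?thesis"
 hence w: "w2 <= w1" unfolding w1_def w2_def by simp
 \<comment> \<open>The pairs up to the leader of \<open>m\<close> are equally many in both states,
   since they correspond to the same label pairs.\<close>
 have c1: "card {g:G1. v (snd g) <= w1} = card {l : lpairs p q. snd l <= m}"
  using card_pairs_le[OF s1 p q pq, of m] m unfolding w1_def G1_def G_def L1_def by simp
 have c2: "card {g:G2. v (snd g) <= w2} = card {l : lpairs p q. snd l <= m}"
  using card_pairs_le[OF s2 p q pq, of m] m P Q unfolding w2_def G2_def G_def L2_def by simp
 have odd: "Suc p < q - 1" "~ red (Suc p)" "red (q - 1)" using p q m red_Suc red_Suc[of "q - 1"] by (cases "q = Suc (Suc p)"; force)+
 show False
 proof (cases "{g:G2. v (snd g) <= w2} = {}")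
  case True
  obtain b r where br: "(b, r) : G1 - G2" using D1 by auto
  hence b: "(b, r) : G" "b : B1" "b ~: B2" "r : A1" using A unfolding G1_def G2_def by auto
  \<comment> \<open>A lost pair shows that no remaining blue point lies between the end
    \<open>p\<close> and its red point, so the leader right above \<open>p\<close> is no lower than
    that red point.\<close>
  have noB: "z ~: B2" if "v (L1 p) < v z" "v z < v r" for z
  proof
  assume zB: "z : B2"
  hence "rk b <= rk z" using b(1) that sub unfolding G_def mpairs_def by auto
  hence "b : B2" using zB prefix_Bl[OF s2] b(2) sub inj_Bl unfolding prefix_def by (metis inj_onD le_less subsetD)
  thus False using b by simp
  qed
  have "L2 (Suc p) : B2" using lead_blue[OF s2, of "Suc p"] odd p q unfolding L2_def by auto
  moreover have "v (L1 p) < v (L2 (Suc p))" using lead_less[OF s2, of p "Suc p"] odd p q P unfolding L2_def by auto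
  ultimately have "v r <= v (L2 (Suc p))" using noB[of "L2 (Suc p)"] by force
  also have "... <= w2" using lead_less[OF s2, of "Suc p" m] m rg unfolding w2_def L2_def by (cases "m = Suc p") auto
  finally have "v r <= w1" using w by simp
  hence "(b, r) : {g:G1. v (snd g) <= w1}" using br by auto
  hence "card {g:G1. v (snd g) <= w1} ~= 0" using fin12 by auto
  thus False using c1 c2 True by simp
 next
  case False
  then obtain g2 where g2: "g2 : G2" "v (snd g2) <= w2" by auto
  define X :: "('p \<times> 'p) set" where "X = {g. v (snd g) <= w2}"
  have "v (fst g2) < v (snd g2)" using g2 unfolding G2_def G_def mpairs_def by auto
  hence D1X: "G1 - G2 <= X" using below[OF _ g2(1)] g2(2) unfolding X_def by fastforce
  have "card (G1 Int X) <= card (G2 Int X)"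
  proof -
  have "card (G1 Int X) <= card {g:G1. v (snd g) <= w1}" using fin12 w by (intro card_mono) (auto simp: X_def)
  also have "... = card (G2 Int X)" unfolding c1 c2[symmetric] X_def by (rule arg_cong[of _ _ card]) auto
  finally show ?thesis .
  qed
  moreover have "card (G1 Int X) = card (G1 - G2) + card (G1 Int G2 Int X)"
  using D1X fin12 by (subst card_Un_disjoint[symmetric]) (auto intro!: arg_cong[of _ _ card])
  moreover have "card (G2 Int X) = card ((G2 - G1) Int X) + card (G1 Int G2 Int X)"
  using fin12 by (subst card_Un_disjoint[symmetric]) (auto intro!: arg_cong[of _ _ card])
  moreover have "card (G1 - G2) = card (G2 - G1)" using card_eq fin12 by (metis Int_commute card_Diff_subset_Int finite_Int)
  ultimately have "card (G2 - G1) <= card ((G2 - G1) Int X)" by simp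
  hence sub2: "G2 - G1 <= X" using fin12 by (metis card_seteq finite_Diff inf_le1 inf.absorb_iff1)
  have "card (G2 - G1) ~= 0" using D1 fin12 \<open>card (G1 - G2) = card (G2 - G1)\<close>
  by (metis card_0_eq finite_Diff)
  then obtain b r where br: "(b, r) : G2 - G1" by (metis card.empty equals0I surj_pair)
  hence r: "(b, r) : G" "r ~: A1" "v r <= w2" using above[OF br] sub2 unfolding G2_def X_def by auto
  \<comment> \<open>Dually, a gained pair shows that the first state has no red point between its
    blue point and the end \<open>q\<close>, so no leader of that state between the ends exceeds
    this blue point.\<close>
  have noA: "z ~: A1" if "v b < v z" "v z < v (L1 q)" for z
  proof
  assume zA: "z : A1"
  hence "rk r <= rk z" using r(1) that sub unfolding G_def mpairs_def by auto
  moreover have "r : Rd" using r(1) unfolding G_def mpairs_def by auto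
  ultimately have "r : A1" using zA prefix_Rd[OF s1] sub inj_Rd unfolding prefix_def by (metis inj_onD le_less subsetD)
  thus False using r by simp
  qed
  have "L1 (q - 1) : A1" using lead_red[OF s1, of "q - 1"] odd p q unfolding L1_def by auto
  moreover have "v (L1 (q - 1)) < v (L1 q)" using lead_less[OF s1, of "q - 1" q] odd p q unfolding L1_def by auto
  ultimately have "v (L1 (q - 1)) <= v b" using noA[of "L1 (q - 1)"] by force
  moreover have "w1 <= v (L1 (q - 1))" using lead_less[OF s1, of m "q - 1"] m rg unfolding w1_def L1_def by (cases "m = q - 1") force+
  moreover have "v b < v r" using r(1) unfolding G_def mpairs_def by auto
  ultimately show False using w r by simp
 qed
qed

lemma swap: "two_colours Bl Rd rk (%e. ~ red e)" by unfold_locales (use red_Suc inj_Rd inj_Bl disj fin_Rd fin_Bl in auto)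

lemma swap_state: "two_colours.state Bl Rd v rk (%e. ~ red e) lo hi ty B A ind <-> state A B ind"
 unfolding two_colours.state_def[OF swap] state_def two_colours.prefix_def[OF swap] prefix_def Un_commute[of B A] by auto

text \<open>\<open>leaders_up\<close> with both the colours and the two states exchanged.\<close>

lemma leaders_down:
 assumes s1: "state A1 B1 i1" and s2: "state A2 B2 i2" and A: "A1 <= A2" and B: "B2 <= B1"
  and p: "lo < p" "~ red p" and q: "q < hi" "red q"
 defines "L1 == lead rk (A1 Un B1) i1" and "L2 == lead rk (A2 Un B2) i2"
 assumes P: "L1 p = L2 p" and Q: "L1 q = L2 q"
  and x: "p < x" "x < q" "~ red x" and x_min: "!!e. p < e ==> e < q ==> ~ red e ==> ty x <= ty e"
  and ne: "L1 x ~= L2 x" and m: "p < m" "m < q"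
 shows "v (L2 m) < v (L1 m)" using two_colours.leaders_up[OF swap, of v lo hi ty B2 A2 i2 B1 A1 i1 p q x m] assms
 by (auto simp: swap_state Un_commute)

text \<open>Without a red end, the leader of \<open>x\<close> is simply the nearest red point
  between the two ends: a nearer one would belong to the prefix \<open>A\<close> and carry a number
  in the range. This description does not mention the state.\<close>

lemma lead_red_const:
 assumes s1: "state A1 B1 i1" and s2: "state A2 B2 i2"
  and p: "lo <= p" "lo < p ==> ~ red p" and q: "q <= hi" "q < hi ==> ~ red q"
 defines "L1 == lead rk (A1 Un B1) i1" and "L2 == lead rk (A2 Un B2) i2"
 assumes P: "lo < p ==> L1 p = L2 p" and Q: "q < hi ==> L1 q = L2 q"
  and x: "p < x" "x < q" "red x" and x_min: "!!e. p < e ==> e < q ==> red e ==> ty x <= ty e"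
 shows "L1 x = L2 x"
proof -
 define Z where "Z = {z:Rd. (lo < p --> v (L1 p) < v z) & (q < hi --> v z < v (L1 q))}"
 have rg: "lo < x" "x < hi" using x p q by auto
 have main: "lead rk (A Un B) ind x : Z & (ALL z:Z. rk (lead rk (A Un B) ind x) <= rk z)"
  if s: "state A B ind" and P: "lo < p ==> L1 p = lead rk (A Un B) ind p"
  and Q: "q < hi ==> L1 q = lead rk (A Un B) ind q" for A B ind
 proof -
  let ?L = "lead rk (A Un B) ind"
  note l = lead[OF s]
  have LA: "?L x : A" by (rule lead_red[OF s rg x(3)])
  have sub: "A <= Rd" using prefix_Rd[OF s] unfolding prefix_def by auto
  have "?L x : Z" using LA sub lead_less[OF s _ x(1) rg(2)] lead_less[OF s rg(1) x(2)] P Q unfolding Z_def by auto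
  moreover have "rk (?L x) <= rk z" if z: "z : Z" for z
  proof (rule ccontr)
  assume c: "~ ?thesis"
  have zA: "z : A" using c z LA prefix_Rd[OF s] unfolding prefix_def Z_def by (auto simp: not_le)
  hence r: "red (ind z)" "lo < ind z" "ind z < hi" using ind_red[OF s] ind_range[OF s] by auto
  have "p < ind z"
  proof (cases "lo < p")
  case True
  hence "p <= ind z" using ind_mono[OF s, of "?L p" z] l[of p] x rg zA z P unfolding Z_def by auto
  thus ?thesis using r p(2)[OF True] by (cases "p = ind z") auto
  qed (use r p in auto)
  moreover have "ind z < q"
  proof (cases "q < hi")
  case True
  hence "ind z <= q" using ind_mono[OF s, of z "?L q"] l[of q] x rg zA z Q unfolding Z_def by auto
  thus ?thesis using r q(2)[OF True] by (cases "q = ind z") auto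
  qed (use r q in auto)
  ultimately have "rk (?L x) <= rk (?L (ind z))" using lead_ty_le[OF s rg, of "ind z"] x_min[of "ind z"] r x by auto
  also have "... <= rk z" using l(3)[of "ind z" z] r zA by auto
  finally show False using c by simp
  qed
  ultimately show ?thesis by blast
 qed
 have "rk (L1 x) = rk (L2 x)" using main[OF s1] main[OF s2] P Q unfolding L1_def L2_def by (auto intro!: antisym)
 thus ?thesis using same_colour_eq[OF s1 s2 rg] unfolding L1_def L2_def by simp
qed

lemma lead_blue_const:
 assumes s1: "state A1 B1 i1" and s2: "state A2 B2 i2"
  and p: "lo <= p" "lo < p ==> red p" and q: "q <= hi" "q < hi ==> red q"
 defines "L1 == lead rk (A1 Un B1) i1" and "L2 == lead rk (A2 Un B2) i2"
 assumes P: "lo < p ==> L1 p = L2 p" and Q: "q < hi ==> L1 q = L2 q"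
  and x: "p < x" "x < q" "~ red x" and x_min: "!!e. p < e ==> e < q ==> ~ red e ==> ty x <= ty e"
 shows "L1 x = L2 x" using two_colours.lead_red_const[OF swap, of v lo hi ty B1 A1 i1 B2 A2 i2 p q x] assms
 by (auto simp: swap_state Un_commute)

end

text \<open>One border moves monotonically, so \<open>A\<close> grows; \<open>B\<close> comes from
  an arbitrary fitting position of the other border at each moment.\<close>

locale chain = two_colours +
 fixes A B :: "nat => 'a set" and ind :: "nat => 'a => nat" and c :: nat
 assumes state: "i < c ==> state (A i) (B i) (ind i)"
  and A_mono: "i <= j ==> j < c ==> A i <= A j"
begin

section \<open>Threshold crossings along a chain\<close>

definition "L i = lead rk (A i Un B i) (ind i)"

text \<open>Prefixes are comparable. If \<open>B\<close> grows together with \<open>A\<close>, the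
  states are nested and nothing changes; so every change of a run number or of a leader comes with
  shrinking \<open>B\<close>.\<close>

lemma nested_or:
 assumes "i <= j" "j < c"
 shows "(ALL e. lo < e & e < hi --> L i e = L j e) & (ALL z:A i. ind i z = ind j z) \<or> B j <= B i"
proof (cases "B i <= B j")
 case True
 have "i < c" using assms by simp
 thus ?thesis using nested_lead[OF state state A_mono[OF assms] True]
  nested_ind[OF state state A_mono[OF assms] True] assms unfolding L_def by auto
next
 case False
 thus ?thesis using prefix_linear[OF prefix_Bl prefix_Bl inj_Bl, OF state state, of i j] assms by auto
qed

text \<open>From the first failure of \<open>P\<close> to its last success everything lies in one
  block, where \<open>inner\<close> counts; beyond these two positions \<open>P\<close> switches
  only right next to them.\<close>

lemma chg_bound:
 fixes N :: "nat => 'b"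
 assumes block: "!!i j. i0 <= i ==> i < j ==> j <= i1 ==> P j ==> ~ P i ==> N i = N j"
  and contig: "!!i j l. i0 <= i ==> i <= j ==> j <= l ==> l <= i1 ==> N i = N l ==> N i = N j"
  and inner: "!!j0 j1. i0 <= j0 ==> j0 <= j1 ==> j1 <= i1 ==> (!!i. j0 <= i ==> i <= j1 ==> N i = N j0) ==>
  card {i. j0 <= i & i < j1 & P i ~= P (Suc i)} <= F" shows "card {i. i0 <= i & i < i1 & P i ~= P (Suc i)} <= F + 2" proof -
 let ?C = "{i. i0 <= i & i < i1 & P i ~= P (Suc i)}"
 show ?thesis
 proof (cases "EX i j. i0 <= i & i < j & j <= i1 & ~ P i & P j")
  case True
  define j0 where "j0 = (LEAST i. i0 <= i & ~ P i)"
  define j1 where "j1 = (GREATEST j. j <= i1 & P j)"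
  obtain i j where ij: "i0 <= i" "i < j" "j <= i1" "~ P i" "P j" using True by blast
  have j0a: "i0 <= j0 & ~ P j0" unfolding j0_def by (rule LeastI[of _ i]) (use ij in auto)
  have j0b: "j0 <= l" if "i0 <= l & ~ P l" for l unfolding j0_def by (rule Least_le) (use that in auto)
  have j0: "i0 <= j0" "~ P j0" "j0 <= i" "!!l. i0 <= l ==> l < j0 ==> P l" using j0a j0b[of i] ij j0b by (auto simp: not_le[symmetric])
  have j1a: "j1 <= i1 & P j1" unfolding j1_def by (rule GreatestI_nat[of _ j i1]) (use ij in auto)
  have j1b: "l <= j1" if "l <= i1 & P l" for l unfolding j1_def by (rule Greatest_le_nat[of _ l i1]) (use that in auto)
  have j1: "j1 <= i1" "P j1" "j <= j1" "!!l. l <= i1 ==> j1 < l ==> ~ P l" using j1a j1b[of j] ij j1b by (auto simp: not_less[symmetric])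
  have less: "j0 < j1" using j0 j1 ij by simp
  have "N j0 = N j1" using block[of j0 j1] j0 j1 less by simp
  hence "card {i. j0 <= i & i < j1 & P i ~= P (Suc i)} <= F"
  proof (intro inner)
  show "N i = N j0" if "j0 <= i" "i <= j1" for i using contig[of j0 i j1] j0(1) j1(1) that \<open>N j0 = N j1\<close> by simp
  qed (use j0 j1 less in auto)
  moreover have "?C <= {i. j0 <= i & i < j1 & P i ~= P (Suc i)} Un {j0 - 1, j1}" using j0 j1 by fastforce
  hence "card ?C <= card ({i. j0 <= i & i < j1 & P i ~= P (Suc i)} Un {j0 - 1, j1})" by (intro card_mono) auto
  moreover have "... <= card {i. j0 <= i & i < j1 & P i ~= P (Suc i)} + card {j0 - 1, j1}" by (rule card_Un_le)
  moreover have "card {j0 - 1, j1} <= 2" by (simp add: card_insert_if)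
  ultimately show ?thesis by linarith
 next
  case False
  have "?C <= {i. i0 <= i & i < i1 & P i & ~ P (Suc i)}" using False by (auto intro: lessI)
  moreover have "card {i. i0 <= i & i < i1 & P i & ~ P (Suc i)} <= 1"
  proof (rule card_le_Suc0_iff_eq[THEN iffD2, unfolded One_nat_def[symmetric]])
  show "ALL a1:{i. i0 <= i & i < i1 & P i & ~ P (Suc i)}. ALL a2:{i. i0 <= i & i < i1 & P i & ~ P (Suc i)}. a1 = a2"
  proof (intro ballI)
  have "~ a < b" if "i0 <= a" "~ P (Suc a)" "b < i1" "P b" for a b using False that by (metis Suc_leI le_SucI le_less less_imp_le)
  thus "a = b" if "a : {i. i0 <= i & i < i1 & P i & ~ P (Suc i)}"
  "b : {i. i0 <= i & i < i1 & P i & ~ P (Suc i)}" for a b using that by (metis (mono_tags, lifting) linorder_neqE_nat mem_Collect_eq)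
  qed
  qed simp
  moreover have "finite {i. i0 <= i & i < i1 & P i & ~ P (Suc i)}" by simp
  ultimately have "card ?C <= 1" using card_mono by (metis (no_types, lifting) order_trans)
  thus ?thesis by simp
 qed
qed

text \<open>Between two labels whose leaders are constant, a fixed threshold is crossed rarely: if one end
 is red and the other one blue, the strip splits into blocks along the chain, and the leaders of
 different blocks are ordered.\<close>

lemma leader_changes:
 assumes "lo <= p" "p < m" "m < q" "q <= hi" "i0 <= i1" "i1 < c"
  and "!!i. lo < p ==> i0 <= i ==> i <= i1 ==> L i p = L i0 p"
  and "!!i. q < hi ==> i0 <= i ==> i <= i1 ==> L i q = L i0 q"
 shows "card {i. i0 <= i & i < i1 & (v (L i m) < M) ~= (v (L (Suc i) m) < M)} <= 2 * (q - p)" using assms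
proof (induction "q - p" arbitrary: p q i0 i1 rule: less_induct)
 case less
 note pq = less.prems
 have ends: "L i p = L j p" if "lo < p" "i0 <= i" "i <= i1" "i0 <= j" "j <= i1" for i j using pq(7) that by metis
 have ends': "L i q = L j q" if "q < hi" "i0 <= i" "i <= i1" "i0 <= j" "j <= i1" for i j using pq(8) that by metis
 let ?C = "%j0 j1. card {i. j0 <= i & i < j1 & (v (L i m) < M) ~= (v (L (Suc i) m) < M)}"
 \<comment> \<open>A run \<open>x\<close> with constant leader can replace one end of the region,
   leaving a shorter one that still contains \<open>m\<close>, unless \<open>m\<close> is
   \<open>x\<close> itself and nothing changes.\<close>
 have halves: "?C j0 j1 <= 2 * (q - p - 1)"
  if x: "p < x" "x < q" and j: "i0 <= j0" "j0 <= j1" "j1 <= i1"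
  and xc: "ALL i. j0 <= i & i <= j1 --> L i x = L j0 x" for x j0 j1
 proof (cases m x rule: linorder_cases)
  case less
  have "?C j0 j1 <= 2 * (x - p)"
  proof (rule less.hyps)
  show "L i p = L j0 p" if "lo < p" "j0 <= i" "i <= j1" for i using ends[of i j0] that j by linarith
  show "L i x = L j0 x" if "x < hi" "j0 <= i" "i <= j1" for i using xc that by blast
  qed (use x pq(1-6) j less in linarith)+
  thus ?thesis using x by simp
 next
  case equal
  have "L i x = L (Suc i) x" if "j0 <= i" "i < j1" for i using xc that by (metis Suc_leI le_SucI less_imp_le)
  hence "{i. j0 <= i & i < j1 & (v (L i m) < M) ~= (v (L (Suc i) m) < M)} = {}" unfolding equal by auto
  thus ?thesis by (simp only: card.empty)
 next
  case greater
  have "?C j0 j1 <= 2 * (q - x)"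
  proof (rule less.hyps)
  show "L i q = L j0 q" if "q < hi" "j0 <= i" "i <= j1" for i using ends'[of i j0] that j by linarith
  show "L i x = L j0 x" if "lo < x" "j0 <= i" "i <= j1" for i using xc that by blast
  qed (use x pq(1-6) j greater in linarith)+
  thus ?thesis using x by simp
 qed
 have split: ?case if x: "p < x" "x < q" and xc: "ALL i. i0 <= i & i <= i1 --> L i x = L i0 x" for x
  using halves[OF x order_refl pq(5) order_refl xc] by simp
 \<comment> \<open>If the leader of \<open>x\<close> varies, its blocks have all their leaders
   ordered in one direction. Crossing back happens inside one block only, so the recursion adds 2
   while the region shrinks by at least one run: hence twice \<open>q - p\<close>.\<close>
 have blocks: ?case
  if x: "p < x" "x < q"
  and dir: "(ALL i j. i0 <= i & i < j & j <= i1 & L i x ~= L j x --> (ALL m. p < m & m < q --> v (L i m) < v (L j m))) \<or>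
  (ALL i j. i0 <= i & i < j & j <= i1 & L i x ~= L j x --> (ALL m. p < m & m < q --> v (L j m) < v (L i m)))" for x proof -
  have contig: "L i x = L j x" if "i0 <= i" "i <= j" "j <= l" "l <= i1" "L i x = L l x" for i j l
  proof (rule ccontr)
  assume n: "L i x ~= L j x"
  hence "i < j" "j < l" using that by (auto simp: le_less)
  moreover have "L j x ~= L l x" using n that by simp
  moreover have "j <= i1" "i0 <= j" using that by auto
  ultimately have "v (L i x) < v (L j x) & v (L j x) < v (L l x) \<or> v (L j x) < v (L i x) & v (L l x) < v (L j x)"
  using dir n that(1,4) x by blast
  thus False using that by auto
  qed
  have "?C i0 i1 <= 2 * (q - p - 1) + 2" using dir
  proof
  assume d: "ALL i j. i0 <= i & i < j & j <= i1 & L i x ~= L j x --> (ALL m. p < m & m < q --> v (L i m) < v (L j m))"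
  show ?thesis
  proof (rule chg_bound[where N = "%i. L i x"])
  show "L i x = L j x" if "i0 <= i" "i < j" "j <= i1" "v (L j m) < M" "~ v (L i m) < M" for i j
  proof (rule ccontr)
  assume "L i x ~= L j x"
  hence "v (L i m) < v (L j m)" using d that(1-3) pq(2,3) by blast
  thus False using that by linarith
  qed
  show "L i x = L j x" if "i0 <= i" "i <= j" "j <= l" "l <= i1" "L i x = L l x" for i j l by (rule contig[OF that])
  show "?C j0 j1 <= 2 * (q - p - 1)" if "i0 <= j0" "j0 <= j1" "j1 <= i1"
  "!!i. j0 <= i ==> i <= j1 ==> L i x = L j0 x" for j0 j1 by (rule halves[OF x that(1-3)]) (use that(4) in blast)
  qed
  next
  assume d: "ALL i j. i0 <= i & i < j & j <= i1 & L i x ~= L j x --> (ALL m. p < m & m < q --> v (L j m) < v (L i m))"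
  have "card {i. i0 <= i & i < i1 & (~ v (L i m) < M) ~= (~ v (L (Suc i) m) < M)} <= 2 * (q - p - 1) + 2"
  proof (rule chg_bound[where N = "%i. L i x"])
  show "L i x = L j x" if "i0 <= i" "i < j" "j <= i1" "~ v (L j m) < M" "~ ~ v (L i m) < M" for i j
  proof (rule ccontr)
  assume "L i x ~= L j x"
  hence "v (L j m) < v (L i m)" using d that(1-3) pq(2,3) by blast
  thus False using that by linarith
  qed
  show "L i x = L j x" if "i0 <= i" "i <= j" "j <= l" "l <= i1" "L i x = L l x" for i j l by (rule contig[OF that])
  show "card {i. j0 <= i & i < j1 & (~ v (L i m) < M) ~= (~ v (L (Suc i) m) < M)} <= 2 * (q - p - 1)"
  if "i0 <= j0" "j0 <= j1" "j1 <= i1"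
  "!!i. j0 <= i ==> i <= j1 ==> L i x = L j0 x" for j0 j1
  proof -
  have "((~ a) ~= (~ b)) = (a ~= b)" for a b :: bool by blast
  thus ?thesis using halves[OF x that(1-3)] that(4) by presburger
  qed
  qed
  moreover have "((~ a) ~= (~ b)) = (a ~= b)" for a b :: bool by blast
  ultimately show ?thesis by presburger
  qed
  thus ?thesis using x by simp
 qed
 have least: "EX x. p < x & x < q & red x = b & (ALL e. p < e --> e < q --> red e = b --> ty x <= ty e)"
  if "p < e" "e < q" "red e = b" for e b using ex_has_least_nat[of "%e. p < e & e < q & red e = b" e ty] that by blast
 have cst: "i < c" if "i <= i1" for i using that pq by simp
 \<comment> \<open>An end at \<open>lo\<close> or \<open>hi\<close> has no leader and may be counted
   with either colour, so four combinations remain.\<close>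
 consider (R) x where "lo < p ==> ~ red p" "q < hi ==> ~ red q" "p < x" "x < q" "red x"
  | (B) x where "lo < p ==> red p" "q < hi ==> red q" "p < x" "x < q" "~ red x"
  | (up) x where "lo < p" "red p" "q < hi" "~ red q" "p < x" "x < q" "red x"
  | (down) x where "lo < p" "~ red p" "q < hi" "red q" "p < x" "x < q" "~ red x"
 proof -
  have p1: "p < Suc p" "Suc p < q" "red (Suc p) ~= red p" using pq red_Suc by auto
  have q1: "p < q - 1" "q - 1 < q" "red (q - 1) ~= red q" using pq red_Suc[of "q - 1"] by auto
  show ?thesis
  proof (cases "red p")
  case True
  thus ?thesis using p1 q1 R[of "q - 1"] R[of "Suc p"] B[of "Suc p"] B[of "q - 1"] up[of "q - 1"]
  by (cases "lo < p"; cases "q < hi"; cases "red q"; blast)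
  next
  case False
  thus ?thesis using p1 q1 R[of "q - 1"] R[of "Suc p"] B[of "Suc p"] B[of "q - 1"] down[of "q - 1"]
  by (cases "lo < p"; cases "q < hi"; cases "red q"; blast)
  qed
 qed
 thus ?case
 proof cases
  case (R x0)
  then obtain x where x: "p < x" "x < q" "red x" "!!e. p < e ==> e < q ==> red e ==> ty x <= ty e" using least[of x0 True] by auto
  have "L i x = L i0 x" if i: "i0 <= i" "i <= i1" for i
  using lead_red_const[OF state[OF cst[OF i(2)]] state[OF cst[OF pq(5)]] pq(1) R(1) pq(4) R(2)
  ends[OF _ i order_refl pq(5), unfolded L_def] ends'[OF _ i order_refl pq(5), unfolded L_def] x] unfolding L_def by blast
  thus ?thesis using split[OF x(1,2)] by blast
 next
  case (B x0)
  then obtain x where x: "p < x" "x < q" "~ red x" "!!e. p < e ==> e < q ==> ~ red e ==> ty x <= ty e" using least[of x0 False] by auto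
  have "L i x = L i0 x" if i: "i0 <= i" "i <= i1" for i
  using lead_blue_const[OF state[OF cst[OF i(2)]] state[OF cst[OF pq(5)]] pq(1) B(1) pq(4) B(2)
  ends[OF _ i order_refl pq(5), unfolded L_def] ends'[OF _ i order_refl pq(5), unfolded L_def] x] unfolding L_def by blast
  thus ?thesis using split[OF x(1,2)] by blast
 next
  case (up x0)
  then obtain x where x: "p < x" "x < q" "red x" "!!e. p < e ==> e < q ==> red e ==> ty x <= ty e" using least[of x0 True] by auto
  have "v (L i m) < v (L j m)" if ij: "i0 <= i" "i < j" "j <= i1" "L i x ~= L j x" and m: "p < m" "m < q" for i j m
  proof -
  have le: "i <= j" "j < c" "i < c" "i <= i1" "i0 <= j" using ij cst by auto
  have "lo < x" "x < hi" using x pq(1,4) by auto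
  hence B: "B j <= B i" using nested_or[OF le(1,2)] ij by auto
  show ?thesis using leaders_up[OF state[OF le(3)] state[OF le(2)] A_mono[OF le(1,2)] B up(1-4)
  ends[OF up(1) ij(1) le(4,5) ij(3), unfolded L_def] ends'[OF up(3) ij(1) le(4,5) ij(3), unfolded L_def]
  x ij(4)[unfolded L_def] m] unfolding L_def .
  qed
  thus ?thesis by (intro blocks[OF x(1,2)]) blast
 next
  case (down x0)
  then obtain x where x: "p < x" "x < q" "~ red x" "!!e. p < e ==> e < q ==> ~ red e ==> ty x <= ty e" using least[of x0 False] by auto
  have "v (L j m) < v (L i m)" if ij: "i0 <= i" "i < j" "j <= i1" "L i x ~= L j x" and m: "p < m" "m < q" for i j m
  proof -
  have le: "i <= j" "j < c" "i < c" "i <= i1" "i0 <= j" using ij cst by auto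
  have "lo < x" "x < hi" using x pq(1,4) by auto
  hence B: "B j <= B i" using nested_or[OF le(1,2)] ij by auto
  show ?thesis using leaders_down[OF state[OF le(3)] state[OF le(2)] A_mono[OF le(1,2)] B down(1-4)
  ends[OF down(1) ij(1) le(4,5) ij(3), unfolded L_def] ends'[OF down(3) ij(1) le(4,5) ij(3), unfolded L_def]
  x ij(4)[unfolded L_def] m] unfolding L_def .
  qed
  thus ?thesis by (intro blocks[OF x(1,2)]) blast
 qed
qed

end

text \<open>Outside \<open>D\<close> the property can only be lost, and two losses need a recovery,
  hence an element of \<open>D\<close>, between them.\<close>

lemma few_changes:
 fixes P :: "nat => bool"
 assumes fin: "finite D" and stay: "!!i j. i < j ==> j < c ==> (!!l. i <= l ==> l < j ==> l ~: D) ==> ~ P i ==> ~ P j"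
 shows "card {i. Suc i < c & P i ~= P (Suc i)} <= 2 * card D + 1"
proof -
 define T where "T = {i. Suc i < c & i ~: D & P i & ~ P (Suc i)}"
 have finT: "finite T" unfolding T_def by (rule finite_subset[of _ "{..<c}"]) auto
 have "{i. Suc i < c & P i ~= P (Suc i)} <= D Un T"
 proof
  fix i assume i: "i : {i. Suc i < c & P i ~= P (Suc i)}"
  have "l = i" if "i <= l" "l < Suc i" for l using that by simp
  thus "i : D Un T" using i stay[of i "Suc i"] unfolding T_def by blast
 qed
 hence "card {i. Suc i < c & P i ~= P (Suc i)} <= card D + card T" using fin finT by (meson card_Un_le card_mono finite_UnI order_trans)
 moreover have "card T <= card D + 1"
 proof (cases "T = {}")
  case False
  have next_D: "EX d:D. i < d & d < j" if "i : T" "j : T" "i < j" for i j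
  proof (rule ccontr)
  assume "~ ?thesis"
  hence "l ~: D" if "Suc i <= l" "l < j" for l using that by (meson Suc_le_lessD)
  hence "~ P j" using stay[of "Suc i" j] that unfolding T_def by (cases "Suc i = j") auto
  thus False using that unfolding T_def by simp
  qed
  define f where "f i = (LEAST d. d : D & i < d)" for i
  have f: "f i : D & i < f i & (ALL j:T. i < j --> f i < j)" if "i : T - {Max T}" for i
  proof -
  have m: "i < Max T" "Max T : T" "i : T" using that finT False by (auto simp: le_neq_trans)
  obtain d where "d : D & i < d" using next_D[OF m(3,2,1)] by blast
  hence "f i : D & i < f i" unfolding f_def by (rule LeastI)
  moreover have "f i < j" if j: "j : T" "i < j" for j
  proof -
  have "i : T" using \<open>i : T - {Max T}\<close> by simp
  then obtain d where "d : D" "i < d" "d < j" using next_D[OF _ j] by blast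
  thus ?thesis unfolding f_def using Least_le[of "%d. d : D & i < d" d] by simp
  qed
  ultimately show ?thesis by blast
  qed
  have "inj_on f (T - {Max T})"
  proof (rule inj_onI, rule ccontr)
  fix i j assume ij: "i : T - {Max T}" "j : T - {Max T}" "f i = f j" "i ~= j"
  thus False using f[OF ij(1)] f[OF ij(2)] by (metis DiffD1 linorder_neqE_nat order.asym)
  qed
  hence "card (T - {Max T}) <= card D" using fin f by (intro card_inj_on_le[of f]) auto
  thus ?thesis using finT False by simp
 qed simp
 ultimately show ?thesis by simp
qed

context chain
begin

definition "side M = {i. Suc i < c & (EX m. lo < m & m < hi & (v (L i m) < M) ~= (v (L (Suc i) m) < M))}"

lemma card_side: "card (side M) <= 2 * hi * hi" and finite_side: "finite (side M)"
proof -
 have eq: "side M = (UN m:{lo<..<hi}. {i. 0 <= i & i < c - 1 & (v (L i m) < M) ~= (v (L (Suc i) m) < M)})" unfolding side_def by auto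
 show "finite (side M)" unfolding side_def by (rule finite_subset[of _ "{..<c}"]) auto
 have "card {i. 0 <= i & i < c - 1 & (v (L i m) < M) ~= (v (L (Suc i) m) < M)} <= 2 * hi"
  if "m : {lo<..<hi}" for m
 proof (cases "c = 0")
  case False
  hence "card {i. 0 <= i & i < c - 1 & (v (L i m) < M) ~= (v (L (Suc i) m) < M)} <= 2 * (hi - lo)" using that by (intro leader_changes) auto
  thus ?thesis by simp
 qed simp
 hence "card (side M) <= (SUM m:{lo<..<hi}. 2 * hi)" unfolding eq by (intro order_trans[OF card_UN_le] sum_mono) auto
 also have "... <= hi * (2 * hi)" by simp
 finally show "card (side M) <= 2 * hi * hi" by (simp add: mult.commute mult.left_commute)
qed

lemma same_side:
 assumes "i <= j" "j < c" "!!l. i <= l ==> l < j ==> l ~: side M" "lo < m" "m < hi"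
 shows "v (L i m) < M <-> v (L j m) < M" using assms(1,2,3)
proof (induction rule: dec_induct)
 case (step k)
 hence "k ~: side M" by auto
 thus ?case using step assms(4,5) unfolding side_def by auto
qed simp

text \<open>Away from the positions at which a leader passes the threshold, the topmost (or lowest) red
 point of a group of runs passes it at most once.\<close>

lemma top_changes:
 "card {i. Suc i < c & (ALL z:A i. ind i z <= e --> v z < M) ~= (ALL z:A (Suc i). ind (Suc i) z <= e --> v z < M)}
  <= 4 * hi * hi + 1" (is "card {i. Suc i < c & ?P i ~= ?P (Suc i)} <= _") proof -
 have "card {i. Suc i < c & ?P i ~= ?P (Suc i)} <= 2 * card (side M) + 1"
 proof (rule few_changes[OF finite_side])
  fix i j assume ij: "i < j" "j < c" and no: "!!l. i <= l ==> l < j ==> l ~: side M"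
  and n: "~ ?P i"
  have le: "i <= j" "i < c" using ij by auto
  note si = state[OF le(2)] and sj = state[OF ij(2)]
  have same: "v (L i m) < M <-> v (L j m) < M" if "lo < m" "m < hi" for m using same_side[OF le(1) ij(2)] no that by blast
  obtain z where z: "z : A i" "ind i z <= e" "M <= v z" using n by (auto simp: not_less)
  have zj: "z : A j" using z A_mono[OF le(1) ij(2)] by auto
  show "~ ?P j"
  proof (cases "ind j z <= e")
  case True
  thus ?thesis using zj z(3) by (auto simp: not_less intro!: bexI[of _ z])
  next
  case False
  \<comment> \<open>The number of \<open>z\<close> has changed, so the states are not nested and
    \<open>B\<close> has shrunk.\<close>
  hence B: "B j <= B i" using nested_or[OF le(1) ij(2)] z by auto
  define r where "r = ind i z"
  have r: "lo < r" "r < hi" "red r" using ind_range[OF si] ind_red[OF si] z unfolding r_def by auto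
  have "r < ind j z" using False z unfolding r_def by simp
  moreover have "ind j z ~= Suc r" using ind_red[OF sj zj] r red_Suc by metis
  ultimately have rj: "Suc r < ind j z" by simp
  have rh: "Suc r < hi" using rj ind_range[OF sj, of z] zj by auto
  show ?thesis
  proof (cases "v (L i r) < M")
  case False
  hence "M <= v (L j r)" using same[OF r(1,2)] by auto
  moreover have "L j r : A j" "ind j (L j r) = r" using lead_red[OF sj r] lead[OF sj r(1,2)] unfolding L_def by auto
  ultimately show ?thesis using z(2) r_def by (auto simp: not_less intro!: bexI[of _ "L j r"])
  next
  case True
  have bj: "L j (Suc r) : B j" "ind j (L j (Suc r)) = Suc r"
  using lead_blue[OF sj, of "Suc r"] lead[OF sj, of "Suc r"] r rh red_Suc unfolding L_def by auto
  have less: "v (L j (Suc r)) < v z" using ind_less[OF sj, of "L j (Suc r)" z] bj zj rj by auto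
  have bi: "L j (Suc r) : B i" using bj B by auto
  have li: "L i r : A i" "ind i (L i r) = r" using lead_red[OF si r] lead[OF si r(1,2)] unfolding L_def by auto
  \<comment> \<open>The leader of blue run \<open>r + 1\<close> of the later state was present
    before, below \<open>z\<close>. If it is not below \<open>M\<close>, it lies between two points
    of the red run \<open>r\<close> of the earlier state. If it is, so is the earlier leader of that
    run, which then lies below \<open>z\<close> although its number is larger.\<close>
  have False
  proof (cases "v (L j (Suc r)) < M")
  case False
  have "ind i (L j (Suc r)) <= r" using ind_mono[OF si, of "L j (Suc r)" z] bi z less unfolding r_def by auto
  moreover have "r <= ind i (L j (Suc r))" using ind_mono[OF si, of "L i r" "L j (Suc r)"] bi li True False by auto
  ultimately show False using ind_blue[OF si bi] r by auto
  next
  case 2: True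
  hence "v (L i (Suc r)) < v z" using same[of "Suc r"] r rh z by auto
  moreover have "v z < v (L i (Suc r))"
  using ind_less[OF si, of z "L i (Suc r)"] lead[OF si, of "Suc r"] z r rh unfolding L_def r_def by auto
  ultimately show False by simp
  qed
  thus ?thesis by simp
  qed
  qed
 qed
 thus ?thesis using card_side[of M] by simp
qed

text \<open>Mirror image of \<open>top_changes\<close>: the blue run below \<open>r\<close> replaces
  the one above.\<close>

lemma bottom_changes:
 "card {i. Suc i < c & (ALL z:A i. e < ind i z --> M <= v z) ~= (ALL z:A (Suc i). e < ind (Suc i) z --> M <= v z)}
  <= 4 * hi * hi + 1" (is "card {i. Suc i < c & ?P i ~= ?P (Suc i)} <= _") proof -
 have "card {i. Suc i < c & ?P i ~= ?P (Suc i)} <= 2 * card (side M) + 1"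
 proof (rule few_changes[OF finite_side])
  fix i j assume ij: "i < j" "j < c" and no: "!!l. i <= l ==> l < j ==> l ~: side M"
  and n: "~ ?P i"
  have le: "i <= j" "i < c" using ij by auto
  note si = state[OF le(2)] and sj = state[OF ij(2)]
  have same: "v (L i m) < M <-> v (L j m) < M" if "lo < m" "m < hi" for m using same_side[OF le(1) ij(2)] no that by blast
  obtain z where z: "z : A i" "e < ind i z" "v z < M" using n by (auto simp: not_le)
  have zj: "z : A j" using z A_mono[OF le(1) ij(2)] by auto
  show "~ ?P j"
  proof (cases "e < ind j z")
  case True
  thus ?thesis using zj z(3) by (auto simp: not_le intro!: bexI[of _ z])
  next
  case False
  hence B: "B j <= B i" using nested_or[OF le(1) ij(2)] z by auto
  define r where "r = ind i z"
  have r: "lo < r" "r < hi" "red r" using ind_range[OF si] ind_red[OF si] z unfolding r_def by auto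
  have "ind j z < r" using False z unfolding r_def by simp
  moreover have "Suc (ind j z) ~= r" using ind_red[OF sj zj] r red_Suc by metis
  ultimately have rj: "ind j z < r - 1" by simp
  have rl: "lo < r - 1" "r - 1 < hi" "~ red (r - 1)" "r - 1 < r" using rj ind_range[OF sj, of z] zj r red_Suc[of "r - 1"] by auto
  show ?thesis
  proof (cases "v (L i r) < M")
  case True
  hence "v (L j r) < M" using same[OF r(1,2)] by auto
  moreover have "L j r : A j" "ind j (L j r) = r" using lead_red[OF sj r] lead[OF sj r(1,2)] unfolding L_def by auto
  ultimately show ?thesis using z(2) r_def by (auto simp: not_le intro!: bexI[of _ "L j r"])
  next
  case False
  have bj: "L j (r - 1) : B j" "ind j (L j (r - 1)) = r - 1"
  using lead_blue[OF sj, of "r - 1"] lead[OF sj, of "r - 1"] rl unfolding L_def by auto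
  have less: "v z < v (L j (r - 1))" using ind_less[OF sj, of z "L j (r - 1)"] bj zj rj by auto
  have bi: "L j (r - 1) : B i" using bj B by auto
  have li: "L i r : A i" "ind i (L i r) = r" using lead_red[OF si r] lead[OF si r(1,2)] unfolding L_def by auto
  have False
  proof (cases "v (L j (r - 1)) < M")
  case True
  have "r <= ind i (L j (r - 1))" using ind_mono[OF si, of z "L j (r - 1)"] bi z less unfolding r_def by auto
  moreover have "ind i (L j (r - 1)) <= r" using ind_mono[OF si, of "L j (r - 1)" "L i r"] bi li True False by auto
  ultimately show False using ind_blue[OF si bi] r by auto
  next
  case 2: False
  hence "v z < v (L i (r - 1))" using same[of "r - 1"] rl z by auto
  moreover have "v (L i (r - 1)) < v z" using ind_less[OF si, of "L i (r - 1)" z] lead[OF si, of "r - 1"] z rl unfolding L_def r_def by auto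
  ultimately show False by simp
  qed
  thus ?thesis by simp
  qed
  qed
 qed
 thus ?thesis using card_side[of M] by simp
qed

end


section \<open>Binary constraints with few changes\<close>

definition digit :: "nat => nat => nat => nat" where
 "digit b w i = (w div b ^ i) mod b"

lemma digits_exist:
 assumes "!!i. i < L ==> U i < b"
 shows "EX w < b ^ L. ALL i < L. digit b w i = U i" using assms
proof (induction L)
 case (Suc L)
 then obtain w where w: "w < b ^ L" "!!i. i < L ==> digit b w i = U i" by auto
 have d: "U L < b" using Suc.prems by simp
 have "w + U L * b ^ L < b ^ L + U L * b ^ L" using w by simp
 also have "... = (U L + 1) * b ^ L" by simp
 also have "... <= b * b ^ L" using d by (intro mult_right_mono) auto
 finally have lt: "w + U L * b ^ L < b ^ Suc L" by simp
 have "digit b (w + U L * b ^ L) i = U i" if "i < Suc L" for i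
 proof (cases "i = L")
  case True
  thus ?thesis using w d unfolding digit_def by simp
 next
  case False
  hence i: "i < L" using that by simp
  have "(w + U L * b ^ L) div b ^ i = w div b ^ i + U L * b ^ (L - i)"
  proof -
  have "b ^ L = b ^ (L - i) * b ^ i" using i by (simp flip: power_add)
  hence "w + U L * b ^ L = w + (U L * b ^ (L - i)) * b ^ i" by simp
  moreover have "(w + (U L * b ^ (L - i)) * b ^ i) div b ^ i = U L * b ^ (L - i) + w div b ^ i" using d by (intro div_mult_self1) simp
  ultimately show ?thesis by (simp only: add.commute)
  qed
  moreover have "b dvd U L * b ^ (L - i)" using i by (simp add: dvd_power)
  ultimately show ?thesis using w(2)[OF i] unfolding digit_def by (metis mod_add_right_eq dvd_imp_mod_0 add_0_right)
 qed
 thus ?case using lt by blast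
qed simp

text \<open>Symmetric binary constraints \<open>E\<close> on \<open>K\<close> variables with values
  below \<open>n\<close>; \<open>b\<close> is the bound that red degrees are to obey. A set
  \<open>C\<close> of cuts \<open>(l, s)\<close> encodes one partition of the values per variable,
  \<open>s\<close> being the left end of an interval of variable \<open>l\<close> other than the
  first.\<close>

locale csp =
 fixes K n b :: nat and E :: "nat => nat => nat => nat => bool"
 assumes E_sym: "E l t a c <-> E t l c a" and n0: "0 < n"
begin

section \<open>Partitions given by cuts, and vectors of parts\<close>

definition pidx :: "(nat \<times> nat) set => nat => nat => nat" where
 "pidx C l a = card {s. 0 < s & s <= a & (l, s) : C}"

definition part :: "(nat \<times> nat) set => nat => nat => nat set" where
 "part C l s = {a. a < n & pidx C l a = pidx C l s}"

definition isl :: "(nat \<times> nat) set => nat => nat => bool" where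
 "isl C l s <-> s < n & (s = 0 \<or> (l, s) : C)"

lemma pidx_0: "pidx C l 0 = 0" unfolding pidx_def by auto

lemma pidx_Suc: "pidx C l (Suc a) = pidx C l a + (if (l, Suc a) : C then 1 else 0)"
proof -
 have "{s. 0 < s & s <= Suc a & (l, s) : C} = {s. 0 < s & s <= a & (l, s) : C} Un (if (l, Suc a) : C then {Suc a} else {})" by (auto simp: le_Suc_eq)
 thus ?thesis unfolding pidx_def by (auto simp: card_Un_disjoint)
qed

lemma pidx_mono: "a <= c ==> pidx C l a <= pidx C l c" unfolding pidx_def by (intro card_mono) auto

lemma pidx_less: "a < s ==> (l, s) : C ==> pidx C l a < pidx C l s"
proof -
 assume a: "a < s" "(l, s) : C"
 then obtain s' where s: "s = Suc s'" "a <= s'" by (cases s) auto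
 thus ?thesis using pidx_mono[OF s(2), of C l] a by (simp add: pidx_Suc)
qed

lemma isl_0: "isl C l 0" using n0 unfolding isl_def by simp

lemma isl_inj: "isl C l s ==> isl C l u ==> pidx C l s = pidx C l u ==> s = u"
 using pidx_less unfolding isl_def by (metis less_irrefl linorder_neqE_nat not_less0)

lemma part_isl: "isl C l s ==> s : part C l s" unfolding isl_def part_def by simp

lemma ex_isl: "a < n ==> EX s<=a. isl C l s & pidx C l s = pidx C l a"
proof (induction a)
 case (Suc a)
 then obtain s where "s <= a" "isl C l s" "pidx C l s = pidx C l a" by auto
 thus ?case by (cases "(l, Suc a) : C") (use Suc.prems in \<open>auto simp: pidx_Suc isl_def intro: exI[of _ "Suc a"] exI[of _ s]\<close>)
qed (use isl_0 in auto)

definition someT where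
 "someT C l s t u <-> (EX a:part C l s. EX c:part C t u. E l t a c)"

definition someF where
 "someF C l s t u <-> (EX a:part C l s. EX c:part C t u. ~ E l t a c)"

definition red where
 "red C l s t u <-> someT C l s t u & someF C l s t u"

text \<open>Vectors of parts: the entry 0 means that the variable is absent, and \<open>Suc s\<close> stands for the
 part with left end \<open>s\<close>.\<close>

definition valid where
 "valid C B <-> (ALL l. B l ~= 0 --> l < K & isl C l (B l - 1))"

definition feas where
 "feas C B <-> (EX x. (ALL l<K. B l ~= 0 --> x l : part C l (B l - 1)) & (ALL l<K. ALL t<K. l ~= t & B l ~= 0 & B t ~= 0 --> E l t (x l) (x t)))"

definition pok where
 "pok C B <-> (ALL l<K. ALL t<K. l ~= t & B l ~= 0 & B t ~= 0 --> someT C l (B l - 1) t (B t - 1))"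

definition subv :: "(nat => nat) => (nat => nat) => bool" where
 "subv D B <-> (ALL l<K. D l = 0 \<or> D l = B l)"

text \<open>Numbers the red neighbours inside one variable, so that under bounded degree a single
  digit below \<open>b\<close> names a neighbour.\<close>

definition rank where
 "rank C l s t u = card {v. v < u & isl C t v & red C l s t v}"

definition deg where
 "deg C <-> (ALL l<K. ALL s<n. ALL t<K. ALL u<n. l ~= t & isl C l s & isl C t u & red C l s t u --> rank C l s t u < b)"

text \<open>Decodes a word into a red-connected vector grown from part \<open>s\<close> of variable
  \<open>l\<close>. A triple of digits \<open>(a, t, r)\<close> adds the \<open>r\<close>-th red
  neighbour, in variable \<open>t\<close>, of the part chosen for \<open>a\<close>; an inconsistent
  triple leaves the vector unchanged. The sum has at most one nonzero term and serves as a definite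
  description that bounded loops can evaluate.\<close>

fun vec where
 "vec C l s U 0 t = (if t = l then Suc s else 0)"
| "vec C l s U (Suc j) t = (if t = U (3 * j + 1) & t < K & U (3 * j) < K & U (3 * j) ~= t & vec C l s U j (U (3 * j)) ~= 0 & vec C l s U j t = 0
  then \<Sum>u<n. if isl C t u & red C (U (3 * j)) (vec C l s U j (U (3 * j)) - 1) t u
  & rank C (U (3 * j)) (vec C l s U j (U (3 * j)) - 1) t u = U (3 * j + 2) then Suc u else 0
  else vec C l s U j t)"

lemma vec_cong:
 "(!!i. i < 3 * j ==> U i = U' i) ==> vec C l s U j t = vec C l s U' j t"
proof (induction j arbitrary: t)
 case (Suc j)
 have "vec C l s U j t = vec C l s U' j t" for t by (rule Suc.IH) (use Suc.prems in auto)
 moreover have "U (3 * j) = U' (3 * j)" "U (3 * j + 1) = U' (3 * j + 1)" "U (3 * j + 2) = U' (3 * j + 2)" using Suc.prems by auto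
 ultimately show ?case by (simp only: vec.simps)
qed simp

lemma rank_inj:
 assumes "isl C t u" "red C l s t u" "isl C t v" "red C l s t v" "rank C l s t u = rank C l s t v"
 shows "u = v"
proof (rule ccontr)
 have *: "rank C l s t u < rank C l s t v" if "u < v" "isl C t u" "red C l s t u" for u v
  unfolding rank_def by (rule psubset_card_mono) (use that in auto)
 assume "u ~= v"
 thus False using * assms by (metis less_irrefl linorder_neqE_nat)
qed

lemma neighbour_sum:
 assumes "isl C t u" "red C l s t u" "u < n"
 shows "(\<Sum>v<n. if isl C t v & red C l s t v & rank C l s t v = rank C l s t u then Suc v else 0) = Suc u"
proof -
 have "(\<Sum>v<n. if isl C t v & red C l s t v & rank C l s t v = rank C l s t u then Suc v else 0) =
  (\<Sum>v<n. if v = u then Suc u else 0)" using rank_inj[OF assms(1,2)] assms by (intro sum.cong) (auto dest: sym) thus ?thesis using assms by simp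
qed

lemma neighbour_sum_valid:
 "(\<Sum>v<n. if isl C t v & red C l s t v & rank C l s t v = r then Suc v else 0) = 0 \<or>
  (EX u<n. isl C t u & (\<Sum>v<n. if isl C t v & red C l s t v & rank C l s t v = r then Suc v else 0) = Suc u)"
 using neighbour_sum sum.neutral by auto

lemma vec_valid: "l < K ==> isl C l s ==> valid C (vec C l s U j)"
proof (induction j)
 case (Suc j)
 show ?case unfolding valid_def
 proof (intro allI impI)
  fix t assume nz: "vec C l s U (Suc j) t ~= 0"
  let ?a = "U (3 * j)"
  let ?c = "t = U (3 * j + 1) & t < K & ?a < K & ?a ~= t & vec C l s U j ?a ~= 0 & vec C l s U j t = 0"
  show "t < K & isl C t (vec C l s U (Suc j) t - 1)"
  proof (cases ?c)
  case True
  hence "vec C l s U (Suc j) t = (\<Sum>u<n. if isl C t u & red C ?a (vec C l s U j ?a - 1) t u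
  & rank C ?a (vec C l s U j ?a - 1) t u = U (3 * j + 2) then Suc u else 0)" unfolding vec.simps by (rule if_P)
  then obtain u where "isl C t u" "vec C l s U (Suc j) t = Suc u"
  using nz neighbour_sum_valid[of C t ?a "vec C l s U j ?a - 1" "U (3 * j + 2)"] by auto
  thus ?thesis using True by simp
  next
  case False
  hence "vec C l s U (Suc j) t = vec C l s U j t" unfolding vec.simps by (rule if_not_P)
  thus ?thesis using Suc nz unfolding valid_def by simp
  qed
 qed
qed (auto simp: valid_def)

section \<open>Red components and their codes\<close>

definition restr :: "(nat => nat) => nat set => nat => nat" where
 "restr B Z l = (if l : Z then B l else 0)"

definition redge where
 "redge C B = {(l, t). l < K & t < K & l ~= t & B l ~= 0 & B t ~= 0 & red C l (B l - 1) t (B t - 1)}"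

lemma redge_sym: "(l, t) : redge C B ==> (t, l) : redge C B" using E_sym unfolding redge_def red_def someT_def someF_def by fastforce

text \<open>The component is grown along red edges, one variable per triple of digits, so
  \<open>K\<close> triples suffice. Once it is complete, the digit \<open>K\<close>, which names no
  variable, makes the remaining triples idle.\<close>

lemma ex_code:
 assumes d: "deg C" and bK: "K < b" and val: "valid C B" and l: "l < K" "B l ~= 0"
 shows "EX U. (ALL i. U i < b) & vec C l (B l - 1) U K = restr B ((redge C B)\<^sup>* `` {l})"
proof -
 let ?Z = "(redge C B)\<^sup>* `` {l}"
 have ZK: "Z <= ?Z ==> Z <= {..<K}" for Z using l unfolding redge_def by (auto elim: rtranclE)
 have Znz: "t : ?Z ==> B t ~= 0" for t using l unfolding redge_def by (auto elim: rtranclE)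
 have "EX U Z. (ALL i. U i < b) & l : Z & Z <= ?Z & vec C l (B l - 1) U j = restr B Z & (Z = ?Z \<or> j < card Z)" for j
 proof (induction j)
  case 0
  have "vec C l (B l - 1) (%_. 0) 0 = restr B {l}" using l by (auto simp: restr_def fun_eq_iff)
  thus ?case using bK by (intro exI[of _ "%_. 0"] exI[of _ "{l}"]) auto
 next
  case (Suc j)
  then obtain U Z where IH: "!!i. U i < b" "l : Z" "Z <= ?Z" "vec C l (B l - 1) U j = restr B Z" "Z = ?Z \<or> j < card Z" by blast
  have finZ: "finite Z" using ZK[OF IH(3)] finite_subset by auto
  show ?case
  proof (cases "Z = ?Z")
  case True
  define U' where "U' = U(3 * j := K)"
  have "vec C l (B l - 1) U' j t = restr B Z t" for t using IH(4) vec_cong[of j U' U] unfolding U'_def by auto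
  hence "vec C l (B l - 1) U' (Suc j) = restr B Z" by (auto simp: fun_eq_iff U'_def)
  moreover have "ALL i. U' i < b" using IH(1) bK unfolding U'_def by simp
  ultimately show ?thesis using True IH(2,3) by blast
  next
  case False
  obtain a t where at: "a : Z" "t : ?Z" "t ~: Z" "(a, t) : redge C B"
  proof -
  obtain y where "(l, y) : (redge C B)\<^sup>*" "y ~: Z" using False IH(3) by auto
  hence "EX a t. a : Z & t ~: Z & (l, a) : (redge C B)\<^sup>* & (a, t) : redge C B" using IH(2) by (induction rule: rtrancl_induct) auto
  thus ?thesis using that by (meson Image_singleton_iff rtrancl.rtrancl_into_rtrancl)
  qed
  have aK: "a < K" "t < K" "a ~= t" "B a ~= 0" "B t ~= 0" "red C a (B a - 1) t (B t - 1)" using at(4) unfolding redge_def by auto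
  have il: "isl C a (B a - 1)" "isl C t (B t - 1)" using val aK unfolding valid_def by auto
  define r where "r = rank C a (B a - 1) t (B t - 1)"
  have r: "r < b" using d aK il unfolding deg_def r_def isl_def by blast
  define U' where "U' = U(3 * j := a, 3 * j + 1 := t, 3 * j + 2 := r)"
  have dd: "U' (3 * j) = a" "U' (3 * j + 1) = t" "U' (3 * j + 2) = r" unfolding U'_def by simp_all
  have v: "vec C l (B l - 1) U' j u = restr B Z u" for u using IH(4) vec_cong[of j U' U] unfolding U'_def by auto
  have "vec C l (B l - 1) U' (Suc j) u = restr B (insert t Z) u" for u
  proof (cases "u = t")
  case True
  have "vec C l (B l - 1) U' (Suc j) t = Suc (B t - 1)" unfolding vec.simps dd v using aK at il neighbour_sum[OF il(2) aK(6)]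
  by (simp add: restr_def isl_def r_def)
  thus ?thesis using True aK by (simp add: restr_def)
  next
  case False
  thus ?thesis unfolding vec.simps dd v by (simp add: restr_def)
  qed
  hence "vec C l (B l - 1) U' (Suc j) = restr B (insert t Z)" by blast
  moreover have "Suc j < card (insert t Z)" using IH(5) False at(3) finZ by simp
  moreover have "ALL i. U' i < b" using IH(1) aK bK r unfolding U'_def by simp
  moreover have "l : insert t Z" "insert t Z <= ?Z" using IH(2,3) at by auto
  ultimately show ?thesis by blast
  qed
 qed
 from this[of K] obtain U Z where 1: "ALL i. U i < b" "Z <= ?Z" "vec C l (B l - 1) U K = restr B Z" "Z = ?Z \<or> K < card Z" by blast
 have "card Z <= K" using card_mono[OF _ ZK[OF 1(2)]] by simp
 thus ?thesis using 1 by auto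
qed

lemma feas_subv: "feas C B ==> subv D B ==> feas C D" unfolding feas_def subv_def by metis

lemma feas_pok: "feas C B ==> pok C B" unfolding feas_def pok_def someT_def by blast

definition code where
 "code C l s w = vec C l s (digit b w) K"

text \<open>A vector splits into its red components; between two components the constraints are constant.\<close>

theorem feas_components:
 assumes d: "deg C" and bK: "K < b" and val: "valid C B" and W: "b ^ (3 * K) <= W"
 shows "feas C B <-> pok C B & (ALL l<K. ALL s<n. ALL w<W. isl C l s & subv (code C l s w) B --> feas C (code C l s w))"
  (is "_ <-> _ & ?fam")
proof
 assume "feas C B"
 thus "pok C B & ?fam" using feas_subv feas_pok by blast
next
 assume a: "pok C B & ?fam"
 define comp where "comp l = (redge C B)\<^sup>* `` {l}" for l
 have "EX x. (ALL t<K. t : comp l --> x t : part C t (B t - 1)) &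
  (ALL t<K. ALL u<K. t ~= u & t : comp l & u : comp l --> E t u (x t) (x u))" if l: "l < K" "B l ~= 0" for l proof -
  obtain U where U: "ALL i. U i < b" "vec C l (B l - 1) U K = restr B (comp l)" using ex_code[OF d bK val l] unfolding comp_def by blast
  obtain w where w: "w < b ^ (3 * K)" "ALL i<3 * K. digit b w i = U i" using digits_exist[of "3 * K" U b] U(1) by blast
  have cw: "code C l (B l - 1) w = restr B (comp l)" unfolding code_def U(2)[symmetric] by (rule ext, rule vec_cong) (use w in auto)
  have "subv (code C l (B l - 1) w) B" unfolding cw subv_def restr_def by auto
  moreover have "isl C l (B l - 1)" "B l - 1 < n" using val l unfolding valid_def isl_def by auto
  ultimately have "feas C (restr B (comp l))" using a w W l unfolding cw[symmetric] by auto
  then obtain x where x: "ALL t<K. restr B (comp l) t ~= 0 --> x t : part C t (restr B (comp l) t - 1)"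
  "ALL t<K. ALL u<K. t ~= u & restr B (comp l) t ~= 0 & restr B (comp l) u ~= 0 --> E t u (x t) (x u)" unfolding feas_def by blast
  have nz: "B t ~= 0" if "t : comp l" for t using that l unfolding comp_def redge_def by (auto elim: rtranclE)
  have r: "restr B (comp l) t = B t" if "t : comp l" for t using that unfolding restr_def by simp
  show ?thesis
  proof (intro exI[of _ x] conjI allI impI)
  show "x t : part C t (B t - 1)" if "t < K" "t : comp l" for t using x(1)[rule_format, OF that(1)] r[OF that(2)] nz[OF that(2)] by simp
  show "E t u (x t) (x u)" if "t < K" "u < K" "t ~= u & t : comp l & u : comp l" for t u
  using x(2)[rule_format, OF that(1,2)] that(3) r nz by simp
  qed
 qed
 hence "ALL l. EX x. l < K & B l ~= 0 --> (ALL t<K. t : comp l --> x t : part C t (B t - 1)) &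
  (ALL t<K. ALL u<K. t ~= u & t : comp l & u : comp l --> E t u (x t) (x u))" by blast
 then obtain X where X: "!!l. l < K ==> B l ~= 0 ==> (ALL t<K. t : comp l --> X l t : part C t (B t - 1)) &
  (ALL t<K. ALL u<K. t ~= u & t : comp l & u : comp l --> E t u (X l t) (X l u))" by metis define rep where "rep l = (LEAST t. t : comp l)" for l
 have in_comp: "l : comp l" for l unfolding comp_def by simp
 have rep_in: "rep l : comp l" for l unfolding rep_def by (rule LeastI[of _ l]) (rule in_comp)
 have symr: "sym ((redge C B)\<^sup>*)" by (rule sym_rtrancl) (use redge_sym in "auto simp: sym_def")
 have comp_eq: "comp t = comp l" if "t : comp l" for t l using that symr unfolding comp_def by (auto simp: sym_def intro: rtrancl_trans)
 have rep_eq: "rep t = rep l" if "t : comp l" for t l using comp_eq[OF that] unfolding rep_def by simp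
 have rep_ok: "rep l < K & B (rep l) ~= 0" if "l < K" "B l ~= 0" for l
  using rep_in[of l] that unfolding comp_def redge_def by (auto elim: rtranclE)
 \<comment> \<open>All variables of a component take their values from one solution, the one
   belonging to its least variable.\<close>
 define x where "x l = X (rep l) l" for l
 have l_in: "l : comp (rep l)" for l using comp_eq[OF rep_in[of l]] in_comp by auto
 have xp: "x l : part C l (B l - 1)" if "l < K" "B l ~= 0" for l using X[of "rep l"] rep_ok[OF that] l_in that unfolding x_def by auto
 have "E l t (x l) (x t)" if lt: "l < K" "t < K" "l ~= t" "B l ~= 0" "B t ~= 0" for l t
 proof (cases "t : comp l")
  case True
  hence "rep t = rep l" by (rule rep_eq)
  moreover have "t : comp (rep l)" using True comp_eq[OF rep_in[of l]] by simp
  ultimately show ?thesis using X[of "rep l"] rep_ok[of l] l_in lt unfolding x_def by auto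
 next
  case False
  hence "(l, t) ~: redge C B" unfolding comp_def by blast
  hence "~ red C l (B l - 1) t (B t - 1)" using lt unfolding redge_def by auto
  moreover have "someT C l (B l - 1) t (B t - 1)" using a lt unfolding pok_def by auto
  ultimately have "~ someF C l (B l - 1) t (B t - 1)" unfolding red_def by simp
  thus ?thesis using xp lt unfolding someF_def by blast
 qed
 thus "feas C B" unfolding feas_def using xp by blast
qed

section \<open>Merging two consecutive parts\<close>

lemma pidx_remove:
 assumes "(l, s) : C" "0 < s"
 shows "pidx (C - {(l, s)}) l a = (if s <= a then pidx C l a - 1 else pidx C l a)"
proof -
 have "{u. 0 < u & u <= a & (l, u) : C - {(l, s)}} = {u. 0 < u & u <= a & (l, u) : C} - {s}" by auto
 moreover have "finite {u. 0 < u & u <= a & (l, u) : C}" by auto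
 ultimately show ?thesis using assms unfolding pidx_def by (auto simp: card_Diff_singleton_if)
qed

lemma pidx_other: "t ~= l ==> pidx (C - {(l, s)}) t a = pidx C t a" unfolding pidx_def by (rule arg_cong[of _ _ card]) auto

lemma part_other: "t ~= l ==> part (C - {(l, s)}) t u = part C t u" unfolding part_def by (simp add: pidx_other)

lemma isl_remove: "isl (C - {(l, s)}) t u <-> isl C t u & (t, u) ~= (l, s)" if "0 < s" using that unfolding isl_def by auto

lemma part_remove:
 assumes cut: "(l, s) : C" "0 < s" and isl: "isl C l s" and p: "isl C l p" "Suc (pidx C l p) = pidx C l s"
 shows "part (C - {(l, s)}) l p = part C l p Un part C l s"
  and "isl C l u ==> u ~= p ==> u ~= s ==> part (C - {(l, s)}) l u = part C l u"
proof -
 have ps: "p < s" using p pidx_mono[of s p] by (metis Suc_n_not_le_n not_le)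
 have ge: "s <= a <-> pidx C l s <= pidx C l a" for a using pidx_mono[of s a C l] pidx_less[OF _ cut(1), of a] by (meson leD leI)
 have pos: "0 < pidx C l s" using p by simp
 show "part (C - {(l, s)}) l p = part C l p Un part C l s"
 proof (rule set_eqI)
  fix a
  have "~ s <= p" using ps by simp
  thus "a : part (C - {(l, s)}) l p <-> a : part C l p Un part C l s"
  unfolding part_def pidx_remove[OF cut] using ge[of a] p(2) by (cases "s <= a") auto
 qed
 show "part (C - {(l, s)}) l u = part C l u" if u: "isl C l u" "u ~= p" "u ~= s"
 proof -
  have "pidx C l u ~= pidx C l p" "pidx C l u ~= pidx C l s" using isl_inj[OF u(1)] u p isl by auto
  moreover have "a : part (C - {(l, s)}) l u <-> a : part C l u" for a
  unfolding part_def pidx_remove[OF cut] using calculation ge[of a] ge[of u] p(2) by (cases "s <= a"; cases "s <= u") auto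
  ultimately show ?thesis by blast
 qed
qed

text \<open>A solution of the merged vector picks at \<open>l\<close> a value from one of the two
  old parts, so it already solves the vector with that old part.\<close>

lemma feas_remove:
 assumes cut: "(l, s) : C" "0 < s" and isl: "isl C l s" and p: "isl C l p" "Suc (pidx C l p) = pidx C l s"
  and val: "valid (C - {(l, s)}) B"
 shows "feas (C - {(l, s)}) B <-> feas C B \<or> (B l = Suc p & feas C (B(l := Suc s)))"
proof -
 have parts: "part (C - {(l, s)}) t (B t - 1) = (if t = l & B l = Suc p then part C l p Un part C l s else part C t (B t - 1))" if "B t ~= 0" for t
 proof (cases "t = l")
  case True
  have "isl C l (B l - 1)" "B l - 1 ~= s" using val that cut True unfolding valid_def by (auto simp: isl_remove)
  thus ?thesis using True part_remove[OF cut isl p] that by (cases "B l") auto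
 next
  case False
  thus ?thesis by (simp add: part_other)
 qed
 show ?thesis
 proof
  assume "feas (C - {(l, s)}) B"
  then obtain x where x: "ALL t<K. B t ~= 0 --> x t : part (C - {(l, s)}) t (B t - 1)"
  "ALL t<K. ALL u<K. t ~= u & B t ~= 0 & B u ~= 0 --> E t u (x t) (x u)" unfolding feas_def by blast
  show "feas C B \<or> (B l = Suc p & feas C (B(l := Suc s)))"
  proof (cases "l < K & B l = Suc p & x l : part C l s")
  case True
  hence "feas C (B(l := Suc s))" unfolding feas_def using x parts by (intro exI[of _ x]) (auto split: if_splits)
  thus ?thesis using True by simp
  next
  case False
  hence "x t : part C t (B t - 1)" if "t < K" "B t ~= 0" for t
  using x(1)[rule_format, OF that] parts[OF that(2)] that by (auto split: if_splits)
  hence "feas C B" unfolding feas_def using x(2) by blast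
  thus ?thesis by simp
  qed
 next
  assume "feas C B \<or> (B l = Suc p & feas C (B(l := Suc s)))"
  thus "feas (C - {(l, s)}) B"
  proof
  assume "feas C B"
  thus ?thesis unfolding feas_def using parts by (metis UnI1 diff_Suc_1)
  next
  assume "B l = Suc p & feas C (B(l := Suc s))"
  then obtain x where Bl: "B l = Suc p" and x: "ALL t<K. (B(l := Suc s)) t ~= 0 --> x t : part C t ((B(l := Suc s)) t - 1)"
  "ALL t<K. ALL u<K. t ~= u & (B(l := Suc s)) t ~= 0 & (B(l := Suc s)) u ~= 0 --> E t u (x t) (x u)" unfolding feas_def by blast
  have "x t : part (C - {(l, s)}) t (B t - 1)" if "t < K" "B t ~= 0" for t
  using x(1)[rule_format, OF that(1)] parts[OF that(2)] that Bl by (auto split: if_splits)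
  moreover have "E t u (x t) (x u)" if "t < K" "u < K" "t ~= u & B t ~= 0 & B u ~= 0" for t u
  using x(2)[rule_format, OF that(1,2)] that Bl by auto
  ultimately show ?thesis unfolding feas_def by blast
  qed
 qed
qed

text \<open>Every partition has a cut whose removal creates few red neighbours. This is a double count:
 an atomic constraint is constant on most pairs of consecutive intervals.\<close>

definition monot where
 "monot R <-> (ALL a<n. ALL c<n. ALL d<n. c <= d --> R a c --> R a d) \<or> (ALL a<n. ALL c<n. ALL d<n. c <= d --> R a d --> R a c)"

definition changes where
 "changes M R <-> (ALL c<n. card {a. Suc a < n & R a c ~= R (Suc a) c} <= M)"

text \<open>A monotone \<open>R\<close> holds on one side of a threshold that depends on the other
  value; the second condition says that this threshold crosses each fixed level at most
  \<open>M\<close> times.\<close>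

definition atomic where
 "atomic M R <-> (monot R & changes M R) \<or> (monot (%a c. R c a) & changes M (%a c. R c a))"

definition nonconst :: "(nat => nat => bool) => nat set => nat set => bool" where
 "nonconst R S T <-> (EX a:S. EX c:T. R a c) & (EX a:S. EX c:T. ~ R a c)"

section \<open>Counting boxes on which a relation is not constant\<close>

definition convex where
 "convex S <-> S <= {..<n} & (ALL a:S. ALL d:S. ALL c. a <= c --> c <= d --> c : S)"

lemma convex_change:
 assumes S: "convex S" and ac: "a : S" "c : S" "P a ~= P c"
 shows "EX d. d : S & Suc d : S & P d ~= P (Suc d)"
proof -
 have main: "EX d. a <= d & Suc d <= c & P d ~= P (Suc d)" if "a <= c" "P a ~= P c" for a c
  using that by (induction rule: dec_induct) (metis le_refl le_SucI le_trans order_refl)+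
 show ?thesis
 proof (cases "a <= c")
  case True
  then obtain d where "a <= d" "Suc d <= c" "P d ~= P (Suc d)" using main ac by blast
  thus ?thesis using S ac unfolding convex_def by (meson Suc_leD le_SucI)
 next
  case False
  then obtain d where "c <= d" "Suc d <= a" "P d ~= P (Suc d)" using main[of c a] ac by auto
  thus ?thesis using S ac unfolding convex_def by (meson Suc_leD le_SucI)
 qed
qed

text \<open>Suppose that along \<open>J j\<close> nothing changes at the least and at the greatest
  element of \<open>Y y\<close>. Then, for the least element of \<open>J j\<close>, the switch of
  \<open>R\<close> happens inside \<open>Y y\<close>; by monotonicity there is one switch, and at
  most two sets \<open>Y y\<close> contain it. The other pairs are charged to \<open>y\<close>: two
  columns, at most \<open>M\<close> changes in each, and each change inside at most two sets
  \<open>J j\<close>.\<close>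

lemma count_nonconst:
 fixes JJ :: "'i set" and YY :: "'k set" and J :: "'i => nat set" and Y :: "'k => nat set"
 assumes R: "monot R" "changes M R" and fin: "finite JJ" "finite YY"
  and J: "!!j. j : JJ ==> convex (J j)" and Y: "!!y. y : YY ==> convex (Y y)"
  and J2: "!!a. card {j : JJ. a : J j} <= 2" and Y2: "!!a. card {y : YY. a : Y y} <= 2"
 shows "card {(j, y). j : JJ & y : YY & nonconst R (J j) (Y y)} <= 2 * card JJ + 4 * M * card YY"
proof -
 have main: "card {(j, y). j : JJ & y : YY & nonconst R (J j) (Y y)} <= 2 * card JJ + 4 * M * card YY"
  if up: "ALL a<n. ALL c<n. ALL d<n. c <= d --> R a c --> R a d" and ch: "changes M R" for R
 proof -
  define S1 where "S1 j = {y : YY. EX c. c : Y y & Suc c : Y y & ~ R (Min (J j)) c & R (Min (J j)) (Suc c)}" for j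
  define Q where "Q c = {j : JJ. EX a. a : J j & Suc a : J j & R a c ~= R (Suc a) c}" for c
  have finY: "finite (Y y)" if "y : YY" for y using Y[OF that] unfolding convex_def by (auto intro: finite_subset)
  have finJ: "finite (J j)" if "j : JJ" for j using J[OF that] unfolding convex_def by (auto intro: finite_subset)
  have S1: "card (S1 j) <= 2" if j: "j : JJ" "J j ~= {}" for j
  proof -
  let ?a = "Min (J j)"
  have a: "?a < n" using J[OF j(1)] j finJ Min_in[of "J j"] unfolding convex_def by blast
  show ?thesis
  proof (cases "S1 j = {}")
  case False
  then obtain y c where c: "y : YY" "c : Y y" "Suc c : Y y" "~ R ?a c" "R ?a (Suc c)" unfolding S1_def by blast
  have "c = d" if "z : YY" "d : Y z" "Suc d : Y z" "~ R ?a d" "R ?a (Suc d)" for z d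
  proof -
  have "Suc c < n" using Y[OF c(1)] c(3) unfolding convex_def by blast
  moreover have "Suc d < n" using Y[OF that(1)] that(3) unfolding convex_def by blast
  ultimately have "~ Suc c <= d" "~ Suc d <= c" using up[rule_format, OF a, of "Suc c" d] up[rule_format, OF a, of "Suc d" c] c that by auto
  thus ?thesis by simp
  qed
  hence "S1 j <= {y : YY. c : Y y}" unfolding S1_def by blast
  moreover have "finite {y : YY. c : Y y}" using fin(2) by simp
  ultimately show ?thesis using Y2[of c] card_mono[of "{y : YY. c : Y y}" "S1 j"] by linarith
  qed simp
  qed
  have Q: "card (Q c) <= 2 * M" if c: "c < n" for c
  proof -
  let ?D = "{a. Suc a < n & R a c ~= R (Suc a) c}"
  have finD: "finite ?D" by (rule finite_subset[of _ "{..<n}"]) auto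
  have "Q c <= (UN a:?D. {j : JJ. a : J j})" using J unfolding Q_def convex_def by blast
  hence "card (Q c) <= card (UN a:?D. {j : JJ. a : J j})" using fin finD by (intro card_mono) auto
  also have "... <= (SUM a:?D. card {j : JJ. a : J j})" by (rule card_UN_le[OF finD])
  also have "... <= (SUM a:?D. 2)" by (rule sum_mono) (rule J2)
  also have "... <= 2 * M" using ch c unfolding changes_def by simp
  finally show ?thesis .
  qed
  have "{(j, y). j : JJ & y : YY & nonconst R (J j) (Y y)} <= (SIGMA j:{j : JJ. J j ~= {}}. S1 j) Un
  prod.swap ` ((SIGMA y:{y : YY. Y y ~= {}}. Q (Min (Y y))) Un (SIGMA y:{y : YY. Y y ~= {}}. Q (Max (Y y))))" proof clarify
  fix j y assume jy: "j : JJ" "y : YY" "nonconst R (J j) (Y y)"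
  and no: "(j, y) ~: prod.swap ` ((SIGMA y:{y : YY. Y y ~= {}}. Q (Min (Y y))) Un (SIGMA y:{y : YY. Y y ~= {}}. Q (Max (Y y))))"
  obtain a c a' c' where w: "a : J j" "c : Y y" "R a c" "a' : J j" "c' : Y y" "~ R a' c'" using jy(3) unfolding nonconst_def by blast
  have lt: "!!a. a : J j ==> a < n" "!!c. c : Y y ==> c < n" using J[OF jy(1)] Y[OF jy(2)] unfolding convex_def by auto
  have ne: "Y y ~= {}" "J j ~= {}" using w by auto
  let ?\<alpha> = "Min (Y y)" and ?\<omega> = "Max (Y y)"
  have in_Y: "?\<alpha> : Y y" "?\<omega> : Y y" using finY[OF jy(2)] ne by auto
  have R1: "R a ?\<omega>" using up[rule_format, of a c ?\<omega>] w lt in_Y finY[OF jy(2)] by auto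
  have R2: "~ R a' ?\<alpha>" using up[rule_format, of a' ?\<alpha> c'] w lt in_Y finY[OF jy(2)] by auto
  have nQ: "j ~: Q ?\<alpha>" "j ~: Q ?\<omega>" using no jy(2) ne rev_image_eqI[of "(y, j)" _ "(j, y)" prod.swap] by auto
  have cst: "R d e = R d' e" if "d : J j" "d' : J j" "e = ?\<alpha> \<or> e = ?\<omega>" for d d' e
  using convex_change[OF J[OF jy(1)] that(1,2), of "%a. R a e"] nQ jy(1) that(3) unfolding Q_def by blast
  have mJ: "Min (J j) : J j" using finJ[OF jy(1)] ne by auto
  have "R (Min (J j)) ?\<omega>" "~ R (Min (J j)) ?\<alpha>" using cst[OF mJ w(1)] cst[OF mJ w(4)] R1 R2 by auto
  hence "R (Min (J j)) ?\<alpha> ~= R (Min (J j)) ?\<omega>" by simp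
  from convex_change[OF Y[OF jy(2)] in_Y, of "R (Min (J j))", OF this]
  obtain d where d: "d : Y y" "Suc d : Y y" "R (Min (J j)) d ~= R (Min (J j)) (Suc d)" by blast
  hence "~ R (Min (J j)) d" "R (Min (J j)) (Suc d)" using up[rule_format, of "Min (J j)" d "Suc d"] lt mJ by auto
  thus "j : {j : JJ. J j ~= {}} & y : S1 j" using d jy ne unfolding S1_def by auto
  qed
  note sub = this
  have fins: "finite (S1 j)" "finite (Q c)" for j c using fin unfolding S1_def Q_def by auto
  let ?S = "SIGMA j:{j : JJ. J j ~= {}}. S1 j"
  let ?T = "%f. SIGMA y:{y : YY. Y y ~= {}}. Q (f (Y y))"
  have finS: "finite ?S" "finite (?T f)" for f using fin fins by (auto intro!: finite_SigmaI)
  have "card {(j, y). j : JJ & y : YY & nonconst R (J j) (Y y)} <= card (?S Un prod.swap ` (?T Min Un ?T Max))"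
  using finS by (intro card_mono[OF _ sub]) blast
  also have "... <= card ?S + card (prod.swap ` (?T Min Un ?T Max))" by (rule card_Un_le)
  also have "card (prod.swap ` (?T Min Un ?T Max)) <= card (?T Min Un ?T Max)" using finS by (intro card_image_le) blast
  also have "... <= card (?T Min) + card (?T Max)" by (rule card_Un_le)
  finally have sum: "card {(j, y). j : JJ & y : YY & nonconst R (J j) (Y y)} <= card ?S + (card (?T Min) + card (?T Max))" by simp
  have S_le: "card ?S <= 2 * card JJ"
  proof -
  have "card ?S = (SUM j:{j : JJ. J j ~= {}}. card (S1 j))" using fin fins by (intro card_SigmaI) auto
  also have "... <= (SUM j:{j : JJ. J j ~= {}}. 2)" using S1 by (intro sum_mono) auto
  also have "... <= 2 * card JJ" using fin by (simp add: card_mono)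
  finally show ?thesis .
  qed
  have T_le: "card (?T f) <= 2 * M * card YY" if f: "!!S::nat set. finite S ==> S ~= {} ==> f S : S" for f
  proof -
  have "card (?T f) = (SUM y:{y : YY. Y y ~= {}}. card (Q (f (Y y))))" using fin fins by (intro card_SigmaI) auto
  also have "... <= (SUM y:{y : YY. Y y ~= {}}. 2 * M)"
  proof (intro sum_mono Q)
  fix y assume y: "y : {y : YY. Y y ~= {}}"
  hence "f (Y y) : Y y" using f finY[of y] by auto
  thus "f (Y y) < n" using Y[of y] y unfolding convex_def by auto
  qed
  also have "... <= 2 * M * card YY" using fin by (simp add: card_mono)
  finally show ?thesis .
  qed
  show ?thesis using sum S_le T_le[of Min] T_le[of Max] Min_in Max_in by simp
 qed
 \<comment> \<open>A decreasing relation is the negation of an increasing one, with the same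
   nonconstant boxes and the same changes.\<close>
 have neg: "nonconst (%a c. ~ R a c) S T = nonconst R S T" for S T unfolding nonconst_def by auto
 have chn: "changes M (%a c. ~ R a c)" using R(2) unfolding changes_def by simp
 show ?thesis using R(1) main[of R] main[of "%a c. ~ R a c"] R(2) chn unfolding monot_def neg by blast
qed

text \<open>Two consecutive parts are taken together so that costs also see switches at the boundary
  between parts; a value still lies in at most two windows.\<close>

definition window :: "(nat \<times> nat) set => nat => nat => nat set" where
 "window C t u = {c. c < n & (pidx C t c = pidx C t u \<or> pidx C t c = Suc (pidx C t u))}"

definition merged :: "(nat \<times> nat) set => nat => nat => nat set" where
 "merged C l s = {a. a < n & (pidx C l a = pidx C l s \<or> Suc (pidx C l a) = pidx C l s)}"

definition cost :: "(nat \<times> nat) set => nat => nat => nat" where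
 "cost C l s = card {(t, u). t < K & t ~= l & isl C t u & nonconst (E l t) (merged C l s) (window C t u)}"

definition decomposes where
 "decomposes r M <-> (ALL l<K. ALL t<K. l ~= t --> (EX Rs. length Rs <= r & (ALL R:set Rs. atomic M R) &
  (ALL a<n. ALL c<n. E l t a c <-> (ALL R:set Rs. R a c))))"

definition cut_set where
 "cut_set C <-> C <= {(l, s). l < K & 0 < s & s < n}"

lemma cut_set_finite: "cut_set C ==> finite C" unfolding cut_set_def by (rule finite_subset[of _ "{..<K} \<times> {..<n}"]) auto

lemma convex_window: "convex (window C t u)" unfolding convex_def window_def
proof (intro conjI ballI allI impI)
 fix a d c assume a: "a : {c. c < n & (pidx C t c = pidx C t u \<or> pidx C t c = Suc (pidx C t u))}"
  and d: "d : {c. c < n & (pidx C t c = pidx C t u \<or> pidx C t c = Suc (pidx C t u))}" and "a <= c" "c <= d"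
 hence "pidx C t a <= pidx C t c" "pidx C t c <= pidx C t d" "c < n" by (auto intro: pidx_mono)
 thus "c : {c. c < n & (pidx C t c = pidx C t u \<or> pidx C t c = Suc (pidx C t u))}" using a d by auto
qed auto

lemma convex_merged: "convex (merged C l s)" unfolding convex_def merged_def
proof (intro conjI ballI allI impI)
 fix a d c assume a: "a : {a. a < n & (pidx C l a = pidx C l s \<or> Suc (pidx C l a) = pidx C l s)}"
  and d: "d : {a. a < n & (pidx C l a = pidx C l s \<or> Suc (pidx C l a) = pidx C l s)}" and "a <= c" "c <= d"
 hence "pidx C l a <= pidx C l c" "pidx C l c <= pidx C l d" "c < n" by (auto intro: pidx_mono)
 thus "c : {a. a < n & (pidx C l a = pidx C l s \<or> Suc (pidx C l a) = pidx C l s)}" using a d by auto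
qed auto

lemma finite_isl: "finite {u. isl C t u}" unfolding isl_def by (rule finite_subset[of _ "{..<n}"]) auto

lemma card_le_2:
 assumes "inj_on f S" "f ` S <= {x, y}"
 shows "card S <= (2::nat)"
proof -
 have "card S = card (f ` S)" using assms(1) by (simp add: card_image)
 also have "... <= card {x, y}" using assms(2) by (intro card_mono) auto
 also have "... <= 2" by (simp add: card_insert_if)
 finally show ?thesis .
qed

lemma window_overlap: "card {u : {u. isl C t u}. a : window C t u} <= 2" by (rule card_le_2[of "pidx C t" _ "pidx C t a" "pidx C t a - 1"])
  (auto simp: window_def inj_on_def intro: isl_inj)

lemma merged_overlap:
 assumes "cut_set C"
 shows "card {s : {s. (l, s) : C}. a : merged C l s} <= 2"
proof (rule card_le_2[of "pidx C l" _ "pidx C l a" "Suc (pidx C l a)"])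
 show "inj_on (pidx C l) {s : {s. (l, s) : C}. a : merged C l s}"
  using assms by (auto simp: inj_on_def cut_set_def intro!: isl_inj[of C l]) (auto simp: isl_def)
qed (auto simp: merged_def)

lemma count_pair:
 assumes C: "cut_set C" and dec: "decomposes r M" and lt: "l < K" "t < K" "l ~= t"
 shows "card {(s, u). (l, s) : C & isl C t u & nonconst (E l t) (merged C l s) (window C t u)} <= r * ((2 + 4 * M) * (card C + 1))"
proof -
 obtain Rs where Rs: "length Rs <= r" "!!R. R : set Rs ==> atomic M R"
  "!!a c. a < n ==> c < n ==> E l t a c <-> (ALL R:set Rs. R a c)" using dec lt unfolding decomposes_def by metis
 let ?JJ = "{s. (l, s) : C}" and ?YY = "{u. isl C t u}"
 let ?X = "%R. {(s, u). s : ?JJ & u : ?YY & nonconst R (merged C l s) (window C t u)}"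
 have finJ: "finite ?JJ" by (rule finite_subset[of _ "snd ` C"]) (use cut_set_finite[OF C] in force)+
 have cJ: "card ?JJ <= card C" by (rule card_inj_on_le[of "Pair l"]) (use cut_set_finite[OF C] in "auto simp: inj_on_def")
 have cY: "card ?YY <= card C + 1"
 proof -
  have "?YY <= insert 0 (snd ` C)" unfolding isl_def by force
  hence "card ?YY <= card (insert 0 (snd ` C))" using cut_set_finite[OF C] by (intro card_mono) auto
  also have "... <= Suc (card (snd ` C))" by (rule card_insert_le_m1) (auto simp: card_gt_0_iff)
  also have "... <= Suc (card C)" using card_image_le[OF cut_set_finite[OF C]] by simp
  finally show ?thesis by simp
 qed
 have each: "card (?X R) <= (2 + 4 * M) * (card C + 1)" if R: "R : set Rs" for R
 proof -
  have "card (?X R) <= 2 * card ?JJ + 4 * M * card ?YY \<or> card (?X R) <= 2 * card ?YY + 4 * M * card ?JJ"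
  using Rs(2)[OF R] unfolding atomic_def
  proof
  assume a: "monot R & changes M R"
  show ?thesis using count_nonconst[OF conjunct1[OF a] conjunct2[OF a] finJ finite_isl convex_merged convex_window
  merged_overlap[OF C] window_overlap] by (rule disjI1)
  next
  assume a: "monot (%a c. R c a) & changes M (%a c. R c a)"
  have "card {(u, s). u : ?YY & s : ?JJ & nonconst (%a c. R c a) (window C t u) (merged C l s)}
  <= 2 * card ?YY + 4 * M * card ?JJ" by (rule count_nonconst[OF conjunct1[OF a] conjunct2[OF a] finite_isl finJ convex_window convex_merged
  window_overlap merged_overlap[OF C]])
  moreover have "?X R = prod.swap ` {(u, s). u : ?YY & s : ?JJ & nonconst (%a c. R c a) (window C t u) (merged C l s)}"
  unfolding nonconst_def image_iff by (auto; blast)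
  ultimately show ?thesis by (simp add: card_image)
  qed
  moreover have "2 * card ?JJ + 4 * M * card ?YY <= (2 + 4 * M) * (card C + 1)"
  "2 * card ?YY + 4 * M * card ?JJ <= (2 + 4 * M) * (card C + 1)"
  using cJ cY mult_le_mono2[of "card ?JJ" "card C + 1" "4 * M"] mult_le_mono2[OF cY, of "4 * M"] unfolding add_mult_distrib by simp_all
  ultimately show ?thesis by linarith
 qed
 \<comment> \<open>A conjunct that fails at the false pair holds at the true one, so it is itself
   nonconstant on the box.\<close>
 have nc: "EX R:set Rs. nonconst R S T" if ST: "S <= {..<n}" "T <= {..<n}" "nonconst (E l t) S T" for S T
 proof -
  obtain a c a' c' where w: "a : S" "c : T" "E l t a c" "a' : S" "c' : T" "~ E l t a' c'" using ST unfolding nonconst_def by blast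
  hence w': "a < n" "c < n" "a' < n" "c' < n" using ST by auto
  then obtain R where R: "R : set Rs" "~ R a' c'" using Rs(3) w by blast
  hence "R a c" using Rs(3) w w' by blast
  thus ?thesis using R w unfolding nonconst_def by blast
 qed
 have "{(s, u). (l, s) : C & isl C t u & nonconst (E l t) (merged C l s) (window C t u)} <= (UN R:set Rs. ?X R)"
  using nc convex_merged convex_window unfolding convex_def by fastforce
 hence "card {(s, u). (l, s) : C & isl C t u & nonconst (E l t) (merged C l s) (window C t u)} <= card (UN R:set Rs. ?X R)"
 proof (intro card_mono finite_UN_I)
  show "finite (?X R)" for R by (rule finite_subset[of _ "?JJ \<times> ?YY"]) (use finJ finite_isl in auto)
 qed auto
 also have "... <= (SUM R:set Rs. card (?X R))" by (rule card_UN_le) simp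
 also have "... <= (SUM R:set Rs. (2 + 4 * M) * (card C + 1))" by (rule sum_mono) (rule each)
 also have "... = card (set Rs) * ((2 + 4 * M) * (card C + 1))" by simp
 also have "... <= r * ((2 + 4 * M) * (card C + 1))" using Rs(1) card_length[of Rs] by (intro mult_le_mono1) linarith
 finally show ?thesis .
qed

text \<open>If every cut cost at least \<open>b\<close>, the total would be at least
  \<open>b * card C\<close>, but summing \<open>count_pair\<close> over all pairs of variables gives
  less. A variable may have one part more than cuts; \<open>card C + 1 <= 2 * card C\<close> absorbs
  this and causes the leading factor 2.\<close>

lemma exists_cheap_cut:
 assumes C: "cut_set C" and dec: "decomposes r M" and ne: "C ~= {}" and b: "2 * K * K * r * (2 + 4 * M) < b"
 shows "EX (l, s):C. cost C l s < b"
proof (rule ccontr)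
 assume "~ ?thesis"
 hence big: "b <= cost C l s" if "(l, s) : C" for l s using that by force
 let ?W = "%(l, s). {(t, u). t < K & t ~= l & isl C t u & nonconst (E l t) (merged C l s) (window C t u)}"
 let ?P = "%l t. {(s, u). (l, s) : C & isl C t u & nonconst (E l t) (merged C l s) (window C t u)}"
 have finC: "finite C" by (rule cut_set_finite[OF C])
 have finW: "finite (?W x)" for x by (cases x, rule finite_subset[of _ "{..<K} \<times> {..<n}"]) (auto simp: isl_def)
 have finP: "finite (?P l t)" for l t by (rule finite_subset[of _ "snd ` C \<times> {u. isl C t u}"]) (use finC finite_isl in force)+
 have "b * card C = (SUM x:C. b)" by simp
 also have "... <= (SUM x:C. card (?W x))" using big unfolding cost_def by (intro sum_mono) auto
 also have "... = card (Sigma C ?W)" using finC finW by simp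
 also have "... <= card (UN (l, t):{(l, t). l < K & t < K & l ~= t}. (%(s, u). ((l, s), (t, u))) ` ?P l t)"
 proof (rule card_mono)
  show "finite (UN (l, t):{(l, t). l < K & t < K & l ~= t}. (%(s, u). ((l, s), (t, u))) ` ?P l t)"
  using finP by (auto intro!: finite_UN_I finite_subset[of "{(l, t). l < K & t < K & l ~= t}" "{..<K} \<times> {..<K}"])
  show "Sigma C ?W <= (UN (l, t):{(l, t). l < K & t < K & l ~= t}. (%(s, u). ((l, s), (t, u))) ` ?P l t)"
  using C unfolding cut_set_def by (fastforce simp: image_iff)
 qed
 also have "... <= (SUM (l, t):{(l, t). l < K & t < K & l ~= t}. r * ((2 + 4 * M) * (card C + 1)))"
 proof (rule order_trans[OF card_UN_le sum_mono])
  show "finite {(l, t). l < K & t < K & l ~= t}" by (rule finite_subset[of _ "{..<K} \<times> {..<K}"]) auto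
  show "card (case x of (l, t) => (%(s, u). ((l, s), (t, u))) ` ?P l t) <= (case x of (l, t) => r * ((2 + 4 * M) * (card C + 1)))"
  if x: "x : {(l, t). l < K & t < K & l ~= t}" for x
  proof -
  obtain l t where lt: "x = (l, t)" "l < K" "t < K" "l ~= t" using x by auto
  have "card ((%(s, u). ((l, s), (t, u))) ` ?P l t) <= card (?P l t)" by (rule card_image_le[OF finP])
  also note count_pair[OF C dec lt(2-4)]
  finally show ?thesis using lt(1) by simp
  qed
 qed
 also have "... = card {(l, t). l < K & t < K & l ~= t} * (r * ((2 + 4 * M) * (card C + 1)))" by simp
 also have "... <= (K * K) * (r * ((2 + 4 * M) * (card C + 1)))"
 proof (rule mult_le_mono1)
  have "card {(l, t). l < K & t < K & l ~= t} <= card ({..<K} \<times> {..<K})" by (rule card_mono) auto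
  thus "card {(l, t). l < K & t < K & l ~= t} <= K * K" by simp
 qed
 also have "... <= (K * K) * (r * ((2 + 4 * M) * (2 * card C)))" using ne finC by (intro mult_le_mono2) (simp add: Suc_leI card_gt_0_iff)
 also have "... = (2 * K * K * r * (2 + 4 * M)) * card C" by (simp only: ac_simps)
 also have "... < b * card C" using b ne finC by (simp add: card_gt_0_iff)
 finally show False by simp
qed

text \<open>Marks the red parts and, charged to its left side, each boundary between two constant
  parts at which the value switches. Merging two parts of variable \<open>t\<close> then at most
  turns such a switch into a red part.\<close>

definition bad where
 "bad C J l t u <-> nonconst (E l t) J (part C t u) \<or>
  (nonconst (E l t) J (window C t u) & ~ nonconst (E l t) J {c. c < n & pidx C t c = Suc (pidx C t u)})"

text \<open>Unlike the number of red neighbours, the number of bad ones never grows when intervals of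
 another variable are merged.\<close>

definition sparse where
 "sparse C <-> (ALL l<K. ALL t<K. l ~= t --> (ALL s. isl C l s --> card {u. isl C t u & bad C (part C l s) l t u} < b))"

section \<open>Sparsity is preserved by cheap merges\<close>

lemma red_nonconst: "red C l s t u <-> nonconst (E l t) (part C l s) (part C t u)"
 unfolding red_def someT_def someF_def nonconst_def by simp

lemma sparse_deg: "sparse C ==> deg C" unfolding deg_def
proof (intro allI impI)
 fix l s t u assume sp: "sparse C" and a: "l < K" "s < n" "t < K" "u < n" "l ~= t & isl C l s & isl C t u & red C l s t u"
 have "rank C l s t u < card {u. isl C t u & bad C (part C l s) l t u}" unfolding rank_def
  by (rule psubset_card_mono) (use a finite_isl[of C t] in "auto simp: red_nonconst bad_def")
 also have "... < b" using sp a unfolding sparse_def by blast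
 finally show "rank C l s t u < b" .
qed

lemma window_Un: "window C t u = part C t u Un {c. c < n & pidx C t c = Suc (pidx C t u)}" unfolding window_def part_def by auto

lemma nonconst_shrink:
 "nonconst R J (T Un S) ==> ~ nonconst R J S ==> S1 <= S ==> S1 ~= {} ==> nonconst R J (T Un S1)" unfolding nonconst_def by blast

lemma nonconst_mono: "nonconst R J S ==> J <= J' ==> S <= S' ==> nonconst R J' S'" unfolding nonconst_def by blast

lemma pred_part:
 assumes "cut_set C" "(l, s) : C"
 shows "EX p. isl C l p & Suc (pidx C l p) = pidx C l s"
proof -
 have s: "0 < s" "s < n" using assms unfolding cut_set_def by auto
 then obtain s' where s': "s = Suc s'" by (cases s) auto
 obtain p where "isl C l p" "pidx C l p = pidx C l s'" using ex_isl[of s' C l] s s' by auto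
 thus ?thesis using assms s' by (auto simp: pidx_Suc)
qed

text \<open>For the merged part itself, the bad parts are among the windows counted by the cost.
  Seen from another variable, only the merged part can become newly bad, and then the part that
  vanished was bad, so the count does not grow.\<close>

lemma sparse_remove:
 assumes C: "cut_set C" and sp: "sparse C" and cut: "(l, s) : C" and ch: "cost C l s < b"
 shows "sparse (C - {(l, s)})" unfolding sparse_def
proof (intro allI impI)
 let ?C = "C - {(l, s)}"
 have s: "0 < s" "s < n" "isl C l s" using C cut unfolding cut_set_def isl_def by auto
 obtain p where p: "isl C l p" "Suc (pidx C l p) = pidx C l s" using pred_part[OF C cut] by blast
 have ps: "p ~= s" using p by auto
 note parts = part_remove[OF cut s(1) s(3) p]
 fix l1 t1 s1 assume lt: "l1 < K" "t1 < K" "l1 ~= t1" and s1: "isl ?C l1 s1"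
 have s1C: "isl C l1 s1" "(l1, s1) ~= (l, s)" using s1 s(1) by (auto simp: isl_remove)
 have old: "card {u. isl C t1 u & bad C (part C l1 s1) l1 t1 u} < b" using sp lt s1C unfolding sparse_def by blast
 show "card {u. isl ?C t1 u & bad ?C (part ?C l1 s1) l1 t1 u} < b"
 proof (cases "t1 = l")
  case False
  have same: "isl ?C t1 u = isl C t1 u" "bad ?C J l1 t1 u = bad C J l1 t1 u" for u J
  using False s(1) by (auto simp: isl_remove bad_def part_other window_def pidx_other)
  show ?thesis
  proof (cases "l1 = l & s1 = p")
  case True
  have "part C l p Un part C l s = merged C l s" unfolding part_def merged_def using p(2) by auto
  hence "part ?C l1 s1 = merged C l s" using parts(1) True by simp
  hence "{u. isl ?C t1 u & bad ?C (part ?C l1 s1) l1 t1 u} <= {u. isl C t1 u & nonconst (E l t1) (merged C l s) (window C t1 u)}"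
  using True unfolding same by (auto simp: bad_def window_Un intro: nonconst_mono)
  hence "card {u. isl ?C t1 u & bad ?C (part ?C l1 s1) l1 t1 u} <= card {u. isl C t1 u & nonconst (E l t1) (merged C l s) (window C t1 u)}"
  by (rule card_mono[rotated]) (rule finite_subset[OF _ finite_isl[of C t1]], blast)
  also have "... <= cost C l s" unfolding cost_def
  proof (rule card_inj_on_le[of "Pair t1"])
  show "finite {(t, u). t < K & t ~= l & isl C t u & nonconst (E l t) (merged C l s) (window C t u)}"
  by (rule finite_subset[of _ "{..<K} \<times> {..<n}"]) (auto simp: isl_def)
  qed (use lt False in "auto simp: inj_on_def")
  also note ch
  finally show ?thesis .
  next
  case 2: False
  have "part ?C l1 s1 = part C l1 s1" using parts(2) part_other[of l1 l] s1C 2 by (cases "l1 = l") auto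
  thus ?thesis using old unfolding same by simp
  qed
 next
  case True
  hence l1: "l1 ~= l" using lt by simp
  define J where "J = part C l1 s1"
  have J: "part ?C l1 s1 = J" using part_other[OF l1] unfolding J_def by simp
  let ?nx = "%C u. {c. c < n & pidx C l c = Suc (pidx C l u)}"
  have ne: "part C l p ~= {}" "part C l s ~= {}" using part_isl p(1) s(3) by blast+
  have nxp: "?nx C p = part C l s" unfolding part_def using p(2) by auto
  have nx_p: "?nx ?C p = ?nx C s"
  proof -
  have "~ s <= p" using p(2) pidx_mono[of s p C l] by linarith
  hence "pidx ?C l c = Suc (pidx ?C l p) <-> pidx C l c = Suc (pidx C l s)" for c unfolding pidx_remove[OF cut s(1)]
  using p(2) pidx_mono[of s c C l] pidx_mono[of c s C l] pidx_less[OF _ cut, of c] by (cases "s <= c") auto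
  thus ?thesis by simp
  qed
  have main: "bad C J l1 l u \<or> u = p & bad C J l1 l s" if u: "isl ?C l u" "bad ?C J l1 l u" for u
  proof (cases "u = p")
  case True
  show ?thesis
  proof (cases "nonconst (E l1 l) J (part C l p Un part C l s)")
  case True
  hence "bad C J l1 l p \<or> bad C J l1 l s" unfolding bad_def window_Un nxp by blast
  thus ?thesis using \<open>u = p\<close> by blast
  next
  case False
  hence "nonconst (E l1 l) J (?nx C s Un (part C l p Un part C l s))" "~ nonconst (E l1 l) J (?nx C s)"
  using u(2) unfolding \<open>u = p\<close> bad_def window_Un parts(1) nx_p by (auto simp: Un_commute)
  hence "nonconst (E l1 l) J (?nx C s Un part C l s)" by (rule_tac nonconst_shrink[OF _ False]) (use ne in auto)
  thus ?thesis using \<open>~ nonconst (E l1 l) J (?nx C s)\<close> \<open>u = p\<close>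
  unfolding bad_def window_Un by (simp add: Un_commute)
  qed
  next
  case False
  have uC: "isl C l u" "u ~= s" using u s(1) by (auto simp: isl_remove)
  have pu: "part ?C l u = part C l u" by (rule parts(2)[OF uC(1) False uC(2)])
  have "bad C J l1 l u"
  proof (cases "nonconst (E l1 l) J (part C l u)")
  case True
  thus ?thesis unfolding bad_def by simp
  next
  case c: False
  hence nb: "nonconst (E l1 l) J (part C l u Un ?nx ?C u)" "~ nonconst (E l1 l) J (?nx ?C u)"
  using u(2) unfolding bad_def window_Un pu by auto
  have upq: "pidx C l u ~= pidx C l p" "pidx C l u ~= pidx C l s" using isl_inj[OF uC(1)] p(1) s(3) False uC(2) by auto
  show ?thesis
  proof (cases "Suc (pidx C l u) = pidx C l p")
  case True
  have "?nx ?C u = part ?C l p"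
  proof -
  have "~ s <= u" "~ s <= p" using pidx_mono[of s u C l] pidx_mono[of s p C l] True p(2) by linarith+
  thus ?thesis unfolding part_def using True by (simp add: pidx_remove[OF cut s(1)])
  qed
  hence eq: "?nx ?C u = part C l p Un part C l s" using parts(1) by simp
  have "nonconst (E l1 l) J (part C l u Un part C l p)" using nb unfolding eq by (rule nonconst_shrink) (use ne in auto)
  moreover have "~ nonconst (E l1 l) J (part C l p)" using nb(2) unfolding eq by (auto intro: nonconst_mono)
  moreover have "?nx C u = part C l p" unfolding part_def using True by auto
  ultimately show ?thesis unfolding bad_def window_Un by simp
  next
  case n: False
  have "?nx ?C u = ?nx C u"
  proof -
  have ge: "s <= c <-> pidx C l s <= pidx C l c" for c using pidx_mono[of s c C l] pidx_less[OF _ cut, of c] by (meson leD leI)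
  have "pidx ?C l c = Suc (pidx ?C l u) <-> pidx C l c = Suc (pidx C l u)" for c
  unfolding pidx_remove[OF cut s(1)] ge using upq n p(2) by (auto split: if_splits)
  thus ?thesis by auto
  qed
  thus ?thesis using nb unfolding bad_def window_Un by auto
  qed
  qed
  thus ?thesis by simp
  qed
  have "card {u. isl ?C l u & bad ?C J l1 l u} <= card {u. isl C l u & bad C J l1 l u}"
  proof (cases "bad C J l1 l s")
  case True
  have "{u. isl ?C l u & bad ?C J l1 l u} <= insert p ({u. isl C l u & bad C J l1 l u} - {s})" using main s(1) by (auto simp: isl_remove)
  hence "card {u. isl ?C l u & bad ?C J l1 l u} <= card (insert p ({u. isl C l u & bad C J l1 l u} - {s}))"
  using finite_isl[of C l] by (intro card_mono) auto
  also have "... <= Suc (card ({u. isl C l u & bad C J l1 l u} - {s}))" using finite_isl[of C l] by (simp add: card_insert_if)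
  also have "... = card {u. isl C l u & bad C J l1 l u}" using finite_isl[of C l] True s(3) by (intro card_Suc_Diff1) auto
  finally show ?thesis .
  next
  case False
  thus ?thesis using main finite_isl[of C l] s(1) by (intro card_mono) (auto simp: isl_remove)
  qed
  thus ?thesis using old unfolding True J J_def by linarith
 qed
qed

definition all_cuts where
 "all_cuts = {(l, s). l < K & 0 < s & s < n}"

lemma monot_changes_1:
 assumes "monot R" "a < n"
 shows "card {c. Suc c < n & R a c ~= R a (Suc c)} <= 1"
proof -
 have "c = d" if "Suc c < n" "Suc d < n" "R a c ~= R a (Suc c)" "R a d ~= R a (Suc d)" "c <= d" for c d
 proof (rule ccontr)
  assume "c ~= d"
  hence "Suc c <= d" "c < n" "d < n" using that by auto
  thus False using assms that unfolding monot_def by (meson le_SucI order_refl)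
 qed
 hence "c = d" if "Suc c < n & R a c ~= R a (Suc c)" "Suc d < n & R a d ~= R a (Suc d)" for c d using that by (metis linear)
 moreover have "finite {c. Suc c < n & R a c ~= R a (Suc c)}" by (rule finite_subset[of _ "{..<n}"]) auto
 ultimately show ?thesis by (simp add: card_le_Suc0_iff_eq)
qed

text \<open>Parts are singletons, so a bad part marks a switch between \<open>u\<close> and
  \<open>u + 1\<close>. Each conjunct switches at most \<open>M\<close> times, or once if it is
  monotone in this argument.\<close>

lemma sparse_all_cuts:
 assumes dec: "decomposes r M" and b: "r * (M + 1) < b"
 shows "sparse all_cuts" unfolding sparse_def
proof (intro allI impI)
 fix l t s assume lt: "l < K" "t < K" "l ~= t" and s: "isl all_cuts l s"
 have idx: "a < n ==> pidx all_cuts l a = a" if "l < K" for l a using that by (induction a) (auto simp: pidx_0 pidx_Suc all_cuts_def)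
 have sn: "s < n" using s unfolding isl_def by simp
 have ps: "part all_cuts l s = {s}" using idx[OF lt(1)] sn unfolding part_def by auto
 obtain Rs where Rs: "length Rs <= r" "!!R. R : set Rs ==> atomic M R"
  "!!a c. a < n ==> c < n ==> E l t a c <-> (ALL R:set Rs. R a c)" using dec lt unfolding decomposes_def by metis
 have each: "card {u. Suc u < n & R s u ~= R s (Suc u)} <= M + 1" if R: "R : set Rs" for R
  using Rs(2)[OF R] sn monot_changes_1[of R s] unfolding atomic_def changes_def by fastforce
 have "{u. isl all_cuts t u & bad all_cuts (part all_cuts l s) l t u} <= (UN R:set Rs. {u. Suc u < n & R s u ~= R s (Suc u)})"
 proof clarify
  fix u assume u: "isl all_cuts t u" "bad all_cuts (part all_cuts l s) l t u"
  have un: "u < n" using u unfolding isl_def by simp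
  have pu: "part all_cuts t u = {u}" using idx[OF lt(2)] un unfolding part_def by auto
  have wu: "window all_cuts t u <= {c. c < n & (c = u \<or> c = Suc u)}" using idx[OF lt(2)] un unfolding window_def by auto
  have "nonconst (E l t) {s} (window all_cuts t u)" using u(2) unfolding bad_def ps pu nonconst_def by auto
  hence "Suc u < n" "E l t s u ~= E l t s (Suc u)" using wu unfolding nonconst_def by auto
  thus "u : (UN R:set Rs. {u. Suc u < n & R s u ~= R s (Suc u)})" using Rs(3) sn un by auto
 qed
 hence "card {u. isl all_cuts t u & bad all_cuts (part all_cuts l s) l t u} <= card (UN R:set Rs. {u. Suc u < n & R s u ~= R s (Suc u)})"
 proof (intro card_mono finite_UN_I)
  show "finite {u. Suc u < n & R s u ~= R s (Suc u)}" for R :: "nat => nat => bool" by (rule finite_subset[of _ "{..<n}"]) auto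
 qed auto
 also have "... <= (SUM R:set Rs. card {u. Suc u < n & R s u ~= R s (Suc u)})" by (rule card_UN_le) simp
 also have "... <= (SUM R:set Rs. M + 1)" by (rule sum_mono) (rule each)
 also have "... = card (set Rs) * (M + 1)" by simp
 also have "... <= r * (M + 1)" using Rs(1) card_length[of Rs] by (intro mult_le_mono1) linarith
 also note b
 finally show "card {u. isl all_cuts t u & bad all_cuts (part all_cuts l s) l t u} < b" .
qed

section \<open>The contraction sequence and the table of feasible codes\<close>

definition cheap where
 "cheap C l s <-> (l, s) : C & cost C l s < b"

text \<open>The lexicographically first cheap cut, described with bounded quantifiers.\<close>

definition pick where
 "pick C l s <-> cheap C l s & ~ (EX t<K. EX u<n. (t < l \<or> t = l & u < s) & cheap C t u)"

definition remove where
 "remove C = {(l, s) : C. ~ pick C l s}"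

fun cuts where
 "cuts 0 = all_cuts"
| "cuts (Suc i) = remove (cuts i)"

lemma cut_set_cuts: "cut_set (cuts i)" by (induction i) (auto simp: cut_set_def all_cuts_def remove_def)

lemma pick_unique:
 assumes "cut_set C" "pick C l s" "pick C t u"
 shows "l = t & s = u"
proof -
 have "l < K" "s < n" "t < K" "u < n" using assms unfolding pick_def cheap_def cut_set_def by auto
 thus ?thesis using assms(2,3) unfolding pick_def by (metis linorder_neqE_nat)
qed

lemma remove_pick: "cut_set C ==> pick C l s ==> remove C = C - {(l, s)}" using pick_unique unfolding remove_def by auto

lemma remove_no_pick: "~ (EX l s. pick C l s) ==> remove C = C" unfolding remove_def by auto

lemma pick_exists:
 assumes C: "cut_set C" and "cheap C l s"
 shows "EX l s. pick C l s"
proof -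
 define l' where "l' = (LEAST l. EX s. cheap C l s)"
 define s' where "s' = (LEAST s. cheap C l' s)"
 have 1: "EX s. cheap C l' s" unfolding l'_def by (rule LeastI[of _ l]) (use assms(2) in blast)
 hence 2: "cheap C l' s'" unfolding s'_def by (rule LeastI_ex)
 have "pick C l' s'" unfolding pick_def using 2 not_less_Least[of _ "%l. EX s. cheap C l s"] not_less_Least[of _ "%s. cheap C l' s"]
  unfolding l'_def[symmetric] s'_def[symmetric] by blast
 thus ?thesis by blast
qed

text \<open>The criterion of \<open>feas_components\<close>, answered from the stored table
  \<open>F\<close>.\<close>

definition combine where
 "combine C W F B <-> pok C B & (ALL l<K. ALL s<n. ALL w<W. isl C l s & subv (code C l s w) B --> F l s w)"

definition table where
 "table C W F <-> (ALL l<K. ALL s<n. ALL w<W. isl C l s --> F l s w = feas C (code C l s w))"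

text \<open>A vector of the coarser partition is also one of the finer partition, in which
  \<open>Suc p\<close> means only the left half of a merged part; so the query is made once as it
  stands and once with the right half \<open>Suc u\<close>.\<close>

definition update where
 "update C W F l s w <-> combine C W F (code (remove C) l s w) \<or>
  (EX t<K. EX u<n. EX p<n. pick C t u & isl C t p & Suc (pidx C t p) = pidx C t u & code (remove C) l s w t = Suc p &
  combine C W F ((code (remove C) l s w)(t := Suc u)))"

lemma combine_iff:
 assumes "table C W F" "deg C" "K < b" "valid C B" "b ^ (3 * K) <= W"
 shows "combine C W F B <-> feas C B" unfolding feas_components[OF assms(2-5)] combine_def using assms(1) unfolding table_def by auto

lemma table_update:
 assumes C: "cut_set C" and tab: "table C W F" and d: "deg C" and bK: "K < b" and W: "b ^ (3 * K) <= W"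
 shows "table (remove C) W (update C W F)" unfolding table_def
proof (intro allI impI)
 fix l s w assume lsw: "l < K" "s < n" "w < W" "isl (remove C) l s"
 have val': "valid (remove C) (code (remove C) l s w)" unfolding code_def by (rule vec_valid[OF lsw(1,4)])
 have val: "valid C (code (remove C) l s w)" using val' unfolding valid_def isl_def remove_def by auto
 note comb = combine_iff[OF tab d bK _ W]
 show "update C W F l s w = feas (remove C) (code (remove C) l s w)"
 proof (cases "EX t u. pick C t u")
  case False
  thus ?thesis unfolding update_def comb[OF val] using remove_no_pick[OF False] by auto
 next
  case True
  then obtain t u where tu: "pick C t u" by blast
  hence cut: "(t, u) : C" "0 < u" "t < K" "u < n" "isl C t u" using C unfolding pick_def cheap_def cut_set_def isl_def by auto
  obtain p where p: "isl C t p" "Suc (pidx C t p) = pidx C t u" using pred_part[OF C cut(1)] by blast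
  have rm: "remove C = C - {(t, u)}" by (rule remove_pick[OF C tu])
  let ?B = "code (remove C) l s w"
  have val2: "valid C (?B(t := Suc u))" using val cut unfolding valid_def by auto
  have "update C W F l s w <-> combine C W F ?B \<or> (?B t = Suc p & combine C W F (?B(t := Suc u)))"
  proof -
  have "t' = t & u' = u & p' = p" if "pick C t' u'" "isl C t' p'" "Suc (pidx C t' p') = pidx C t' u'" for t' u' p'
  using pick_unique[OF C tu that(1)] isl_inj[OF p(1), of p'] that p(2) by auto
  moreover have "p < n" using p unfolding isl_def by simp
  ultimately show ?thesis unfolding update_def using tu p cut by blast
  qed
  also have "... <-> feas (remove C) ?B" unfolding comb[OF val] comb[OF val2]
  using feas_remove[OF cut(1,2,5) p, of ?B] val' unfolding rm by simp
  finally show ?thesis .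
 qed
qed

definition full :: "nat => nat" where
 "full l = (if l < K then Suc 0 else 0)"

lemma feas_full: "feas {} full <-> (EX x. (ALL l<K. x l < n) & (ALL l<K. ALL t<K. l ~= t --> E l t (x l) (x t)))"
 unfolding part_def pidx_def feas_def full_def by auto

lemma valid_full: "valid C full" unfolding valid_def full_def using isl_0 by auto

lemma cuts_empty:
 assumes dec: "decomposes r M" and b: "2 * K * K * r * (2 + 4 * M) < b" and i: "K * n <= i"
 shows "cuts i = {}"
proof -
 have "card (cuts i) <= K * n - i" for i
 proof (induction i)
  case 0
  have "card all_cuts <= card ({..<K} \<times> {..<n})" unfolding all_cuts_def by (rule card_mono) auto
  thus ?case by simp
 next
  case (Suc i)
  show ?case
  proof (cases "cuts i = {}")
  case True
  thus ?thesis by (simp add: remove_def)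
  next
  case False
  obtain l s where "cheap (cuts i) l s" using exists_cheap_cut[OF cut_set_cuts dec False b] unfolding cheap_def by auto
  then obtain l s where ls: "pick (cuts i) l s" using pick_exists[OF cut_set_cuts] by blast
  hence "(l, s) : cuts i" unfolding pick_def cheap_def by simp
  hence "card (cuts (Suc i)) < card (cuts i)" unfolding cuts.simps remove_pick[OF cut_set_cuts ls] using cut_set_finite[OF cut_set_cuts]
  by (rule_tac card_Diff1_less) auto
  thus ?thesis using Suc by simp
  qed
 qed
 hence "card (cuts i) = 0" using i by (metis diff_is_0_eq le_zero_eq)
 thus ?thesis using cut_set_finite[OF cut_set_cuts] by simp
qed

lemma sparse_cuts:
 assumes dec: "decomposes r M" and b: "r * (M + 1) < b"
 shows "sparse (cuts i)"
proof (induction i)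
 case 0
 thus ?case using sparse_all_cuts[OF assms] by simp
next
 case (Suc i)
 show ?case
 proof (cases "EX l s. pick (cuts i) l s")
  case True
  then obtain l s where ls: "pick (cuts i) l s" by blast
  thus ?thesis using sparse_remove[OF cut_set_cuts Suc, of l s] remove_pick[OF cut_set_cuts ls] unfolding pick_def cheap_def by simp
 next
  case False
  thus ?thesis using Suc remove_no_pick by simp
 qed
qed

end


section \<open>Discretization as a constraint problem\<close>

text \<open>The label of a run is odd if the run is red and even if it is blue.\<close>

fun scan :: "(bool => nat => bool) => nat => nat" where
 "scan P 0 = 0"
| "scan P (Suc v) = (if P True v & even (scan P v) then Suc (scan P v)
  else if P False v & (odd (scan P v) \<or> scan P v = 0) then (if scan P v = 0 then 2 else Suc (scan P v))
  else scan P v)"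

lemma scan_mono: "v <= w ==> scan P v <= scan P w" by (rule lift_Suc_mono_le[of "scan P"]) auto

lemma scan_parity: "P c v ==> ~ P (~ c) v ==> odd (scan P (Suc v)) <-> c" by (cases c) auto

lemma scan_pos: "P c v ==> 0 < scan P (Suc v)" by (cases c) (auto simp: odd_pos)

lemma scan_change: "v < w ==> scan P (Suc v) ~= scan P (Suc w) ==> EX u. v < u & u <= w & scan P (Suc u) ~= scan P u"
proof (induction w)
 case (Suc w)
 thus ?case by (metis le_SucI less_Suc_eq less_Suc_eq_le order_refl)
qed simp

text \<open>Coordinates are already ranks below \<open>N\<close>; \<open>co 0\<close> is the
  coordinate cut by vertical lines. A line at \<open>a\<close> separates the coordinates below
  \<open>a\<close> from the rest, so positions range from 0 to \<open>N\<close>.\<close>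

locale points =
 fixes N k :: nat and co :: "nat => nat => nat" and cl :: "nat => bool"
 assumes co_less: "d < 2 ==> z < N ==> co d z < N"
begin

text \<open>The lines themselves and a frame of two lines in each direction.\<close>

abbreviation "K == k + 4"

definition sep where
 "sep d a z w <-> (co d z < a) ~= (co d w < a)"

definition solvable :: bool where
 "solvable <-> (EX X Y. finite X & finite Y & card X + card Y <= k &
  (ALL z<N. ALL w<N. cl z & ~ cl w --> (EX a:X. sep 0 a z w) \<or> (EX a:Y. sep 1 a z w)))"

text \<open>Coarse slabs: a slab is extended as long as it can be separated with few lines of the other
 direction.\<close>

definition slab where
 "slab d s c e v <-> (EX z<N. cl z = e & s <= co d z & co d z <= c & co (1 - d) z = v)"

text \<open>The first run is numbered 1 or 2 and each further run needs a line of its own, whence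
  \<open>k + 2\<close>.\<close>

definition good where
 "good d s c <-> ~ (EX v<N. slab d s c True v & slab d s c False v) & scan (slab d s c) N <= k + 2"

fun st where
 "st d 0 = 0"
| "st d (Suc v) = (if good d (st d v) (Suc v) then st d v else Suc v)"

fun cc :: "nat => nat => nat" where
 "cc d 0 = 0"
| "cc d (Suc v) = cc d v + (if st d (Suc v) = Suc v then 1 else 0)"

definition band where
 "band d c e v <-> (EX z<N. cl z = e & st d (co d z) = st d c & co (1 - d) z = v)"

text \<open>A fine slab begins also wherever some coarse slab of the other direction changes its
  run; this makes the cells of \<open>cell_colour\<close> monochromatic.\<close>

definition nf where
 "nf d v <-> st d v = v \<or> (EX c<N. scan (band (1 - d) c) (Suc v) ~= scan (band (1 - d) c) v)"

fun ff :: "nat => nat => nat" where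
 "ff d 0 = 0"
| "ff d (Suc v) = ff d v + (if nf d (Suc v) then 1 else 0)"

definition no_conflict :: bool where
 "no_conflict <-> (ALL z<N. ALL w<N. co 0 z = co 0 w & co 1 z = co 1 w --> cl z = cl w)"

lemma cc_mono: "v <= w ==> cc d v <= cc d w" by (rule lift_Suc_mono_le[of "cc d"]) auto

lemma ff_mono: "v <= w ==> ff d v <= ff d w" by (rule lift_Suc_mono_le[of "ff d"]) auto

lemma st_le: "st d v <= v" by (induction v) auto

lemma st_eq: "v <= w ==> cc d v = cc d w ==> st d v = st d w"
proof (induction w)
 case (Suc w)
 show ?case
 proof (cases "v = Suc w")
  case False
  hence vw: "v <= w" using Suc.prems by simp
  have "cc d v <= cc d w" "cc d w <= cc d (Suc w)" using vw by (auto intro: cc_mono)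
  hence eq: "cc d v = cc d w" "st d (Suc w) ~= Suc w" using Suc.prems by (auto split: if_splits)
  thus ?thesis using Suc.IH[OF vw] by (auto split: if_splits)
 qed simp
qed simp

lemma cc_eq_st_eq: "cc d v = cc d w ==> st d v = st d w" using st_eq[of v w d] st_eq[of w v d] by (metis linear)

lemma st_good: "st d v < v ==> good d (st d v) v" by (cases v) (auto split: if_splits)

lemma ff_cc_aux: "v <= w ==> ff d v = ff d w ==> cc d v = cc d w"
proof (induction w)
 case (Suc w)
 show ?case
 proof (cases "v = Suc w")
  case False
  hence vw: "v <= w" using Suc.prems by simp
  have "ff d v <= ff d w" "ff d w <= ff d (Suc w)" using vw by (auto intro: ff_mono)
  hence "ff d v = ff d w" "~ nf d (Suc w)" using Suc.prems by (auto split: if_splits)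
  thus ?thesis using Suc.IH[OF vw] unfolding nf_def by auto
 qed simp
qed simp

lemma ff_cc: "ff d v = ff d w ==> cc d v = cc d w" using ff_cc_aux[of v w d] ff_cc_aux[of w v d] by (metis linear)

lemma ff_less: "v < u ==> u <= w ==> nf d u ==> ff d v < ff d w"
proof -
 assume a: "v < u" "u <= w" "nf d u"
 then obtain u' where u: "u = Suc u'" by (cases u) auto
 have "ff d v <= ff d u'" using a u by (intro ff_mono) auto
 also have "... < ff d u" using a(3) unfolding u by simp
 also have "... <= ff d w" using a by (intro ff_mono) auto
 finally show ?thesis .
qed

text \<open>A coarse slab never has both colours at one cross position, and a change of run between
  two cross positions starts a new fine slab between them.\<close>

lemma cell_colour:
 assumes nc: "no_conflict" and d: "d < 2" and z: "z < N" "w < N"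
  and c: "cc d (co d z) = cc d (co d w)" and f: "ff (1 - d) (co (1 - d) z) = ff (1 - d) (co (1 - d) w)"
 shows "cl z = cl w"
proof -
 have no_both: "cl z = cl w"
  if z: "z < N" "w < N" and st: "st d (co d z) = st d (co d w)" and le: "co d z <= co d w"
  and v: "co (1 - d) z = co (1 - d) w" for z w
 proof (cases "co d z = co d w")
  case True
  hence "co 0 z = co 0 w & co 1 z = co 1 w" using v d less_2_cases[OF d] by auto
  thus ?thesis using nc z unfolding no_conflict_def by blast
 next
  case False
  hence lt: "co d z < co d w" using le by simp
  hence "st d (co d w) < co d w" using st_le[of d "co d z"] st by simp
  hence g: "good d (st d (co d w)) (co d w)" by (rule st_good)
  have "slab d (st d (co d w)) (co d w) (cl z) (co (1 - d) z)" unfolding slab_def using z lt st_le[of d "co d z"] st by auto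
  moreover have "slab d (st d (co d w)) (co d w) (cl w) (co (1 - d) z)" unfolding slab_def using z st_le[of d "co d w"] v by auto
  moreover have "co (1 - d) z < N" using co_less[of "1 - d" z] z by simp
  ultimately show ?thesis using g unfolding good_def by (cases "cl z"; cases "cl w") auto
 qed
 have st: "st d (co d z) = st d (co d w)" by (rule cc_eq_st_eq[OF c])
 have main: "cl z = cl w" if z: "z < N" "w < N" and st: "st d (co d z) = st d (co d w)"
  and f: "ff (1 - d) (co (1 - d) z) = ff (1 - d) (co (1 - d) w)" and lt: "co (1 - d) z < co (1 - d) w" for z w
 proof -
  let ?P = "band d (co d w)"
  have only: "~ ?P (~ cl x) (co (1 - d) x)" if x: "x < N" "st d (co d x) = st d (co d w)" for x
  proof
  assume "?P (~ cl x) (co (1 - d) x)"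
  then obtain y where y: "y < N" "cl y = (~ cl x)" "st d (co d y) = st d (co d w)" "co (1 - d) y = co (1 - d) x" unfolding band_def by auto
  thus False using no_both[of x y] no_both[of y x] x by (metis linear)
  qed
  have "?P (cl x) (co (1 - d) x)" if x: "x < N" "st d (co d x) = st d (co d w)" for x unfolding band_def using x by auto
  hence par: "odd (scan ?P (Suc (co (1 - d) x))) <-> cl x" if x: "x < N" "st d (co d x) = st d (co d w)" for x
  using only[OF x] x by (intro scan_parity) auto
  show ?thesis
  proof (rule ccontr)
  assume "cl z ~= cl w"
  hence ne: "scan ?P (Suc (co (1 - d) z)) ~= scan ?P (Suc (co (1 - d) w))"
  using par[OF z(1) st] par[OF z(2) refl] by (auto simp del: scan.simps)
  obtain u where u: "co (1 - d) z < u" "u <= co (1 - d) w" "scan ?P (Suc u) ~= scan ?P u" using scan_change[OF lt ne] by blast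
  have d': "1 - (1 - d) = d" using d by simp
  have "nf (1 - d) u" unfolding nf_def d' using u(3) co_less[OF d z(2)] by blast
  thus False using ff_less[OF u(1,2), of "1 - d"] f by simp
  qed
 qed
 show ?thesis
 proof (cases "co (1 - d) z" "co (1 - d) w" rule: linorder_cases)
  case less
  thus ?thesis using main[OF z st f] by simp
 next
  case equal
  thus ?thesis using no_both[OF z st] no_both[OF z(2,1) st[symmetric]] by (metis linear)
 next
  case greater
  thus ?thesis using main[OF z(2,1) st[symmetric] f[symmetric]] by simp
 qed
qed

end

locale layout = points +
 fixes p :: nat and F G :: "nat => nat"
begin

section \<open>Strips, fine rows and run numbers\<close>

definition dir :: "nat => nat" where
 "dir l = (if l < p + 2 then 0 else 1)"

definition strip where
 "strip l <-> Suc l < K & dir l = dir (Suc l)"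

text \<open>A strip inside one coarse slab shows a single colour in each fine row, so run numbers
  matter for strips that reach into the next slab.\<close>

definition active where
 "active l m <-> strip l & m < K & dir m ~= dir l & G (Suc l) = Suc (G l)"

text \<open>The coarse index keeps the set on one side of the slab boundary, so it depends on the
  position of one border only.\<close>

definition inA where
 "inA l m a z <-> z < N & cc (dir l) (co (dir l) z) = G l & ff (dir m) (co (dir m) z) = F m & a <= co (dir l) z"

definition inB where
 "inB l m b z <-> z < N & cc (dir l) (co (dir l) z) = Suc (G l) & ff (dir m) (co (dir m) z) = F m & co (dir l) z < b"

definition stP where
 "stP l m a b e v <-> (EX z<N. cl z = e & (inA l m a z \<or> inB l m b z) & co (dir m) z = v)"

definition lab where
 "lab l m a b z = scan (stP l m a b) (Suc (co (dir m) z))"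

text \<open>Nearness to the boundary between the two coarse slabs, which is where both point sets
  start to grow; ties are broken by the number of the point.\<close>

definition nearA where
 "nearA l z w <-> co (dir l) w < co (dir l) z \<or> co (dir l) w = co (dir l) z & z < w"

definition nearB where
 "nearB l z w <-> co (dir l) z < co (dir l) w \<or> co (dir l) w = co (dir l) z & z < w"

definition leadA where
 "leadA l m a b z <-> inA l m a z & ~ (EX w<N. inA l m a w & lab l m a b w = lab l m a b z & nearA l w z)"

definition leadB where
 "leadB l m a b z <-> inB l m b z & ~ (EX w<N. inB l m b w & lab l m a b w = lab l m a b z & nearB l w z)"

lemma dir_2: "dir l < 2" unfolding dir_def by simp

lemma dir_other: "dir m ~= dir l ==> dir m = 1 - dir l" unfolding dir_def by (auto split: if_splits)

abbreviation "setA l m a == {z. inA l m a z}"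
abbreviation "setB l m b == {z. inB l m b z}"

text \<open>Both orders as one injective rank on each side: lexicographic in base \<open>N\<close>,
  with the coordinate reversed on the first side.\<close>

definition near :: "nat => nat => nat" where
 "near l z = (if cc (dir l) (co (dir l) z) = G l then (N - co (dir l) z) * N + z else co (dir l) z * N + z)"

lemma lex_less: "z < M ==> w < M ==> i * M + z < j * M + w <-> i < j \<or> i = j & z < (w :: nat)"
proof -
 assume zw: "z < M" "w < M"
 have less: "i * M + z < j * M + w" if "i < j" "z < M" for i j z w
 proof -
  have "i * M + z < Suc i * M" using that by simp
  also have "... <= j * M" using that by (intro mult_le_mono1) simp
  finally show ?thesis by simp
 qed
 show ?thesis using less[of i j z w] less[of j i w z] zw by (cases i j rule: linorder_cases) auto
qed

lemma inA_less: "inA l m a z ==> z < N" and inB_less: "inB l m b z ==> z < N" unfolding inA_def inB_def by auto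

lemma near_A: "inA l m a z ==> inA l m a' w ==> near l z < near l w <-> nearA l z w"
proof -
 assume zw: "inA l m a z" "inA l m a' w"
 have "z < N" "w < N" using zw inA_less by auto
 hence "co (dir l) z < N" "co (dir l) w < N" using co_less[OF dir_2] by auto
 hence "N - co (dir l) z < N - co (dir l) w <-> co (dir l) w < co (dir l) z"
  "N - co (dir l) z = N - co (dir l) w <-> co (dir l) w = co (dir l) z" by auto
 thus ?thesis unfolding near_def nearA_def using zw by (simp add: inA_def lex_less)
qed

lemma near_B: "inB l m a z ==> inB l m a' w ==> near l z < near l w <-> nearB l z w"
 unfolding near_def nearB_def by (auto simp: inB_def lex_less)

lemma near_inj_A: "inj_on (near l) (setA l m a)"
proof (rule inj_onI; clarify)
 fix z w assume "inA l m a z" "inA l m a w" "near l z = near l w"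
 hence "~ nearA l z w" "~ nearA l w z" using near_A[of l m a] by (metis less_irrefl)+
 thus "z = w" unfolding nearA_def by auto
qed

lemma near_inj_B: "inj_on (near l) (setB l m a)"
proof (rule inj_onI; clarify)
 fix z w assume "inB l m a z" "inB l m a w" "near l z = near l w"
 hence "~ nearB l z w" "~ nearB l w z" using near_B[of l m a] by (metis less_irrefl)+
 thus "z = w" unfolding nearB_def by auto
qed

definition opposite where
 "opposite l m c <-> (ALL z. inA l m 0 z --> cl z = c) & (ALL z. inB l m N z --> cl z ~= c)"

lemma inA_0: "inA l m a z ==> inA l m 0 z" and inB_N: "inB l m b z ==> inB l m N z"
 using co_less[OF dir_2] unfolding inA_def inB_def by auto

lemma colours: "two_colours (setA l m 0) (setB l m N) (near l) (%e. odd e = c)"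
proof
 show "setA l m 0 Int setB l m N = {}" unfolding inA_def inB_def by auto
 show "finite (setA l m 0)" "finite (setB l m N)" by (rule finite_subset[of _ "{..<N}"]; auto simp: inA_def inB_def)+
qed (use near_inj_A near_inj_B in auto)

end

locale guess = layout +
 fixes slot :: "nat => nat" and sg :: "nat => nat => bool" and al top lo ty :: "nat => nat => nat"
begin

definition valid where
 "valid l m a b <-> ~ (EX v<N. stP l m a b True v & stP l m a b False v) &
  (ALL z<N. inA l m a z \<or> inB l m b z --> lo l (slot m) < lab l m a b z & lab l m a b z <= top l (slot m)) &
  (ALL e<=top l (slot m). lo l (slot m) < e --> (EX z<N. (inA l m a z \<or> inB l m b z) & lab l m a b z = e)) &
  (ALL z<N. ALL w<N. leadA l m a b z & leadA l m a b w & lab l m a b z ~= lab l m a b w -->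
  (nearA l z w <-> ty l (slot m + lab l m a b z) < ty l (slot m + lab l m a b w))) &
  (ALL z<N. ALL w<N. leadB l m a b z & leadB l m a b w & lab l m a b z ~= lab l m a b w -->
  (nearB l z w <-> ty l (slot m + lab l m a b z) < ty l (slot m + lab l m a b w)))"

text \<open>Slab indices are read at \<open>a - 1\<close>, the last coordinate before the line;
  truncated subtraction gives a line at 0 the indices of coordinate 0.\<close>

definition pos_ok where
 "pos_ok l a <-> a <= N & ff (dir l) (a - 1) = F l & cc (dir l) (a - 1) = G l &
  (l = 0 \<or> l = p + 2 --> a = 0) & (l = p + 1 \<or> Suc l = K --> a = N)"

text \<open>Each row may use its own partner position, which can differ from the one finally chosen:
  run numbers on one side are determined by that side (\<open>lab_unique_A\<close>).\<close>

definition allowed where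
 "allowed l a <-> pos_ok l a & (ALL m<K. active l m --> (EX b<=N. valid l m a b)) &
  (ALL m<K. 0 < l & active (l - 1) m --> (EX b<=N. valid (l - 1) m b a))"

text \<open>\<open>beyond t l a z\<close>: the point lies in strip \<open>t\<close>, judged by the position \<open>a\<close> of its boundary
 line \<open>l\<close> and by the fine index of the other boundary line only.\<close>

definition beyond where
 "beyond t l a z <-> strip t & (t = l & a <= co (dir l) z & ff (dir l) (co (dir l) z) < F (Suc l) \<or>
  Suc t = l & co (dir l) z < a & F t < ff (dir l) (co (dir l) z))"

definition corner where
 "corner t u l m a c <-> (ALL z<N. beyond t l a z & beyond u m c z --> cl z = sg t u)"

definition corners where
 "corners l m a c <-> (ALL t<K. ALL u<K. (t = l \<or> Suc t = l) & (u = m \<or> Suc u = m) --> corner t u l m a c)"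

definition sysA where
 "sysA l m a y <-> (EX b<=N. valid l m a b & (ALL z<N. inA l m a z --> (lab l m a b z <= al l m <-> co (dir m) z < y)))"

definition sysB where
 "sysB l m b y <-> (EX a<=N. valid l m a b & (ALL z<N. inB l m b z --> (lab l m a b z <= al l m <-> co (dir m) z < y)))"

definition systems where
 "systems l m a y <-> (active l m & 0 < al l m --> sysA l m a y) & (0 < l & active (l - 1) m & 0 < al (l - 1) m --> sysB (l - 1) m a y)"

definition E where
 "E l m a c <-> (dir l ~= dir m --> (if l < m then corners l m a c else corners m l c a) & systems l m a c & systems m l c a)"

text \<open>The last clause demands a cutting line between any two consecutive runs of an active
  strip and row.\<close>

definition check :: bool where
 "check <-> p <= k & no_conflict & (ALL l<K. strip l --> G (Suc l) <= Suc (G l)) &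
  (ALL l<K. ALL m<K. active l m --> (ALL e<top l (slot m). lo l (slot m) < e -->
  (EX m'<K. dir m' = dir m & F m' = F m & slot m' = slot m & al l m' = e)))"

section \<open>Soundness of a consistent guess\<close>

lemma valid_parity:
 assumes v: "valid l m a b" and z: "inA l m a z \<or> inB l m b z"
 shows "odd (lab l m a b z) <-> cl z"
proof -
 have zN: "z < N" using z unfolding inA_def inB_def by auto
 have "stP l m a b (cl z) (co (dir m) z)" unfolding stP_def using z zN by auto
 moreover have "co (dir m) z < N" using co_less[OF dir_2 zN] .
 ultimately have "~ stP l m a b (~ cl z) (co (dir m) z)" using v unfolding valid_def by (cases "cl z") auto
 thus ?thesis unfolding lab_def using \<open>stP l m a b (cl z) (co (dir m) z)\<close> by (intro scan_parity)
qed
abbreviation "rstate l m c == two_colours.state (setA l m 0) (setB l m N) (co (dir m)) (near l) (%e. odd e = c)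
  (lo l (slot m)) (Suc (top l (slot m))) (%e. ty l (slot m + e))"

text \<open>Makes \<open>two_colours\<close> applicable with \<open>near\<close> as the rank.
  \<open>top\<close> is the last number in use, so the exclusive upper limit is its
  successor.\<close>

lemma valid_state:
 assumes v: "valid l m a b" and op: "opposite l m c"
 shows "rstate l m c (setA l m a) (setB l m b) (lab l m a b)"
proof -
 interpret two_colours "setA l m 0" "setB l m N" "co (dir m)" "near l" "%e. odd e = c"
  "lo l (slot m)" "Suc (top l (slot m))" "%e. ty l (slot m + e)" by (rule colours)
 let ?S = "setA l m a Un setB l m b" and ?i = "lab l m a b"
 have par: "odd (?i z) <-> cl z" if "z : ?S" for z using valid_parity[OF v] that by blast
 have clA: "cl z = c" if "inA l m a z" for z using op inA_0[OF that] unfolding opposite_def by blast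
 have clB: "cl z ~= c" if "inB l m b z" for z using op inB_N[OF that] unfolding opposite_def by blast
 have pA: "prefix (setA l m a) (setA l m 0)" unfolding prefix_def
 proof (intro conjI ballI impI subsetI; clarify)
  fix z w assume z: "inA l m a z" and w: "inA l m 0 w" and "near l w < near l z"
  hence "nearA l w z" using near_A[OF w z] by simp
  thus "inA l m a w" using z w unfolding inA_def nearA_def by auto
 qed (rule inA_0)
 have pB: "prefix (setB l m b) (setB l m N)" unfolding prefix_def
 proof (intro conjI ballI impI subsetI; clarify)
  fix z w assume z: "inB l m b z" and w: "inB l m N w" and "near l w < near l z"
  hence "nearB l w z" using near_B[OF w z] by simp
  thus "inB l m b w" using z w unfolding inB_def nearB_def by auto
 qed (rule inB_N)
 have rng: "lo l (slot m) < ?i z & ?i z < Suc (top l (slot m))" if "z : ?S" for z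
 proof -
  have "z < N" using that inA_less inB_less by auto
  thus ?thesis using v that unfolding valid_def by (auto simp: less_Suc_eq_le)
 qed
 have ex: "EX z:?S. ?i z = e" if "lo l (slot m) < e" "e < Suc (top l (slot m))" for e
  using v that unfolding valid_def by (auto simp: less_Suc_eq_le)
 have mono: "co (dir m) z < co (dir m) w" if "?i z < ?i w" for z w
 proof (rule ccontr)
  assume "~ ?thesis"
  hence "?i w <= ?i z" unfolding lab_def by (intro scan_mono) simp
  thus False using that by simp
 qed
 have ldr: "lead (near l) ?S ?i e : ?S & ?i (lead (near l) ?S ?i e) = e & (ALL w:?S. ?i w = e --> near l (lead (near l) ?S ?i e) <= near l w)"
  if e: "lo l (slot m) < e" "e < Suc (top l (slot m))" for e
 proof -
  obtain z0 where z0: "z0 : ?S & ?i z0 = e" using ex[OF e] by blast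
  show ?thesis unfolding lead_def using arg_min_nat_lemma[of "%z. z : ?S & ?i z = e" z0 "near l", OF z0] by blast
 qed
 have leadAI: "leadA l m a b q" if q: "inA l m a q" "ALL w:?S. ?i w = ?i q --> near l q <= near l w" for q
  unfolding leadA_def using q near_A[OF _ q(1)] by (metis UnI1 mem_Collect_eq not_less)
 have leadBI: "leadB l m a b q" if q: "inB l m b q" "ALL w:?S. ?i w = ?i q --> near l q <= near l w" for q
  unfolding leadB_def using q near_B[OF _ q(1)] by (metis UnI2 mem_Collect_eq not_less)
 have ty: "near l (lead (near l) ?S ?i e) < near l (lead (near l) ?S ?i f) <-> ty l (slot m + e) < ty l (slot m + f)"
  if e: "lo l (slot m) < e" "e < Suc (top l (slot m))" and f: "lo l (slot m) < f" "f < Suc (top l (slot m))"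
  and ne: "e ~= f" and same: "(odd e = c) = (odd f = c)" for e f
 proof -
  define z where "z = lead (near l) ?S ?i e"
  define w where "w = lead (near l) ?S ?i f"
  note le = ldr[OF e, folded z_def] and lf = ldr[OF f, folded w_def]
  have cl: "cl z <-> odd e" "cl w <-> odd f" using par[of z] par[of w] le lf by auto
  have "near l z < near l w <-> ty l (slot m + e) < ty l (slot m + f)"
  proof (cases "odd e = c")
  case True
  hence zw: "inA l m a z" "inA l m a w" using le lf cl same clB[of z] clB[of w] by auto
  have "leadA l m a b z" "leadA l m a b w" using leadAI[OF zw(1)] leadAI[OF zw(2)] le lf by simp_all
  moreover have "?i z ~= ?i w" using le lf ne by simp
  ultimately have "nearA l z w <-> ty l (slot m + ?i z) < ty l (slot m + ?i w)"
  using v inA_less[OF zw(1)] inA_less[OF zw(2)] unfolding valid_def by (elim conjE) simp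
  thus ?thesis using near_A[OF zw] le lf by simp
  next
  case False
  hence zw: "inB l m b z" "inB l m b w" using le lf cl same clA[of z] clA[of w] by auto
  have "leadB l m a b z" "leadB l m a b w" using leadBI[OF zw(1)] leadBI[OF zw(2)] le lf by simp_all
  moreover have "?i z ~= ?i w" using le lf ne by simp
  ultimately have "nearB l z w <-> ty l (slot m + ?i z) < ty l (slot m + ?i w)"
  using v inB_less[OF zw(1)] inB_less[OF zw(2)] unfolding valid_def by (elim conjE) simp
  thus ?thesis using near_B[OF zw] le lf by simp
  qed
  thus ?thesis unfolding z_def w_def .
 qed
 have cA: "odd (?i z) = c" if "inA l m a z" for z using par[of z] clA[OF that] that by blast
 have cB: "odd (?i z) ~= c" if "inB l m b z" for z using par[of z] clB[OF that] that by blast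
 show ?thesis unfolding state_def
 proof (intro conjI)
  show "ALL z:?S. lo l (slot m) < ?i z & ?i z < Suc (top l (slot m))" using rng by (rule ballI)
  show "ALL e. lo l (slot m) < e & e < Suc (top l (slot m)) --> (EX z:?S. ?i z = e)" by (intro allI impI, elim conjE) (rule ex)
  show "ALL z:?S. ALL w:?S. ?i z < ?i w --> co (dir m) z < co (dir m) w" by (intro ballI impI) (rule mono)
  show "ALL e f. lo l (slot m) < e & e < Suc (top l (slot m)) & lo l (slot m) < f & f < Suc (top l (slot m)) &
  e ~= f & ((odd e = c) <-> (odd f = c)) -->
  (near l (lead (near l) ?S ?i e) < near l (lead (near l) ?S ?i f) <-> ty l (slot m + e) < ty l (slot m + f))"
  by (intro allI impI, elim conjE) (rule ty)
 qed (use pA pB cA cB in auto)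
qed

text \<open>For fixed \<open>a\<close> the point sets of two partners are nested, so
  \<open>nested_ind\<close> applies. This is why a condition on run numbers involves two lines and
  not three.\<close>

lemma lab_unique_A:
 assumes "valid l m a b" "valid l m a b'" "opposite l m c" "inA l m a z"
 shows "lab l m a b z = lab l m a b' z"
proof -
 interpret two_colours "setA l m 0" "setB l m N" "co (dir m)" "near l" "%e. odd e = c"
  "lo l (slot m)" "Suc (top l (slot m))" "%e. ty l (slot m + e)" by (rule colours)
 have sub: "setB l m b <= setB l m b'" if "b <= b'" for b b' using that unfolding inB_def by auto
 note s = valid_state[OF assms(1,3)] valid_state[OF assms(2,3)]
 show ?thesis
 proof (cases b b' rule: le_cases)
  case le
  show ?thesis using nested_ind[OF s subset_refl sub[OF le], of z] assms(4) by simp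
 next
  case ge
  show ?thesis using nested_ind[OF s(2,1) subset_refl sub[OF ge], of z] assms(4) by simp
 qed
qed

lemma lab_unique_B:
 assumes "valid l m a b" "valid l m a' b" "opposite l m c" "inB l m b z"
 shows "lab l m a b z = lab l m a' b z"
proof -
 interpret two_colours "setA l m 0" "setB l m N" "co (dir m)" "near l" "%e. odd e = c"
  "lo l (slot m)" "Suc (top l (slot m))" "%e. ty l (slot m + e)" by (rule colours)
 have sub: "setA l m a <= setA l m a'" if "a' <= a" for a a' using that unfolding inA_def by auto
 note s = valid_state[OF assms(1,3)] valid_state[OF assms(2,3)]
 show ?thesis
 proof (cases a a' rule: le_cases)
  case le
  show ?thesis using nested_ind[OF s(2,1) sub[OF le] subset_refl, of z] assms(4) by simp
 next
  case ge
  show ?thesis using nested_ind[OF s sub[OF ge] subset_refl, of z] assms(4) by simp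
 qed
qed

text \<open>Two unseparated points of different colours share a vertical and a horizontal strip. If
  they lie in one fine row or column, the systems of that row separate them. Otherwise both are told
  apart from a border of each strip by the fine index alone, so the corner constraints give them the
  same colour.\<close>

theorem soundness:
 assumes ck: "check" and al: "!!l. l < K ==> allowed l (x l)"
  and E: "!!l t. l < K ==> t < K ==> l ~= t ==> E l t (x l) (x t)"
 shows solvable
proof -
 have pk: "p <= k" and nc: no_conflict using ck unfolding check_def by auto
 have pos: "pos_ok l (x l)" if "l < K" for l using al[OF that] unfolding allowed_def by auto
 define X where "X = x ` {1..p}"
 define Y where "Y = x ` {p + 3..k + 2}"
 have "card X <= p" unfolding X_def by (rule order_trans[OF card_image_le]) auto
 moreover have "card Y <= k - p" unfolding Y_def by (rule order_trans[OF card_image_le]) auto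
 ultimately have card: "card X + card Y <= k" using pk by simp
 have x0: "x 0 = 0" "x (p + 2) = 0" "x (p + 1) = N" "x (k + 3) = N"
  using pos[of 0] pos[of "p + 2"] pos[of "p + 1"] pos[of "k + 3"] pk unfolding pos_ok_def by auto
 have in_strip: "EX l. strip l & dir l = d & x l <= v & v < x (Suc l)" if v: "v < N" and d: "d < 2" for v d
 proof -
  define i0 where "i0 = (if d = 0 then 0 else p + 2)"
  define i1 where "i1 = (if d = 0 then p + 1 else k + 3)"
  have i: "i0 < i1" "x i0 <= v" "v < x i1" using x0 v pk unfolding i0_def i1_def by auto
  have "EX l. i0 <= l & Suc l <= i1 & x l <= v & v < x (Suc l)"
  proof -
  have "EX l. i0 <= l & Suc l <= j & x l <= v & v < x (Suc l)" if "i0 <= j" "v < x j" for j using that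
  proof (induction rule: dec_induct)
  case base
  thus ?case using i by simp
  next
  case (step j)
  thus ?case by (cases "x j <= v") (auto intro: le_SucI)
  qed
  thus ?thesis using i by auto
  qed
  then obtain l where l: "i0 <= l" "Suc l <= i1" "x l <= v" "v < x (Suc l)" by blast
  moreover have "strip l & dir l = d" unfolding strip_def dir_def using l(1,2) pk d unfolding i0_def i1_def by (auto split: if_splits)
  ultimately show ?thesis by blast
 qed
 have "(EX a:X. sep 0 a z w) \<or> (EX a:Y. sep 1 a z w)" if zw: "z < N" "w < N" "cl z" "~ cl w" for z w
 proof (rule ccontr)
  assume n: "~ ?thesis"
  have nosep: "co (dir l) z < x l <-> co (dir l) w < x l" if l: "l < K" for l
  proof -
  consider "l = 0 \<or> l = p + 2" | "l = p + 1 \<or> l = k + 3" | "l : {1..p}" | "l : {p + 3..k + 2}" using l by fastforce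
  thus ?thesis
  proof cases
  case 1
  thus ?thesis using x0 by auto
  next
  case 2
  thus ?thesis using x0 co_less[OF dir_2] zw by (elim disjE) simp_all
  next
  case 3
  hence "x l : X" "dir l = 0" unfolding X_def dir_def by auto
  thus ?thesis using n unfolding sep_def by auto
  next
  case 4
  hence "x l : Y" "dir l = 1" unfolding Y_def dir_def by auto
  thus ?thesis using n unfolding sep_def by auto
  qed
  qed
  have strips: "EX l. strip l & dir l = d & (ALL y:{z, w}. x l <= co d y & co d y < x (Suc l))" if d: "d < 2" for d
  proof -
  obtain l where l: "strip l" "dir l = d" "x l <= co d z" "co d z < x (Suc l)" using in_strip[OF co_less[OF d zw(1)] d] by blast
  hence "x l <= co d w & co d w < x (Suc l)" using nosep[of l] nosep[of "Suc l"] unfolding strip_def by auto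
  thus ?thesis using l by auto
  qed
  obtain l where l: "strip l" "dir l = 0" "!!y. y : {z, w} ==> x l <= co 0 y & co 0 y < x (Suc l)" using strips[of 0] by auto
  obtain m where m: "strip m" "dir m = 1" "!!y. y : {z, w} ==> x m <= co 1 y & co 1 y < x (Suc m)" using strips[of 1] by auto
  have lm: "l < m" using l(2) m(2) unfolding dir_def by (auto split: if_splits)
  have ranges: "F t <= ff (dir t) (co (dir t) y) & ff (dir t) (co (dir t) y) <= F (Suc t) &
  G t <= cc (dir t) (co (dir t) y) & cc (dir t) (co (dir t) y) <= G (Suc t)" if "strip t" "x t <= co (dir t) y" "co (dir t) y < x (Suc t)" for t y
  proof -
  have "t < K" "Suc t < K" "dir (Suc t) = dir t" using that(1) unfolding strip_def by auto
  moreover have "x t - 1 <= co (dir t) y" "co (dir t) y <= x (Suc t) - 1" using that by auto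
  ultimately show ?thesis using pos[of t] pos[of "Suc t"] unfolding pos_ok_def by (metis cc_mono ff_mono)
  qed
  have corner_col: "cl y = sg l m"
  if y: "y : {z, w}" and f0: "ff 0 (co 0 y) < F (Suc l) \<or> F l < ff 0 (co 0 y)"
  and f1: "ff 1 (co 1 y) < F (Suc m) \<or> F m < ff 1 (co 1 y)" for y
  proof -
  have yN: "y < N" using y zw by auto
  obtain l' where l': "l' = l \<or> l' = Suc l" "beyond l l' (x l') y" "dir l' = 0" "l' < K"
  using f0 l(3)[OF y] l(1,2) unfolding beyond_def strip_def by fastforce
  obtain m' where m': "m' = m \<or> m' = Suc m" "beyond m m' (x m') y" "dir m' = 1" "m' < K"
  using f1 m(3)[OF y] m(1,2) unfolding beyond_def strip_def by fastforce
  have lm': "l' < m'" using l'(3) m'(3) unfolding dir_def by (auto split: if_splits)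
  hence "corners l' m' (x l') (x m')" using E[of l' m'] l' m' unfolding E_def by auto
  hence "corner l m l' m' (x l') (x m')" using l' m' l(1) m(1) unfolding corners_def strip_def by auto
  thus ?thesis using l'(2) m'(2) yN unfolding corner_def by blast
  qed
  text \<open>Two points of different colours in the same fine row: the system of the strip and the row
  separates them.\<close>
  have same_row: False
  if t: "strip t" "strip u" "dir u ~= dir t"
  and in_t: "!!y. y : {z, w} ==> x t <= co (dir t) y & co (dir t) y < x (Suc t)"
  and in_u: "!!y. y : {z, w} ==> x u <= co (dir u) y & co (dir u) y < x (Suc u)"
  and fine: "ff (dir u) (co (dir u) z) = ff (dir u) (co (dir u) w)"
  and cor: "!!y. y : {z, w} ==> ff (dir t) (co (dir t) y) < F (Suc t) \<or> F t < ff (dir t) (co (dir t) y) ==>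
  ff (dir u) (co (dir u) y) < F (Suc u) \<or> F u < ff (dir u) (co (dir u) y) ==> cl y = s" for t u s proof -
  have du: "dir u = 1 - dir t" by (rule dir_other[OF t(3)])
  have tK: "t < K" "Suc t < K" "dir (Suc t) = dir t" using t(1) unfolding strip_def by auto
  have uK: "u < K" "Suc u < K" "dir (Suc u) = dir u" using t(2) unfolding strip_def by auto
  note rt = ranges[OF t(1)] and ru = ranges[OF t(2)]
  have cne: "cc (dir t) (co (dir t) z) ~= cc (dir t) (co (dir t) w)"
  using cell_colour[OF nc dir_2 zw(1,2), of t] fine zw unfolding du by auto
  have cz: "G t <= cc (dir t) (co (dir t) z)" "cc (dir t) (co (dir t) z) <= G (Suc t)"
  "G t <= cc (dir t) (co (dir t) w)" "cc (dir t) (co (dir t) w) <= G (Suc t)" using rt[of z] rt[of w] in_t by auto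
  have "G (Suc t) <= Suc (G t)" using ck t(1) tK unfolding check_def by auto
  hence G1: "G (Suc t) = Suc (G t)" and
  zwc: "cc (dir t) (co (dir t) z) = G t & cc (dir t) (co (dir t) w) = Suc (G t) \<or>
  cc (dir t) (co (dir t) w) = G t & cc (dir t) (co (dir t) z) = Suc (G t)" using cne cz by auto
  have act: "active t u" "active t (Suc u)" unfolding active_def using t tK uK G1 by auto
  have cornt: "ff (dir t) (co (dir t) y) < F (Suc t) \<or> F t < ff (dir t) (co (dir t) y)" if y: "y : {z, w}" for y
  proof (rule ccontr)
  assume "~ ?thesis"
  hence "ff (dir t) (co (dir t) y) = F t" "F (Suc t) = F t" using rt[of y] in_t[OF y] by auto
  hence "ff (dir t) (x (Suc t) - 1) = ff (dir t) (x t - 1)" using pos[OF tK(1)] pos[OF tK(2)] tK unfolding pos_ok_def by simp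
  hence "cc (dir t) (x (Suc t) - 1) = cc (dir t) (x t - 1)" by (rule ff_cc)
  thus False using pos[OF tK(1)] pos[OF tK(2)] tK G1 unfolding pos_ok_def by simp
  qed
  have fu: "F u = ff (dir u) (co (dir u) z)" "F (Suc u) = ff (dir u) (co (dir u) z)"
  proof -
  have "~ (ff (dir u) (co (dir u) z) < F (Suc u) \<or> F u < ff (dir u) (co (dir u) z))"
  using cor[of z] cor[of w] cornt[of z] cornt[of w] fine zw by auto
  thus "F u = ff (dir u) (co (dir u) z)" "F (Suc u) = ff (dir u) (co (dir u) z)" using ru[of z] in_u by auto
  qed
  obtain y y' where y: "{y, y'} = {z, w}" "cc (dir t) (co (dir t) y) = G t" "cc (dir t) (co (dir t) y') = Suc (G t)" using zwc by blast
  have yy: "y : {z, w}" "y' : {z, w}" "cl y ~= cl y'" "y < N" "y' < N" using y(1) zw by (auto simp: doubleton_eq_iff)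
  have yA: "inA t u (x t) y" unfolding inA_def using y yy in_t fu fine by auto
  have yB: "inB t u (x (Suc t)) y'" unfolding inB_def using y yy in_t fu fine by auto
  obtain b where b: "b <= N" "valid t u (x t) b" using al[OF tK(1)] act uK unfolding allowed_def by blast
  have "ALL m<K. 0 < Suc t & active (Suc t - 1) m --> (EX a<=N. valid (Suc t - 1) m a (x (Suc t)))"
  using al[OF tK(2)] unfolding allowed_def by (elim conjE)
  then obtain a where a: "a <= N" "valid t u a (x (Suc t))" using act(1) uK(1) by auto
  let ?i = "lab t u (x t) b y" and ?j = "lab t u a (x (Suc t)) y'"
  have ij: "?i ~= ?j" using valid_parity[OF b(2), of y] valid_parity[OF a(2), of y'] yA yB yy(3) by metis
  have rng: "lo t (slot u) < ?i" "?i <= top t (slot u)" "lo t (slot u) < ?j" "?j <= top t (slot u)"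
  using b(2) a(2) yA yB yy unfolding valid_def by auto
  \<comment> \<open>The run numbers have different parity, so the line demanded by
    \<open>check\<close> right above the smaller one separates the points.\<close>
  define e where "e = min ?i ?j"
  have e: "lo t (slot u) < e" "e < top t (slot u)" "(?i <= e) ~= (?j <= e)" using rng ij unfolding e_def by auto
  obtain m' where m': "m' < K" "dir m' = dir u" "F m' = F u" "slot m' = slot u" "al t m' = e"
  using ck e(1,2) act(1) tK uK unfolding check_def by blast
  have act': "active t m'" using act(1) m' unfolding active_def by auto
  have inAB: "inA t m' a = inA t u a" "inB t m' b = inB t u b" for a b unfolding inA_def inB_def using m' by (auto simp: fun_eq_iff)
  have lab': "lab t m' a b = lab t u a b" for a b unfolding lab_def stP_def inAB m'(2) by (simp add: fun_eq_iff)
  have dne: "dir t ~= dir m'" "dir m' ~= dir t" "dir (Suc t) ~= dir m'" "t ~= m'" "Suc t ~= m'" using m' t tK by auto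
  have alp: "0 < al t m'" using e m' by simp
  have "systems t m' (x t) (x m')" using E[OF tK(1) m'(1) dne(4)] dne unfolding E_def by blast
  hence sA: "sysA t m' (x t) (x m')" using act' alp unfolding systems_def by blast
  have "systems (Suc t) m' (x (Suc t)) (x m')" using E[OF tK(2) m'(1) dne(5)] dne unfolding E_def by blast
  hence sB: "sysB t m' (x (Suc t)) (x m')" using act' alp unfolding systems_def by simp
  have vl: "valid t m' a b = valid t u a b" for a b unfolding valid_def leadA_def leadB_def lab' inAB stP_def m'(2,4) ..
  have op: "opposite t u (cl y)" unfolding opposite_def
  proof (intro conjI allI impI)
  fix q assume q: "inA t u 0 q"
  thus "cl q = cl y" using cell_colour[OF nc dir_2, of q y t] yy y(2) fu fine unfolding inA_def du by auto
  next
  fix q assume q: "inB t u N q"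
  hence "cl q = cl y'" using cell_colour[OF nc dir_2, of q y' t] yy y(3) fu fine unfolding inB_def du by auto
  thus "cl q ~= cl y" using yy by auto
  qed
  obtain b' where b': "valid t u (x t) b'" "!!z. z < N ==> inA t u (x t) z ==> lab t u (x t) b' z <= e <-> co (dir u) z < x m'"
  using sA unfolding sysA_def vl inAB lab' m'(2,5) by blast
  obtain a' where a': "valid t u a' (x (Suc t))" "!!z. z < N ==> inB t u (x (Suc t)) z ==> lab t u a' (x (Suc t)) z <= e <-> co (dir u) z < x m'"
  using sB unfolding sysB_def vl inAB lab' m'(2,5) by blast
  have "?i <= e <-> co (dir u) y < x m'" using lab_unique_A[OF b(2) b'(1) op yA] b'(2)[OF yy(4) yA] by simp
  moreover have "?j <= e <-> co (dir u) y' < x m'" using lab_unique_B[OF a(2) a'(1) op yB] a'(2)[OF yy(5) yB] by simp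
  moreover have "co (dir u) y < x m' <-> co (dir u) y' < x m'" using nosep[OF m'(1)] yy(1,2) m'(2) by auto
  ultimately show False using e(3) by blast
  qed
  have lK: "l < K" "m < K" using l m unfolding strip_def by auto
  have yl: "x l <= co (dir l) y & co (dir l) y < x (Suc l)" and ym: "x m <= co (dir m) y & co (dir m) y < x (Suc m)"
  if "y : {z, w}" for y using l m that by auto
  have row: "ff 1 (co 1 z) ~= ff 1 (co 1 w)" using same_row[OF l(1) m(1) _ yl ym, of "sg l m"] corner_col l(2) m(2) by auto
  have col: "ff 0 (co 0 z) ~= ff 0 (co 0 w)" using same_row[OF m(1) l(1) _ ym yl, of "sg l m"] corner_col l(2) m(2) by auto
  \<comment> \<open>If both inequalities failed, the whole strip would lie in a single fine
    slab.\<close>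
  have off: "ff (dir t) (co (dir t) y) < F (Suc t) \<or> F t < ff (dir t) (co (dir t) y)"
  if t: "t : {l, m}" "y : {z, w}" "ff (dir t) (co (dir t) z) ~= ff (dir t) (co (dir t) w)" for t y
  proof (rule ccontr)
  assume "~ ?thesis"
  moreover have "strip t & x t <= co (dir t) q & co (dir t) q < x (Suc t)" if "q : {z, w}" for q
  using t(1) l(1) m(1) yl[OF that] ym[OF that] by (elim insertE; simp)
  ultimately show False using ranges[of t z] ranges[of t w] t(2,3) by fastforce
  qed
  have "cl z = sg l m" "cl w = sg l m"
  using corner_col[of z] corner_col[of w] off[of l z] off[of l w] off[of m z] off[of m w] row col l(2) m(2) by simp_all
  thus False using zw by simp
 qed
 moreover have "finite X" "finite Y" unfolding X_def Y_def by auto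
 ultimately show solvable unfolding solvable_def using card by (intro exI[of _ X] exI[of _ Y] conjI allI impI) blast+
qed

end


text \<open>Lets the first border of a strip run from right to left, the direction in which its
  point set grows.\<close>

lemma card_reverse:
 "card {a. Suc a < Suc M & P (M - a) ~= P (M - Suc a)} = card {a. Suc a < Suc M & P a ~= P (Suc a)}"
proof (rule bij_betw_same_card)
 show "bij_betw (%a. M - Suc a) {a. Suc a < Suc M & P (M - a) ~= P (M - Suc a)} {a. Suc a < Suc M & P a ~= P (Suc a)}"
  by (rule bij_betw_byWitness[where f' = "%a. M - Suc a"]) (auto simp: Suc_diff_Suc)
qed

lemma ex_indep: "b <= n ==> V b ==> (!!b'. V b' ==> Q b' <-> Q b) ==> (EX b'<=(n::nat). V b' & Q b') <-> Q b" by blast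

section \<open>Rounding to allowed positions and decomposition into atomic constraints\<close>

context guess
begin

text \<open>Unary conditions are built into the constraints by rounding to the greatest allowed
  position up to \<open>a\<close>, or to the least allowed one if there is none. Rounding is
  monotone, so monotonicity in a position survives it.\<close>

definition is_rep where
 "is_rep l a c <-> allowed l c & (c <= a & ~ (EX d<=N. c < d & d <= a & allowed l d) \<or> a < c & ~ (EX d<=N. d < c & allowed l d))"

definition rep where
 "rep l a = (THE c. is_rep l a c)"

lemma allowed_le: "allowed l a ==> a <= N" unfolding allowed_def pos_ok_def by auto

lemma is_rep_unique: "is_rep l a c ==> is_rep l a d ==> c = d"
proof -
 have less: "~ c < d" if r: "is_rep l a c" "is_rep l a d" for c d
 proof
  assume cd: "c < d"
  have "allowed l c" "allowed l d" "c <= N" "d <= N" using r allowed_le unfolding is_rep_def by auto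
  thus False using r cd unfolding is_rep_def by (elim conjE disjE) auto
 qed
 assume "is_rep l a c" "is_rep l a d"
 thus ?thesis using less[of c d] less[of d c] by simp
qed

lemma ex_rep: "EX d. allowed l d ==> EX c. is_rep l a c"
proof -
 assume ex: "EX d. allowed l d"
 show ?thesis
 proof (cases "EX d<=a. allowed l d")
  case True
  define c where "c = (GREATEST d. d <= a & allowed l d)"
  obtain d where d: "d <= a & allowed l d" using True by blast
  have c: "c <= a & allowed l c" unfolding c_def by (rule GreatestI_nat[where P = "%d. d <= a & allowed l d" and b = a, OF d]) simp
  have le: "d <= c" if "d <= a" "allowed l d" for d
  unfolding c_def by (rule Greatest_le_nat[where P = "%d. d <= a & allowed l d" and b = a]) (use that in auto)
  have "~ (EX d<=N. c < d & d <= a & allowed l d)" using le by fastforce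
  thus ?thesis unfolding is_rep_def using c by blast
 next
  case False
  define c where "c = (LEAST d. allowed l d)"
  have c: "allowed l c" unfolding c_def using ex by (rule LeastI_ex)
  have le: "c <= d" if "allowed l d" for d unfolding c_def using that by (rule Least_le)
  have "~ (EX d<=N. d < c & allowed l d)" using le by fastforce
  moreover have "a < c" using False c by (meson not_le)
  ultimately show ?thesis unfolding is_rep_def using c by blast
 qed
qed

lemma is_rep_rep: "EX d. allowed l d ==> is_rep l a (rep l a)" unfolding rep_def using ex_rep[of l a] is_rep_unique[of l a] by (metis theI)

lemma rep_allowed: "EX d. allowed l d ==> allowed l (rep l a)" using is_rep_rep unfolding is_rep_def by blast

lemma rep_fix: "allowed l a ==> rep l a = a" using is_rep_unique[OF is_rep_rep, of l a a] unfolding is_rep_def by auto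

lemma rep_mono: "EX d. allowed l d ==> a <= a' ==> rep l a <= rep l a'"
proof (rule ccontr)
 assume ex: "EX d. allowed l d" and a: "a <= a'" and "~ ?thesis"
 hence lt: "rep l a' < rep l a" by simp
 note r = is_rep_rep[OF ex, of a] is_rep_rep[OF ex, of a']
 have "rep l a <= N" "rep l a' <= N" using rep_allowed[OF ex] allowed_le by auto
 thus False using r lt a unfolding is_rep_def by (elim conjE disjE) auto
qed

definition E' where
 "E' l t a c <-> E l t (rep l a) (rep t c)"

lemma E_sym: "E l t a c <-> E t l c a" unfolding E_def by (cases l t rule: linorder_cases) auto

lemma csp_E': "csp (Suc N) E'"
proof
 show "E' l t a c <-> E' t l c a" for l t a c unfolding E'_def by (rule E_sym)
qed simp

text \<open>One half of \<open>sysA\<close>, with \<open>botA\<close> as the other: each half is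
  monotone in \<open>y\<close>, and its dependence on the border is what \<open>top_changes\<close>
  and \<open>bottom_changes\<close> bound.\<close>

definition topA where
 "topA l m a y <-> (EX b<=N. valid l m a b & (ALL z. inA l m a z --> lab l m a b z <= al l m --> co (dir m) z < y))"

definition botA where
 "botA l m a y <-> (EX b<=N. valid l m a b & (ALL z. inA l m a z --> al l m < lab l m a b z --> y <= co (dir m) z))"

definition topB where
 "topB l m b y <-> (EX a<=N. valid l m a b & (ALL z. inB l m b z --> lab l m a b z <= al l m --> co (dir m) z < y))"

definition botB where
 "botB l m b y <-> (EX a<=N. valid l m a b & (ALL z. inB l m b z --> al l m < lab l m a b z --> y <= co (dir m) z))"

lemma topA_valid:
 assumes "opposite l m c" "b <= N" "valid l m a b"
 shows "topA l m a y <-> (ALL z. inA l m a z --> lab l m a b z <= al l m --> co (dir m) z < y)"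
  and "botA l m a y <-> (ALL z. inA l m a z --> al l m < lab l m a b z --> y <= co (dir m) z)"
  and "sysA l m a y <-> topA l m a y & botA l m a y"
proof -
 have u: "lab l m a b' z = lab l m a b z" if "valid l m a b'" "inA l m a z" for b' z using lab_unique_A[OF that(1) assms(3,1) that(2)] .
 show t: "topA l m a y <-> (ALL z. inA l m a z --> lab l m a b z <= al l m --> co (dir m) z < y)" unfolding topA_def
  by (rule ex_indep[where V = "%b. valid l m a b", OF assms(2,3)]) (simp cong: imp_cong add: u)
 show b: "botA l m a y <-> (ALL z. inA l m a z --> al l m < lab l m a b z --> y <= co (dir m) z)" unfolding botA_def
  by (rule ex_indep[where V = "%b. valid l m a b", OF assms(2,3)]) (simp cong: imp_cong add: u)
 have "sysA l m a y <-> (ALL z<N. inA l m a z --> (lab l m a b z <= al l m <-> co (dir m) z < y))" unfolding sysA_def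
  by (rule ex_indep[where V = "%b. valid l m a b", OF assms(2,3)]) (simp cong: imp_cong add: u)
 thus "sysA l m a y <-> topA l m a y & botA l m a y" unfolding t b using inA_less by (meson not_le)
qed

lemma topB_valid:
 assumes "opposite l m c" "a <= N" "valid l m a b"
 shows "topB l m b y <-> (ALL z. inB l m b z --> lab l m a b z <= al l m --> co (dir m) z < y)"
  and "botB l m b y <-> (ALL z. inB l m b z --> al l m < lab l m a b z --> y <= co (dir m) z)"
  and "sysB l m b y <-> topB l m b y & botB l m b y"
proof -
 have u: "lab l m a' b z = lab l m a b z" if "valid l m a' b" "inB l m b z" for a' z using lab_unique_B[OF that(1) assms(3,1) that(2)] .
 show t: "topB l m b y <-> (ALL z. inB l m b z --> lab l m a b z <= al l m --> co (dir m) z < y)" unfolding topB_def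
  by (rule ex_indep[where V = "%a. valid l m a b", OF assms(2,3)]) (simp cong: imp_cong add: u)
 show b: "botB l m b y <-> (ALL z. inB l m b z --> al l m < lab l m a b z --> y <= co (dir m) z)" unfolding botB_def
  by (rule ex_indep[where V = "%a. valid l m a b", OF assms(2,3)]) (simp cong: imp_cong add: u)
 have "sysB l m b y <-> (ALL z<N. inB l m b z --> (lab l m a b z <= al l m <-> co (dir m) z < y))" unfolding sysB_def
  by (rule ex_indep[where V = "%a. valid l m a b", OF assms(2,3)]) (simp cong: imp_cong add: u)
 thus "sysB l m b y <-> topB l m b y & botB l m b y" unfolding t b using inB_less by (meson not_le)
qed

abbreviation "few l m == 4 * Suc (top l (slot m)) * Suc (top l (slot m)) + 1"

text \<open>Moving the first border to the left enlarges its point set, hence the reversed sequence;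
  the partners \<open>b i\<close> may be chosen independently of each other, as a
  \<open>chain\<close> allows.\<close>

lemma changes_A:
 assumes op: "opposite l m c" and ac: "active l m" and ex: "EX d. allowed l d"
 shows "card {a. Suc a < Suc N & topA l m (rep l a) y ~= topA l m (rep l (Suc a)) y} <= few l m"
  and "card {a. Suc a < Suc N & botA l m (rep l a) y ~= botA l m (rep l (Suc a)) y} <= few l m"
proof -
 define A where "A i = rep l (N - i)" for i
 have "EX b<=N. valid l m (A i) b" for i using rep_allowed[OF ex] ac unfolding A_def allowed_def active_def by blast
 then obtain b where b: "b i <= N" "valid l m (A i) (b i)" for i by metis
 interpret two_colours "setA l m 0" "setB l m N" "co (dir m)" "near l" "%e. odd e = c"
  "lo l (slot m)" "Suc (top l (slot m))" "%e. ty l (slot m + e)" by (rule colours)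
 interpret ch: chain "setA l m 0" "setB l m N" "co (dir m)" "near l" "%e. odd e = c"
  "lo l (slot m)" "Suc (top l (slot m))" "%e. ty l (slot m + e)"
  "%i. setA l m (A i)" "%i. setB l m (b i)" "%i. lab l m (A i) (b i)" "Suc N"
 proof
  show "state (setA l m (A i)) (setB l m (b i)) (lab l m (A i) (b i))" for i by (rule valid_state[OF b(2) op])
  show "setA l m (A i) <= setA l m (A j)" if "i <= j" for i j
  using rep_mono[OF ex diff_le_mono2[OF that], of N] unfolding A_def inA_def by auto
 qed
 have t: "topA l m (A i) y <-> (ALL z:setA l m (A i). lab l m (A i) (b i) z <= al l m --> co (dir m) z < y)" for i
  using topA_valid(1)[OF op b] by simp
 have bt: "botA l m (A i) y <-> (ALL z:setA l m (A i). al l m < lab l m (A i) (b i) z --> y <= co (dir m) z)" for i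
  using topA_valid(2)[OF op b] by simp
 show "card {a. Suc a < Suc N & topA l m (rep l a) y ~= topA l m (rep l (Suc a)) y} <= few l m"
  using ch.top_changes[of "al l m" y, folded t] unfolding A_def using card_reverse[of N "%a. topA l m (rep l a) y"] by simp
 show "card {a. Suc a < Suc N & botA l m (rep l a) y ~= botA l m (rep l (Suc a)) y} <= few l m"
  using ch.bottom_changes[of "al l m" y, folded bt] unfolding A_def using card_reverse[of N "%a. botA l m (rep l a) y"] by simp
qed

text \<open>For the second border the growing colour is the other one, so the colours are exchanged
  and positions run upwards.\<close>

lemma changes_B:
 assumes op: "opposite l m c" and ac: "active l m" and ex: "EX d. allowed (Suc l) d"
 shows "card {a. Suc a < Suc N & topB l m (rep (Suc l) a) y ~= topB l m (rep (Suc l) (Suc a)) y} <= few l m"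
  and "card {a. Suc a < Suc N & botB l m (rep (Suc l) a) y ~= botB l m (rep (Suc l) (Suc a)) y} <= few l m"
proof -
 have "m < K" using ac unfolding active_def by simp
 hence "EX a<=N. valid l m a (rep (Suc l) i)" for i using rep_allowed[OF ex, of i] ac unfolding allowed_def by auto
 then obtain a where a: "a i <= N" "valid l m (a i) (rep (Suc l) i)" for i by metis
 interpret tc: two_colours "setA l m 0" "setB l m N" "co (dir m)" "near l" "%e. odd e = c"
  "lo l (slot m)" "Suc (top l (slot m))" "%e. ty l (slot m + e)" by (rule colours)
 interpret two_colours "setB l m N" "setA l m 0" "co (dir m)" "near l" "%e. odd e ~= c"
  "lo l (slot m)" "Suc (top l (slot m))" "%e. ty l (slot m + e)" using tc.swap by simp
 interpret ch: chain "setB l m N" "setA l m 0" "co (dir m)" "near l" "%e. odd e ~= c"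
  "lo l (slot m)" "Suc (top l (slot m))" "%e. ty l (slot m + e)"
  "%i. setB l m (rep (Suc l) i)" "%i. setA l m (a i)" "%i. lab l m (a i) (rep (Suc l) i)" "Suc N"
 proof
  show "state (setB l m (rep (Suc l) i)) (setA l m (a i)) (lab l m (a i) (rep (Suc l) i))" for i
  using tc.swap_state valid_state[OF a(2) op] by simp
  show "setB l m (rep (Suc l) i) <= setB l m (rep (Suc l) j)" if "i <= j" for i j using rep_mono[OF ex that] unfolding inB_def by auto
 qed
 have t: "topB l m (rep (Suc l) i) y <-> (ALL z:setB l m (rep (Suc l) i). lab l m (a i) (rep (Suc l) i) z <= al l m --> co (dir m) z < y)" for i
  using topB_valid(1)[OF op a] by simp
 have bt: "botB l m (rep (Suc l) i) y <-> (ALL z:setB l m (rep (Suc l) i). al l m < lab l m (a i) (rep (Suc l) i) z --> y <= co (dir m) z)" for i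
  using topB_valid(2)[OF op a] by simp
 show "card {a. Suc a < Suc N & topB l m (rep (Suc l) a) y ~= topB l m (rep (Suc l) (Suc a)) y} <= few l m"
  using ch.top_changes[of "al l m" y, folded t] .
 show "card {a. Suc a < Suc N & botB l m (rep (Suc l) a) y ~= botB l m (rep (Suc l) (Suc a)) y} <= few l m"
  using ch.bottom_changes[of "al l m" y, folded bt] .
qed

definition pieces where
 "pieces l m = [%a y. active l m & 0 < al l m --> topA l m (rep l a) (rep m y), %a y. active l m & 0 < al l m --> botA l m (rep l a) (rep m y),
  %a y. 0 < l & active (l - 1) m & 0 < al (l - 1) m --> topB (l - 1) m (rep l a) (rep m y),
  %a y. 0 < l & active (l - 1) m & 0 < al (l - 1) m --> botB (l - 1) m (rep l a) (rep m y)]"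

text \<open>Properties of a guess read off a solution, from which the bounds on changes follow. The
  algorithm tests the resulting degrees directly.\<close>

definition tidy where
 "tidy h <-> (ALL l<K. EX d. allowed l d) & (ALL l<K. ALL m<K. active l m & 0 < al l m --> (EX c. opposite l m c) & top l (slot m) < h)"

lemma few_le: "top l (slot m) < h ==> few l m <= 4 * h * h + 1"
proof -
 assume "top l (slot m) < h"
 hence "Suc (top l (slot m)) * Suc (top l (slot m)) <= h * h" by (intro mult_le_mono) auto
 hence "4 * (Suc (top l (slot m)) * Suc (top l (slot m))) <= 4 * (h * h)" by (rule mult_le_mono2)
 thus ?thesis by (simp only: mult.assoc add_le_cancel_right)
qed

lemma pieces_iff:
 assumes td: "tidy h" and l: "l < K" and m: "m < K"
 shows "systems l m (rep l a) (rep m y) <-> (ALL R:set (pieces l m). R a y)"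
proof -
 have al: "allowed l (rep l a)" using td l rep_allowed unfolding tidy_def by blast
 have 1: "sysA l m (rep l a) y' <-> topA l m (rep l a) y' & botA l m (rep l a) y'"
  if ac: "active l m" "0 < al l m" for y'
 proof -
  obtain c where "opposite l m c" using td l m ac unfolding tidy_def by blast
  moreover obtain b where "b <= N" "valid l m (rep l a) b" using al m ac unfolding allowed_def by blast
  ultimately show ?thesis by (rule topA_valid(3))
 qed
 have 2: "sysB (l - 1) m (rep l a) y' <-> topB (l - 1) m (rep l a) y' & botB (l - 1) m (rep l a) y'"
  if ac: "0 < l" "active (l - 1) m" "0 < al (l - 1) m" for y'
 proof -
  have "l - 1 < K" using l by simp
  then obtain c where "opposite (l - 1) m c" using td m ac unfolding tidy_def by blast
  moreover obtain b where "b <= N" "valid (l - 1) m b (rep l a)" using al m ac unfolding allowed_def by blast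
  ultimately show ?thesis by (rule topB_valid(3))
 qed
 show ?thesis unfolding systems_def pieces_def using 1 2 by auto
qed

lemma pieces_atomic:
 assumes td: "tidy h" and l: "l < K" and m: "m < K" and R: "R : set (pieces l m)"
 shows "csp.monot (Suc N) R" "csp.changes (Suc N) (4 * h * h + 1) R"
proof -
 interpret d: csp K "Suc N" 0 E' by (rule csp_E')
 have exm: "EX d. allowed m d" and exl: "EX d. allowed l d" using td l m unfolding tidy_def by auto
 have mon: "topA l' m a (rep m c) --> topA l' m a (rep m d)" "topB l' m a (rep m c) --> topB l' m a (rep m d)"
  "botA l' m a (rep m d) --> botA l' m a (rep m c)" "botB l' m a (rep m d) --> botB l' m a (rep m c)"
  if "c <= d" for l' a c d using rep_mono[OF exm that] unfolding topA_def topB_def botA_def botB_def by (meson le_trans less_le_trans)+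
 have "(ALL a<Suc N. ALL c<Suc N. ALL d<Suc N. c <= d --> R a c --> R a d) \<or> (ALL a<Suc N. ALL c<Suc N. ALL d<Suc N. c <= d --> R a d --> R a c)"
  using R mon unfolding pieces_def by (simp only: list.set insert_iff empty_iff) (elim disjE; simp; blast)
 thus "d.monot R" unfolding d.monot_def .
 have triv: "card {a. Suc a < Suc N & (g --> P a) ~= (g --> P (Suc a))} <= 4 * h * h + 1"
  if "g ==> card {a. Suc a < Suc N & P a ~= P (Suc a)} <= 4 * h * h + 1" for g and P :: "nat => bool" using that by (cases g) simp_all
 have A: "card {a. Suc a < Suc N & topA l m (rep l a) y ~= topA l m (rep l (Suc a)) y} <= 4 * h * h + 1"
  "card {a. Suc a < Suc N & botA l m (rep l a) y ~= botA l m (rep l (Suc a)) y} <= 4 * h * h + 1"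
  if ac: "active l m & 0 < al l m" for y
 proof -
  obtain c where c: "opposite l m c" "top l (slot m) < h" using td l m ac unfolding tidy_def by blast
  show "card {a. Suc a < Suc N & topA l m (rep l a) y ~= topA l m (rep l (Suc a)) y} <= 4 * h * h + 1"
  "card {a. Suc a < Suc N & botA l m (rep l a) y ~= botA l m (rep l (Suc a)) y} <= 4 * h * h + 1"
  using changes_A[OF c(1) _ exl, of y] ac few_le[OF c(2)] by (meson le_trans)+
 qed
 have B: "card {a. Suc a < Suc N & topB (l - 1) m (rep l a) y ~= topB (l - 1) m (rep l (Suc a)) y} <= 4 * h * h + 1"
  "card {a. Suc a < Suc N & botB (l - 1) m (rep l a) y ~= botB (l - 1) m (rep l (Suc a)) y} <= 4 * h * h + 1"
  if ac: "0 < l & active (l - 1) m & 0 < al (l - 1) m" for y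
 proof -
  have l': "l - 1 < K" "Suc (l - 1) = l" using l ac by auto
  obtain c where c: "opposite (l - 1) m c" "top (l - 1) (slot m) < h" using td l' m ac unfolding tidy_def by blast
  show "card {a. Suc a < Suc N & topB (l - 1) m (rep l a) y ~= topB (l - 1) m (rep l (Suc a)) y} <= 4 * h * h + 1"
  "card {a. Suc a < Suc N & botB (l - 1) m (rep l a) y ~= botB (l - 1) m (rep l (Suc a)) y} <= 4 * h * h + 1"
  using changes_B[OF c(1), of y] exl ac few_le[OF c(2)] unfolding l' by (meson le_trans)+
 qed
 show "d.changes (4 * h * h + 1) R" unfolding d.changes_def
 proof (intro allI impI)
  fix c
  show "card {a. Suc a < Suc N & R a c ~= R (Suc a) c} <= 4 * h * h + 1" using R unfolding pieces_def
  by (simp only: list.set insert_iff empty_iff, elim disjE FalseE; simp only:; intro triv A B)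
 qed
qed

text \<open>As a line moves, the set of points \<open>beyond\<close> it only grows or only shrinks,
  depending on the side on which the strip lies.\<close>

lemma corner_mono:
 "(ALL a c d. c <= d --> corner t u l m a c --> corner t u l m a d) \<or> (ALL a c d. c <= d --> corner t u l m a d --> corner t u l m a c)"
 and corner_mono': "(ALL a b c. a <= b --> corner t u l m a c --> corner t u l m b c) \<or> (ALL a b c. a <= b --> corner t u l m b c --> corner t u l m a c)"
proof -
 have "(ALL c d z. c <= d --> beyond u m d z --> beyond u m c z) \<or> (ALL c d z. c <= d --> beyond u m c z --> beyond u m d z)" for u m
  unfolding beyond_def by (cases "u = m") auto
 note b = this[of u m] this[of t l]
 show "(ALL a c d. c <= d --> corner t u l m a c --> corner t u l m a d) \<or> (ALL a c d. c <= d --> corner t u l m a d --> corner t u l m a c)"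
  using b(1) unfolding corner_def by (elim disjE) blast+
 show "(ALL a b c. a <= b --> corner t u l m a c --> corner t u l m b c) \<or> (ALL a b c. a <= b --> corner t u l m b c --> corner t u l m a c)"
  using b(2) unfolding corner_def by (elim disjE) blast+
qed

definition corner_piece where
 "corner_piece l m t u a c <-> ((t = l \<or> Suc t = l) & (u = m \<or> Suc u = m) --> corner t u l m (rep l a) (rep m c))"

lemma corner_piece_mono:
 assumes td: "tidy h" and l: "l < K" and m: "m < K"
 shows "csp.monot (Suc N) (corner_piece l m t u)" "csp.monot (Suc N) (%a c. corner_piece l m t u c a)"
proof -
 interpret d: csp K "Suc N" 0 E' by (rule csp_E')
 have exm: "EX d. allowed m d" and exl: "EX d. allowed l d" using td l m unfolding tidy_def by auto
 show "d.monot (corner_piece l m t u)" unfolding d.monot_def corner_piece_def using corner_mono[of t u l m] rep_mono[OF exm] by meson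
 show "d.monot (%a c. corner_piece l m t u c a)" unfolding d.monot_def corner_piece_def
  using corner_mono'[of t u l m] rep_mono[OF exl] by meson
qed

text \<open>Four corner conditions and four halves of systems from each of the two lines make 12
  atoms; the number of changes is that of \<open>top_changes\<close> with
  \<open>hi <= h\<close>.\<close>

theorem E'_decomposes:
 assumes td: "tidy h"
 shows "csp.decomposes K (Suc N) E' 12 (4 * h * h + 1)"
proof -
 interpret d: csp K "Suc N" 0 E' by (rule csp_E')
 let ?c = "4 * h * h + 1"
 have at: "d.atomic ?c R" if "d.monot R" "d.monot (%a c. R c a)" for R
 proof -
  have "card {a. Suc a < Suc N & R a c ~= R (Suc a) c} <= ?c" if "c < Suc N" for c
  using d.monot_changes_1[OF \<open>d.monot (%a c. R c a)\<close> that] by simp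
  thus ?thesis using that(1) unfolding d.atomic_def d.changes_def by blast
 qed
 show ?thesis unfolding d.decomposes_def
 proof (intro allI impI)
  fix l t assume lt: "l < K" "t < K" "l ~= t"
  show "EX Rs. length Rs <= 12 & (ALL R:set Rs. d.atomic ?c R) & (ALL a<Suc N. ALL c<Suc N. E' l t a c <-> (ALL R:set Rs. R a c))"
  proof (cases "dir l = dir t")
  case True
  thus ?thesis by (intro exI[of _ "[]"]) (simp add: E'_def E_def)
  next
  case False
  define Cs where "Cs = (if l < t
  then [corner_piece l t l t, corner_piece l t l (t - 1), corner_piece l t (l - 1) t, corner_piece l t (l - 1) (t - 1)]
  else map (%R a c. R c a) [corner_piece t l t l, corner_piece t l t (l - 1), corner_piece t l (t - 1) l, corner_piece t l (t - 1) (l - 1)])"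
  define Rs where "Rs = Cs @ pieces l t @ map (%R a c. R c a) (pieces t l)"
  have len: "length Rs <= 12" unfolding Rs_def Cs_def pieces_def by auto
  have "d.atomic ?c R" if "R : set Cs" for R using that corner_piece_mono[OF td lt(1,2)] corner_piece_mono[OF td lt(2,1)]
  unfolding Cs_def by (auto split: if_splits intro!: at[simplified])
  moreover have "d.atomic ?c R" if "R : set (pieces l t)" for R using pieces_atomic[OF td lt(1,2) that] unfolding d.atomic_def by blast
  moreover have "d.atomic ?c (%a c. R c a)" if "R : set (pieces t l)" for R
  using pieces_atomic[OF td lt(2,1) that] unfolding d.atomic_def by blast
  ultimately have atom: "ALL R:set Rs. d.atomic ?c R" unfolding Rs_def by auto
  have cor: "corners l' t' (rep l' a) (rep t' c) <-> corner_piece l' t' l' t' a c & corner_piece l' t' l' (t' - 1) a c &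
  corner_piece l' t' (l' - 1) t' a c & corner_piece l' t' (l' - 1) (t' - 1) a c" if "l' < K" "t' < K" for l' t' a c proof -
  have "(ALL i<K. (i = l' \<or> Suc i = l') --> P i) <-> P l' & (Suc (l' - 1) = l' --> P (l' - 1))" if "l' < K" for l' P
  using that by (cases l') (simp, metis Suc_lessD diff_Suc_1 less_Suc_eq nat.inject)
  note ex = this
  have "corners l' t' (rep l' a) (rep t' c) <->
  (ALL i<K. (i = l' \<or> Suc i = l') --> (ALL u<K. (u = t' \<or> Suc u = t') --> corner i u l' t' (rep l' a) (rep t' c)))"
  unfolding corners_def by blast
  thus ?thesis unfolding ex[OF that(1)] ex[OF that(2)] corner_piece_def by auto
  qed
  have "E' l t a c <-> (ALL R:set Rs. R a c)" for a c
  proof -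
  have "E' l t a c <-> (if l < t then corners l t (rep l a) (rep t c) else corners t l (rep t c) (rep l a)) &
  systems l t (rep l a) (rep t c) & systems t l (rep t c) (rep l a)" unfolding E'_def E_def using False by simp
  also have "(if l < t then corners l t (rep l a) (rep t c) else corners t l (rep t c) (rep l a)) <-> (ALL R:set Cs. R a c)"
  unfolding Cs_def cor[OF lt(1,2)] cor[OF lt(2,1)] by auto
  finally show ?thesis unfolding pieces_iff[OF td lt(1,2)] pieces_iff[OF td lt(2,1)] Rs_def by auto
  qed
  thus ?thesis using len atom by blast
  qed
 qed
qed

end


section \<open>The guess of a solution\<close>

lemma scan_last: "scan P v ~= 0 ==> EX u<v. P (odd (scan P v)) u & scan P (Suc u) = scan P v"
proof (induction v)
 case (Suc v)
 show ?case
 proof (cases "scan P (Suc v) = scan P v")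
  case True
  then obtain u where "u < v" "P (odd (scan P v)) u" "scan P (Suc u) = scan P v" using Suc by auto
  thus ?thesis using True by (auto simp del: scan.simps intro: less_SucI)
 next
  case False
  hence "P (odd (scan P (Suc v))) v" by (auto split: if_splits)
  thus ?thesis by blast
 qed
qed simp

text \<open>Each run after the first needs its own element of \<open>Q\<close>, and the first one
  may be numbered 2.\<close>

lemma scan_bound:
 assumes fin: "finite Q" and Q: "!!c v w. P c v ==> P (~ c) w ==> v < w ==> EX a:Q. v < a & a <= w"
 shows "scan P v <= 2 + card {a : Q. a < v}"
proof (induction v rule: less_induct)
 case (less v)
 show ?case
 proof (cases v)
  case (Suc u)
  have mono: "card {a : Q. a < i} <= card {a : Q. a < j}" if "i <= j" for i j using fin that by (intro card_mono) auto
  consider "scan P v = scan P u" | "scan P v ~= scan P u" "scan P u = 0" | "scan P v ~= scan P u" "scan P u ~= 0" by blast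
  thus ?thesis
  proof cases
  case 1
  thus ?thesis using less[of u] mono[of u v] Suc by simp
  next
  case 2
  thus ?thesis unfolding Suc by (auto split: if_splits)
  next
  case 3
  obtain u' where u': "u' < u" "P (odd (scan P u)) u'" "scan P (Suc u') = scan P u" using scan_last[OF 3(2)] by blast
  have s: "P (~ odd (scan P u)) u" "scan P v = Suc (scan P u)" using 3 unfolding Suc by (auto split: if_splits)
  obtain a where a: "a : Q" "u' < a" "a <= u" using Q[OF u'(2) s(1) u'(1)] by blast
  have "Suc (card {a : Q. a < Suc u'}) = card (insert a {a : Q. a < Suc u'})" using fin a by (subst card_insert_disjoint) auto
  also have "... <= card {a : Q. a < v}" using fin a u' Suc by (intro card_mono) auto
  finally show ?thesis using less[of "Suc u'"] u' s(2) Suc by (simp del: scan.simps)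
  qed
 qed simp
qed

lemma scan_card: "card {u. u < v & scan P (Suc u) ~= scan P u} <= scan P v"
proof (induction v)
 case (Suc v)
 show ?case
 proof (cases "scan P (Suc v) = scan P v")
  case True
  hence "{u. u < Suc v & scan P (Suc u) ~= scan P u} = {u. u < v & scan P (Suc u) ~= scan P u}"
  by (auto simp: less_Suc_eq simp del: scan.simps)
  thus ?thesis using Suc True by simp
 next
  case False
  hence "{u. u < Suc v & scan P (Suc u) ~= scan P u} = insert v {u. u < v & scan P (Suc u) ~= scan P u}"
  by (auto simp: less_Suc_eq simp del: scan.simps)
  moreover have "scan P v < scan P (Suc v)" using False scan_mono[of v "Suc v" P] by (simp del: scan.simps)
  ultimately show ?thesis using Suc by (simp del: scan.simps)
 qed
qed simp

text \<open>A solution in normal form: exactly \<open>k\<close> lines, sorted in each direction and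
  framed by lines at 0 and \<open>N\<close>.\<close>

locale solution = points +
 fixes p :: nat and x :: "nat => nat"
 assumes pk: "p <= k" and x0: "x 0 = 0" "x (p + 2) = 0" and xN: "x (p + 1) = N" "x (k + 3) = N"
  and x_mono: "i <= j ==> j < k + 4 ==> (i < p + 2) = (j < p + 2) ==> x i <= x j"
  and x_sep: "z < N ==> w < N ==> cl z ==> ~ cl w ==>
  EX l<k + 4. (co (if l < p + 2 then 0 else 1) z < x l) ~= (co (if l < p + 2 then 0 else 1) w < x l)"

lemma (in points) solvable_solution:
 assumes solvable
 shows "EX p x. solution N k co cl p x"
proof -
 from assms obtain X Y where XY': "finite X & finite Y & card X + card Y <= k &
  (ALL z<N. ALL w<N. cl z & ~ cl w --> (EX a:X. sep 0 a z w) \<or> (EX a:Y. sep 1 a z w))" unfolding solvable_def by (elim exE)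
 hence XY: "finite X" "finite Y" "card X + card Y <= k"
  and sp: "!!z w. z < N ==> w < N ==> cl z ==> ~ cl w ==> (EX a:X. sep 0 a z w) \<or> (EX a:Y. sep 1 a z w)" by auto
 define X' where "X' = X Int {..N}"
 define Y' where "Y' = Y Int {..N}"
 have fin: "finite X'" "finite Y'" unfolding X'_def Y'_def by auto
 have "card X' <= card X" "card Y' <= card Y" unfolding X'_def Y'_def using XY by (auto intro: card_mono)
 hence cd: "card X' + card Y' <= k" using XY by simp
 define p where "p = card X'"
 define xs where "xs = 0 # sorted_list_of_set X' @ [N]"
 \<comment> \<open>Surplus lines are placed at \<open>N\<close>, where they separate nothing, to
   make the total exactly \<open>k\<close>.\<close>
 define ys where "ys = 0 # sorted_list_of_set Y' @ replicate (k - p - card Y') N @ [N]"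
 define x where "x l = (if l < p + 2 then xs ! l else ys ! (l - (p + 2)))" for l
 have len: "length xs = p + 2" "length ys = k - p + 2" using cd unfolding xs_def ys_def p_def by auto
 have sorted: "sorted xs" "sorted ys" unfolding xs_def ys_def using fin by (auto simp: sorted_append X'_def Y'_def)
 have set: "X' <= set xs" "Y' <= set ys" unfolding xs_def ys_def using fin by auto
 have pk: "p <= k" using cd unfolding p_def by simp
 have last: "xs ! (p + 1) = N" "ys ! (k - p + 1) = N" using len unfolding xs_def ys_def by (auto simp: nth_append)
 have "solution N k co cl p x"
 proof
  show "p <= k" by (rule pk)
  show "x 0 = 0" "x (p + 2) = 0" unfolding x_def xs_def ys_def by auto
  show "x (p + 1) = N" "x (k + 3) = N" using last pk unfolding x_def by (auto simp: Suc_diff_le numeral_3_eq_3)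
  show "x i <= x j" if "i <= j" "j < k + 4" "(i < p + 2) = (j < p + 2)" for i j
  unfolding x_def using that pk len by (auto intro!: sorted_nth_mono sorted)
  show "EX l<k + 4. (co (if l < p + 2 then 0 else 1) z < x l) ~= (co (if l < p + 2 then 0 else 1) w < x l)"
  if zw: "z < N" "w < N" "cl z" "~ cl w" for z w
  proof -
  have small: "a <= N" if "sep d a z w" "d < 2" for d a
  using that(1) co_less[OF that(2) zw(1)] co_less[OF that(2) zw(2)] unfolding sep_def by auto
  from sp[OF zw] show ?thesis
  proof (elim disjE bexE)
  fix a assume a: "a : X" "sep 0 a z w"
  hence "a : set xs" using small[of 0 a] set unfolding X'_def by auto
  then obtain i where i: "i < p + 2" "xs ! i = a" using len by (auto simp: in_set_conv_nth)
  thus ?thesis using a(2) pk unfolding sep_def by (intro exI[of _ i]) (auto simp: x_def)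
  next
  fix a assume a: "a : Y" "sep 1 a z w"
  hence "a : set ys" using small[of 1 a] set unfolding Y'_def by auto
  then obtain i where i: "i < k - p + 2" "ys ! i = a" using len by (auto simp: in_set_conv_nth)
  thus ?thesis using a(2) pk unfolding sep_def by (intro exI[of _ "p + 2 + i"]) (auto simp: x_def)
  qed
  qed
 qed
 thus ?thesis by blast
qed

section \<open>Strips and slabs of a solution\<close>

context solution
begin

definition F where
 "F l = (if l < K then ff (if l < p + 2 then 0 else 1) (x l - 1) else 0)"

definition G where
 "G l = (if l < K then cc (if l < p + 2 then 0 else 1) (x l - 1) else 0)"

sublocale layout N k co cl p F G ..

lemma F: "l < K ==> F l = ff (dir l) (x l - 1)" and G: "l < K ==> G l = cc (dir l) (x l - 1)" unfolding F_def G_def dir_def by auto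

lemma x_le_N: "l < K ==> x l <= N"
proof -
 assume l: "l < K"
 show ?thesis
 proof (cases "l < p + 2")
  case True
  hence "x l <= x (p + 1)" using pk by (intro x_mono) auto
  thus ?thesis using xN by simp
 next
  case False
  hence "x l <= x (k + 3)" using l pk by (intro x_mono) auto
  thus ?thesis using xN by simp
 qed
qed

lemma x_mono_dir: "i <= j ==> j < K ==> dir i = dir j ==> x i <= x j" by (rule x_mono) (auto simp: dir_def split: if_splits)

definition inside where
 "inside l z <-> z < N & x l <= co (dir l) z & co (dir l) z < x (Suc l)"

definition inner where
 "inner d = {j. j < K & dir j = d & j ~= 0 & j ~= p + 1 & j ~= p + 2 & j ~= k + 3}"

lemma card_inner: "finite (inner d)" "card (inner d) <= k"
proof -
 show "finite (inner d)" unfolding inner_def by simp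
 have "inner d <= (if d = 0 then {1..p} else {p + 3..k + 2})" unfolding inner_def dir_def by auto
 hence "card (inner d) <= card (if d = 0 then {1..p} else {p + 3..k + 2})" by (intro card_mono) auto
 also have "... <= k" using pk by auto
 finally show "card (inner d) <= k" .
qed

text \<open>Lines of the strip's own direction have both points on the same side, so the separating
  line has the other direction; frame lines separate nothing.\<close>

lemma separated:
 assumes t: "strip t" and z: "inside t z" "inside t w" "cl z ~= cl w" and le: "co (1 - dir t) z <= co (1 - dir t) w"
 shows "EX j:inner (1 - dir t). co (1 - dir t) z < x j & x j <= co (1 - dir t) w"
proof -
 have zw: "z < N" "w < N" using z unfolding inside_def by auto
 have "EX l<K. (co (dir l) z < x l) ~= (co (dir l) w < x l)"
  using x_sep[of z w] x_sep[of w z] zw z(3) unfolding dir_def by (cases "cl z"; cases "cl w") fastforce+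
 then obtain l where l: "l < K" "(co (dir l) z < x l) ~= (co (dir l) w < x l)" by blast
 have tK: "Suc t < K" "dir (Suc t) = dir t" using t unfolding strip_def by auto
 have "dir l ~= dir t"
 proof
  assume d: "dir l = dir t"
  consider "l <= t" | "Suc t <= l" by linarith
  thus False
  proof cases
  case 1
  hence "x l <= x t" using tK d by (intro x_mono_dir) auto
  thus False using l(2) z d unfolding inside_def by auto
  next
  case 2
  hence "x (Suc t) <= x l" using tK d l by (intro x_mono_dir) auto
  thus False using l(2) z d unfolding inside_def by auto
  qed
 qed
 hence d: "dir l = 1 - dir t" by (rule dir_other)
 have "l ~= 0 & l ~= p + 1 & l ~= p + 2 & l ~= k + 3" using l(2) x0 xN co_less[OF dir_2 zw(1)] co_less[OF dir_2 zw(2)] by (metis not_less0)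
 hence "l : inner (1 - dir t)" using l d unfolding inner_def by auto
 thus ?thesis using l(2) le d by (intro bexI[of _ l]) auto
qed

lemma strip_scan:
 assumes t: "strip t" and P: "!!c v. P c v ==> EX z. inside t z & cl z = c & co (1 - dir t) z = v"
  and J: "!!j c v c' v'. P c v ==> P c' v' ==> j : inner (1 - dir t) ==> v < x j ==> x j <= v' ==> j : J"
  and fin: "finite J"
 shows "scan P v <= 2 + card J"
proof -
 have "scan P v <= 2 + card {a : x ` J. a < v}"
 proof (rule scan_bound)
  fix c v w assume v: "P c v" "P (~ c) w" "v < w"
  obtain z where z: "inside t z" "cl z = c" "co (1 - dir t) z = v" using P[OF v(1)] by blast
  obtain z' where z': "inside t z'" "cl z' = (~ c)" "co (1 - dir t) z' = w" using P[OF v(2)] by blast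
  obtain j where j: "j : inner (1 - dir t)" "v < x j" "x j <= w" using separated[OF t z(1) z'(1)] z z' v(3) by auto
  thus "EX a:x ` J. v < a & a <= w" using J[OF v(1,2) j] by blast
 qed (use fin in simp)
 also have "card {a : x ` J. a < v} <= card (x ` J)" using fin by (intro card_mono) auto
 also have "card (x ` J) <= card J" using fin by (rule card_image_le)
 finally show ?thesis by simp
qed

lemma no_both: "strip t ==> inside t z ==> inside t w ==> co (1 - dir t) z = co (1 - dir t) w ==> cl z = cl w"
 using separated[of t z w] by (metis leD order_refl)

lemma ex_strip:
 assumes "d < 2" "v < N"
 shows "EX t. strip t & dir t = d & x t <= v & v < x (Suc t)"
proof -
 define i0 where "i0 = (if d = 0 then 0 else p + 2)"
 define i1 where "i1 = (if d = 0 then p + 1 else k + 3)"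
 have i: "i0 < i1" "x i0 <= v" "v < x i1" using x0 xN assms pk unfolding i0_def i1_def by auto
 have ex: "EX t. i0 <= t & Suc t <= j & x t <= v & v < x (Suc t)" if "i0 <= j" "v < x j" for j using that
 proof (induction rule: dec_induct)
  case base
  thus ?case using i by simp
 next
  case (step j)
  thus ?case by (cases "x j <= v") (auto intro: le_SucI)
 qed
 obtain t where t: "i0 <= t" "Suc t <= i1" "x t <= v" "v < x (Suc t)" using ex[OF less_imp_le_nat[OF i(1)] i(3)] by blast
 moreover have "strip t & dir t = d"
 proof (cases "d = 0")
  case True
  hence "Suc t < p + 2" using t(2) unfolding i1_def by simp
  thus ?thesis using pk True unfolding strip_def dir_def by simp
 next
  case False
  hence "d = 1" "p + 2 <= t" "Suc t <= k + 3" using t(1,2) assms(1) unfolding i0_def i1_def by auto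
  thus ?thesis unfolding strip_def dir_def by simp
 qed
 ultimately show ?thesis by blast
qed

lemma no_conflict: no_conflict unfolding no_conflict_def
proof (intro allI impI)
 fix z w assume zw: "z < N" "w < N" and eq: "co 0 z = co 0 w & co 1 z = co 1 w"
 obtain t where t: "strip t" "dir t = 0" "x t <= co 0 z" "co 0 z < x (Suc t)" using ex_strip[of 0 "co 0 z"] co_less[of 0 z] zw by auto
 hence i: "inside t z" "inside t w" unfolding inside_def using zw eq by auto
 have "co (1 - dir t) z = co (1 - dir t) w" unfolding t(2) using eq by simp
 thus "cl z = cl w" by (rule no_both[OF t(1) i])
qed

lemma st_st: "st d (st d v) = st d v" by (induction v) auto

text \<open>Any piece of a strip is cut into its runs by the at most \<open>k\<close> lines of the
  other direction, so the greedy rule may always extend a slab within a strip.\<close>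

lemma strip_good:
 assumes t: "strip t" and c: "x t <= s" "c < x (Suc t)" "c < N"
 shows "good (dir t) s c"
proof -
 have P: "EX z. inside t z & cl z = e & co (1 - dir t) z = v" if "slab (dir t) s c e v" for e v
  using that c unfolding slab_def inside_def by auto
 have "~ (slab (dir t) s c True v & slab (dir t) s c False v)" for v using P[of True v] P[of False v] no_both[OF t] by metis
 moreover have "scan (slab (dir t) s c) N <= 2 + card (inner (1 - dir t))" by (rule strip_scan[OF t P]) (use card_inner in auto)
 ultimately show ?thesis using card_inner(2)[of "1 - dir t"] unfolding good_def by simp
qed

text \<open>If the index rose by two inside a strip, the middle slab would begin in the strip and
  have been stopped there, although extending it keeps it in the strip and hence
  \<open>good\<close>.\<close>

lemma G_step: "strip l ==> G (Suc l) <= Suc (G l)"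
proof (rule ccontr)
 assume l: "strip l" and "~ ?thesis"
 hence lt: "Suc (G l) < G (Suc l)" by simp
 have lK: "l < K" "Suc l < K" "dir (Suc l) = dir l" using l unfolding strip_def by auto
 let ?d = "dir l"
 have g: "G l = cc ?d (x l - 1)" "G (Suc l) = cc ?d (x (Suc l) - 1)" using G lK by auto
 define Q where "Q v = (v <= x (Suc l) - 1 & Suc (G l) < cc ?d v)" for v
 define v where "v = (LEAST v. Q v)"
 have "Q (x (Suc l) - 1)" unfolding Q_def using lt g by simp
 hence v: "Q v" "!!u. u < v ==> ~ Q u" unfolding v_def by (auto intro: LeastI dest: not_less_Least)
 have "v ~= 0" using v(1) unfolding Q_def by (cases v) auto
 then obtain u where u: "v = Suc u" by (cases v) auto
 have "~ Q u" using v(2) u by simp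
 hence cu: "cc ?d u <= Suc (G l)" using v(1) u unfolding Q_def by auto
 have st: "st ?d v = v" "cc ?d u = Suc (G l)" using v(1) cu unfolding Q_def u by (auto split: if_splits)
 hence ng: "~ good ?d (st ?d u) v" unfolding u using st_le[of ?d u] by (auto split: if_splits)
 have "x l <= st ?d u"
 proof (rule ccontr)
  assume "~ ?thesis"
  hence "st ?d u <= x l - 1" by simp
  hence "cc ?d (st ?d u) <= G l" unfolding g by (rule cc_mono)
  moreover have "cc ?d (st ?d u) = cc ?d u"
  proof -
  have "cc ?d (st ?d w) = cc ?d w" for w by (induction w) (auto simp: st_st split: if_splits)
  thus ?thesis by simp
  qed
  ultimately show False using st by simp
 qed
 moreover have "v < x (Suc l)" "v < N" using v(1) x_le_N[OF lK(2)] \<open>v ~= 0\<close> unfolding Q_def by auto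
 ultimately show False using strip_good[OF l] ng by blast
qed

text \<open>By \<open>G_step\<close> the coarse index rises by at most one per line; for horizontal
  lines the count restarts at line \<open>p + 2\<close>.\<close>

lemma cc_bound: "d < 2 ==> v < N ==> cc d v <= k + 2" and G_bound: "G l <= k + 3"
proof -
 have le: "G l <= l" if "l < K" for l using that
 proof (induction l)
  case 0
  thus ?case using G x0 by simp
 next
  case (Suc l)
  show ?case
  proof (cases "l = p + 1")
  case True
  thus ?thesis using G[of "p + 2"] Suc.prems x0 pk by simp
  next
  case False
  hence "strip l" using Suc.prems unfolding strip_def dir_def by auto
  thus ?thesis using G_step[of l] Suc by simp
  qed
 qed
 show "G l <= k + 3" using le[of l] by (cases "l < K") (auto simp: G_def)
 assume d: "d < 2" and v: "v < N"
 obtain t where t: "strip t" "dir t = d" "x t <= v" "v < x (Suc t)" using ex_strip[OF d v] by blast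
 have tK: "Suc t < K" "dir (Suc t) = d" using t unfolding strip_def by auto
 show "cc d v <= k + 2"
 proof (cases "Suc t = k + 3")
  case False
  have "cc d v <= cc d (x (Suc t) - 1)" using t by (intro cc_mono) simp
  also have "... = G (Suc t)" using G[OF tK(1)] tK by simp
  also have "... <= Suc t" using le[OF tK(1)] .
  finally show ?thesis using tK False by simp
 next
  case True
  have p: "p + 2 <= t" using t(1) True pk unfolding strip_def dir_def by (auto split: if_splits)
  have le': "G j <= j - (p + 2)" if "p + 2 <= j" "j < K" for j using that
  proof (induction rule: dec_induct)
  case base
  thus ?case using G[of "p + 2"] x0 pk by simp
  next
  case (step j)
  hence "strip j" unfolding strip_def dir_def by auto
  thus ?case using G_step[of j] step by simp
  qed
  have "G (Suc t) <= Suc t - (p + 2)" by (rule le') (use p tK in auto)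
  also have "... <= k + 2" using True by simp
  finally have "G (Suc t) <= k + 2" .
  moreover have "cc d v <= cc d (x (Suc t) - 1)" using t by (intro cc_mono) simp
  ultimately show ?thesis using G[OF tK(1)] tK by simp
 qed
qed

text \<open>A full coarse slab is a \<open>slab\<close> ending at its last position. It is
  \<open>good\<close> by the greedy rule or, if it is a single position, by
  \<open>strip_good\<close>.\<close>

lemma band_scan:
 assumes d: "d < 2"
 shows "scan (band d c) N <= k + 2"
proof (cases "EX z<N. st d (co d z) = st d c")
 case False
 hence "band d c = (%_ _. False)" unfolding band_def by (auto simp: fun_eq_iff)
 moreover have "scan (%_ _. False) v = 0" for v by (induction v) auto
 ultimately show ?thesis by simp
next
 case True
 then obtain z0 where z0: "z0 < N" "st d (co d z0) = st d c" by blast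
 define e where "e = Max {v. v < N & st d v = st d c}"
 have fin: "finite {v. v < N & st d v = st d c}" by simp
 have "e : {v. v < N & st d v = st d c}" unfolding e_def using fin z0 co_less[OF d] by (intro Max_in) auto
 hence e: "e < N" "st d e = st d c" by auto
 have le_e: "v <= e" if "v < N" "st d v = st d c" for v unfolding e_def using fin that by (intro Max_ge) auto
 have g: "good d (st d e) e"
 proof (cases "st d e < e")
  case False
  hence eq: "st d e = e" using st_le[of d e] by simp
  obtain t where t: "strip t" "dir t = d" "x t <= e" "e < x (Suc t)" using ex_strip[OF d e(1)] by blast
  thus ?thesis using strip_good[OF t(1), of e e] eq e(1) by simp
 qed (rule st_good)
 have "band d c = slab d (st d e) e"
 proof (intro ext iffI)
  fix b v assume "band d c b v"
  then obtain z where z: "z < N" "cl z = b" "st d (co d z) = st d c" "co (1 - d) z = v" unfolding band_def by auto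
  have "st d e <= co d z" using z(3) e(2) st_le[of d "co d z"] by simp
  moreover have "co d z <= e" using le_e[OF co_less[OF d z(1)] z(3)] .
  ultimately show "slab d (st d e) e b v" unfolding slab_def using z by blast
 next
  fix b v assume "slab d (st d e) e b v"
  then obtain z where z: "z < N" "cl z = b" "st d e <= co d z" "co d z <= e" "co (1 - d) z = v" unfolding slab_def by auto
  have ccst: "cc d (st d w) = cc d w" for w by (induction w) (auto simp: st_st split: if_splits)
  have "cc d (st d e) <= cc d (co d z)" "cc d (co d z) <= cc d e" using z cc_mono by auto
  hence "cc d (co d z) = cc d e" using ccst by simp
  hence "st d (co d z) = st d c" using cc_eq_st_eq e(2) by metis
  thus "band d c b v" unfolding band_def using z by blast
 qed
 thus ?thesis using g unfolding good_def by simp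
qed

lemma cc_card: "card {u. u < v & st d (Suc u) = Suc u} = cc d v"
proof (induction v)
 case (Suc v)
 have "{u. u < Suc v & st d (Suc u) = Suc u} = {u. u < v & st d (Suc u) = Suc u} Un (if st d (Suc v) = Suc v then {v} else {})"
  by (auto simp: less_Suc_eq)
 thus ?case using Suc by (auto simp: card_Un_disjoint)
qed simp

lemma ff_card: "card {u. u < v & nf d (Suc u)} = ff d v"
proof (induction v)
 case (Suc v)
 have "{u. u < Suc v & nf d (Suc u)} = {u. u < v & nf d (Suc u)} Un (if nf d (Suc v) then {v} else {})" by (auto simp: less_Suc_eq)
 thus ?case using Suc by (auto simp: card_Un_disjoint)
qed simp

text \<open>At most \<open>k + 2\<close> coarse starts, and at most \<open>k + 2\<close> changes of
  run in each of the at most \<open>k + 3\<close> coarse slabs of the other direction.\<close>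

lemma ff_bound:
 assumes d: "d < 2" and v: "v < N"
 shows "ff d v <= (k + 2) + (k + 3) * (k + 2)"
proof -
 let ?e = "1 - d" and ?T = "%c. {u. u < v & scan (band (1 - d) c) (Suc (Suc u)) ~= scan (band (1 - d) c) (Suc u)}"
 have e: "?e < 2" by simp
 have T: "card (?T c) <= k + 2" for c
 proof -
  let ?P = "band ?e c"
  have "card (?T c) = card (Suc ` ?T c)" by (rule card_image[symmetric]) simp
  also have "... <= card {u. u < N & scan ?P (Suc u) ~= scan ?P u}" using v by (intro card_mono) (auto simp del: scan.simps)
  also have "... <= scan ?P N" by (rule scan_card)
  also have "... <= k + 2" by (rule band_scan[OF e])
  finally show ?thesis .
 qed
 define f where "f i = (SOME c. c < N & cc ?e c = i)" for i
 have cov: "EX i:{..k + 2}. ?T c = ?T (f i)" if "c < N" for c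
 proof -
  have "f (cc ?e c) < N & cc ?e (f (cc ?e c)) = cc ?e c" unfolding f_def using that by (intro someI) simp
  hence "st ?e (f (cc ?e c)) = st ?e c" using cc_eq_st_eq by blast
  hence "band ?e c = band ?e (f (cc ?e c))" unfolding band_def by simp
  thus ?thesis using cc_bound[OF e that] by (intro bexI[of _ "cc ?e c"]) auto
 qed
 have "{u. u < v & nf d (Suc u)} <= {u. u < v & st d (Suc u) = Suc u} Un (UN i:{..k + 2}. ?T (f i))"
 proof
  fix u assume u: "u : {u. u < v & nf d (Suc u)}"
  show "u : {u. u < v & st d (Suc u) = Suc u} Un (UN i:{..k + 2}. ?T (f i))"
  proof (cases "st d (Suc u) = Suc u")
  case False
  then obtain c where c: "c < N" "u : ?T c" using u unfolding nf_def by (auto simp del: scan.simps)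
  thus ?thesis using cov[OF c(1)] by blast
  qed (use u in blast)
 qed
 hence "ff d v <= card ({u. u < v & st d (Suc u) = Suc u} Un (UN i:{..k + 2}. ?T (f i)))"
  unfolding ff_card[symmetric] by (rule card_mono[rotated]) (simp del: scan.simps)
 also have "... <= card {u. u < v & st d (Suc u) = Suc u} + card (UN i:{..k + 2}. ?T (f i))" by (rule card_Un_le)
 also have "card (UN i:{..k + 2}. ?T (f i)) <= (SUM i:{..k + 2}. card (?T (f i)))" by (rule card_UN_le) simp
 also have "... <= (SUM i:{..k + 2}. k + 2)" by (intro sum_mono T)
 also have "... = (k + 3) * (k + 2)" by (simp add: algebra_simps)
 also have "card {u. u < v & st d (Suc u) = Suc u} <= k + 2" unfolding cc_card by (rule cc_bound[OF d v])
 finally show ?thesis by simp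
qed

lemma F_bound: "F l <= (k + 2) + (k + 3) * (k + 2)"
proof (cases "l < K & 0 < N")
 case True
 hence "x l - 1 < N" using x_le_N[of l] by auto
 thus ?thesis using ff_bound[OF dir_2] F[of l] True by auto
next
 case False
 have "F l = 0"
 proof (cases "l < K")
  case True
  hence "x l - 1 = 0" using False x_le_N[of l] by simp
  thus ?thesis using F[OF True] by simp
 qed (simp add: F_def)
 thus ?thesis by simp
qed

abbreviation "true_lab l m == lab l m (x l) (x (Suc l))"
abbreviation "pts l m == {z. inA l m (x l) z \<or> inB l m (x (Suc l)) z}"

lemma pts_inside:
 assumes ac: "active l m" and z: "z : pts l m"
 shows "inside l z" "z < N" "ff (dir m) (co (dir m) z) = F m"
proof -
 have l: "l < K" "Suc l < K" "dir (Suc l) = dir l" "G (Suc l) = Suc (G l)" using ac unfolding active_def strip_def by auto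
 show zN: "z < N" "ff (dir m) (co (dir m) z) = F m" using z unfolding inA_def inB_def by auto
 have A: "co (dir l) z < x (Suc l)" if "inA l m (x l) z"
 proof (rule ccontr)
  assume "~ ?thesis"
  hence "cc (dir l) (x (Suc l) - 1) <= cc (dir l) (co (dir l) z)" by (intro cc_mono) simp
  thus False using that G[OF l(2)] l unfolding inA_def by simp
 qed
 have B: "x l <= co (dir l) z" if "inB l m (x (Suc l)) z"
 proof (rule ccontr)
  assume "~ ?thesis"
  hence "cc (dir l) (co (dir l) z) <= cc (dir l) (x l - 1)" by (intro cc_mono) simp
  thus False using that G[OF l(1)] unfolding inB_def by simp
 qed
 show "inside l z" unfolding inside_def using zN z A B unfolding inA_def inB_def by auto
qed

lemma other_dir: "active l m ==> 1 - dir l = dir m" unfolding active_def using dir_other by metis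

lemma lab_parity:
 assumes ac: "active l m" and z: "z : pts l m"
 shows "odd (true_lab l m z) <-> cl z"
proof -
 note i = pts_inside[OF ac z]
 have st: "strip l" using ac unfolding active_def by simp
 have "stP l m (x l) (x (Suc l)) (cl z) (co (dir m) z)" unfolding stP_def using z i by auto
 moreover have "~ stP l m (x l) (x (Suc l)) (~ cl z) (co (dir m) z)"
 proof
  assume "stP l m (x l) (x (Suc l)) (~ cl z) (co (dir m) z)"
  then obtain w where "cl w = (~ cl z)" "w : pts l m" "co (dir m) w = co (dir m) z" unfolding stP_def by auto
  thus False using no_both[OF st pts_inside(1)[OF ac] i(1), of w] other_dir[OF ac] by simp
 qed
 ultimately show ?thesis unfolding lab_def by (rule scan_parity)
qed

section \<open>Fine rows and run numbers of a solution\<close>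

definition row where
 "row m = {j. j < K & dir j = dir m & F j = F m}"

text \<open>The separating line lies between two coordinates of one fine slab, so monotonicity of
  the fine index puts it into the same row.\<close>

lemma row_separates:
 assumes ac: "active l m" and z: "z : pts l m" "w : pts l m" "cl z ~= cl w" "co (dir m) z <= co (dir m) w"
 shows "EX j:row m. j : inner (dir m) & co (dir m) z < x j & x j <= co (dir m) w"
proof -
 have st: "strip l" using ac unfolding active_def by simp
 note i = pts_inside[OF ac z(1)] pts_inside[OF ac z(2)]
 obtain j where j: "j : inner (dir m)" "co (dir m) z < x j" "x j <= co (dir m) w"
  using separated[OF st i(1,4) z(3)] z(4) unfolding other_dir[OF ac] by blast
 have jK: "j < K" "dir j = dir m" using j(1) unfolding inner_def by auto
 have "F m <= ff (dir m) (x j - 1)" unfolding i(3)[symmetric] using j by (intro ff_mono) simp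
 moreover have "ff (dir m) (x j - 1) <= F m" unfolding i(6)[symmetric] using j by (intro ff_mono) simp
 ultimately have "j : row m" unfolding row_def using jK F[OF jK(1)] by simp
 thus ?thesis using j by blast
qed

lemma lab_le_row:
 assumes ac: "active l m"
 shows "true_lab l m z <= 2 + card (row m Int inner (dir m))" unfolding lab_def
proof -
 have "scan (stP l m (x l) (x (Suc l))) v <= 2 + card {a : x ` (row m Int inner (dir m)). a < v}" for v
 proof (rule scan_bound)
  fix c v w assume v: "stP l m (x l) (x (Suc l)) c v" "stP l m (x l) (x (Suc l)) (~ c) w" "v < w"
  obtain z where z: "z : pts l m" "cl z = c" "co (dir m) z = v" using v(1) unfolding stP_def by blast
  obtain z' where z': "z' : pts l m" "cl z' = (~ c)" "co (dir m) z' = w" using v(2) unfolding stP_def by blast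
  show "EX a:x ` (row m Int inner (dir m)). v < a & a <= w" using row_separates[OF ac z(1) z'(1)] z z' v(3) by auto
 qed (simp add: row_def)
 moreover have "card {a : x ` (row m Int inner (dir m)). a < v} <= card (x ` (row m Int inner (dir m)))" for v
  by (intro card_mono) (auto simp: row_def)
 moreover have "card (x ` (row m Int inner (dir m))) <= card (row m Int inner (dir m))" by (intro card_image_le) (simp add: row_def)
 ultimately show "scan (stP l m (x l) (x (Suc l))) (Suc (co (dir m) z)) <= 2 + card (row m Int inner (dir m))"
  by (meson add_le_cancel_left le_trans)
qed

lemma lab_le: "active l m ==> true_lab l m z <= k + 2"
proof -
 assume ac: "active l m"
 have "card (row m Int inner (dir m)) <= k" using card_inner[of "dir m"] by (meson Int_lower2 card_mono le_trans)
 thus ?thesis using lab_le_row[OF ac, of z] by simp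
qed

definition first where
 "first m = (LEAST j. j : row m)"

lemma first: "m < K ==> first m : row m" and first_le: "j : row m ==> first m <= j"
 unfolding first_def by (rule LeastI[of _ m], simp add: row_def) (rule Least_le)

lemma row_eq: "j : row m ==> row j = row m" unfolding row_def by auto

text \<open>Fine indices are monotone along the lines of one direction, so the rows are disjoint
  intervals of line numbers.\<close>

lemma row_card: "m < K ==> m' < K ==> first m < first m' ==> first m + card (row m) <= first m'"
proof -
 assume m: "m < K" "m' < K" and lt: "first m < first m'"
 have "row m <= {first m..<first m'}"
 proof
  fix j assume j: "j : row m"
  have "j < first m'"
  proof (rule ccontr)
  assume ge: "~ ?thesis"
  note f = first[OF m(1)] first[OF m(2)]
  have d: "dir (first m) = dir m" "dir (first m') = dir m'" "dir j = dir m" "first m' < K" "j < K" using f j unfolding row_def by auto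
  have "dir (first m) <= dir (first m')" "dir (first m') <= dir j" using lt ge unfolding dir_def by auto
  hence dd: "dir m' = dir m" using d by simp
  have Fm: "F i <= F j" if "i <= j" "j < K" "dir i = dir j" for i j using that F[of i] F[of j] x_mono_dir[of i j] by (simp add: ff_mono)
  have "F (first m) <= F (first m')" "F (first m') <= F j" using lt ge d dd by (auto intro!: Fm)
  hence "F m' = F m" using f j unfolding row_def by auto
  hence "row m' = row m" unfolding row_def using dd by auto
  thus False using lt unfolding first_def by simp
  qed
  thus "j : {first m..<first m'}" using first_le[OF j] by simp
 qed
 hence "card (row m) <= card {first m..<first m'}" by (intro card_mono) auto
 thus ?thesis using lt by simp
qed

text \<open>A row of \<open>r\<close> lines has at most \<open>r + 2 <= 3 * r\<close> run numbers,
  so the offsets \<open>3 * first m\<close> keep the entries of different rows apart. This brings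
  the table \<open>ty\<close> down to O(k) entries per strip.\<close>

lemma slot_unique:
 assumes m: "active l m" "active l' m'" and e: "0 < e" "e <= 2 + card (row m Int inner (dir m))"
  "0 < e'" "e' <= 2 + card (row m' Int inner (dir m'))" and eq: "3 * first m + e = 3 * first m' + e'"
 shows "first m = first m'"
proof -
 have K: "m < K" "m' < K" using m unfolding active_def by auto
 have le: "card (row m Int inner (dir m)) <= card (row m)" for m by (intro card_mono) (auto simp: row_def)
 show ?thesis using row_card[OF K] row_card[OF K(2,1)] le[of m] le[of m'] e eq by (cases "first m" "first m'" rule: linorder_cases) auto
qed

definition labs where
 "labs l m = true_lab l m ` pts l m"

text \<open>Once positive, \<open>scan\<close> rises in unit steps, and each rise comes from a point
  of the strip.\<close>

lemma labs_convex:
 assumes ac: "active l m" and e: "e : labs l m" "f : labs l m" "e <= g" "g <= f"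
 shows "g : labs l m"
proof -
 let ?P = "stP l m (x l) (x (Suc l))"
 obtain z w where zw: "z : pts l m" "true_lab l m z = e" "w : pts l m" "true_lab l m w = f" using e unfolding labs_def by blast
 have e0: "0 < e"
 proof -
  have "?P (cl z) (co (dir m) z)" unfolding stP_def using zw pts_inside[OF ac zw(1)] by auto
  thus ?thesis using zw unfolding lab_def by (metis scan_pos)
 qed
 show ?thesis
 proof (cases "e = g")
  case False
  define v where "v = (LEAST v. g <= scan ?P (Suc v))"
  have v: "g <= scan ?P (Suc v)" "!!u. u < v ==> scan ?P (Suc u) < g" unfolding v_def using e(4) zw(4) unfolding lab_def
  by (metis (mono_tags, lifting) LeastI, metis (mono_tags, lifting) not_le not_less_Least)
  have lt: "co (dir m) z < v"
  proof (rule ccontr)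
  assume "~ ?thesis"
  hence "Suc v <= Suc (co (dir m) z)" by simp
  hence "scan ?P (Suc v) <= e" unfolding zw(2)[symmetric] lab_def by (rule scan_mono)
  thus False using v(1) e(3) False by simp
  qed
  then obtain u where u: "v = Suc u" "co (dir m) z <= u" by (cases v) auto
  have su: "scan ?P v < g" using v(2)[of u] u by simp
  have "e <= scan ?P v" unfolding zw(2)[symmetric] lab_def using u by (intro scan_mono) simp
  hence pos: "scan ?P v ~= 0" using e0 by simp
  have chg: "scan ?P (Suc v) ~= scan ?P v" using su v(1) by simp
  have g: "g = scan ?P (Suc v)" using su v(1) pos by (auto split: if_splits)
  have "?P (odd (scan ?P (Suc v))) v" using chg by (auto split: if_splits)
  then obtain q where q: "q : pts l m" "co (dir m) q = v" unfolding stP_def by blast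
  hence "true_lab l m q = g" unfolding lab_def g by simp
  thus ?thesis unfolding labs_def using q by blast
 qed (use e in simp)
qed

lemma labs_range: "active l m ==> e : labs l m ==> 0 < e & e <= 2 + card (row m Int inner (dir m)) & e <= k + 2"
proof -
 assume ac: "active l m" and "e : labs l m"
 then obtain z where z: "z : pts l m" "e = true_lab l m z" unfolding labs_def by blast
 have "stP l m (x l) (x (Suc l)) (cl z) (co (dir m) z)" unfolding stP_def using z pts_inside[OF ac z(1)] by auto
 hence "0 < e" unfolding z(2) lab_def by (rule scan_pos)
 thus ?thesis using lab_le_row[OF ac, of z] lab_le[OF ac, of z] z by simp
qed

lemma finite_labs: "finite (labs l m)"
proof -
 have "pts l m <= {..<N}" by (auto simp: inA_def inB_def)
 thus ?thesis unfolding labs_def by (meson finite_imageI finite_lessThan finite_subset)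
qed

lemma labs_point: "e : labs l m ==> EX z. z : pts l m & true_lab l m z = e" unfolding labs_def by (erule imageE) blast

lemma stP_point: "stP l m (x l) (x (Suc l)) c v ==> EX z. z : pts l m & cl z = c & co (dir m) z = v" unfolding stP_def by blast

lemma row_same:
 assumes "row m = row m'" "m < K" "m' < K"
 shows "dir m = dir m'" "inA l m a = inA l m' a" "inB l m b = inB l m' b" "stP l m a b = stP l m' a b"
  "lab l m a b = lab l m' a b" "labs l m = labs l m'" "active l m = active l m'"
proof -
 have "m : row m'" using assms unfolding row_def by blast
 hence d: "dir m = dir m'" "F m = F m'" unfolding row_def by auto
 show "dir m = dir m'" by (rule d)
 show A: "inA l m a = inA l m' a" and B: "inB l m b = inB l m' b" for l a b unfolding inA_def inB_def d by (rule refl)+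
 show S: "stP l m a b = stP l m' a b" for l a b unfolding stP_def A B d by (rule refl)
 show L: "lab l m a b = lab l m' a b" for l a b unfolding lab_def S d by (rule refl)
 show "labs l m = labs l m'" unfolding labs_def A B L by (rule refl)
 show "active l m = active l m'" unfolding active_def d using assms by auto
qed

text \<open>Two numbers in use give two neighbouring runs of different colours. Each side of the
  slab boundary has one colour by \<open>cell_colour\<close>, so the two sides have opposite
  ones.\<close>

lemma labs_opposite:
 assumes ac: "active l m" and e: "e : labs l m" "f : labs l m" "e ~= f"
 shows "EX c. opposite l m c"
proof -
 have main: "EX c. opposite l m c" if ef: "e < f" "e : labs l m" "f : labs l m" for e f
 proof -
  have "Suc e : labs l m" using labs_convex[OF ac ef(2,3)] ef(1) by simp
  then obtain w where w: "w : pts l m" "true_lab l m w = Suc e" using labs_point by blast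
  obtain z where z: "z : pts l m" "true_lab l m z = e" using labs_point[OF ef(2)] by blast
  note zw = z w
  have d: "dir m = 1 - dir l" using other_dir[OF ac] by simp
  have ne: "cl z ~= cl w" using lab_parity[OF ac zw(1)] lab_parity[OF ac zw(3)] zw by auto
  have A: "cl q = cl r" if "inA l m a q" "inA l m a' r" for q r a a'
  using cell_colour[OF no_conflict dir_2, of q r l] that unfolding inA_def d by auto
  have B: "cl q = cl r" if "inB l m a q" "inB l m a' r" for q r a a'
  using cell_colour[OF no_conflict dir_2, of q r l] that unfolding inB_def d by auto
  obtain q r where qr: "inA l m (x l) q" "inB l m (x (Suc l)) r" "cl q ~= cl r" using zw(1,3) ne A B by blast
  have "opposite l m (cl q)" unfolding opposite_def using A[OF _ qr(1)] B[OF _ qr(2)] qr(3) by blast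
  thus ?thesis by blast
 qed
 show ?thesis using main[of e f] main[of f e] e by (cases e f rule: linorder_cases) auto
qed

definition ldr where
 "ldr l m e = (ARG_MIN (near l) z. z : pts l m & true_lab l m z = e)"

lemma ldr:
 assumes "e : labs l m"
 shows "ldr l m e : pts l m" "true_lab l m (ldr l m e) = e"
  "z : pts l m ==> true_lab l m z = e ==> near l (ldr l m e) <= near l z"
proof -
 obtain z0 where z0: "z0 : pts l m & true_lab l m z0 = e" using assms unfolding labs_def by blast
 note * = arg_min_nat_lemma[of "%z. z : pts l m & true_lab l m z = e" z0 "near l", OF z0, folded ldr_def]
 show "ldr l m e : pts l m" "true_lab l m (ldr l m e) = e" using * by auto
 show "z : pts l m ==> true_lab l m z = e ==> near l (ldr l m e) <= near l z" using * by blast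
qed

text \<open>Records the relative order of leaders of one colour by small numbers instead of
  ranks.\<close>

definition order where
 "order l m e = card {f : labs l m. even f = even e & near l (ldr l m f) < near l (ldr l m e)}"

lemma order_less:
 assumes "e : labs l m" "f : labs l m" "even e = even f"
 shows "order l m e < order l m f <-> near l (ldr l m e) < near l (ldr l m f)"
proof
 assume lt: "near l (ldr l m e) < near l (ldr l m f)"
 let ?S = "%e. {f : labs l m. even f = even e & near l (ldr l m f) < near l (ldr l m e)}"
 have "?S e <= ?S f" using assms(3) lt by (auto intro: less_trans)
 moreover have "e : ?S f" "e ~: ?S e" using assms lt by blast+
 ultimately have "?S e \<subset> ?S f" by blast
 thus "order l m e < order l m f" unfolding order_def using finite_labs[of l m] by (intro psubset_card_mono) auto
next
 assume "order l m e < order l m f"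
 moreover have "order l m f <= order l m e" if "near l (ldr l m f) <= near l (ldr l m e)"
  unfolding order_def using assms that finite_labs[of l m] by (intro card_mono) auto
 ultimately show "near l (ldr l m e) < near l (ldr l m f)" by (meson not_le)
qed

lemma order_le: "active l m ==> order l m e <= k + 2"
proof -
 assume ac: "active l m"
 have "order l m e <= card {1..k + 2}" unfolding order_def using labs_range[OF ac] by (intro card_mono) (auto simp: Suc_le_eq)
 thus ?thesis by simp
qed

section \<open>The guess read off a solution\<close>

abbreviation "W == 5 * K"

definition slot where
 "slot m = (if m < K then 3 * first m else 0)"

definition sg where
 "sg t u <-> t < K & u < K & (EX z. inside t z & inside u z & cl z)"

text \<open>The conditions ensure that a positive value comes with two consecutive runs, hence with
  \<open>opposite\<close> sides, and that the system it imposes holds in the solution.\<close>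

definition al where
 "al l m = (let e = scan (stP l m (x l) (x (Suc l))) (x m) in
  if active l m & e : labs l m & Suc e : labs l m & (ALL z:pts l m. x m <= co (dir m) z --> e < true_lab l m z) then e else 0)"

text \<open>The slot of a row is thrice its first line, so \<open>s div 3\<close> recovers a line of
  the row.\<close>

definition top where
 "top l s = (if active l (s div 3) & 3 dvd s & labs l (s div 3) ~= {} then Max (labs l (s div 3)) else 0)"

definition lo where
 "lo l s = (if active l (s div 3) & 3 dvd s & labs l (s div 3) ~= {} then Min (labs l (s div 3)) - 1 else 0)"

definition is_ty where
 "is_ty l i r <-> (EX m e. m < K & first m = m & active l m & e : labs l m & i = 3 * m + e & r = order l m e)"

definition ty where
 "ty l i = (if EX r. is_ty l i r then THE r. is_ty l i r else 0)"

sublocale guess N k co cl p F G slot sg al top lo ty ..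

lemma first_props: "m < K ==> row (first m) = row m" "m < K ==> first m < K" "m < K ==> first (first m) = first m"
proof -
 assume m: "m < K"
 show r: "row (first m) = row m" using first[OF m] row_eq by blast
 show "first m < K" using first[OF m] unfolding row_def by simp
 show "first (first m) = first m" by (simp only: first_def[of "first m"] r) (simp only: first_def)
qed

lemma ty_order:
 assumes ac: "active l m" and e: "e : labs l m"
 shows "ty l (slot m + e) = order l (first m) e"
proof -
 have m: "m < K" using ac unfolding active_def by simp
 note f = first_props[OF m]
 note same = row_same[OF f(1,2) m]
 have it: "is_ty l (slot m + e) (order l (first m) e)"
  unfolding is_ty_def slot_def using m f same ac e by (intro exI[of _ "first m"] exI[of _ e]) simp
 have "r = order l (first m) e" if r: "is_ty l (slot m + e) r" for r
 proof -
  obtain m' e' where m': "m' < K" "first m' = m'" "active l m'" "e' : labs l m'" "slot m + e = 3 * m' + e'" "r = order l m' e'"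
  using r unfolding is_ty_def by blast
  have "first m = first m'"
  using slot_unique[OF ac m'(3), of e e'] labs_range[OF ac e] labs_range[OF m'(3,4)] m' m unfolding slot_def by simp
  thus ?thesis using m' m unfolding slot_def by simp
 qed
 hence "(THE r. is_ty l (slot m + e) r) = order l (first m) e" using it by (rule the_equality[rotated])
 thus ?thesis unfolding ty_def using it by auto
qed

lemma top_lo:
 assumes ac: "active l m"
 shows "e : labs l m <-> lo l (slot m) < e & e <= top l (slot m)"
proof -
 have m: "m < K" using ac unfolding active_def by simp
 note f = first_props[OF m]
 note same = row_same[OF f(1,2) m]
 have s: "slot m div 3 = first m" "3 dvd slot m" unfolding slot_def using m by auto
 show ?thesis
 proof (cases "labs l m = {}")
  case False
  have tl: "top l (slot m) = Max (labs l m)" "lo l (slot m) = Min (labs l m) - 1"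
  unfolding top_def lo_def s(1) using same ac s(2) False by auto
  have mm: "Max (labs l m) : labs l m" "Min (labs l m) : labs l m" using finite_labs False by auto
  have "0 < Min (labs l m)" using labs_range[OF ac mm(2)] by simp
  hence "lo l (slot m) < e & e <= top l (slot m) <-> Min (labs l m) <= e & e <= Max (labs l m)" unfolding tl by auto
  also have "... <-> e : labs l m" using labs_convex[OF ac mm(2,1)] finite_labs[of l m] by auto
  finally show ?thesis by blast
 next
  case True
  hence "top l (slot m) = 0" unfolding top_def s(1) using same by simp
  thus ?thesis using True by simp
 qed
qed

lemma top_le: "top l s <= k + 2" and lo_le: "lo l s <= k + 2"
proof -
 have "Max (labs l m) <= k + 2" "Min (labs l m) <= k + 2" if "active l m" "labs l m ~= {}" for m
  using labs_range[OF that(1)] Max_in[OF finite_labs that(2)] Min_in[OF finite_labs that(2)] by auto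
 thus "top l s <= k + 2" "lo l s <= k + 2" unfolding top_def lo_def by (auto simp: le_diff_conv le_SucI)
qed

lemma al:
 assumes ac: "active l m" and al: "0 < al l m" and z: "z : pts l m"
 shows "true_lab l m z <= al l m <-> co (dir m) z < x m"
proof -
 let ?e = "scan (stP l m (x l) (x (Suc l))) (x m)"
 have e: "al l m = ?e" "ALL z:pts l m. x m <= co (dir m) z --> ?e < true_lab l m z"
  using al unfolding al_def Let_def by (auto split: if_splits)
 show ?thesis
 proof (cases "co (dir m) z < x m")
  case True
  hence "true_lab l m z <= ?e" unfolding lab_def by (intro scan_mono) simp
  thus ?thesis using e True by simp
 next
  case False
  hence "?e < true_lab l m z" using e(2) z by (meson not_le)
  thus ?thesis using e(1) False by simp
 qed
qed

lemma al_labs: "0 < al l m ==> active l m & al l m : labs l m & Suc (al l m) : labs l m" unfolding al_def Let_def by (auto split: if_splits)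

text \<open>Take a line between the highest point of run \<open>e\<close> and the lowest point of
  run \<open>e + 1\<close>; it belongs to the row by \<open>row_separates\<close>.\<close>

lemma ex_al:
 assumes ac: "active l m" and e: "e : labs l m" "Suc e : labs l m"
 shows "EX j:row m. al l j = e"
proof -
 let ?P = "stP l m (x l) (x (Suc l))" and ?d = "dir m"
 have m: "m < K" using ac unfolding active_def by simp
 have fin: "finite (pts l m)" by (rule finite_subset[of _ "{..<N}"]) (auto simp: inA_def inB_def)
 define Z where "Z f = {z : pts l m. true_lab l m z = f}" for f
 have finZ: "finite (Z f)" for f unfolding Z_def using fin by simp
 have ne: "Z e ~= {}" "Z (Suc e) ~= {}" using e unfolding Z_def labs_def by fastforce+
 obtain z where z: "z : Z e" "!!q. q : Z e ==> co ?d q <= co ?d z"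
  using Max_in[of "co ?d ` Z e"] Max_ge[of "co ?d ` Z e"] finZ[of e] ne(1) by fastforce
 obtain w where w: "w : Z (Suc e)" "!!q. q : Z (Suc e) ==> co ?d w <= co ?d q"
  using Min_in[of "co ?d ` Z (Suc e)"] Min_le[of "co ?d ` Z (Suc e)"] finZ[of "Suc e"] ne(2) by fastforce
 have zw: "z : pts l m" "true_lab l m z = e" "w : pts l m" "true_lab l m w = Suc e" using z w unfolding Z_def by auto
 have mono: "true_lab l m q <= true_lab l m r" if "co ?d q <= co ?d r" for q r unfolding lab_def using that by (intro scan_mono) simp
 have le: "co ?d z <= co ?d w" using mono[of w z] zw(2,4) by (cases "co ?d z <= co ?d w") simp_all
 have "cl z ~= cl w" using lab_parity[OF ac zw(1)] lab_parity[OF ac zw(3)] zw by auto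
 then obtain j where j: "j : row m" "co ?d z < x j" "x j <= co ?d w" using row_separates[OF ac zw(1,3) _ le] by blast
 have jK: "j < K" using j(1) unfolding row_def by simp
 note same = row_same[OF row_eq[OF j(1)] jK m]
 have "e <= scan ?P (x j)" unfolding zw(2)[symmetric] lab_def using j(2) by (intro scan_mono) simp
 moreover have "scan ?P (x j) <= Suc e" unfolding zw(4)[symmetric] lab_def using j(3) by (intro scan_mono) simp
 moreover have "scan ?P (x j) ~= Suc e"
 proof
  assume s: "scan ?P (x j) = Suc e"
  then obtain u where u: "u < x j" "?P (odd (Suc e)) u" "scan ?P (Suc u) = Suc e" using scan_last[of ?P "x j"] by auto
  obtain q where q: "q : pts l m" "co ?d q = u" using u(2) unfolding stP_def by blast
  hence "q : Z (Suc e)" unfolding Z_def lab_def using u(3) by (simp del: scan.simps)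
  thus False using w(2)[of q] q u(1) j(3) by simp
 qed
 ultimately have s: "scan ?P (x j) = e" by simp
 have "e < true_lab l m q" if q: "q : pts l m" "x j <= co ?d q" for q
 proof -
  have "e <= true_lab l m q" using mono[of z q] zw(2) q(2) j(2) by simp
  moreover have "q ~: Z e" using z(2)[of q] q(2) j(2) by auto
  ultimately show ?thesis using q unfolding Z_def by auto
 qed
 hence "al l j = e" unfolding al_def Let_def same s using ac e by auto
 thus ?thesis using j(1) by blast
qed

lemma check: check unfolding check_def
proof (intro conjI allI impI)
 fix l m e assume lm: "active l m" "e < top l (slot m)" "lo l (slot m) < e"
 have m: "m < K" using lm unfolding active_def by simp
 have "e : labs l m" "Suc e : labs l m" using top_lo[OF lm(1)] lm by auto
 then obtain j where j: "j : row m" "al l j = e" using ex_al[OF lm(1)] by blast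
 have "slot j = slot m" using row_eq[OF j(1)] j(1) m unfolding slot_def row_def first_def by auto
 thus "EX m'<K. dir m' = dir m & F m' = F m & slot m' = slot m & al l m' = e" using j unfolding row_def by blast
qed (use pk no_conflict G_step in auto)

lemma opposite_parts:
 assumes op: "opposite l m c" and z: "inA l m (x l) z" and w: "w : pts l m" "cl w = cl z"
 shows "inA l m (x l) w" using op w inA_0[OF z] inB_N[of l m "x (Suc l)" w] z unfolding opposite_def by auto

lemma opposite_parts':
 assumes op: "opposite l m c" and z: "inB l m (x (Suc l)) z" and w: "w : pts l m" "cl w = cl z"
 shows "inB l m (x (Suc l)) w" using op w inB_N[OF z] inA_0[of l m "x l" w] z unfolding opposite_def by auto

text \<open>If the leaders of two different runs lie on one side, that side has one colour and
  contains both runs completely, so they are the leaders compared by \<open>order\<close>.\<close>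

lemma true_valid:
 assumes ac: "active l m"
 shows "valid l m (x l) (x (Suc l))"
proof -
 let ?a = "x l" and ?b = "x (Suc l)"
 have m: "m < K" and st: "strip l" using ac unfolding active_def by auto
 note f = first_props[OF m]
 note same = row_same[OF f(1,2) m]
 have ord: "order l (first m) = order l m" unfolding order_def ldr_def same by (rule refl)
 have pe: "z : pts l m" if "inA l m ?a z \<or> inB l m ?b z" for z using that by simp
 have near_ldr: "near l (ldr l m (true_lab l m z)) = near l z"
  if z: "z : pts l m" and min: "!!w. w : pts l m ==> true_lab l m w = true_lab l m z ==> near l z <= near l w" for z
 proof -
  have "true_lab l m z : labs l m" unfolding labs_def using z by blast
  note d = ldr[OF this]
  show ?thesis using min[OF d(1,2)] d(3)[OF z refl] by simp
 qed
 have ty: "near l z < near l w <-> ty l (slot m + true_lab l m z) < ty l (slot m + true_lab l m w)"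
  if z: "z : pts l m" "w : pts l m" and par: "cl z = cl w"
  and mz: "!!q. q : pts l m ==> true_lab l m q = true_lab l m z ==> near l z <= near l q"
  and mw: "!!q. q : pts l m ==> true_lab l m q = true_lab l m w ==> near l w <= near l q" for z w
 proof -
  have e: "true_lab l m z : labs l m" "true_lab l m w : labs l m" unfolding labs_def using z by blast+
  have "odd (true_lab l m z) = odd (true_lab l m w)" unfolding lab_parity[OF ac z(1)] lab_parity[OF ac z(2)] by (rule par)
  hence ev: "even (true_lab l m z) = even (true_lab l m w)" by simp
  show ?thesis unfolding ty_order[OF ac e(1)] ty_order[OF ac e(2)] ord order_less[OF e ev]
  using near_ldr[OF z(1) mz] near_ldr[OF z(2) mw] by simp
 qed
 show ?thesis unfolding valid_def
 proof (intro conjI allI impI)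
  show "~ (EX v<N. stP l m ?a ?b True v & stP l m ?a ?b False v)"
  proof
  assume "EX v<N. stP l m ?a ?b True v & stP l m ?a ?b False v"
  then obtain v where v: "stP l m ?a ?b True v" "stP l m ?a ?b False v" by blast
  obtain z where z: "z : pts l m" "cl z = True" "co (dir m) z = v" using stP_point[OF v(1)] by blast
  obtain w where w: "w : pts l m" "cl w = False" "co (dir m) w = v" using stP_point[OF v(2)] by blast
  note zw = z(1) w(1) z(2,3) w(2,3)
  thus False using no_both[OF st pts_inside(1)[OF ac zw(1)] pts_inside(1)[OF ac zw(2)]] other_dir[OF ac] by simp
  qed
 next
  fix z assume "z < N" "inA l m ?a z \<or> inB l m ?b z"
  hence "true_lab l m z : labs l m" unfolding labs_def by blast
  thus "lo l (slot m) < lab l m ?a ?b z" "lab l m ?a ?b z <= top l (slot m)" using top_lo[OF ac] by auto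
 next
  fix e assume "e <= top l (slot m)" "lo l (slot m) < e"
  hence "e : labs l m" using top_lo[OF ac] by simp
  thus "EX z<N. (inA l m ?a z \<or> inB l m ?b z) & lab l m ?a ?b z = e" unfolding labs_def using inA_less inB_less by blast
 next
  fix z w assume "z < N" "w < N" and a: "leadA l m ?a ?b z & leadA l m ?a ?b w & lab l m ?a ?b z ~= lab l m ?a ?b w"
  hence zw: "inA l m ?a z" "inA l m ?a w" unfolding leadA_def by auto
  have e: "true_lab l m z : labs l m" "true_lab l m w : labs l m" unfolding labs_def using zw by blast+
  then obtain c where op: "opposite l m c" using labs_opposite[OF ac e] a by blast
  have c: "cl z = cl w" using op inA_0[OF zw(1)] inA_0[OF zw(2)] unfolding opposite_def by simp
  have min: "near l r <= near l q"
  if r: "inA l m ?a r" "leadA l m ?a ?b r" and q: "q : pts l m" "true_lab l m q = true_lab l m r" for q r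
  proof -
  have "cl q = cl r" using lab_parity[OF ac q(1)] lab_parity[OF ac pe, of r] r(1) q(2) by simp
  hence qA: "inA l m ?a q" by (rule opposite_parts[OF op r(1) q(1)])
  hence "~ nearA l q r" using r(2) q(2) inA_less[OF qA] unfolding leadA_def by blast
  thus ?thesis using near_A[OF qA r(1)] by simp
  qed
  show "nearA l z w <-> ty l (slot m + lab l m ?a ?b z) < ty l (slot m + lab l m ?a ?b w)"
  unfolding near_A[OF zw, symmetric] using a zw by (intro ty c min) auto
 next
  fix z w assume "z < N" "w < N" and a: "leadB l m ?a ?b z & leadB l m ?a ?b w & lab l m ?a ?b z ~= lab l m ?a ?b w"
  hence zw: "inB l m ?b z" "inB l m ?b w" unfolding leadB_def by auto
  have e: "true_lab l m z : labs l m" "true_lab l m w : labs l m" unfolding labs_def using zw by blast+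
  then obtain c where op: "opposite l m c" using labs_opposite[OF ac e] a by blast
  have c: "cl z = cl w" using op inB_N[OF zw(1)] inB_N[OF zw(2)] unfolding opposite_def by auto
  have min: "near l r <= near l q"
  if r: "inB l m ?b r" "leadB l m ?a ?b r" and q: "q : pts l m" "true_lab l m q = true_lab l m r" for q r
  proof -
  have "cl q = cl r" using lab_parity[OF ac q(1)] lab_parity[OF ac pe, of r] r(1) q(2) by simp
  hence qB: "inB l m ?b q" by (rule opposite_parts'[OF op r(1) q(1)])
  hence "~ nearB l q r" using r(2) q(2) inB_less[OF qB] unfolding leadB_def by blast
  thus ?thesis using near_B[OF qB r(1)] by simp
  qed
  show "nearB l z w <-> ty l (slot m + lab l m ?a ?b z) < ty l (slot m + lab l m ?a ?b w)"
  unfolding near_B[OF zw, symmetric] using a zw by (intro ty c min) auto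
 qed
qed

lemma x_allowed: "l < K ==> allowed l (x l)"
proof -
 assume l: "l < K"
 have "l = 0 \<or> l = p + 2 --> x l = 0" "l = p + 1 \<or> l = k + 3 --> x l = N" using x0 xN by auto
 moreover have "Suc l = K <-> l = k + 3" by auto
 ultimately have pos: "pos_ok l (x l)" unfolding pos_ok_def using x_le_N[OF l] F[OF l] G[OF l] by simp
 have "EX b<=N. valid l m (x l) b" if "active l m" for m
  using true_valid[OF that] x_le_N[of "Suc l"] that unfolding active_def strip_def by blast
 moreover have "EX b<=N. valid (l - 1) m b (x l)" if "0 < l" "active (l - 1) m" for m
  using true_valid[OF that(2)] x_le_N[of "l - 1"] that l by (intro exI[of _ "x (l - 1)"]) simp
 ultimately show ?thesis unfolding allowed_def using pos by blast
qed

lemma tidy: "tidy (k + 3)" unfolding tidy_def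
proof (intro conjI allI impI)
 fix l m assume "active l m & 0 < al l m"
 thus "EX c. opposite l m c" using al_labs[of l m] labs_opposite[of l m "al l m" "Suc (al l m)"] by simp
 show "top l (slot m) < k + 3" using top_le[of l "slot m"] by simp
qed (use x_allowed in blast)

lemma strip_colour: "strip t ==> strip u ==> dir u ~= dir t ==> inside t z ==> inside u z ==> inside t w ==> inside u w ==> cl z = cl w"
proof -
 assume s: "strip t" "strip u" "dir u ~= dir t" "inside t z" "inside u z" "inside t w" "inside u w"
 have main: "cl z = cl w"
  if s: "inside t z" "inside u z" "inside t w" "inside u w" and le: "co (1 - dir t) z <= co (1 - dir t) w" for z w
 proof (rule ccontr)
  assume ne: "cl z ~= cl w"
  have d: "1 - dir t = dir u" using dir_other[OF \<open>dir u ~= dir t\<close>] by simp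
  obtain j where j: "j : inner (dir u)" "co (dir u) z < x j" "x j <= co (dir u) w"
  using separated[OF \<open>strip t\<close> s(1,3) ne le] unfolding d by blast
  have jK: "j < K" "dir j = dir u" using j(1) unfolding inner_def by auto
  have u: "Suc u < K" "dir (Suc u) = dir u" using \<open>strip u\<close> unfolding strip_def by auto
  show False
  proof (cases "j <= u")
  case True
  hence "x j <= x u" using u jK by (intro x_mono_dir) auto
  thus False using j s unfolding inside_def by auto
  next
  case False
  hence "x (Suc u) <= x j" using u jK by (intro x_mono_dir) auto
  thus False using j s unfolding inside_def by auto
  qed
 qed
 show ?thesis using main[OF s(4-7)] main[OF s(6,7,4,5)] by (meson nat_le_linear)
qed

text \<open>Fine indices are monotone, so a strict inequality with the index of the other border
  places the point on the inner side of that border.\<close>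

lemma beyond_inside: "l < K ==> z < N ==> beyond t l (x l) z ==> inside t z"
proof -
 assume l: "l < K" "z < N" and b: "beyond t l (x l) z"
 have t: "strip t" "t < K" "Suc t < K" "dir (Suc t) = dir t" using b unfolding beyond_def strip_def by auto
 consider "t = l" "x l <= co (dir l) z" "ff (dir l) (co (dir l) z) < F (Suc l)"
  | "Suc t = l" "co (dir l) z < x l" "F t < ff (dir l) (co (dir l) z)" using b unfolding beyond_def by blast
 thus ?thesis
 proof cases
  case 1
  have "~ x (Suc l) - 1 <= co (dir l) z" using 1(1,3) F[OF t(3)] t(4) ff_mono[of "x (Suc l) - 1" "co (dir l) z" "dir l"] by auto
  thus ?thesis using 1 l unfolding inside_def by simp
 next
  case 2
  have d: "dir l = dir t" using t(4) 2(1) by simp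
  have "~ co (dir t) z <= x t - 1" using 2(3) F[OF t(2)] ff_mono[of "co (dir t) z" "x t - 1" "dir t"] d by auto
  thus ?thesis using 2 l d unfolding inside_def by simp
 qed
qed

lemma x_corners: "l < K ==> m < K ==> dir m ~= dir l ==> corners l m (x l) (x m)" unfolding corners_def corner_def
proof (intro allI impI, elim conjE)
 fix t u z assume a: "l < K" "m < K" "dir m ~= dir l" "t < K" "u < K" "z < N" "t = l \<or> Suc t = l" "u = m \<or> Suc u = m"
  and b: "beyond t l (x l) z" "beyond u m (x m) z"
 have i: "inside t z" "inside u z" using beyond_inside[OF a(1,6) b(1)] beyond_inside[OF a(2,6) b(2)] by auto
 have s: "strip t" "strip u" using b unfolding beyond_def by auto
 have d: "dir u ~= dir t" using a(3,7,8) s unfolding strip_def by auto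
 show "cl z = sg t u" unfolding sg_def using strip_colour[OF s d i] i a(4,5) by blast
qed

lemma x_systems: "l < K ==> m < K ==> systems l m (x l) (x m)" unfolding systems_def
proof (intro conjI impI, elim conjE)
 assume lm: "l < K" "m < K" and a: "active l m" "0 < al l m"
 have "Suc l < K" using a unfolding active_def strip_def by auto
 thus "sysA l m (x l) (x m)" unfolding sysA_def using true_valid[OF a(1)] al[OF a] x_le_N by blast
next
 assume lm: "l < K" "m < K" and a: "0 < l & active (l - 1) m & 0 < al (l - 1) m"
 obtain t where t: "l = Suc t" using a by (cases l) auto
 have a': "active t m" "0 < al t m" using a t by auto
 have "sysB t m (x (Suc t)) (x m)" unfolding sysB_def using true_valid[OF a'(1)] al[OF a'] x_le_N[of t] lm t by (intro exI[of _ "x t"]) simp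
 thus "sysB (l - 1) m (x l) (x m)" using t by simp
qed

lemma x_E: "l < K ==> m < K ==> E l m (x l) (x m)" unfolding E_def using x_corners x_systems by auto

text \<open>The components of a guess are read off from one function \<open>U\<close>, whose first argument selects
 the component.\<close>

definition word :: "nat => nat => nat => nat" where
 "word j l i = (if l < W & i < W then (if j = 0 & l = 0 & i = 0 then p
  else if j = 1 & i = 0 then F l else if j = 2 & i = 0 then G l else if j = 3 & i = 0 then slot l
  else if j = 4 then of_bool (sg l i) else if j = 5 then al l i else if j = 6 then top l i
  else if j = 7 then lo l i else if j = 8 then ty l i else 0) else 0)"

text \<open>The largest entries are fine indices, quadratic in \<open>k\<close>. The exponent 12
  leaves room for the degree bound in \<open>base_large\<close>.\<close>

lemma word_bound: "word j l i < (k + 5) ^ 12"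
proof -
 have p1: "(k + 5) ^ 2 <= (k + 5) ^ 12" by (rule power_increasing) auto
 have sq: "(k + 5) ^ 2 = k * k + 10 * k + 25" by (simp add: power2_eq_square algebra_simps)
 have slot: "slot l <= 3 * K" using first_props(2)[of l] unfolding slot_def by (cases "l < K") auto
 have al: "al l i <= k + 2" using al_labs[of l i] labs_range[of l i "al l i"] by (cases "al l i = 0") auto
 have ty: "ty l i <= k + 2"
 proof (cases "EX r. is_ty l i r")
  case True
  then obtain m e where m: "m < K" "first m = m" "active l m" "e : labs l m" "i = 3 * m + e" unfolding is_ty_def by blast
  hence "ty l i = order l m e" using ty_order[OF m(3,4)] unfolding slot_def by simp
  thus ?thesis using order_le[OF m(3)] by simp
 qed (simp add: ty_def)
 have "word j l i <= max (k + 2 + (k + 3) * (k + 2)) (3 * K)"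
  using F_bound[of l] G_bound[of l] slot al ty top_le[of l i] lo_le[of l i] pk unfolding word_def by (auto simp: max_def of_bool_def)
 also have "... < k * k + 10 * k + 25" by (auto simp: algebra_simps)
 finally show ?thesis using p1 sq by simp
qed

lemma word_guess:
 "p = word 0 0 0" "F = (%l. word 1 l 0)" "G = (%l. word 2 l 0)" "slot = (%l. word 3 l 0)"
 "sg = (%t u. word 4 t u = 1)" "al = word 5" "top = word 6" "lo = word 7" "ty = word 8"
proof -
 have W: "i < W" if "i < K" for i using that by simp
 show "p = word 0 0 0" unfolding word_def by simp
 show "F = (%l. word 1 l 0)" "G = (%l. word 2 l 0)" "slot = (%l. word 3 l 0)"
  unfolding word_def by (auto simp: fun_eq_iff F_def G_def slot_def)
 show "sg = (%t u. word 4 t u = 1)" unfolding word_def by (auto simp: fun_eq_iff sg_def)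
 have act: "active l m ==> l < K & m < K" for l m unfolding active_def strip_def by auto
 have "al l m = 0" if "~ (l < W & m < W)" for l m using that act[of l m] unfolding al_def Let_def by auto
 thus "al = word 5" unfolding word_def by (auto simp: fun_eq_iff)
 have "top l s = 0 & lo l s = 0" if "~ (l < W & s < W)" for l s using that act[of l "s div 3"] unfolding top_def lo_def by auto
 thus "top = word 6" "lo = word 7" unfolding word_def by (auto simp: fun_eq_iff)
 have "ty l i = 0" if "~ (l < W & i < W)" for l i
 proof -
  have "~ is_ty l i r" for r
  proof
  assume "is_ty l i r"
  then obtain m e where "m < K" "active l m" "e : labs l m" "i = 3 * m + e" unfolding is_ty_def by blast
  thus False using that act[of l m] labs_range[of l m e] by auto
  qed
  hence "~ (EX r. is_ty l i r)" by blast
  thus ?thesis unfolding ty_def by (rule if_not_P)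
 qed
 thus "ty = word 8" unfolding word_def by (auto simp: fun_eq_iff)
qed

end

theorem (in points) completeness:
 assumes solvable
 shows "EX (U :: nat => nat => nat => nat) x. (ALL j l i. U j l i < (k + 5) ^ 12) & (ALL j l i. ~ (l < 5 * K & i < 5 * K) --> U j l i = 0) &
  guess.check N k co cl (U 0 0 0) (%l. U 1 l 0) (%l. U 2 l 0) (%m. U 3 m 0) (U 5) (U 6) (U 7) &
  guess.tidy N k co cl (U 0 0 0) (%l. U 1 l 0) (%l. U 2 l 0) (%m. U 3 m 0) (U 5) (U 6) (U 7) (U 8) (k + 3) &
  (ALL l<K. guess.allowed N k co cl (U 0 0 0) (%l. U 1 l 0) (%l. U 2 l 0) (%m. U 3 m 0) (U 6) (U 7) (U 8) l (x l)) &
  (ALL l<K. ALL t<K. guess.E N k co cl (U 0 0 0) (%l. U 1 l 0) (%l. U 2 l 0) (%m. U 3 m 0)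
  (%t u. U 4 t u = 1) (U 5) (U 6) (U 7) (U 8) l t (x l) (x t))" proof -
 obtain p x where "solution N k co cl p x" using solvable_solution[OF assms] by blast
 then interpret s: solution N k co cl p x .
 note w = s.word_guess[symmetric]
 show ?thesis by (rule exI[of _ s.word], rule exI[of _ x], unfold w, intro conjI allI impI)
  (simp_all add: s.word_bound s.check s.tidy s.x_allowed s.x_E, auto simp: s.word_def)
qed


section \<open>The table algorithm and its acceptance test\<close>

context csp
begin

lemma pidx_all: "l < K ==> a < n ==> pidx all_cuts l a = a"
proof -
 assume l: "l < K" "a < n"
 hence "{s. 0 < s & s <= a & (l, s) : all_cuts} = {1..a}" unfolding all_cuts_def by auto
 thus ?thesis unfolding pidx_def by simp
qed

lemma part_all: "l < K ==> s < n ==> part all_cuts l s = {s}" unfolding part_def by (auto simp: pidx_all)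

lemma feas_all: "valid all_cuts B ==> feas all_cuts B <-> pok all_cuts B"
proof
 assume v: "valid all_cuts B" and p: "pok all_cuts B"
 have B: "B l - 1 < n" if "l < K" "B l ~= 0" for l using v that unfolding valid_def isl_def by auto
 show "feas all_cuts B" unfolding feas_def
 proof (intro exI[of _ "%l. B l - 1"] conjI allI impI)
  show "B l - 1 : part all_cuts l (B l - 1)" if "l < K" "B l ~= 0" for l unfolding part_all[OF that(1) B[OF that]] by simp
  show "E l t (B l - 1) (B t - 1)" if lt: "l < K" "t < K" "l ~= t & B l ~= 0 & B t ~= 0" for l t
  proof -
  have "someT all_cuts l (B l - 1) t (B t - 1)" using p lt unfolding pok_def by blast
  thus ?thesis unfolding someT_def using part_all B lt by auto
  qed
 qed
qed (rule feas_pok)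

text \<open>Initially all parts are singletons, and \<open>pok\<close> already decides feasibility
  (\<open>feas_all\<close>).\<close>

fun tab where
 "tab W 0 l s w <-> pok all_cuts (code all_cuts l s w)"
| "tab W (Suc i) l s w <-> update (cuts i) W (tab W i) l s w"

lemma code_valid: "l < K ==> isl C l s ==> valid C (code C l s w)" unfolding code_def by (intro vec_valid)

lemma table_tab:
 assumes d: "!!j. j < i ==> deg (cuts j)" and bK: "K < b" and W: "b ^ (3 * K) <= W"
 shows "table (cuts i) W (tab W i)" using d
proof (induction i)
 case 0
 show ?case unfolding table_def using feas_all[OF code_valid] by simp
next
 case (Suc i)
 have "tab W (Suc i) = update (cuts i) W (tab W i)" by (simp add: fun_eq_iff)
 thus ?case using table_update[OF cut_set_cuts Suc.IH _ bK W] Suc.prems by simp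
qed

text \<open>The degrees and the disappearance of all cuts are tested rather than assumed, so that
  acceptance is reliable for every guess.\<close>

definition accepting :: bool where
 "accepting <-> (ALL i<=K * n. deg (cuts i)) & (ALL l<K. ALL s<n. (l, s) ~: cuts (K * n)) &
  combine (cuts (K * n)) (b ^ (3 * K)) (tab (b ^ (3 * K)) (K * n)) full"

lemma accepting_iff:
 assumes bK: "K < b"
 shows "accepting <-> (ALL i<=K * n. deg (cuts i)) & cuts (K * n) = {} & feas {} full"
proof -
 have e: "(ALL l<K. ALL s<n. (l, s) ~: cuts (K * n)) <-> cuts (K * n) = {}" using cut_set_cuts[of "K * n"] unfolding cut_set_def by auto
 have c: "combine (cuts (K * n)) (b ^ (3 * K)) (tab (b ^ (3 * K)) (K * n)) full <-> feas (cuts (K * n)) full"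
  if "ALL i<=K * n. deg (cuts i)" using that by (intro combine_iff table_tab bK valid_full) auto
 show ?thesis unfolding accepting_def e using c by auto
qed

end

context guess
begin

text \<open>\<open>rep\<close> is a definite description; this relational form has bounded
  quantifiers only, as the loop language demands.\<close>

definition E2 where
 "E2 l t a c <-> (EX a'<=N. EX c'<=N. is_rep l a a' & is_rep t c c' & E l t a' c')"

lemma csp_E2: "csp (Suc N) E2"
proof
 show "E2 l t a c <-> E2 t l c a" for l t a c unfolding E2_def using E_sym by blast
qed simp

lemma E2_E': "EX d. allowed l d ==> EX d. allowed t d ==> E2 l t a c <-> E' l t a c"
proof -
 assume ex: "EX d. allowed l d" "EX d. allowed t d"
 have r: "is_rep l a (rep l a)" "is_rep t c (rep t c)" using ex is_rep_rep by auto
 have N: "rep l a <= N" "rep t c <= N" using ex rep_allowed allowed_le by auto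
 show ?thesis unfolding E2_def E'_def using r N is_rep_unique by metis
qed

definition accepted where
 "accepted b <-> check & (ALL l<K. EX a<=N. allowed l a) & csp.accepting K (Suc N) b E2"

lemma accepted_sound:
 assumes "accepted b" "K < b"
 shows solvable
proof -
 interpret d: csp K "Suc N" b E2 by (rule csp_E2)
 have ex: "EX d. allowed l d" if "l < K" for l using assms(1) that unfolding accepted_def by blast
 have "d.feas {} d.full" using assms d.accepting_iff unfolding accepted_def by blast
 then obtain x where x: "!!l t. l < K ==> t < K ==> l ~= t ==> E2 l t (x l) (x t)" unfolding d.feas_full by blast
 have "E l t (rep l (x l)) (rep t (x t))" if "l < K" "t < K" "l ~= t" for l t
  using x[OF that] E2_E'[OF ex ex] that unfolding E'_def by blast
 thus ?thesis using assms(1) ex unfolding accepted_def by (intro soundness[where x = "%l. rep l (x l)"] rep_allowed) auto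
qed

lemma accepted_complete:
 assumes td: "tidy h" and ck: check and x: "!!l. l < K ==> allowed l (x l)"
  and E: "!!l t. l < K ==> t < K ==> E l t (x l) (x t)"
  and b: "2 * K * K * 12 * (2 + 4 * (4 * h * h + 1)) < b"
 shows "accepted b"
proof -
 interpret d: csp K "Suc N" b E2 by (rule csp_E2)
 interpret d': csp K "Suc N" b E' by (rule csp_E')
 have ex: "EX d. allowed l d" if "l < K" for l using x[OF that] by blast
 have "d.decomposes 12 (4 * h * h + 1) <-> d'.decomposes 12 (4 * h * h + 1)"
  unfolding d.decomposes_def d'.decomposes_def using E2_E'[OF ex ex] by simp
 hence dec: "d.decomposes 12 (4 * h * h + 1)" using E'_decomposes[OF td] by blast
 have "12 * (c + 1) <= 2 * K * K * 12 * (2 + 4 * c)" for c by (intro mult_le_mono) auto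
 from this[of "4 * h * h + 1"] have "12 * ((4 * h * h + 1) + 1) <= 2 * K * K * 12 * (2 + 4 * (4 * h * h + 1))" .
 hence b2: "12 * ((4 * h * h + 1) + 1) < b" using b by linarith
 have K0: "K <= 2 * K * K * 12 * (2 + 4 * (4 * h * h + 1))" by simp
 hence bK: "K < b" using b by linarith
 have "EX x. (ALL l<K. x l < Suc N) & (ALL l<K. ALL t<K. l ~= t --> E2 l t (x l) (x t))"
 proof (intro exI[of _ x] conjI allI impI)
  show "x l < Suc N" if "l < K" for l using allowed_le[OF x[OF that]] by simp
  show "E2 l t (x l) (x t)" if "l < K" "t < K" for l t
  using E[OF that] x that unfolding E2_E'[OF ex[OF that(1)] ex[OF that(2)]] E'_def by (simp add: rep_fix)
 qed
 hence "d.feas {} d.full" unfolding d.feas_full .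
 moreover have "d.cuts (K * Suc N) = {}" by (rule d.cuts_empty[OF dec b order_refl])
 moreover have "d.deg (d.cuts i)" for i by (rule d.sparse_deg[OF d.sparse_cuts[OF dec b2]])
 ultimately have "d.accepting" unfolding d.accepting_iff[OF bK] by blast
 moreover have "ALL l<K. EX a<=N. allowed l a" using x allowed_le by blast
 ultimately show ?thesis unfolding accepted_def using ck by blast
qed

end

text \<open>Serves at the same time as base for the digits of a guess, as base for the codes of
  vectors and as bound on red degrees.\<close>

definition base :: "nat => nat" where
 "base k = (k + 5) ^ 12"

definition width :: "nat => nat" where
 "width k = 5 * (k + 4)"

text \<open>Nine square tables of side \<open>width k\<close> are packed into the number
  \<open>w\<close>; outside of them the value is 0, as it is for the guess of a solution.\<close>

definition guess_digit :: "nat => nat => nat => nat => nat => nat" where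
 "guess_digit k w j l i = (if l < width k & i < width k then digit (base k) w ((j * width k + l) * width k + i) else 0)"

definition guesses :: "nat => nat" where
 "guesses k = base k ^ (9 * width k * width k)"

section \<open>Guesses as numbers\<close>

lemma guess_exists:
 assumes "!!j l i. U j l i < base k" "!!j l i. ~ (l < width k & i < width k) ==> U j l i = 0"
 shows "EX w<guesses k. ALL j<9. ALL l i. guess_digit k w j l i = U j l i"
proof -
 let ?W = "width k"
 have W: "0 < ?W" unfolding width_def by simp
 define f where "f c = U (c div ?W div ?W) (c div ?W mod ?W) (c mod ?W)" for c
 obtain w where w: "w < base k ^ (9 * ?W * ?W)" "!!c. c < 9 * ?W * ?W ==> digit (base k) w c = f c"
  using digits_exist[of "9 * ?W * ?W" f "base k"] assms(1) unfolding f_def by blast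
 have "guess_digit k w j l i = U j l i" if j: "j < 9" for j l i
 proof (cases "l < ?W & i < ?W")
  case True
  have a: "j * ?W + l < 9 * ?W"
  proof -
  have "j * ?W + l < Suc j * ?W" using True by simp
  also have "... <= 9 * ?W" using j by (intro mult_le_mono1) simp
  finally show ?thesis .
  qed
  have "(j * ?W + l) * ?W + i < Suc (j * ?W + l) * ?W" using True by simp
  also have "... <= 9 * ?W * ?W" using a by (intro mult_le_mono1) simp
  finally have "digit (base k) w ((j * ?W + l) * ?W + i) = f ((j * ?W + l) * ?W + i)" by (rule w(2))
  moreover have "f ((j * ?W + l) * ?W + i) = U j l i" unfolding f_def using True W by simp
  ultimately show ?thesis unfolding guess_digit_def using True by simp
 qed (use assms(2) in "auto simp: guess_digit_def")
 thus ?thesis using w(1) unfolding guesses_def by blast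
qed

context points
begin

abbreviation "accepts_guess w == guess.accepted N k co cl (guess_digit k w 0 0 0) (%l. guess_digit k w 1 l 0) (%l. guess_digit k w 2 l 0)
  (%m. guess_digit k w 3 m 0) (%t u. guess_digit k w 4 t u = 1) (guess_digit k w 5) (guess_digit k w 6) (guess_digit k w 7)
  (guess_digit k w 8) (base k)"

text \<open>The bound of \<open>exists_cheap_cut\<close> for 12 atoms, with the number of changes
  from \<open>E'_decomposes\<close> at \<open>h = k + 3\<close>.\<close>

lemma base_large: "2 * K * K * 12 * (2 + 4 * (4 * (k + 3) * (k + 3) + 1)) < base k"
proof -
 have "2 * K * K * 12 * (2 + 4 * (4 * (k + 3) * (k + 3) + 1)) <= 2 * (k + 5) * (k + 5) * 12 * (22 * (k + 5) * (k + 5))"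
  by (intro mult_le_mono) (auto simp: algebra_simps)
 also have "... = 528 * (k + 5) ^ 4" by (simp add: power4_eq_xxxx algebra_simps)
 also have "... < 5 ^ 8 * (k + 5) ^ 4" by simp
 also have "... <= (k + 5) ^ 8 * (k + 5) ^ 4" by (intro mult_le_mono1 power_mono) auto
 also have "... = base k" unfolding base_def by (simp flip: power_add)
 finally show ?thesis .
qed

lemma base_K: "K < base k"
proof -
 have "K <= 2 * K * K * 12 * (2 + 4 * (4 * (k + 3) * (k + 3) + 1))" by simp
 thus ?thesis using base_large by linarith
qed

theorem solvable_iff: "solvable <-> (EX w<guesses k. accepts_guess w)"
proof
 assume "EX w<guesses k. accepts_guess w"
 then obtain w where w: "accepts_guess w" by blast
 interpret guess N k co cl "guess_digit k w 0 0 0" "%l. guess_digit k w 1 l 0" "%l. guess_digit k w 2 l 0"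
  "%m. guess_digit k w 3 m 0" "%t u. guess_digit k w 4 t u = 1" "guess_digit k w 5" "guess_digit k w 6" "guess_digit k w 7"
  "guess_digit k w 8" ..
 show solvable by (rule accepted_sound[OF w base_K])
next
 assume solvable
 from completeness[OF this] obtain U :: "nat => nat => nat => nat" and x where U: "(ALL j l i. U j l i < (k + 5) ^ 12) & (ALL j l i. ~ (l < 5 * K & i < 5 * K) --> U j l i = (0::nat)) &
  guess.check N k co cl (U 0 0 0) (%l. U 1 l 0) (%l. U 2 l 0) (%m. U 3 m 0) (U 5) (U 6) (U 7) &
  guess.tidy N k co cl (U 0 0 0) (%l. U 1 l 0) (%l. U 2 l 0) (%m. U 3 m 0) (U 5) (U 6) (U 7) (U 8) (k + 3) &
  (ALL l<K. guess.allowed N k co cl (U 0 0 0) (%l. U 1 l 0) (%l. U 2 l 0) (%m. U 3 m 0) (U 6) (U 7) (U 8) l (x l)) &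
  (ALL l<K. ALL t<K. guess.E N k co cl (U 0 0 0) (%l. U 1 l 0) (%l. U 2 l 0) (%m. U 3 m 0)
  (%t u. U 4 t u = 1) (U 5) (U 6) (U 7) (U 8) l t (x l) (x t))" by (elim exE)
 note parts = U[THEN conjunct1] U[THEN conjunct2, THEN conjunct1] U[THEN conjunct2, THEN conjunct2, THEN conjunct1]
  U[THEN conjunct2, THEN conjunct2, THEN conjunct2, THEN conjunct1]
  U[THEN conjunct2, THEN conjunct2, THEN conjunct2, THEN conjunct2, THEN conjunct1]
  U[THEN conjunct2, THEN conjunct2, THEN conjunct2, THEN conjunct2, THEN conjunct2]
 have "EX w<guesses k. ALL j<9. ALL l i. guess_digit k w j l i = U j l i"
  by (rule guess_exists) (unfold base_def width_def, rule parts(1)[rule_format], rule parts(2)[rule_format], assumption)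
 then obtain w where w: "w < guesses k" "!!j l i. j < 9 ==> guess_digit k w j l i = U j l i" by blast
 have e: "guess_digit k w 0 = U 0" "guess_digit k w 1 = U 1" "guess_digit k w 2 = U 2" "guess_digit k w 3 = U 3"
  "guess_digit k w 4 = U 4" "guess_digit k w 5 = U 5" "guess_digit k w 6 = U 6" "guess_digit k w 7 = U 7" "guess_digit k w 8 = U 8"
  using w(2) by (auto simp: fun_eq_iff)
 interpret guess N k co cl "U 0 0 0" "%l. U 1 l 0" "%l. U 2 l 0" "%m. U 3 m 0" "%t u. U 4 t u = 1" "U 5" "U 6" "U 7" "U 8" ..
 have acc: "accepted (base k)" by (rule accepted_complete[where h = "k + 3" and x = x, OF _ _ _ _ base_large])
  (rule parts(4), rule parts(3), rule parts(5)[rule_format], assumption, rule parts(6)[rule_format], assumption+)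
 show "EX w<guesses k. accepts_guess w" by (rule exI[of _ w], rule conjI[OF w(1)], unfold e, rule acc)
qed

end


section \<open>A language of bounded loops\<close>

declare [[coercion_enabled = false]]

datatype binop = Plus | Monus | Less | CellLess

datatype tm = Num nat | Inp nat | Var nat | Bin binop tm tm | Ite tm tm tm | Load tm | Sum tm

datatype cmd = Skip | Store tm tm | Seq cmd cmd | For cmd

type_synonym inst = "(nat => nat) \<times> rat list"

abbreviation bound :: "inst => nat" where
 "bound I == fst I 3"

text \<open>The variables are de Bruijn levels: at level \<open>n\<close> the variables below \<open>n\<close> are bound, and all
 loops run up to the bound of the instance.\<close>

fun apply_op where
 "apply_op cs Plus x y = x + y"
| "apply_op cs Monus x y = x - y"
| "apply_op cs Less x y = of_bool (x < y)"
| "apply_op cs CellLess x y = of_bool (cell cs (int x) < cell cs (int y))"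

fun eval where
 "eval I h n Z (Num c) = c"
| "eval I h n Z (Inp i) = fst I i"
| "eval I h n Z (Var i) = Z i"
| "eval I h n Z (Bin f s t) = apply_op (snd I) f (eval I h n Z s) (eval I h n Z t)"
| "eval I h n Z (Ite c s t) = (if 0 < eval I h n Z c then eval I h n Z s else eval I h n Z t)"
| "eval I h n Z (Load s) = h (eval I h n Z s)"
| "eval I h n Z (Sum s) = (\<Sum>v<bound I. eval I h (Suc n) (Z(n := v)) s)"

fun run where
 "run I n Z Skip h = h"
| "run I n Z (Store s t) h = h(eval I h n Z s := eval I h n Z t)"
| "run I n Z (Seq c c') h = run I n Z c' (run I n Z c h)"
| "run I n Z (For c) h = fold (%v. run I (Suc n) (Z(n := v)) c) [0..<bound I] h"

fun wf_tm where
 "wf_tm V n (Num c) <-> True"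
| "wf_tm V n (Inp i) <-> i < 4"
| "wf_tm V n (Var i) <-> i < n"
| "wf_tm V n (Bin f s t) <-> wf_tm V n s & wf_tm V n t"
| "wf_tm V n (Ite c s t) <-> wf_tm V n c & wf_tm V n s & wf_tm V n t"
| "wf_tm V n (Load s) <-> wf_tm V n s"
| "wf_tm V n (Sum s) <-> n < V & wf_tm V (Suc n) s"

fun wf_cmd where
 "wf_cmd V n Skip <-> True"
| "wf_cmd V n (Store s t) <-> wf_tm V n s & wf_tm V n t"
| "wf_cmd V n (Seq c c') <-> wf_cmd V n c & wf_cmd V n c'"
| "wf_cmd V n (For c) <-> n < V & wf_cmd V (Suc n) c"

lemma wf_tm_mono: "wf_tm V n t ==> V <= V' ==> wf_tm V' n t" by (induction t arbitrary: n) auto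

lemma wf_cmd_mono: "wf_cmd V n c ==> V <= V' ==> wf_cmd V' n c" by (induction c arbitrary: n) (auto intro: wf_tm_mono)

text \<open>An upper bound on the registers from \<open>d\<close> on that the code of a term
  overwrites.\<close>

fun temps :: "tm => nat" where
 "temps (Bin f s t) = max (temps s) (Suc (temps t) + 1)"
| "temps (Ite c s t) = temps c + temps s + temps t + 1"
| "temps (Load s) = Suc (temps s)"
| "temps (Sum s) = Suc (temps s)"
| "temps _ = 1"

fun ctemps :: "cmd => nat" where
 "ctemps Skip = 1"
| "ctemps (Store s t) = temps s + temps t + 2"
| "ctemps (Seq c c') = max (ctemps c) (ctemps c')"
| "ctemps (For c) = Suc (ctemps c)"

lemma temps_pos: "0 < temps t" by (induction t) auto

text \<open>Registers 0 to 3 hold the input and the bound, the variables follow from register 4 on, then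
 the temporaries, and the memory of the language starts at register \<open>B\<close>. The code leaves
 its result in register \<open>d\<close>.\<close>

fun op_code where
 "op_code d q Plus = [Add d d (Suc d)]"
| "op_code d q Monus = [Sub d d (Suc d), JumpPos d (q + 3), LoadConst d 0]"
| "op_code d q Less = [Sub d (Suc d) d, LoadConst (Suc d) 1, JumpPos d (q + 4), LoadConst (Suc d) 0, LoadConst d 0, Add d d (Suc d)]"
| "op_code d q CellLess = [LoadConst (Suc (Suc d)) 1, JumpLess d (Suc d) (q + 3), LoadConst (Suc (Suc d)) 0, LoadConst d 0, Add d d (Suc (Suc d))]"

text \<open>Jump targets are absolute, hence the argument \<open>pc\<close>. Loading 1 before
  \<open>JumpPos\<close> makes a jump unconditional. A loop is entered at its test, so a zero bound
  runs no round.\<close>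

fun comp where
 "comp B n d pc (Num c) = [LoadConst d (int c)]"
| "comp B n d pc (Inp i) = [LoadConst d 0, Add d d i]"
| "comp B n d pc (Var i) = [LoadConst d 0, Add d d (4 + i)]"
| "comp B n d pc (Bin f s t) = (let S = comp B n d pc s; T = comp B n (Suc d) (pc + length S) t in S @ T @ op_code d (pc + length S + length T) f)"
| "comp B n d pc (Ite c s t) = (let C = comp B n d pc c; T = comp B n d (pc + length C + 1) t; S = comp B n d (pc + length C + length T + 3) s in
  C @ [JumpPos d (pc + length C + length T + 3)] @ T @
  [LoadConst (Suc d) 1, JumpPos (Suc d) (pc + length C + length T + length S + 3)] @ S)"
| "comp B n d pc (Load s) = comp B n d pc s @ [LoadConst (Suc d) (int B), Add d d (Suc d), LoadInd d d]"
| "comp B n d pc (Sum s) = (let S = comp B (Suc n) (Suc d) (pc + 4) s in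
  [LoadConst d 0, LoadConst (4 + n) 0, LoadConst (Suc d) 1, JumpPos (Suc d) (pc + length S + 7)] @ S @
  [Add d d (Suc d), LoadConst (Suc d) 1, Add (4 + n) (4 + n) (Suc d),
  Sub (Suc d) 3 (4 + n), JumpPos (Suc d) (pc + 4)])"

fun ccomp where
 "ccomp B n d pc Skip = []"
| "ccomp B n d pc (Store s t) = (let S = comp B n d pc s; T = comp B n (Suc d) (pc + length S) t in
  S @ T @ [LoadConst (Suc (Suc d)) (int B), Add d d (Suc (Suc d)), StoreInd d (Suc d)])"
| "ccomp B n d pc (Seq c c') = (let C = ccomp B n d pc c in C @ ccomp B n d (pc + length C) c')"
| "ccomp B n d pc (For c) = (let C = ccomp B (Suc n) d (pc + 3) c in [LoadConst (4 + n) 0, LoadConst d 1, JumpPos d (pc + length C + 5)] @ C @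
  [LoadConst d 1, Add (4 + n) (4 + n) d, Sub d 3 (4 + n), JumpPos d (pc + 3)])"

fun cost :: "nat => tm => nat" where
 "cost m (Bin f s t) = cost m s + cost m t + 6"
| "cost m (Ite c s t) = cost m c + cost m s + cost m t + 3"
| "cost m (Load s) = cost m s + 3"
| "cost m (Sum s) = 6 + m * (cost m s + 5)"
| "cost m _ = 2"

fun ccost :: "nat => cmd => nat" where
 "ccost m Skip = 0"
| "ccost m (Store s t) = cost m s + cost m t + 3"
| "ccost m (Seq c c') = ccost m c + ccost m c'"
| "ccost m (For c) = 5 + m * (ccost m c + 4)"

section \<open>Correctness of the compiled code\<close>

definition code_at :: "program => nat => instr list => bool" where
 "code_at p pc is <-> pc + length is <= length p & (ALL i<length is. p ! (pc + i) = is ! i)"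

lemma code_at_append: "code_at p pc (xs @ ys) <-> code_at p pc xs & code_at p (pc + length xs) ys"
proof -
 have "(ALL i<length xs + length ys. p ! (pc + i) = (xs @ ys) ! i) <->
  (ALL i<length xs. p ! (pc + i) = xs ! i) & (ALL i<length ys. p ! (pc + length xs + i) = ys ! i)" (is "?l <-> ?r") proof assume ?l
  hence "p ! (pc + i) = xs ! i" if "i < length xs" for i using that by (metis nth_append trans_less_add1)
  moreover have "p ! (pc + length xs + i) = ys ! i" if "i < length ys" for i
  using \<open>?l\<close>[rule_format, of "length xs + i"] that by (simp add: add.assoc)
  ultimately show ?r by blast
 next
  assume r: ?r
  show ?l
  proof (intro allI impI)
  fix i assume "i < length xs + length ys"
  thus "p ! (pc + i) = (xs @ ys) ! i" using r[THEN conjunct1, rule_format, of i] r[THEN conjunct2, rule_format, of "i - length xs"]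
  by (cases "i < length xs") (auto simp: nth_append)
  qed
 qed
 thus ?thesis unfolding code_at_def by auto
qed

lemma code_at_Cons: "code_at p pc (x # xs) <-> pc < length p & p ! pc = x & code_at p (Suc pc) xs"
 using code_at_append[of p pc "[x]" xs] by (auto simp: code_at_def)

lemma code_at_Nil: "pc <= length p ==> code_at p pc []" unfolding code_at_def by simp

lemmas exec_simps = code_at_Cons eval_nat_numeral fun_eq_iff

definition reach where
 "reach p cs b c c' <-> (EX k<=b. (step p cs ^^ k) c = c')"

lemma reach_refl: "reach p cs b c c" unfolding reach_def by (intro exI[of _ 0]) simp

lemma reach_trans: "reach p cs b c c' ==> reach p cs b' c' c'' ==> reach p cs (b + b') c c''"
proof -
 assume "reach p cs b c c'" "reach p cs b' c' c''"
 then obtain k k' where k: "k <= b" "(step p cs ^^ k) c = c'" "k' <= b'" "(step p cs ^^ k') c' = c''" unfolding reach_def by blast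
 hence "(step p cs ^^ (k' + k)) c = c''" by (simp add: funpow_add)
 thus ?thesis unfolding reach_def using k by (intro exI[of _ "k' + k"]) auto
qed

lemma reach_le: "reach p cs b c c' ==> b <= b' ==> reach p cs b' c c'" unfolding reach_def using le_trans by blast

abbreviation "runs p I k a M b M' == reach p (snd I) k (Running a M) (Running b M')"

definition rel :: "nat => inst => (nat => nat) => nat => (nat => nat) => (nat => int) => bool" where
 "rel B I h n Z M <-> (ALL i<4. M i = int (fst I i)) & (ALL i<n. M (4 + i) = int (Z i)) & (ALL a. M (B + a) = int (h a))"

text \<open>Inputs, bound variables, temporaries below \<open>d\<close> and the memory are
  untouched; the registers from \<open>4 + n\<close> up to \<open>4 + V\<close> are free for inner
  loop counters.\<close>

definition keeps :: "nat => nat => nat => nat => (nat => int) => (nat => int) => bool" where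
 "keeps V B n d M M' <-> (ALL r. r < 4 + n \<or> 4 + V <= r & r < d \<or> B <= r --> M' r = M r)"

lemma keeps_rel: "keeps V B n d M M' ==> rel B I h n Z M ==> rel B I h n Z M'" unfolding keeps_def rel_def by auto

lemma keeps_trans: "keeps V B n d M M' ==> keeps V B n d M' M'' ==> keeps V B n d M M''" unfolding keeps_def by auto

lemma keeps_Suc: "keeps V B n (Suc d) M M' ==> keeps V B n d M M'" unfolding keeps_def by auto

lemma keeps_upd: "keeps V B n d M M' ==> 4 + V <= d ==> n <= V ==> d <= r ==> r < B ==> keeps V B n d M (M'(r := x))"
 unfolding keeps_def by auto

lemma reachI: "(step p cs ^^ k) c = c' ==> k <= b ==> reach p cs b c c'" unfolding reach_def by blast

definition lands where
 "lands V B n d p cs b pc M pc' x <-> (EX M'. reach p cs b (Running pc M) (Running pc' M') & M' d = x & keeps V B n d M M')"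

lemma landsI: "reach p cs b (Running pc M) (Running pc' M') ==> M' d = x ==> keeps V B n d M M' ==> lands V B n d p cs b pc M pc' x"
 unfolding lands_def by blast

lemma landsE:
 assumes "lands V B n d p cs b pc M pc' x"
 obtains M' where "reach p cs b (Running pc M) (Running pc' M')" "M' d = x" "keeps V B n d M M'" using assms unfolding lands_def by blast

lemma op_code_correct:
 assumes "code_at p q (op_code d q f)" "M d = int x" "M (Suc d) = int y"
 shows "EX M'. reach p cs 6 (Running q M) (Running (q + length (op_code d q f)) M') & M' d = int (apply_op cs f x y) &
  (ALL r. r < d \<or> Suc (Suc d) < r --> M' r = M r)" proof -
 have *: ?thesis if "(step p cs ^^ k) (Running q M) = Running (q + length (op_code d q f)) M'" "k <= 6"
  "M' d = int (apply_op cs f x y)" "ALL r. r < d \<or> Suc (Suc d) < r --> M' r = M r" for k M'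
  using reachI[OF that(1,2)] that(3,4) by blast
 note [simp] = exec_simps
 show ?thesis
 proof (cases f)
  case Plus
  thus ?thesis using assms by (intro *[where k = 1 and M' = "M(d := int (x + y))"]) auto
 next
  case Monus
  show ?thesis
  proof (cases "y < x")
  case True
  thus ?thesis using assms Monus by (intro *[where k = 2 and M' = "M(d := int (x - y))"]) auto
  next
  case False
  thus ?thesis using assms Monus by (intro *[where k = 3 and M' = "M(d := 0)"]) auto
  qed
 next
  case Less
  show ?thesis
  proof (cases "x < y")
  case True
  thus ?thesis using assms Less by (intro *[where k = 5 and M' = "M(Suc d := 1, d := 1)"]) auto
  next
  case False
  thus ?thesis using assms Less by (intro *[where k = 6 and M' = "M(Suc d := 0, d := 0)"]) auto
  qed
 next
  case CellLess
  show ?thesis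
  proof (cases "cell cs (int x) < cell cs (int y)")
  case True
  thus ?thesis using assms CellLess by (intro *[where k = 4 and M' = "M(Suc (Suc d) := 1, d := 1)"]) auto
  next
  case False
  thus ?thesis using assms CellLess by (intro *[where k = 5 and M' = "M(Suc (Suc d) := 0, d := 0)"]) auto
  qed
 qed
qed

lemma comp_correct:
 fixes M :: "nat => int"
 assumes "wf_tm V n t" "n <= V" "4 + V <= d" "d + temps t <= B" "code_at p pc (comp B n d pc t)" "rel B I h n Z M"
 shows "lands V B n d p (snd I) (cost (bound I) t) pc M (pc + length (comp B n d pc t)) (int (eval I h n Z t))" using assms
proof (induction t arbitrary: n d pc Z M)
 case (Num c)
 have "runs p I (Suc 0) pc M (Suc pc) (M(d := int c))" using Num.prems(5) by (intro reachI[where k = 1]) (auto simp: exec_simps)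
 moreover have "keeps V B n d M (M(d := int c))" using Num.prems unfolding keeps_def by auto
 ultimately show ?case by (intro landsI[where M' = "M(d := int c)"]) (auto intro: reach_le)
next
 case (Inp i)
 let ?M = "M(d := M i)"
 have "runs p I (Suc (Suc 0)) pc M (Suc (Suc pc)) ?M" using Inp.prems by (intro reachI[where k = 2]) (auto simp: exec_simps)
 moreover have "keeps V B n d M ?M" using Inp.prems unfolding keeps_def by auto
 moreover have "?M d = int (fst I i)" using Inp.prems unfolding rel_def by auto
 ultimately show ?case by (intro landsI[where M' = ?M]) (auto simp: numeral_2_eq_2)
next
 case (Var i)
 let ?M = "M(d := M (4 + i))"
 have "runs p I (Suc (Suc 0)) pc M (Suc (Suc pc)) ?M" using Var.prems by (intro reachI[where k = 2]) (auto simp: exec_simps)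
 moreover have "keeps V B n d M ?M" using Var.prems unfolding keeps_def by auto
 moreover have "?M d = int (Z i)" using Var.prems unfolding rel_def by auto
 ultimately show ?case by (intro landsI[where M' = ?M]) (auto simp: numeral_2_eq_2)
next
 case (Bin f s t)
 define q1 where "q1 = pc + length (comp B n d pc s)"
 define q2 where "q2 = q1 + length (comp B n (Suc d) q1 t)"
 have code: "code_at p pc (comp B n d pc s)" "code_at p q1 (comp B n (Suc d) q1 t)" "code_at p q2 (op_code d q2 f)"
  using Bin.prems(5) unfolding q1_def q2_def by (auto simp: Let_def code_at_append add.assoc)
 obtain M1 where M1: "runs p I (cost (bound I) s) pc M q1 M1"
  "M1 d = int (eval I h n Z s)" "keeps V B n d M M1"
  using Bin.IH(1)[of n d pc Z M] Bin.prems code unfolding q1_def by (auto simp: nat_add_max_right elim!: landsE)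
 obtain M2 where M2: "runs p I (cost (bound I) t) q1 M1 q2 M2"
  "M2 (Suc d) = int (eval I h n Z t)" "keeps V B n (Suc d) M1 M2"
  using Bin.IH(2)[of n "Suc d" q1 Z M1] Bin.prems code keeps_rel[OF M1(3)] unfolding q2_def by (auto simp: nat_add_max_right elim!: landsE)
 have d: "M2 d = int (eval I h n Z s)" using M2(3) M1(2) Bin.prems unfolding keeps_def by auto
 from op_code_correct[OF code(3) d M2(2), of "snd I"] obtain M3 where
  M3: "runs p I 6 q2 M2 (q2 + length (op_code d q2 f)) M3"
  "M3 d = int (eval I h n Z (Bin f s t))" "ALL r. r < d \<or> Suc (Suc d) < r --> M3 r = M2 r" by auto
 have "keeps V B n d M M3" using keeps_trans[OF M1(3) keeps_Suc[OF M2(3)]] Bin.prems(2-4) temps_pos[of t] M3(3) unfolding keeps_def by auto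
 moreover have "q2 + length (op_code d q2 f) = pc + length (comp B n d pc (Bin f s t))"
  unfolding q1_def q2_def by (simp add: Let_def add.assoc)
 ultimately show ?case using reach_trans[OF reach_trans[OF M1(1) M2(1)] M3(1)] M3(2)
  by (intro landsI[where M' = M3]) (simp_all del: comp.simps)
next
 case (Ite c s t)
 define q1 where "q1 = pc + length (comp B n d pc c)"
 define q2 where "q2 = Suc q1 + length (comp B n d (Suc q1) t)"
 define q3 where "q3 = Suc (Suc q2)"
 define q4 where "q4 = q3 + length (comp B n d q3 s)"
 have code: "code_at p pc (comp B n d pc c)" "code_at p q1 [JumpPos d q3]" "code_at p (Suc q1) (comp B n d (Suc q1) t)"
  "code_at p q2 [LoadConst (Suc d) 1, JumpPos (Suc d) q4]" "code_at p q3 (comp B n d q3 s)"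
  using Ite.prems(5) unfolding q1_def q2_def q3_def q4_def
  by (auto simp: Let_def code_at_append code_at_Cons code_at_Nil eval_nat_numeral add.assoc)
 have len: "q4 = pc + length (comp B n d pc (Ite c s t))" unfolding q1_def q2_def q3_def q4_def by (simp add: Let_def eval_nat_numeral)
 obtain M1 where M1: "runs p I (cost (bound I) c) pc M q1 M1"
  "M1 d = int (eval I h n Z c)" "keeps V B n d M M1" using Ite.IH(1)[of n d pc Z M] Ite.prems code unfolding q1_def by (auto elim!: landsE)
 show ?case
 proof (cases "0 < eval I h n Z c")
  case True
  have 1: "runs p I (Suc 0) q1 M1 q3 M1" using code(2) M1(2) True by (intro reachI[where k = 1]) (auto simp: exec_simps)
  obtain M2 where M2: "runs p I (cost (bound I) s) q3 M1 q4 M2"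
  "M2 d = int (eval I h n Z s)" "keeps V B n d M1 M2"
  using Ite.IH(2)[of n d q3 Z M1] Ite.prems code keeps_rel[OF M1(3)] unfolding q4_def by (auto elim!: landsE)
  have "runs p I (cost (bound I) (Ite c s t)) pc M q4 M2" using reach_trans[OF reach_trans[OF M1(1) 1] M2(1)] by (rule reach_le) simp
  thus ?thesis using M2 True keeps_trans[OF M1(3) M2(3)] unfolding len by (intro landsI[where M' = M2]) simp_all
 next
  case False
  have 1: "runs p I (Suc 0) q1 M1 (Suc q1) M1" using code(2) M1(2) False by (intro reachI[where k = 1]) (auto simp: exec_simps)
  obtain M2 where M2: "runs p I (cost (bound I) t) (Suc q1) M1 q2 M2"
  "M2 d = int (eval I h n Z t)" "keeps V B n d M1 M2"
  using Ite.IH(3)[of n d "Suc q1" Z M1] Ite.prems code keeps_rel[OF M1(3)] unfolding q2_def by (auto elim!: landsE)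
  let ?M = "M2(Suc d := 1)"
  have 2: "runs p I (Suc (Suc 0)) q2 M2 q4 ?M" using code(4) by (intro reachI[where k = 2]) (auto simp: exec_simps)
  have "runs p I (cost (bound I) (Ite c s t)) pc M q4 ?M"
  using reach_trans[OF reach_trans[OF reach_trans[OF M1(1) 1] M2(1)] 2] by (rule reach_le) simp
  moreover have "keeps V B n d M ?M" using keeps_trans[OF M1(3) M2(3)] Ite.prems temps_pos[of c] temps_pos[of s] by (intro keeps_upd) auto
  ultimately show ?thesis using M2(2) False unfolding len by (intro landsI[where M' = ?M]) simp_all
 qed
next
 case (Load s)
 define q1 where "q1 = pc + length (comp B n d pc s)"
 have code: "code_at p pc (comp B n d pc s)" "code_at p q1 [LoadConst (Suc d) (int B), Add d d (Suc d), LoadInd d d]"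
  using Load.prems(5) unfolding q1_def by (auto simp: code_at_append)
 obtain M1 where M1: "runs p I (cost (bound I) s) pc M q1 M1"
  "M1 d = int (eval I h n Z s)" "keeps V B n d M M1" using Load.IH[of n d pc Z M] Load.prems code unfolding q1_def by (auto elim!: landsE)
 let ?M = "M1(Suc d := int B, d := int (h (eval I h n Z s)))"
 have mem: "M1 (nat (int (eval I h n Z s) + int B)) = int (h (eval I h n Z s))" using keeps_rel[OF M1(3)] Load.prems(6) unfolding rel_def
  by (metis add.commute nat_int of_nat_add)
 have ne: "nat (int (eval I h n Z s) + int B) ~= d" "nat (int (eval I h n Z s) + int B) ~= Suc d"
  using Load.prems(4) temps_pos[of s] by (simp_all add: nat_add_distrib)
 have "runs p I (Suc (Suc (Suc 0))) q1 M1 (q1 + 3) ?M" using code(2) M1(2) mem ne by (intro reachI[where k = 3]) (auto simp: exec_simps)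
 from reach_trans[OF M1(1) this]
 have "runs p I (cost (bound I) (Load s)) pc M (q1 + 3) ?M" by (rule reach_le) simp
 moreover have "keeps V B n d M ?M" using M1(3) Load.prems temps_pos[of s] by (intro keeps_upd) auto
 ultimately show ?case unfolding q1_def by (intro landsI[where M' = ?M]) (simp_all add: add.assoc eval_nat_numeral)
next
 case (Sum s)
 let ?m = "bound I" and ?c = "cost (bound I) s"
 define S where "S = comp B (Suc n) (Suc d) (pc + 4) s"
 define q where "q = pc + 4 + length S"
 have nV: "n < V" using Sum.prems by simp
 have "code_at p pc [LoadConst d 0, LoadConst (4 + n) 0, LoadConst (Suc d) 1, JumpPos (Suc d) (q + 3)] & code_at p (pc + 4) S &
  code_at p q [Add d d (Suc d), LoadConst (Suc d) 1, Add (4 + n) (4 + n) (Suc d), Sub (Suc d) 3 (4 + n), JumpPos (Suc d) (pc + 4)]"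
  using Sum.prems(5) unfolding q_def S_def by (simp add: Let_def code_at_append code_at_Cons code_at_Nil eval_nat_numeral add.assoc)
 hence code: "code_at p pc [LoadConst d 0, LoadConst (4 + n) 0, LoadConst (Suc d) 1, JumpPos (Suc d) (q + 3)]"
  "code_at p (pc + 4) S"
  "code_at p q [Add d d (Suc d), LoadConst (Suc d) 1, Add (4 + n) (4 + n) (Suc d), Sub (Suc d) 3 (4 + n), JumpPos (Suc d) (pc + 4)]" by auto
 have dB: "d + Suc (temps s) <= B" "4 + V <= d" using Sum.prems by auto
 have body: "EX M' :: nat => int. runs p I (?c + 5) (pc + 4) M1 (if Suc v < ?m then pc + 4 else q + 5) M' &
  M' d = M1 d + int (eval I h (Suc n) (Z(n := v)) s) & M' (4 + n) = int (Suc v) & keeps V B n d M M'"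
  if M1: "M1 (4 + n) = int v" "keeps V B n d M M1" and v: "v < ?m" for v and M1 :: "nat => int"
 proof -
  have "rel B I h (Suc n) (Z(n := v)) M1" using keeps_rel[OF M1(2) Sum.prems(6)] M1(1) unfolding rel_def by (auto simp: less_Suc_eq)
  hence "lands V B (Suc n) (Suc d) p (snd I) ?c (pc + 4) M1 q (int (eval I h (Suc n) (Z(n := v)) s))"
  unfolding q_def S_def by (rule Sum.IH[rotated 5]) (use Sum.prems code(2) in "auto simp: S_def")
  then obtain M2 where M2: "runs p I ?c (pc + 4) M1 q M2"
  "M2 (Suc d) = int (eval I h (Suc n) (Z(n := v)) s)" "keeps V B (Suc n) (Suc d) M1 M2" by (rule landsE)
  have k2: "keeps V B n d M1 M2" using M2(3) unfolding keeps_def by auto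
  have vals: "M2 d = M1 d" "M2 (4 + n) = int v" "M2 3 = int ?m" using M2(3) M1 dB nV Sum.prems(6) unfolding keeps_def rel_def by auto
  let ?M = "M2(d := M2 d + M2 (Suc d), 4 + n := int (Suc v), Suc d := int ?m - int (Suc v))"
  have ne: "d ~= 4 + n" "Suc d ~= 4 + n" "d ~= 3" "Suc d ~= 3" using dB nV by auto
  have "runs p I (Suc (Suc (Suc (Suc (Suc 0))))) q M2 (if Suc v < ?m then pc + 4 else q + 5) ?M"
  using code(3) vals ne by (intro reachI[where k = 5]) (auto simp: exec_simps)
  from reach_trans[OF M2(1) this]
  have "runs p I (?c + 5) (pc + 4) M1 (if Suc v < ?m then pc + 4 else q + 5) ?M" by (rule reach_le) simp
  moreover have "keeps V B n d M ?M" using keeps_trans[OF M1(2) k2] dB nV temps_pos[of s] unfolding keeps_def by auto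
  moreover have "?M d = M1 d + int (eval I h (Suc n) (Z(n := v)) s)" "?M (4 + n) = int (Suc v)" using vals M2(2) ne by simp_all
  ultimately show ?thesis by blast
 qed
 let ?f = "%v. eval I h (Suc n) (Z(n := v)) s"
 \<comment> \<open>\<open>j\<close> counts the remaining rounds, and register \<open>d\<close> holds
   the sum so far.\<close>
 have loop: "EX M' :: nat => int. runs p I (j * (?c + 5)) (pc + 4) M1 (q + 5) M' & M' d = M1 d + int (SUM u:{v..<?m}. ?f u) & keeps V B n d M M'"
  if "M1 (4 + n) = int v" "keeps V B n d M M1" "v < ?m" "v + j = ?m" for j v and M1 :: "nat => int" using that
 proof (induction j arbitrary: v M1)
  case (Suc j)
  obtain M2 where M2: "runs p I (?c + 5) (pc + 4) M1 (if Suc v < ?m then pc + 4 else q + 5) M2"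
  "M2 d = M1 d + int (?f v)" "M2 (4 + n) = int (Suc v)" "keeps V B n d M M2" using body[OF Suc.prems(1-3)] by blast
  have sum: "(SUM u:{v..<?m}. ?f u) = ?f v + (SUM u:{Suc v..<?m}. ?f u)" using Suc.prems(3) by (rule sum.atLeast_Suc_lessThan)
  show ?case
  proof (cases "Suc v < ?m")
  case True
  obtain M3 where M3: "runs p I (j * (?c + 5)) (pc + 4) M2 (q + 5) M3"
  "M3 d = M2 d + int (SUM u:{Suc v..<?m}. ?f u)" "keeps V B n d M M3" using Suc.IH[OF M2(3,4) True] Suc.prems(4) by (metis add_Suc_shift)
  have "runs p I (Suc j * (?c + 5)) (pc + 4) M1 (q + 5) M3" using reach_trans[OF M2(1)] M3(1) True by simp
  moreover have "M3 d = M1 d + int (SUM u:{v..<?m}. ?f u)" using M3(2) M2(2) sum by simp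
  ultimately show ?thesis using M3(3) by blast
  next
  case False
  hence "j = 0" using Suc.prems(3,4) by simp
  hence "runs p I (Suc j * (?c + 5)) (pc + 4) M1 (q + 5) M2" using M2(1) False by simp
  moreover have "M2 d = M1 d + int (SUM u:{v..<?m}. ?f u)" using M2(2) sum False by simp
  ultimately show ?thesis using M2(4) by blast
  qed
 qed simp
 let ?M0 = "M(d := 0, 4 + n := 0, Suc d := 1)"
 have ne: "d ~= 4 + n" "Suc d ~= 4 + n" "d ~= 3" "Suc d ~= 3" using dB nV by auto
 have init: "runs p I (Suc (Suc (Suc (Suc 0)))) pc M (q + 3) ?M0" using code(1) by (intro reachI[where k = 4]) (auto simp: exec_simps)
 let ?M1 = "?M0(Suc d := int ?m)"
 have m3: "M 3 = int ?m" using Sum.prems(6) unfolding rel_def by auto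
 have test: "runs p I (Suc (Suc 0)) (q + 3) ?M0 (if 0 < ?m then pc + 4 else q + 5) ?M1"
  using code(3) ne m3 by (intro reachI[where k = 2]) (auto simp: exec_simps)
 have k1: "keeps V B n d M ?M1" using dB nV temps_pos[of s] unfolding keeps_def by auto
 have len: "q + 5 = pc + length (comp B n d pc (Sum s))" unfolding q_def S_def by (simp add: Let_def)
 have "EX M' :: nat => int. runs p I (?m * (?c + 5)) (if 0 < ?m then pc + 4 else q + 5) ?M1 (q + 5) M' &
  M' d = int (SUM u:{0..<?m}. ?f u) & keeps V B n d M M'" proof (cases "0 < ?m") case True
  moreover have "?M1 (4 + n) = int 0" "?M1 d = 0" using ne by auto
  ultimately show ?thesis using loop[OF _ k1 True add_0] by simp
 next
  case False
  hence "runs p I (?m * (?c + 5)) (if 0 < ?m then pc + 4 else q + 5) ?M1 (q + 5) ?M1" by (simp add: reach_refl)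
  moreover have "?M1 d = int (SUM u:{0..<?m}. ?f u)" using False ne by simp
  ultimately show ?thesis using k1 by blast
 qed
 then obtain M' where M': "runs p I (?m * (?c + 5)) (if 0 < ?m then pc + 4 else q + 5) ?M1 (q + 5) M'"
  "M' d = int (SUM u:{0..<?m}. ?f u)" "keeps V B n d M M'" by blast
 have "runs p I (cost ?m (Sum s)) pc M (q + 5) M'" using reach_trans[OF reach_trans[OF init test] M'(1)] by (rule reach_le) simp
 thus ?case using M' unfolding len by (intro landsI[where M' = M']) (simp_all add: lessThan_atLeast0)
qed

definition clands where
 "clands B I h n Z p b pc M pc' <-> (EX M'. runs p I b pc M pc' M' & rel B I h n Z M')"

lemma clandsI: "runs p I b pc M pc' M' ==> rel B I h n Z M' ==> clands B I h n Z p b pc M pc'" unfolding clands_def by blast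

lemma clandsE:
 assumes "clands B I h n Z p b pc M pc'"
 obtains M' where "runs p I b pc M pc' M'" "rel B I h n Z M'" using assms unfolding clands_def by blast

lemma rel_upd: "rel B I h n Z M ==> 4 + n <= r ==> r < B ==> rel B I h n Z (M(r := x))" unfolding rel_def by auto

lemma rel_var: "rel B I h n Z M ==> 4 + n < B ==> rel B I h (Suc n) (Z(n := v)) (M(4 + n := int v))"
 unfolding rel_def by (auto simp: less_Suc_eq)

lemma rel_drop: "rel B I h (Suc n) (Z(n := v)) M ==> rel B I h n Z M" unfolding rel_def by (auto simp: less_Suc_eq split: if_splits)

lemma ccomp_correct:
 fixes M :: "nat => int"
 assumes "wf_cmd V n c" "n <= V" "4 + V <= d" "d + ctemps c <= B" "code_at p pc (ccomp B n d pc c)" "rel B I h n Z M"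
 shows "clands B I (run I n Z c h) n Z p (ccost (bound I) c) pc M (pc + length (ccomp B n d pc c))" using assms
proof (induction c arbitrary: n pc Z M h)
 case Skip
 thus ?case by (intro clandsI[where M' = M]) (auto intro: reach_refl)
next
 case (Store s t)
 define q1 where "q1 = pc + length (comp B n d pc s)"
 define q2 where "q2 = q1 + length (comp B n (Suc d) q1 t)"
 have code: "code_at p pc (comp B n d pc s)" "code_at p q1 (comp B n (Suc d) q1 t)"
  "code_at p q2 [LoadConst (Suc (Suc d)) (int B), Add d d (Suc (Suc d)), StoreInd d (Suc d)]"
  using Store.prems(5) unfolding q1_def q2_def by (auto simp: Let_def code_at_append add.assoc)
 have w: "wf_tm V n s" "wf_tm V n t" "d + temps s <= B" "Suc d + temps t <= B" "Suc (Suc d) < B" using Store.prems temps_pos[of s] by auto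
 obtain M1 where M1: "runs p I (cost (bound I) s) pc M q1 M1"
  "M1 d = int (eval I h n Z s)" "keeps V B n d M M1"
  using comp_correct[OF w(1) Store.prems(2,3) w(3) code(1) Store.prems(6)] unfolding q1_def by (rule landsE)
 have d': "4 + V <= Suc d" using Store.prems by simp
 obtain M2 where M2: "runs p I (cost (bound I) t) q1 M1 q2 M2"
  "M2 (Suc d) = int (eval I h n Z t)" "keeps V B n (Suc d) M1 M2"
  using comp_correct[OF w(2) Store.prems(2) d' w(4) code(2) keeps_rel[OF M1(3) Store.prems(6)]] unfolding q2_def by (rule landsE)
 have d: "M2 d = M1 d" using M2(3) Store.prems unfolding keeps_def by auto
 let ?a = "eval I h n Z s"
 let ?M3 = "M2(Suc (Suc d) := int B, d := int (B + ?a))"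
 let ?M = "?M3(B + ?a := int (eval I h n Z t))"
 have a: "nat (int ?a + int B) = B + ?a" by simp
 have "runs p I 3 q2 M2 (q2 + 3) ?M" using code(3) d M1(2) M2(2) w(5) a by (intro reachI[where k = 3]) (auto simp: exec_simps)
 from reach_trans[OF reach_trans[OF M1(1) M2(1)] this]
 have r: "runs p I (ccost (bound I) (Store s t)) pc M (q2 + 3) ?M" by simp
 have "rel B I h n Z M2" using keeps_rel[OF keeps_trans[OF M1(3) keeps_Suc[OF M2(3)]] Store.prems(6)] .
 hence "rel B I h n Z ?M3" using w(5) Store.prems(2,3) by (intro rel_upd) auto
 hence "rel B I (run I n Z (Store s t) h) n Z ?M" using w(5) Store.prems(2,3) unfolding rel_def by auto
 from clandsI[OF r this] show ?case unfolding q1_def q2_def by (simp add: Let_def add.assoc eval_nat_numeral del: run.simps)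
next
 case (Seq c c')
 define q1 where "q1 = pc + length (ccomp B n d pc c)"
 have code: "code_at p pc (ccomp B n d pc c)" "code_at p q1 (ccomp B n d q1 c')"
  using Seq.prems(5) unfolding q1_def by (auto simp: Let_def code_at_append)
 obtain M1 where M1: "runs p I (ccost (bound I) c) pc M q1 M1"
  "rel B I (run I n Z c h) n Z M1" unfolding q1_def by (rule clandsE[OF Seq.IH(1)[of n pc h Z M]]) (use Seq.prems code in auto)
 obtain M2 where M2: "runs p I (ccost (bound I) c') q1 M1 (q1 + length (ccomp B n d q1 c')) M2"
  "rel B I (run I n Z c' (run I n Z c h)) n Z M2"
  by (rule clandsE[OF Seq.IH(2)[of n q1 "run I n Z c h" Z M1]]) (use Seq.prems code M1(2) in auto)
 show ?case using clandsI[OF reach_trans[OF M1(1) M2(1)] M2(2)] unfolding q1_def by (simp add: Let_def add.assoc)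
next
 case (For c)
 let ?m = "bound I" and ?c = "ccost (bound I) c"
 define S where "S = ccomp B (Suc n) d (pc + 3) c"
 define q where "q = pc + 3 + length S"
 have nV: "n < V" and dB: "4 + V <= d" "d < B" using For.prems by auto
 have "code_at p pc [LoadConst (4 + n) 0, LoadConst d 1, JumpPos d (q + 2)] & code_at p (pc + 3) S &
  code_at p q [LoadConst d 1, Add (4 + n) (4 + n) d, Sub d 3 (4 + n), JumpPos d (pc + 3)]" using For.prems(5) unfolding q_def S_def
  by (simp add: Let_def code_at_append code_at_Cons code_at_Nil eval_nat_numeral add.assoc)
 hence code: "code_at p pc [LoadConst (4 + n) 0, LoadConst d 1, JumpPos d (q + 2)]" "code_at p (pc + 3) S"
  "code_at p q [LoadConst d 1, Add (4 + n) (4 + n) d, Sub d 3 (4 + n), JumpPos d (pc + 3)]" by auto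
 let ?body = "%v. run I (Suc n) (Z(n := v)) c"
 have ne: "d ~= 4 + n" "d ~= 3" using dB nV by auto
 have body: "EX M'. runs p I (?c + 4) (pc + 3) M1 (if Suc v < ?m then pc + 3 else q + 4) M' & rel B I (?body v h) (Suc n) (Z(n := Suc v)) M'"
  if M1: "rel B I h (Suc n) (Z(n := v)) M1" for v h and M1 :: "nat => int"
 proof -
  have "clands B I (?body v h) (Suc n) (Z(n := v)) p ?c (pc + 3) M1 q"
  unfolding q_def S_def using M1 by (rule For.IH[rotated 5]) (use For.prems code(2) in "auto simp: S_def")
  then obtain M2 where M2: "runs p I ?c (pc + 3) M1 q M2"
  "rel B I (?body v h) (Suc n) (Z(n := v)) M2" by (rule clandsE)
  have vals: "M2 (4 + n) = int v" "M2 3 = int ?m" using M2(2) unfolding rel_def by auto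
  let ?M = "M2(4 + n := int (Suc v), d := int ?m - int (Suc v))"
  have "runs p I 4 q M2 (if Suc v < ?m then pc + 3 else q + 4) ?M"
  using code(3) vals ne by (intro reachI[where k = 4]) (auto simp: exec_simps)
  from reach_trans[OF M2(1) this]
  have r: "runs p I (?c + 4) (pc + 3) M1 (if Suc v < ?m then pc + 3 else q + 4) ?M" .
  have "rel B I (?body v h) (Suc n) (Z(n := Suc v)) (M2(4 + n := int (Suc v)))" by (rule rel_var[OF rel_drop[OF M2(2)]]) (use dB nV in auto)
  hence "rel B I (?body v h) (Suc n) (Z(n := Suc v)) ?M" by (rule rel_upd) (use dB nV in auto)
  thus ?thesis using r by blast
 qed
 have loop: "clands B I (fold ?body [v..<?m] h) n Z p (j * (?c + 4)) (pc + 3) M1 (q + 4)"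
  if "rel B I h (Suc n) (Z(n := v)) M1" "v < ?m" "v + j = ?m" for j v h and M1 :: "nat => int" using that
 proof (induction j arbitrary: v h M1)
  case (Suc j)
  obtain M2 where M2: "runs p I (?c + 4) (pc + 3) M1 (if Suc v < ?m then pc + 3 else q + 4) M2"
  "rel B I (?body v h) (Suc n) (Z(n := Suc v)) M2" using body[OF Suc.prems(1)] by blast
  have f: "fold ?body [v..<?m] h = fold ?body [Suc v..<?m] (?body v h)" using Suc.prems(2) by (simp add: upt_conv_Cons del: upt_Suc)
  show ?case
  proof (cases "Suc v < ?m")
  case True
  have "Suc v + j = ?m" using Suc.prems(3) by simp
  from Suc.IH[OF M2(2) True this]
  obtain M3 where M3: "runs p I (j * (?c + 4)) (pc + 3) M2 (q + 4) M3"
  "rel B I (fold ?body [Suc v..<?m] (?body v h)) n Z M3" by (rule clandsE)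
  show ?thesis unfolding f using reach_trans[OF M2(1), of "j * (?c + 4)"] M3 True by (intro clandsI[OF _ M3(2)]) simp
  next
  case False
  hence j: "j = 0" using Suc.prems(2,3) by simp
  have "fold ?body [Suc v..<?m] (?body v h) = ?body v h" using False by simp
  thus ?thesis unfolding f using M2 rel_drop[OF M2(2)] False j by (intro clandsI[where M' = M2]) simp_all
  qed
 qed simp
 let ?M0 = "M(4 + n := 0, d := 1)"
 have init: "runs p I 3 pc M (q + 2) ?M0" using code(1) ne by (intro reachI[where k = 3]) (auto simp: exec_simps)
 let ?M1 = "M(4 + n := int 0, d := int ?m)"
 have m3: "M 3 = int ?m" using For.prems(6) unfolding rel_def by auto
 have test: "runs p I 2 (q + 2) ?M0 (if 0 < ?m then pc + 3 else q + 4) ?M1"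
  using code(3) ne m3 by (intro reachI[where k = 2]) (auto simp: exec_simps)
 have "rel B I h (Suc n) (Z(n := 0)) (M(4 + n := int 0))" by (rule rel_var[OF For.prems(6)]) (use dB nV in auto)
 hence r1: "rel B I h (Suc n) (Z(n := 0)) ?M1" by (rule rel_upd) (use dB nV in auto)
 have len: "q + 4 = pc + length (ccomp B n d pc (For c))" unfolding q_def S_def by (simp add: Let_def)
 have "clands B I (run I n Z (For c) h) n Z p (?m * (?c + 4)) (if 0 < ?m then pc + 3 else q + 4) ?M1 (q + 4)"
 proof (cases "0 < ?m")
  case True
  thus ?thesis using loop[OF r1 True add_0] by simp
 next
  case False
  thus ?thesis using rel_drop[OF r1] by (intro clandsI[where M' = ?M1]) (auto simp: reach_refl)
 qed
 then obtain M' where M': "runs p I (?m * (?c + 4)) (if 0 < ?m then pc + 3 else q + 4) ?M1 (q + 4) M'"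
  "rel B I (run I n Z (For c) h) n Z M'" by (rule clandsE)
 have "runs p I (ccost ?m (For c)) pc M (q + 4) M'" using reach_trans[OF reach_trans[OF init test] M'(1)] by (rule reach_le) simp
 thus ?case using M'(2) unfolding len by (rule clandsI)
qed

section \<open>Running time polynomial in the loop bound\<close>

definition poly_bound :: "(nat => nat) => bool" where
 "poly_bound f <-> (EX D. ALL m. f m <= D * (m + 2) ^ D)"

lemma poly_bound_add: "poly_bound f ==> poly_bound g ==> poly_bound (%m. f m + g m)"
proof -
 assume "poly_bound f" "poly_bound g"
 then obtain D E where DE: "!!m. f m <= D * (m + 2) ^ D" "!!m. g m <= E * (m + 2) ^ E" unfolding poly_bound_def by blast
 have "f m + g m <= (D + E) * (m + 2) ^ (D + E)" for m
 proof -
  have "(m + 2) ^ D <= (m + 2) ^ (D + E)" "(m + 2) ^ E <= (m + 2) ^ (D + E)" by (intro power_increasing; simp)+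
  hence "D * (m + 2) ^ D <= D * (m + 2) ^ (D + E)" "E * (m + 2) ^ E <= E * (m + 2) ^ (D + E)" by simp_all
  hence "f m <= D * (m + 2) ^ (D + E)" "g m <= E * (m + 2) ^ (D + E)" using DE[of m] by (meson le_trans)+
  thus ?thesis by (simp only: add_mult_distrib add_mono)
 qed
 thus ?thesis unfolding poly_bound_def by blast
qed

lemma poly_bound_const: "poly_bound (%m. c)" unfolding poly_bound_def
proof (intro exI allI)
 show "c <= c * (m + 2) ^ c" for m using mult_le_mono2[of 1 "(m + 2) ^ c" c] by simp
qed

lemma poly_bound_Suc: "poly_bound f ==> poly_bound (%m. Suc (f m))" using poly_bound_add[of f "%m. 1"] poly_bound_const by simp

lemma poly_bound_mult: "poly_bound f ==> poly_bound (%m. m * f m)"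
proof -
 assume "poly_bound f"
 then obtain D where D: "!!m. f m <= D * (m + 2) ^ D" unfolding poly_bound_def by blast
 have "m * f m <= Suc D * (m + 2) ^ Suc D" for m
 proof -
  have "m * f m <= (m + 2) * (D * (m + 2) ^ D)" using D[of m] by (intro mult_le_mono) auto
  also have "... <= Suc D * (m + 2) ^ Suc D" by (simp add: algebra_simps)
  finally show ?thesis .
 qed
 thus ?thesis unfolding poly_bound_def by blast
qed

lemma poly_bound_cost: "poly_bound (%m. cost m t)"
 by (induction t) (auto intro!: poly_bound_Suc poly_bound_add poly_bound_const poly_bound_mult)

lemma poly_bound_ccost: "poly_bound (%m. ccost m c)"
 by (induction c) (auto intro!: poly_bound_Suc poly_bound_add poly_bound_const poly_bound_mult poly_bound_cost)


section \<open>Definable functions\<close>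

text \<open>All arrays share one memory: the array number \<open>A\<close> followed by the indices
  is read as a numeral in base \<open>m\<close>, so different arrays and indices never collide
  (\<open>addr_eq\<close>).\<close>

definition addr :: "nat => nat => nat list => nat" where
 "addr m A xs = foldl (%a x. a * m + x) A xs"

text \<open>Eight indices: one for the variable of a recursion and up to seven parameters.\<close>

definition index :: "nat => nat list => bool" where
 "index m xs <-> length xs = 8 & (ALL x:set xs. x < m)"

lemma addr_inj: "length xs = length ys ==> ALL x:set xs. x < m ==> ALL y:set ys. y < m ==> addr m A xs = addr m B ys ==> A = B & xs = ys"
proof (induction xs arbitrary: ys rule: rev_induct)
 case (snoc x xs)
 then obtain y zs where ys: "ys = zs @ [y]" by (cases ys rule: rev_cases) auto
 have xy: "x < m" "y < m" using snoc.prems ys by auto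
 have e: "addr m A xs * m + x = addr m B zs * m + y" using snoc.prems(4) unfolding ys addr_def by simp
 hence "(addr m A xs * m + x) div m = (addr m B zs * m + y) div m" by simp
 hence "addr m A xs = addr m B zs" using xy by simp
 thus ?case using snoc.IH[of zs] snoc.prems e ys by auto
qed (auto simp: addr_def)

lemma addr_eq: "index m xs ==> index m ys ==> addr m A xs = addr m B ys ==> A = B & xs = ys" unfolding index_def by (rule addr_inj) auto

lemma addr_shift: "addr m A xs = A * m ^ length xs + addr m 0 xs" by (induction xs rule: rev_induct) (auto simp: addr_def algebra_simps)

section \<open>Filling arrays by nested loops\<close>

fun nest :: "nat => cmd => cmd" where
 "nest 0 c = c"
| "nest (Suc j) c = For (nest j c)"

lemma wf_nest: "wf_cmd V (n + j) c ==> n + j <= V ==> wf_cmd V n (nest j c)" by (induction j arbitrary: n) auto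

definition okenv :: "nat => inst => (nat => nat) => bool" where
 "okenv n I Z <-> (ALL i<n. Z i < bound I)"

text \<open>\<open>Q\<close> is the invariant under which the stored terms have the right values; it
  must survive every single write. That all other addresses keep their contents is what preserves
  the entries written in earlier rounds.\<close>

lemma run_nest:
 assumes "n + j = 8" "okenv n I Z" "Q h"
  and ev: "!!h Z'. Q h ==> ALL i<n. Z' i = Z i ==> okenv 8 I Z' ==>
  eval I h 8 Z' s = addr (bound I) A (map Z' [0..<8]) & eval I h 8 Z' t = f (map Z' [0..<8])"
  and Q: "!!h xs w. Q h ==> index (bound I) xs ==> ALL i<n. xs ! i = Z i ==> Q (h(addr (bound I) A xs := w))"
 defines "h' == run I n Z (nest j (Store s t)) h"
 shows "Q h' & (ALL xs. index (bound I) xs & (ALL i<n. xs ! i = Z i) --> h' (addr (bound I) A xs) = f xs) &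
  (ALL a. (ALL xs. index (bound I) xs & (ALL i<n. xs ! i = Z i) --> a ~= addr (bound I) A xs) --> h' a = h a)" unfolding h'_def using assms(1-5)
proof (induction j arbitrary: n Z h)
 case 0
 hence n: "n = 8" by simp
 have ix: "index (bound I) (map Z [0..<8])" using 0(2) unfolding index_def okenv_def n by auto
 have pre: "ALL i<n. map Z [0..<8] ! i = Z i" unfolding n by simp
 have uniq: "xs = map Z [0..<8]" if "index (bound I) xs" "ALL i<n. xs ! i = Z i" for xs
  using that unfolding index_def n by (intro nth_equalityI) auto
 have *: "eval I h 8 Z s = addr (bound I) A (map Z [0..<8]) & eval I h 8 Z t = f (map Z [0..<8])"
  by (rule 0(4)[OF 0(3)]) (use 0(2) n in auto)
 have r: "run I n Z (nest 0 (Store s t)) h = h(addr (bound I) A (map Z [0..<8]) := f (map Z [0..<8]))" using * unfolding n by simp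
 show ?case unfolding r
 proof (intro conjI allI impI)
  show "Q (h(addr (bound I) A (map Z [0..<8]) := f (map Z [0..<8])))" by (rule 0(5)[OF 0(3) ix pre])
 next
  fix xs assume "index (bound I) xs & (ALL i<n. xs ! i = Z i)"
  hence "xs = map Z [0..<8]" using uniq by blast
  thus "(h(addr (bound I) A (map Z [0..<8]) := f (map Z [0..<8]))) (addr (bound I) A xs) = f xs" by (simp only: fun_upd_same)
 next
  fix a assume "ALL xs. index (bound I) xs & (ALL i<n. xs ! i = Z i) --> a ~= addr (bound I) A xs"
  hence "a ~= addr (bound I) A (map Z [0..<8])" using ix pre by blast
  thus "(h(addr (bound I) A (map Z [0..<8]) := f (map Z [0..<8]))) a = h a" by (rule fun_upd_other)
 qed
next
 case (Suc j)
 let ?m = "bound I"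
 let ?pre = "%xs. index ?m xs & (ALL i<n. xs ! i = Z i)"
 have n8: "n < 8" using Suc.prems(1) by simp
 define b where "b v = run I (Suc n) (Z(n := v)) (nest j (Store s t))" for v
 note IH0 = Suc.IH and pr = Suc.prems
 have main: "Q (fold b [0..<w] h) & (ALL xs. ?pre xs & xs ! n < w --> fold b [0..<w] h (addr ?m A xs) = f xs) &
  (ALL a. (ALL xs. ?pre xs --> a ~= addr ?m A xs) --> fold b [0..<w] h a = h a)" if "w <= ?m" for w using that proof (induction w) case 0
  thus ?case using Suc.prems(3) by simp
 next
  case (Suc w)
  define g where "g = fold b [0..<w] h"
  define g' where "g' = b w g"
  have fold: "fold b [0..<Suc w] h = g'" unfolding g'_def g_def by simp
  have w: "w < ?m" using Suc.prems by simp
  have g: "Q g" "!!xs. ?pre xs ==> xs ! n < w ==> g (addr ?m A xs) = f xs"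
  "!!a. ALL xs. ?pre xs --> a ~= addr ?m A xs ==> g a = h a" using Suc.IH w unfolding g_def by auto
  have pre': "(ALL i<Suc n. xs ! i = (Z(n := w)) i) <-> (ALL i<n. xs ! i = Z i) & xs ! n = w" for xs :: "nat list"
  by (auto simp: less_Suc_eq)
  have IH: "Q g' & (ALL xs. index ?m xs & (ALL i<Suc n. xs ! i = (Z(n := w)) i) --> g' (addr ?m A xs) = f xs) &
  (ALL a. (ALL xs. index ?m xs & (ALL i<Suc n. xs ! i = (Z(n := w)) i) --> a ~= addr ?m A xs) --> g' a = g a)" unfolding g'_def b_def proof (rule IH0)
  show "Suc n + j = 8" using pr(1) by simp
  show "okenv (Suc n) I (Z(n := w))" using pr(2) w unfolding okenv_def by (simp add: less_Suc_eq)
  show "Q g" by (rule g)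
  next
  fix h Z' assume a: "Q h" "ALL i<Suc n. Z' i = (Z(n := w)) i" "okenv 8 I Z'"
  hence "ALL i<n. Z' i = Z i" by (simp add: less_Suc_eq)
  thus "eval I h 8 Z' s = addr ?m A (map Z' [0..<8]) & eval I h 8 Z' t = f (map Z' [0..<8])" using pr(4)[OF a(1) _ a(3)] by blast
  next
  fix h xs y assume a: "Q h" "index ?m xs" "ALL i<Suc n. xs ! i = (Z(n := w)) i"
  hence "ALL i<n. xs ! i = Z i" unfolding pre' by blast
  thus "Q (h(addr ?m A xs := y))" by (rule pr(5)[OF a(1,2)])
  qed
  have keep: "g' a = g a" if "!!xs. ?pre xs ==> xs ! n = w ==> a ~= addr ?m A xs" for a using IH that unfolding pre' by blast
  show ?case unfolding fold
  proof (intro conjI allI impI)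
  show "Q g'" using IH by blast
  next
  fix xs assume xs: "?pre xs & xs ! n < Suc w"
  show "g' (addr ?m A xs) = f xs"
  proof (cases "xs ! n = w")
  case True
  thus ?thesis using IH xs unfolding pre' by blast
  next
  case False
  have "g' (addr ?m A xs) = g (addr ?m A xs)"
  proof (rule keep)
  fix ys assume ys: "?pre ys" "ys ! n = w"
  show "addr ?m A xs ~= addr ?m A ys"
  proof
  assume "addr ?m A xs = addr ?m A ys"
  hence "xs = ys" using addr_eq[of ?m xs ys A A] xs ys by simp
  thus False using ys False by simp
  qed
  qed
  also have "... = f xs" using g(2) xs False by (simp add: less_Suc_eq)
  finally show ?thesis .
  qed
  next
  fix a assume a: "ALL xs. ?pre xs --> a ~= addr ?m A xs"
  hence "g' a = g a" by (intro keep) blast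
  thus "g' a = h a" using g(3)[OF a] by simp
  qed
 qed
 have "xs ! n < ?m" if "index ?m xs" for xs using that n8 unfolding index_def by auto
 moreover have "run I n Z (nest (Suc j) (Store s t)) h = fold b [0..<?m] h" unfolding b_def by simp
 ultimately show ?case using main[of ?m] by (simp del: nest.simps)
qed

locale lang =
 fixes good :: "inst => bool"
 assumes good_pos: "good I ==> 0 < bound I"
begin

definition holds where
 "holds I h L <-> (ALL (A, F):set L. ALL xs. index (bound I) xs --> h (addr (bound I) A xs) = F I xs)"

text \<open>Array 0 is scratch space.\<close>

definition prog where
 "prog L <-> (ALL (A, F):set L. 0 < A) & (EX c. (EX V. wf_cmd V 0 c) & (ALL I Z h. good I --> holds I (run I 0 Z c h) L))"

definition yields where
 "yields q n L t f <-> (EX V. wf_tm V n t) & (ALL I h Z. good I --> okenv n I Z --> holds I h L --> q I (Z 0) h --> eval I h n Z t = f I Z)"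

text \<open>\<open>expr q n f\<close>: after some arrays have been computed, the function \<open>f\<close> of the instance and of the
 variables below \<open>n\<close> is the value of a term, for all memories with the property \<open>q\<close>.\<close>

definition expr where
 "expr q n f <-> 0 < n & (ALL I Z Z'. good I --> okenv n I Z --> (ALL i<n. Z i = Z' i) --> f I Z = f I Z') &
  (ALL L n'. prog L --> n <= n' --> (EX L' t. prog L' & set L <= set L' & yields q n' L' t f))"

abbreviation "pred q n P == expr q n (%I Z. of_bool (P I Z))"

text \<open>Values below the bound may serve as array indices and may be substituted for loop
  variables.\<close>

definition bexpr where
 "bexpr q n f <-> expr q n f & (ALL I Z. good I --> okenv n I Z --> f I Z < bound I)"

section \<open>Closure properties of definable functions\<close>

lemma okenv_mono: "okenv n' I Z ==> n <= n' ==> okenv n I Z" unfolding okenv_def by auto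

lemma okenv_upd: "okenv n I Z ==> v < bound I ==> okenv (Suc n) I (Z(n := v))" unfolding okenv_def by (simp add: less_Suc_eq)

lemma holds_mono: "holds I h L' ==> set L <= set L' ==> holds I h L" unfolding holds_def by blast

lemma yieldsI:
 assumes "wf_tm V n t"
  and "!!I h Z. good I ==> okenv n I Z ==> holds I h L ==> q I (Z 0) h ==> eval I h n Z t = f I Z"
 shows "yields q n L t f" unfolding yields_def using assms by blast

lemma yieldsE:
 assumes "yields q n L t f"
 obtains V where "wf_tm V n t"
  "!!I h Z. good I ==> okenv n I Z ==> holds I h L ==> q I (Z 0) h ==> eval I h n Z t = f I Z" using assms unfolding yields_def by blast

lemma yields_mono: "yields q n L t f ==> set L <= set L' ==> yields q n L' t f" unfolding yields_def using holds_mono by blast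

lemma exprI:
 assumes "0 < n"
  and "!!I Z Z'. good I ==> okenv n I Z ==> ALL i<n. Z i = Z' i ==> f I Z = f I Z'"
  and "!!L n'. prog L ==> n <= n' ==> EX L' t. prog L' & set L <= set L' & yields q n' L' t f"
 shows "expr q n f" unfolding expr_def using assms by (intro conjI allI impI) (blast, blast, meson)

lemma expr_pos: "expr q n f ==> 0 < n" unfolding expr_def by blast

lemma expr_dep: "expr q n f ==> good I ==> okenv n I Z ==> ALL i<n. Z i = Z' i ==> f I Z = f I Z'" unfolding expr_def by blast

lemma exprE:
 assumes "expr q n f" "prog L" "n <= n'"
 obtains L' t where "prog L'" "set L <= set L'" "yields q n' L' t f" using assms unfolding expr_def by meson

lemma expr_mono: "expr q n f ==> n <= n' ==> expr q n' f"
proof (rule exprI)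
 assume e: "expr q n f" and le: "n <= n'"
 show "0 < n'" using expr_pos[OF e] le by simp
 show "f I Z = f I Z'" if "good I" "okenv n' I Z" "ALL i<n'. Z i = Z' i" for I Z Z'
  by (rule expr_dep[OF e that(1) okenv_mono[OF that(2) le]]) (use that(3) le in auto)
 show "EX L' t. prog L' & set L <= set L' & yields q j L' t f" if L: "prog L" "n' <= j" for L j
  by (rule exprE[OF e L(1) le_trans[OF le L(2)]]) blast
qed

lemma bexpr_mono: "bexpr q n f ==> n <= n' ==> bexpr q n' f" unfolding bexpr_def using expr_mono okenv_mono by blast

lemma bexpr_expr: "bexpr q n f ==> expr q n f" and bexpr_less: "bexpr q n f ==> good I ==> okenv n I Z ==> f I Z < bound I"
 unfolding bexpr_def by blast+

lemma bexprI: "expr q n f ==> (!!I Z. good I ==> okenv n I Z ==> f I Z < bound I) ==> bexpr q n f" unfolding bexpr_def by blast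

lemma expr_cong:
 assumes e: "expr q n f" and eq: "!!I Z. good I ==> okenv n I Z ==> f I Z = g I Z"
 shows "expr q n g"
proof (rule exprI)
 show "0 < n" by (rule expr_pos[OF e])
 show "g I Z = g I Z'" if "good I" "okenv n I Z" "ALL i<n. Z i = Z' i" for I Z Z'
 proof -
  have "okenv n I Z'" using that unfolding okenv_def by auto
  thus ?thesis using expr_dep[OF e that] eq that by metis
 qed
 show "EX L' t. prog L' & set L <= set L' & yields q j L' t g" if L: "prog L" "n <= j" for L j
 proof (rule exprE[OF e L])
  fix L' t assume a: "prog L'" "set L <= set L'" "yields q j L' t f"
  have "yields q j L' t g" using a(3) eq okenv_mono[OF _ L(2)] unfolding yields_def by simp
  thus ?thesis using a(1,2) by blast
 qed
qed

lemma expr_basic: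
 assumes n: "0 < n" and wf: "!!n'. n <= n' ==> wf_tm 0 n' t"
  and ev: "!!I h n' Z. n <= n' ==> eval I h n' Z t = f I Z"
  and dep: "!!I Z Z'. ALL i<n. Z i = Z' i ==> f I Z = f I Z'"
 shows "expr q n f"
proof (rule exprI[OF n])
 fix L n' assume "prog L" "n <= n'"
 thus "EX L' t. prog L' & set L <= set L' & yields q n' L' t f" using wf ev unfolding yields_def by blast
qed (use dep in blast)

lemma expr_const: "0 < n ==> expr q n (%I Z. c)" by (rule expr_basic[where t = "Num c"]) auto

lemma expr_input: "0 < n ==> i < 4 ==> expr q n (%I Z. fst I i)" by (rule expr_basic[where t = "Inp i"]) auto

lemma expr_var: "i < n ==> expr q n (%I Z. Z i)" by (rule expr_basic[where t = "Var i"]) auto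

lemma bexpr_var: "i < n ==> bexpr q n (%I Z. Z i)" by (rule bexprI[OF expr_var]) (auto simp: okenv_def)

lemma expr_bin:
 assumes a: "expr q n a" and b: "expr q n b"
  and ev: "!!I h n Z s t. eval I h n Z (T s t) = g I (eval I h n Z s) (eval I h n Z t)"
  and wf: "!!V n s t. wf_tm V n (T s t) <-> wf_tm V n s & wf_tm V n t"
 shows "expr q n (%I Z. g I (a I Z) (b I Z))"
proof (rule exprI[OF expr_pos[OF a]])
 show "g I (a I Z) (b I Z) = g I (a I Z') (b I Z')" if "good I" "okenv n I Z" "ALL i<n. Z i = Z' i" for I Z Z'
  using expr_dep[OF a that] expr_dep[OF b that] by simp
next
 fix L n' assume L: "prog L" "n <= n'"
 obtain L1 s where 1: "prog L1" "set L <= set L1" "yields q n' L1 s a" by (rule exprE[OF a L])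
 obtain L2 t where 2: "prog L2" "set L1 <= set L2" "yields q n' L2 t b" by (rule exprE[OF b 1(1) L(2)])
 have "yields q n' L2 (T s t) (%I Z. g I (a I Z) (b I Z))"
 proof (rule yieldsE[OF yields_mono[OF 1(3) 2(2)]], rule yieldsE[OF 2(3)], rule yieldsI)
  fix V V' assume "wf_tm V n' s" "wf_tm V' n' t"
  thus "wf_tm (max V V') n' (T s t)" unfolding wf using wf_tm_mono by (meson max.cobounded1 max.cobounded2)
 qed (simp add: ev)
 thus "EX L' t. prog L' & set L <= set L' & yields q n' L' t (%I Z. g I (a I Z) (b I Z))" using 2(1) subset_trans[OF 1(2) 2(2)] by blast
qed

lemma expr_add: "expr q n a ==> expr q n b ==> expr q n (%I Z. a I Z + b I Z)" by (erule (1) expr_bin[where T = "Bin Plus"]) simp_all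

lemma expr_diff: "expr q n a ==> expr q n b ==> expr q n (%I Z. a I Z - b I Z)" by (erule (1) expr_bin[where T = "Bin Monus"]) simp_all

lemma expr_less: "expr q n a ==> expr q n b ==> pred q n (%I Z. a I Z < b I Z)" by (erule (1) expr_bin[where T = "Bin Less"]) simp_all

lemma expr_cell: "expr q n a ==> expr q n b ==>
  pred q n (%I Z. cell (snd I) (int (a I Z)) < cell (snd I) (int (b I Z)))" by (erule (1) expr_bin[where T = "Bin CellLess"]) simp_all

lemma expr_Suc: "expr q n a ==> expr q n (%I Z. Suc (a I Z))" using expr_add[OF _ expr_const[of n q 1]] expr_pos by fastforce

lemma expr_not: "pred q n P ==> pred q n (%I Z. ~ P I Z)"
proof -
 assume e: "pred q n P"
 show ?thesis by (rule expr_cong[OF expr_diff[OF expr_const[OF expr_pos[OF e], of q 1] e]]) simp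
qed

lemma expr_and: "pred q n P ==> pred q n Q ==> pred q n (%I Z. P I Z & Q I Z)"
proof -
 assume e: "pred q n P" "pred q n Q"
 show ?thesis by (rule expr_cong[OF expr_less[OF expr_const[OF expr_pos[OF e(1)], of q 1] expr_add[OF e]]]) simp
qed

lemma expr_or: "pred q n P ==> pred q n Q ==>
  pred q n (%I Z. P I Z \<or> Q I Z)" by (rule expr_cong[OF expr_not[OF expr_and[OF expr_not expr_not]]]) simp_all

lemma expr_imp: "pred q n P ==> pred q n Q ==> pred q n (%I Z. P I Z --> Q I Z)"
proof -
 assume p: "pred q n P" and q: "pred q n Q"
 have "pred q n (%I Z. ~ P I Z \<or> Q I Z)" by (rule expr_or[OF expr_not[OF p] q])
 thus ?thesis by (simp only: imp_conv_disj)
qed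

lemma expr_iff: "pred q n P ==> pred q n Q ==>
  pred q n (%I Z. P I Z <-> Q I Z)" by (rule expr_cong[OF expr_and[OF expr_imp expr_imp, of _ _ P Q Q P]]) auto

lemma expr_le: "expr q n a ==> expr q n b ==> pred q n (%I Z. a I Z <= b I Z)"
 using expr_not[OF expr_less, of q n b a] by (simp add: not_less)

lemma expr_eq: "expr q n a ==> expr q n b ==> pred q n (%I Z. a I Z = b I Z)"
 by (rule expr_cong[OF expr_and[OF expr_le expr_le, of _ _ a b b a]]) (simp_all add: eq_iff)

lemma expr_if:
 assumes c: "pred q n P" and a: "expr q n a" and b: "expr q n b"
 shows "expr q n (%I Z. if P I Z then a I Z else b I Z)"
proof (rule exprI[OF expr_pos[OF a]])
 show "(if P I Z then a I Z else b I Z) = (if P I Z' then a I Z' else b I Z')"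
  if "good I" "okenv n I Z" "ALL i<n. Z i = Z' i" for I Z Z' using expr_dep[OF a that] expr_dep[OF b that] expr_dep[OF c that] by auto
next
 fix L n' assume L: "prog L" "n <= n'"
 obtain L0 r where 0: "prog L0" "set L <= set L0" "yields q n' L0 r (%I Z. of_bool (P I Z))" by (rule exprE[OF c L])
 obtain L1 s where 1: "prog L1" "set L0 <= set L1" "yields q n' L1 s a" by (rule exprE[OF a 0(1) L(2)])
 obtain L2 t where 2: "prog L2" "set L1 <= set L2" "yields q n' L2 t b" by (rule exprE[OF b 1(1) L(2)])
 have "yields q n' L2 (Ite r s t) (%I Z. if P I Z then a I Z else b I Z)"
 proof (rule yieldsE[OF yields_mono[OF 0(3) subset_trans[OF 1(2) 2(2)]]], rule yieldsE[OF yields_mono[OF 1(3) 2(2)]],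
  rule yieldsE[OF 2(3)], rule yieldsI)
  fix V V' V'' assume "wf_tm V n' r" "wf_tm V' n' s" "wf_tm V'' n' t"
  from this[THEN wf_tm_mono, of "V + V' + V''"] show "wf_tm (V + V' + V'') n' (Ite r s t)" by simp
 qed simp
 thus "EX L' t. prog L' & set L <= set L' & yields q n' L' t (%I Z. if P I Z then a I Z else b I Z)"
  using 2(1) subset_trans[OF subset_trans[OF 0(2) 1(2)] 2(2)] by blast
qed

text \<open>The body of a sum is given as a family of expressions, one for every expression that may be
 substituted for the summation variable; constants show that it does not depend on further variables.\<close>

lemma expr_sum:
 assumes n: "0 < n" and body: "!!n' x. n <= n' ==> bexpr q n' x ==> expr q n' (%I Z. P I Z (x I Z))"
 shows "expr q n (%I Z. \<Sum>v<bound I. P I Z v)"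
proof -
 have dep: "P I Z v = P I Z' v"
  if g: "good I" "okenv n I Z" "ALL i<n. Z i = Z' i" and v: "v < bound I" for I Z Z' v
 proof -
  let ?x = "%I (Z :: nat => nat). if v < fst I 3 then v else 0"
  have "expr q n ?x" by (intro expr_if expr_less expr_const expr_input n) simp
  hence "bexpr q n ?x" by (rule bexprI) (use good_pos in auto)
  from expr_dep[OF body[OF order_refl this] g] show ?thesis using v by simp
 qed
 show ?thesis
 proof (rule exprI[OF n])
  show "(\<Sum>v<bound I. P I Z v) = (\<Sum>v<bound I. P I Z' v)"
  if "good I" "okenv n I Z" "ALL i<n. Z i = Z' i" for I Z Z' using dep[OF that] by (intro sum.cong) auto
 next
  fix L n' assume L: "prog L" "n <= n'"
  have b: "expr q (Suc n') (%I Z. P I Z (Z n'))" using body[OF _ bexpr_var] L(2) by simp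
  obtain L' t where L': "prog L'" "set L <= set L'" "yields q (Suc n') L' t (%I Z. P I Z (Z n'))" by (rule exprE[OF b L(1) order_refl])
  from L'(3) obtain V where t: "wf_tm V (Suc n') t" "!!I h Z. good I ==> okenv (Suc n') I Z ==> holds I h L' ==> q I (Z 0) h ==>
  eval I h (Suc n') Z t = P I Z (Z n')" by (rule yieldsE) (rule that) have "eval I h n' Z (Sum t) = (\<Sum>v<bound I. P I Z v)"
  if g: "good I" "okenv n' I Z" "holds I h L'" "q I (Z 0) h" for I h Z
  proof -
  have "eval I h (Suc n') (Z(n' := v)) t = P I Z v" if v: "v < bound I" for v
  proof -
  have "q I ((Z(n' := v)) 0) h" using g(4) n L(2) by simp
  hence "eval I h (Suc n') (Z(n' := v)) t = P I (Z(n' := v)) v" using t(2)[OF g(1) okenv_upd[OF g(2) v] g(3)] by simp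
  also have "... = P I Z v" by (rule dep[symmetric, OF g(1) okenv_mono[OF g(2) L(2)]]) (use L(2) v in auto)
  finally show ?thesis .
  qed
  thus ?thesis by simp
  qed
  moreover have "wf_tm (max V (Suc n')) n' (Sum t)" using wf_tm_mono[OF t(1), of "max V (Suc n')"] by simp
  ultimately have "yields q n' L' (Sum t) (%I Z. \<Sum>v<bound I. P I Z v)" by (rule yieldsI[rotated])
  thus "EX L' t. prog L' & set L <= set L' & yields q n' L' t (%I Z. \<Sum>v<bound I. P I Z v)" using L'(1,2) by blast
 qed
qed

lemma expr_ex_less:
 assumes a: "expr q n a" and le: "!!I Z. good I ==> okenv n I Z ==> a I Z <= bound I"
  and body: "!!n' x. n <= n' ==> bexpr q n' x ==> pred q n' (%I Z. P I Z (x I Z))"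
 shows "pred q n (%I Z. EX v<a I Z. P I Z v)"
proof -
 note n = expr_pos[OF a]
 have b: "pred q n' (%I Z. x I Z < a I Z & P I Z (x I Z))" if "n <= n'" "bexpr q n' x" for n' x
  by (rule expr_and[OF expr_less[OF bexpr_expr[OF that(2)] expr_mono[OF a that(1)]] body[OF that]])
 have "pred q n (%I Z. 0 < (\<Sum>v<bound I. of_bool (v < a I Z & P I Z v) :: nat))"
  by (rule expr_less[OF expr_const[OF n] expr_sum[OF n b]])
 thus ?thesis
 proof (rule expr_cong)
  fix I Z assume "good I" "okenv n I Z"
  hence "(EX v<a I Z. P I Z v) <-> (EX v:{..<bound I}. v < a I Z & P I Z v)" using le by fastforce
  also have "... <-> 0 < (\<Sum>v<bound I. of_bool (v < a I Z & P I Z v) :: nat)" by (auto simp: neq0_conv[symmetric] simp del: neq0_conv)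
  finally show "of_bool (0 < (\<Sum>v<bound I. of_bool (v < a I Z & P I Z v) :: nat)) = (of_bool (EX v<a I Z. P I Z v) :: nat)"
  by (simp only:)
 qed
qed

lemma expr_all_less:
 assumes "expr q n a" "!!I Z. good I ==> okenv n I Z ==> a I Z <= bound I"
  and "!!n' x. n <= n' ==> bexpr q n' x ==> pred q n' (%I Z. P I Z (x I Z))"
 shows "pred q n (%I Z. ALL v<a I Z. P I Z v)" by (rule expr_cong[OF expr_not[OF expr_ex_less[OF assms(1,2) expr_not[OF assms(3)]]]]) auto

lemma expr_ex_le:
 assumes "expr q n a" "!!I Z. good I ==> okenv n I Z ==> a I Z < bound I"
  and "!!n' x. n <= n' ==> bexpr q n' x ==> pred q n' (%I Z. P I Z (x I Z))"
 shows "pred q n (%I Z. EX v<=a I Z. P I Z v)"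
 by (rule expr_cong[OF expr_ex_less[OF expr_Suc[OF assms(1)] _ assms(3)]]) (use assms(2) in "auto simp: Suc_le_eq less_Suc_eq_le")

lemma expr_all_le:
 assumes "expr q n a" "!!I Z. good I ==> okenv n I Z ==> a I Z < bound I"
  and "!!n' x. n <= n' ==> bexpr q n' x ==> pred q n' (%I Z. P I Z (x I Z))"
 shows "pred q n (%I Z. ALL v<=a I Z. P I Z v)" by (rule expr_cong[OF expr_not[OF expr_ex_le[OF assms(1,2) expr_not[OF assms(3)]]]]) auto

lemma expr_sum_less:
 assumes a: "expr q n a" and le: "!!I Z. good I ==> okenv n I Z ==> a I Z <= bound I"
  and body: "!!n' x. n <= n' ==> bexpr q n' x ==> expr q n' (%I Z. P I Z (x I Z))"
 shows "expr q n (%I Z. \<Sum>v<a I Z. P I Z v)"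
proof -
 note n = expr_pos[OF a]
 have b: "expr q n' (%I Z. if x I Z < a I Z then P I Z (x I Z) else 0)" if "n <= n'" "bexpr q n' x" for n' x
  by (rule expr_if[OF expr_less[OF bexpr_expr[OF that(2)] expr_mono[OF a that(1)]] body[OF that] expr_const[OF expr_pos[OF body[OF that]]]])
 have "expr q n (%I Z. \<Sum>v<bound I. if v < a I Z then P I Z v else 0)" by (rule expr_sum[OF n b])
 thus ?thesis
 proof (rule expr_cong)
  fix I Z assume "good I" "okenv n I Z"
  hence "{..<bound I} Int {v. v < a I Z} = {..<a I Z}" using le by fastforce
  thus "(\<Sum>v<bound I. if v < a I Z then P I Z v else 0) = (\<Sum>v<a I Z. P I Z v)" by (simp add: sum.If_cases)
 qed
qed

lemma expr_card:
 assumes "expr q n a" "!!I Z. good I ==> okenv n I Z ==> a I Z <= bound I"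
  and "!!n' x. n <= n' ==> bexpr q n' x ==> pred q n' (%I Z. P I Z (x I Z))"
 shows "expr q n (%I Z. card {v. v < a I Z & P I Z v})"
proof -
 have "card {v. v < (b::nat) & R v} = (\<Sum>v<b. of_bool (R v))" for b R by (simp add: lessThan_def Collect_conj_eq)
 thus ?thesis using expr_sum_less[OF assms] by simp
qed

lemma expr_mult:
 assumes a: "expr q n a" "!!I Z. good I ==> okenv n I Z ==> a I Z <= bound I" and b: "expr q n b"
 shows "expr q n (%I Z. a I Z * b I Z)" by (rule expr_cong[OF expr_sum_less[OF a expr_mono[OF b]]]) auto

lemma expr_scale: "expr q n a ==> expr q n (%I Z. a I Z * bound I)"
 by (rule expr_cong[OF expr_mult[where a = "%I Z. fst I 3"]]) (auto intro: expr_input expr_pos)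

lemma expr_power: "0 < n ==> expr q n (%I Z. bound I ^ j)"
proof (induction j)
 case 0
 thus ?case using expr_const[of n q 1] by simp
next
 case (Suc j)
 thus ?case using expr_scale[of q n "%I Z. bound I ^ j"] by (simp add: mult.commute)
qed

lemma expr_addr:
 assumes "0 < n" "ALL a:set as. expr q n a"
 shows "expr q n (%I Z. addr (bound I) 0 (map (%a. a I Z) as))" using assms(2)
proof (induction as rule: rev_induct)
 case Nil
 thus ?case using expr_const[OF assms(1), of q 0] by (simp add: addr_def)
next
 case (snoc a as)
 hence "expr q n (%I Z. addr (bound I) 0 (map (%a. a I Z) as) * bound I + a I Z)" by (intro expr_add expr_scale) auto
 thus ?case by (simp add: addr_def)
qed

text \<open>\<open>L'\<close> is fixed before \<open>A\<close>, since in \<open>array_exists\<close>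
  the number of the new array has to avoid those in \<open>L'\<close>. The term for \<open>A\<close>
  adds \<open>bound I ^ 8\<close> repeatedly.\<close>

lemma addr_term:
 assumes "0 < n" "length as = 8" "ALL a:set as. expr q n a" and L: "prog L"
 obtains L' where "prog L'" "set L <= set L'"
  "!!A. EX t. yields q n L' t (%I Z. addr (bound I) A (map (%a. a I Z) as))"
proof -
 obtain L1 s where 1: "prog L1" "set L <= set L1" "yields q n L1 s (%I Z. addr (bound I) 0 (map (%a. a I Z) as))"
  by (rule exprE[OF expr_addr[OF assms(1,3)] L order_refl])
 obtain L2 u where 2: "prog L2" "set L1 <= set L2" "yields q n L2 u (%I Z. bound I ^ 8)"
  by (rule exprE[OF expr_power[OF assms(1)] 1(1) order_refl])
 have ex: "EX t. yields q n L2 t (%I Z. A * bound I ^ 8 + addr (bound I) 0 (map (%a. a I Z) as))" for A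
 proof (induction A)
  case 0
  thus ?case using yields_mono[OF 1(3) 2(2)] by auto
 next
  case (Suc A)
  then obtain t where t: "yields q n L2 t (%I Z. A * bound I ^ 8 + addr (bound I) 0 (map (%a. a I Z) as))" by blast
  have "yields q n L2 (Bin Plus u t) (%I Z. Suc A * bound I ^ 8 + addr (bound I) 0 (map (%a. a I Z) as))"
  proof (rule yieldsE[OF 2(3)], rule yieldsE[OF t], rule yieldsI)
  fix V V' assume "wf_tm V n u" "wf_tm V' n t"
  from this[THEN wf_tm_mono, of "V + V'"] show "wf_tm (V + V') n (Bin Plus u t)" by simp
  qed simp
  thus ?case by blast
 qed
 have e: "addr (bound I) A (map (%a. a I Z) as) = A * bound I ^ 8 + addr (bound I) 0 (map (%a. a I Z) as)" for A I Z
  using addr_shift[of "bound I" A "map (%a. a I Z) as"] assms(2) by simp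
 have "EX t. yields q n L2 t (%I Z. addr (bound I) A (map (%a. a I Z) as))" for A unfolding e[where A = A] by (rule ex)
 thus ?thesis by (rule that[OF 2(1) subset_trans[OF 1(2) 2(2)]])
qed

lemma bexpr_index:
 assumes "length as = 8" "ALL a:set as. bexpr q n a" "good I" "okenv n I Z"
 shows "index (bound I) (map (%a. a I Z) as)"
proof -
 have "a I Z < bound I" if "a : set as" for a using bexpr_less[OF _ assms(3,4)] assms(2) that by blast
 thus ?thesis using assms(1) unfolding index_def by auto
qed

lemma lookup:
 assumes n: "0 < n" and as: "length as = 8" "ALL a:set as. bexpr q n a" and L: "prog L"
 obtains L' where "prog L'" "set L <= set L'" "!!A. EX t V. wf_tm V n t & (ALL I h Z. good I --> okenv n I Z --> holds I h L' --> q I (Z 0) h -->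
  eval I h n Z t = h (addr (bound I) A (map (%a. a I Z) as)))" proof (rule addr_term[OF n as(1) _ L]) fix L' assume L': "prog L'" "set L <= set L'"
  and ad: "!!A. EX t. yields q n L' t (%I Z. addr (bound I) A (map (%a. a I Z) as))"
 show thesis
 proof (rule that[OF L'])
  fix A
  obtain t where "yields q n L' t (%I Z. addr (bound I) A (map (%a. a I Z) as))" using ad by blast
  thus "EX t V. wf_tm V n t & (ALL I h Z. good I --> okenv n I Z --> holds I h L' --> q I (Z 0) h -->
  eval I h n Z t = h (addr (bound I) A (map (%a. a I Z) as)))" unfolding yields_def by (intro exI[of _ "Load t"]) auto qed
qed (use as(2) bexpr_expr in blast)

text \<open>While the array of a recursion is being filled, an expression may read its earlier stages.\<close>

definition stages :: "(inst => nat => nat list => nat) => inst => nat => (nat => nat) => bool" where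
 "stages F I i h <-> (ALL j<i. ALL xs. index (bound I) (j # xs) --> h (addr (bound I) 0 (j # xs)) = F I j xs)"

text \<open>The stored term reads earlier stages through array 0, because the number of the final
  array depends on the program that this term needs. When array 0 is full, it is copied to the fresh
  number \<open>A\<close>.\<close>

lemma array_exists:
 assumes F: "expr (stages F) 8 (%I Z. F I (Z 0) (map Z [1..<8]))" and L: "prog L"
 shows "EX L' A. prog L' & set L <= set L' & (A, %I xs. F I (hd xs) (tl xs)) : set L'"
proof -
 obtain L1 t where L1: "prog L1" "set L <= set L1" "yields (stages F) 8 L1 t (%I Z. F I (Z 0) (map Z [1..<8]))"
  by (rule exprE[OF F L order_refl])
 from L1(3) obtain V1 where t: "wf_tm V1 8 t" "!!I h Z. good I ==> okenv 8 I Z ==> holds I h L1 ==> stages F I (Z 0) h ==>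
  eval I h 8 Z t = F I (Z 0) (map Z [1..<8])" by (rule yieldsE) (rule that)
 define vars where "vars = map (%i (I :: inst) (Z :: nat => nat). Z i) [0..<8]"
 let ?true = "%(_ :: inst) (_ :: nat) (_ :: nat => nat). True"
 have vars: "length vars = 8" "ALL a:set vars. expr ?true 8 a" unfolding vars_def by (auto intro: expr_var)
 have mapv: "map (%a. a I Z) vars = map Z [0..<8]" for I :: inst and Z :: "nat => nat" unfolding vars_def by simp
 obtain L2 where 2: "prog L2" "set L1 <= set L2"
  and ad: "!!A. EX t. yields ?true 8 L2 t (%I Z. addr (bound I) A (map (%a. a I Z) vars))" by (rule addr_term[OF _ vars L1(1)]) auto
 have adr: "EX t V. wf_tm V 8 t & (ALL I h Z. good I --> okenv 8 I Z --> holds I h L2 -->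
  eval I h 8 Z t = addr (bound I) A (map Z [0..<8]))" for A using ad[of A] unfolding mapv yields_def by blast
 define A where "A = Suc (Max (insert 0 (fst ` set L2)))"
 have fresh: "B ~= A" if "(B, G) : set L2" for B G
 proof -
  have "B : insert 0 (fst ` set L2)" using that by (force simp: image_iff)
  hence "B <= Max (insert 0 (fst ` set L2))" by (intro Max_ge) auto
  thus ?thesis unfolding A_def by simp
 qed
 obtain s0 W0 where s0: "wf_tm W0 8 s0" "!!I h Z. good I ==> okenv 8 I Z ==> holds I h L2 ==> eval I h 8 Z s0 = addr (bound I) 0 (map Z [0..<8])"
  using adr[of 0] by blast
 obtain sA WA where sA: "wf_tm WA 8 sA" "!!I h Z. good I ==> okenv 8 I Z ==> holds I h L2 ==> eval I h 8 Z sA = addr (bound I) A (map Z [0..<8])"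
  using adr[of A] by blast
 obtain c V where c: "wf_cmd V 0 c" "!!I Z h. good I ==> holds I (run I 0 Z c h) L2" using 2(1) unfolding prog_def by blast
 define F' where "F' = (%I xs. F I (hd xs) (tl xs))"
 let ?fill = "nest 8 (Store s0 t)" and ?copy = "nest 8 (Store sA (Load s0))"
 define c' where "c' = Seq c (Seq ?fill ?copy)"
 define U where "U = V + V1 + W0 + WA + 8"
 have "wf_cmd U 0 c'" unfolding c'_def U_def using wf_cmd_mono[OF c(1)] wf_tm_mono[OF t(1)] wf_tm_mono[OF s0(1)] wf_tm_mono[OF sA(1)]
  by (auto intro!: wf_nest)
 moreover have "holds I (run I 0 Z c' h) ((A, F') # L2)" if g: "good I" for I Z h
 proof -
  let ?m = "bound I"
  define h1 where "h1 = run I 0 Z c h"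
  have h1: "holds I h1 L2" unfolding h1_def by (rule c(2)[OF g])
  have keepL: "holds I (h(addr ?m B xs := w)) L2" if "holds I h L2" "index ?m xs" "ALL G. (B, G) ~: set L2" for h B xs w unfolding holds_def
  proof (safe)
  fix B' G ys assume "(B', G) : set L2" "index ?m ys"
  moreover from this have "addr ?m B' ys ~= addr ?m B xs" using addr_eq[OF _ that(2)] that(3) by blast
  ultimately show "(h(addr ?m B xs := w)) (addr ?m B' ys) = G I ys" using that(1) unfolding holds_def by auto
  qed
  have no0: "ALL G. (0, G) ~: set L2" using 2(1) unfolding prog_def by blast
  define b where "b v = run I 1 (Z(0 := v)) (nest 7 (Store s0 t))" for v
  have stage: "holds I (fold b [0..<w] h1) L2 & stages F I w (fold b [0..<w] h1)" if "w <= ?m" for w using that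
  proof (induction w)
  case 0
  thus ?case using h1 unfolding stages_def by simp
  next
  case (Suc w)
  define g1 where "g1 = fold b [0..<w] h1"
  define \<tau> where "\<tau> = Z(0 := w)"
  define g2 where "g2 = run I 1 \<tau> (nest 7 (Store s0 t)) g1"
  have w: "w < ?m" using Suc.prems by simp
  have f: "fold b [0..<Suc w] h1 = g2" unfolding g2_def g1_def \<tau>_def b_def by simp
  have pre1: "(ALL i<1. xs ! i = \<tau> i) <-> xs ! 0 = w" for xs :: "nat list" unfolding \<tau>_def by simp
  let ?Q = "%h. holds I h L2 & stages F I w h"
  have r: "?Q g2 & (ALL xs. index ?m xs & (ALL i<1. xs ! i = \<tau> i) --> g2 (addr ?m 0 xs) = F' I xs) &
  (ALL a. (ALL xs. index ?m xs & (ALL i<1. xs ! i = \<tau> i) --> a ~= addr ?m 0 xs) --> g2 a = g1 a)" unfolding g2_def proof (rule run_nest)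
  show "(1::nat) + 7 = 8" by simp
  show "okenv 1 I \<tau>" unfolding okenv_def \<tau>_def using w by simp
  show "?Q g1" unfolding g1_def using Suc.IH w by simp
  next
  fix h Z' assume a: "?Q h" "ALL i<1. Z' i = \<tau> i" "okenv 8 I Z'"
  have s: "Z' 0 = w" using a(2) unfolding \<tau>_def by simp
  have "stages F I (Z' 0) h" using a(1) s by simp
  hence "eval I h 8 Z' t = F I (Z' 0) (map Z' [1..<8])" using t(2)[OF g a(3) holds_mono[OF _ 2(2)]] a(1) by blast
  also have "... = F' I (map Z' [0..<8])" unfolding F'_def by (simp add: upt_rec)
  finally show "eval I h 8 Z' s0 = addr ?m 0 (map Z' [0..<8]) & eval I h 8 Z' t = F' I (map Z' [0..<8])"
  using s0(2)[OF g a(3)] a(1) by blast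
  next
  fix h xs y assume a: "?Q h" "index ?m xs" "ALL i<1. xs ! i = \<tau> i"
  have "stages F I w (h(addr ?m 0 xs := y))" unfolding stages_def
  proof (intro allI impI)
  fix j ys assume j: "j < w" "index ?m (j # ys)"
  have "addr ?m 0 (j # ys) ~= addr ?m 0 xs"
  proof
  assume "addr ?m 0 (j # ys) = addr ?m 0 xs"
  hence "xs = j # ys" using addr_eq[OF j(2) a(2), of 0 0] by simp
  thus False using a(3) j(1) unfolding pre1 by simp
  qed
  thus "(h(addr ?m 0 xs := y)) (addr ?m 0 (j # ys)) = F I j ys" using a(1) j unfolding stages_def by simp
  qed
  thus "?Q (h(addr ?m 0 xs := y))" using keepL[OF _ a(2) no0] a(1) by blast
  qed
  have "stages F I (Suc w) g2" unfolding stages_def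
  proof (intro allI impI)
  fix j xs assume j: "j < Suc w" "index ?m (j # xs)"
  show "g2 (addr ?m 0 (j # xs)) = F I j xs"
  proof (cases "j = w")
  case True
  hence "index ?m (j # xs) & (ALL i<1. (j # xs) ! i = \<tau> i)" using j(2) unfolding pre1 by simp
  hence "g2 (addr ?m 0 (j # xs)) = F' I (j # xs)" using r by blast
  thus ?thesis unfolding F'_def by simp
  next
  case False
  thus ?thesis using r j unfolding stages_def by (simp add: less_Suc_eq)
  qed
  qed
  thus ?case using r unfolding f by blast
  qed
  define h2 where "h2 = run I 0 Z ?fill h1"
  have "h2 = fold b [0..<?m] h1" unfolding h2_def b_def by (simp add: numeral_eq_Suc)
  hence h2: "holds I h2 L2" "stages F I ?m h2" using stage[of ?m] by auto
  define h3 where "h3 = run I 0 Z ?copy h2"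
  have all: "h (addr ?m 0 xs) = F' I xs" if al: "stages F I ?m h" "index ?m xs" for h xs
  proof -
  obtain x ys where xs: "xs = x # ys" using al(2) unfolding index_def by (cases xs) auto
  hence "x < ?m" using al(2) unfolding index_def by simp
  thus ?thesis using al xs unfolding stages_def F'_def by simp
  qed
  let ?Q = "%h. holds I h L2 & stages F I ?m h"
  have "?Q h3 & (ALL xs. index ?m xs & (ALL i<0. xs ! i = Z i) --> h3 (addr ?m A xs) = F' I xs) &
  (ALL a. (ALL xs. index ?m xs & (ALL i<0. xs ! i = Z i) --> a ~= addr ?m A xs) --> h3 a = h2 a)" unfolding h3_def proof (rule run_nest)
  show "(0::nat) + 8 = 8" by simp
  show "okenv 0 I Z" unfolding okenv_def by simp
  show "?Q h2" using h2 by simp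
  next
  fix h Z' assume a: "?Q h" "okenv 8 I Z'"
  have "index ?m (map Z' [0..<8])" using a(2) unfolding index_def okenv_def by simp
  thus "eval I h 8 Z' sA = addr ?m A (map Z' [0..<8]) & eval I h 8 Z' (Load s0) = F' I (map Z' [0..<8])"
  using s0(2)[OF g a(2)] sA(2)[OF g a(2)] a(1) all by simp
  next
  fix h xs y assume a: "?Q h" "index ?m xs"
  have "stages F I ?m (h(addr ?m A xs := y))" unfolding stages_def
  proof (intro allI impI)
  fix j ys assume j: "j < ?m" "index ?m (j # ys)"
  have "addr ?m 0 (j # ys) ~= addr ?m A xs" using addr_eq[OF j(2) a(2)] unfolding A_def by blast
  thus "(h(addr ?m A xs := y)) (addr ?m 0 (j # ys)) = F I j ys" using a(1) j unfolding stages_def by simp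
  qed
  thus "?Q (h(addr ?m A xs := y))" using keepL[OF _ a(2)] fresh a(1) by blast
  qed
  hence "holds I h3 ((A, F') # L2)" unfolding holds_def by auto
  moreover have "run I 0 Z c' h = h3" unfolding c'_def h3_def h2_def h1_def by (simp del: nest.simps)
  ultimately show ?thesis by simp
 qed
 ultimately have "prog ((A, F') # L2)" using 2(1) unfolding prog_def A_def by auto
 moreover have "set L <= set ((A, F') # L2)" using L1(2) 2(2) by auto
 ultimately show ?thesis unfolding F'_def by (intro exI[of _ "(A, %I xs. F I (hd xs) (tl xs)) # L2"] exI[of _ A]) simp
qed

text \<open>Functions defined by recursion on a number, with further parameters. The value at one stage may
 depend on all values of the previous stage, so the rule for the step is parametric in them.\<close>

lemma expr_rec:
 fixes F :: "inst => nat => nat list => nat"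
 assumes r: "r <= 7"
  and base: "!!q n as. 0 < n ==> length as = r ==> ALL a:set as. bexpr q n a ==> expr q n (%I Z. B I (map (%a. a I Z) as))"
  and step: "!!q n i as prev. 0 < n ==> bexpr q n i ==> length as = r ==> ALL a:set as. bexpr q n a ==>
  (!!n' bs. n <= n' ==> length bs = r ==> ALL b:set bs. bexpr q n' b ==> expr q n' (%I Z. prev I Z (map (%b. b I Z) bs))) ==>
  expr q n (%I Z. S I (i I Z) (map (%a. a I Z) as) (prev I Z))"
  and F0: "!!I xs. good I ==> F I 0 xs = B I xs" and FS: "!!I i xs. good I ==> Suc i < bound I ==> F I (Suc i) xs = S I i xs (F I i)"
  and i: "bexpr q n i" and as: "length as = r" "ALL a:set as. bexpr q n a"
 shows "expr q n (%I Z. F I (i I Z) (map (%a. a I Z) as))"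
proof -
 \<comment> \<open>The array always has seven parameters; shorter lists are padded by zeros, which
   \<open>take r\<close> cuts off again.\<close>
 define F7 where "F7 I i xs = F I i (take r xs)" for I i xs
 define prev where "prev I Z ys = (if Z (0::nat) = 0 then 0 else F I (Z 0 - 1) ys)" for I Z ys
 define vars where "vars = map (%i (I :: inst) (Z :: nat => nat). Z i) [1..<Suc r]"
 have vars: "length vars = r" "ALL a:set vars. bexpr (stages F7) 8 a" unfolding vars_def using r by (auto intro!: bexpr_var)
 have mapv: "map (%a. a I Z) vars = take r (map Z [1..<8])" for I Z unfolding vars_def using r by (simp add: take_map take_upt del: upt_Suc)
 have zero: "expr q n (%I Z. 0)" "bexpr q n (%I Z. 0)" if "0 < n" for q n
  using expr_const[OF that] bexprI[OF expr_const[OF that]] good_pos by auto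
 have v0: "bexpr (stages F7) n' (%I Z. Z 0 - 1)" if "8 <= n'" for n'
 proof (rule bexprI)
  show "expr (stages F7) n' (%I Z. Z 0 - 1)" using that by (intro expr_diff expr_var expr_const) auto
  show "Z 0 - 1 < bound I" if "okenv n' I Z" for I and Z :: "nat => nat"
  proof -
  have "Z 0 < bound I" using that \<open>8 <= n'\<close> unfolding okenv_def by simp
  thus ?thesis by simp
  qed
 qed
 have prev: "expr (stages F7) n' (%I Z. prev I Z (map (%b. b I Z) bs))"
  if n': "8 <= n'" and bs: "length bs = r" "ALL b:set bs. bexpr (stages F7) n' b" for n' bs
 proof (rule exprI)
  show "0 < n'" using n' by simp
 next
  fix I and Z Z' :: "nat => nat" assume a: "good I" "okenv n' I Z" "ALL i<n'. Z i = Z' i"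
  have m: "map (%b. b I Z) bs = map (%b. b I Z') bs" using expr_dep[OF bexpr_expr a] bs(2) by auto
  have z: "Z 0 = Z' 0" using a(3) n' by simp
  show "prev I Z (map (%b. b I Z) bs) = prev I Z' (map (%b. b I Z') bs)" unfolding prev_def m z ..
 next
  fix L j assume L: "prog L" "n' <= j"
  define cs where "cs = (%I Z. Z 0 - 1) # bs @ replicate (7 - r) (%I Z. 0)"
  have j: "8 <= j" "0 < j" using n' L(2) by auto
  have cs: "length cs = 8" "ALL a:set cs. bexpr (stages F7) j a"
  unfolding cs_def using bs r v0[OF j(1)] zero(2)[OF j(2)] bexpr_mono[OF _ L(2)] by auto
  obtain L' where L': "prog L'" "set L <= set L'"
  "!!A. EX t V. wf_tm V j t & (ALL I h Z. good I --> okenv j I Z --> holds I h L' --> stages F7 I (Z 0) h -->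
  eval I h j Z t = h (addr (bound I) A (map (%a. a I Z) cs)))" using lookup[OF j(2) cs L(1)] by blast
  obtain t V where t: "wf_tm V j t" "!!I h Z. good I ==> okenv j I Z ==> holds I h L' ==> stages F7 I (Z 0) h ==>
  eval I h j Z t = h (addr (bound I) 0 (map (%a. a I Z) cs))" using L'(3)[of 0] by blast
  have "eval I h j Z (Ite (Var 0) t (Num 0)) = prev I Z (map (%b. b I Z) bs)"
  if g: "good I" "okenv j I Z" "holds I h L'" "stages F7 I (Z 0) h" for I h Z
  proof (cases "Z 0 = 0")
  case False
  have ix: "index (bound I) (map (%a. a I Z) cs)" by (rule bexpr_index[OF cs g(1,2)])
  have cs': "map (%a. a I Z) cs = (Z 0 - 1) # (map (%b. b I Z) bs @ replicate (7 - r) 0)" unfolding cs_def by simp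
  have "h (addr (bound I) 0 (map (%a. a I Z) cs)) = F7 I (Z 0 - 1) (map (%b. b I Z) bs @ replicate (7 - r) 0)"
  using g(4) ix False unfolding stages_def cs' by simp
  also have "... = F I (Z 0 - 1) (map (%b. b I Z) bs)" unfolding F7_def using bs(1) by simp
  finally show ?thesis using t(2)[OF g] False unfolding prev_def by simp
  qed (simp add: prev_def)
  moreover have "wf_tm V j (Ite (Var 0) t (Num 0))" using t(1) j by simp
  ultimately have "yields (stages F7) j L' (Ite (Var 0) t (Num 0)) (%I Z. prev I Z (map (%b. b I Z) bs))" by (rule yieldsI[rotated])
  thus "EX L' t. prog L' & set L <= set L' & yields (stages F7) j L' t (%I Z. prev I Z (map (%b. b I Z) bs))" using L'(1,2) by blast
 qed
 have "expr (stages F7) 8 (%I Z. if Z 0 = 0 then B I (map (%a. a I Z) vars) else S I (Z 0 - 1) (map (%a. a I Z) vars) (prev I Z))"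
  by (intro expr_if expr_eq expr_var expr_const base step v0 vars prev) auto
 hence F7: "expr (stages F7) 8 (%I Z. F7 I (Z 0) (map Z [1..<8]))"
 proof (rule expr_cong)
  fix I and Z :: "nat => nat" assume g: "good I" and ok: "okenv 8 I Z"
  show "(if Z 0 = 0 then B I (map (%a. a I Z) vars) else S I (Z 0 - 1) (map (%a. a I Z) vars) (prev I Z)) = F7 I (Z 0) (map Z [1..<8])"
  proof (cases "Z 0")
  case 0
  thus ?thesis by (simp add: F7_def mapv F0[OF g])
  next
  case (Suc w)
  hence "prev I Z = F I w" unfolding prev_def by (auto simp: fun_eq_iff)
  moreover have "Suc w < bound I" using ok Suc unfolding okenv_def by (metis zero_less_numeral)
  ultimately show ?thesis using Suc unfolding F7_def mapv by (simp add: FS[OF g])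
  qed
 qed
 show ?thesis
 proof (rule exprI)
  show "0 < n" by (rule expr_pos[OF bexpr_expr[OF i]])
 next
  fix I and Z Z' :: "nat => nat" assume a: "good I" "okenv n I Z" "ALL i<n. Z i = Z' i"
  have m: "map (%b. b I Z) as = map (%b. b I Z') as" using expr_dep[OF bexpr_expr a] as(2) by auto
  have e: "i I Z = i I Z'" by (rule expr_dep[OF bexpr_expr[OF i] a])
  show "F I (i I Z) (map (%b. b I Z) as) = F I (i I Z') (map (%b. b I Z') as)" unfolding m e ..
 next
  fix L j assume L: "prog L" "n <= j"
  obtain L1 A where 1: "prog L1" "set L <= set L1" "(A, %I xs. F7 I (hd xs) (tl xs)) : set L1" using array_exists[OF F7 L(1)] by blast
  define cs where "cs = i # as @ replicate (7 - r) (%I Z. 0)"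
  have j: "0 < j" using expr_pos[OF bexpr_expr[OF i]] L(2) by simp
  have cs: "length cs = 8" "ALL a:set cs. bexpr q j a" unfolding cs_def using as r i zero(2)[OF j] bexpr_mono[OF _ L(2)] by auto
  obtain L' where L': "prog L'" "set L1 <= set L'"
  "!!A. EX t V. wf_tm V j t & (ALL I h Z. good I --> okenv j I Z --> holds I h L' --> q I (Z 0) h -->
  eval I h j Z t = h (addr (bound I) A (map (%a. a I Z) cs)))" using lookup[OF j cs 1(1)] by blast
  obtain t V where t: "wf_tm V j t" "!!I h Z. good I ==> okenv j I Z ==> holds I h L' ==> q I (Z 0) h ==>
  eval I h j Z t = h (addr (bound I) A (map (%a. a I Z) cs))" using L'(3)[of A] by blast have "eval I h j Z t = F I (i I Z) (map (%b. b I Z) as)"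
  if g: "good I" "okenv j I Z" "holds I h L'" "q I (Z 0) h" for I h Z
  proof -
  have ix: "index (bound I) (map (%a. a I Z) cs)" by (rule bexpr_index[OF cs g(1,2)])
  have "h (addr (bound I) A (map (%a. a I Z) cs)) = F7 I (hd (map (%a. a I Z) cs)) (tl (map (%a. a I Z) cs))"
  using bspec[OF g(3)[unfolded holds_def] subsetD[OF L'(2) 1(3)]] ix by (simp del: list.map)
  also have "... = F I (i I Z) (map (%b. b I Z) as)" unfolding F7_def cs_def using as(1) by simp
  finally show ?thesis using t(2)[OF g] by simp
  qed
  with t(1) have "yields q j L' t (%I Z. F I (i I Z) (map (%b. b I Z) as))" by (rule yieldsI)
  thus "EX L' t. prog L' & set L <= set L' & yields q j L' t (%I Z. F I (i I Z) (map (%b. b I Z) as))"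
  using L'(1) subset_trans[OF 1(2) L'(2)] by blast
 qed
qed

end


text \<open>Expressions have at least one variable, so the term is evaluated at level 1;
  \<open>LoadConst 4 0\<close> sets that variable to 0.\<close>

definition stage_code :: "nat => nat => nat => cmd \<times> tm => instr list" where
 "stage_code B V pc s = (let d = 4 + V; C = ccomp B 0 d pc (fst s) in C @ [LoadConst 4 0] @ comp B 1 d (Suc (pc + length C)) (snd s))"

definition stage_size :: "nat => nat => cmd \<times> tm => bool" where
 "stage_size B V s <-> 0 < V & wf_cmd V 0 (fst s) & wf_tm V 1 (snd s) & 4 + V + ctemps (fst s) + temps (snd s) <= B"

definition stage_cost :: "nat => cmd \<times> tm => nat" where
 "stage_cost m s = ccost m (fst s) + 1 + cost m (snd s)"

lemma stage_size_mono: "stage_size B V s ==> V <= V' ==> B + V' <= B' ==> stage_size B' V' s"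
 unfolding stage_size_def using wf_cmd_mono wf_tm_mono by auto

lemma ex_stage_size: "wf_cmd V 0 (fst s) ==> wf_tm V 1 (snd s) ==> EX B V. stage_size B V s" unfolding stage_size_def
 by (rule exI[of _ "4 + Suc V + ctemps (fst s) + temps (snd s)"], rule exI[of _ "Suc V"]) (auto intro: wf_cmd_mono wf_tm_mono)

lemma poly_bound_stage: "poly_bound (%m. stage_cost m s)"
 unfolding stage_cost_def by (intro poly_bound_add poly_bound_ccost poly_bound_cost poly_bound_const)

section \<open>Stages with increasing loop bounds\<close>

lemma run_stage:
 assumes sz: "stage_size B V s" and code: "code_at p pc (stage_code B V pc s)" and r: "rel B I h 0 Z M"
 shows "EX M'. runs p I (stage_cost (bound I) s) pc M (pc + length (stage_code B V pc s)) M' &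
  M' (4 + V) = int (eval I (run I 0 Z (fst s) h) 1 (%_. 0) (snd s)) & rel B I (run I 0 Z (fst s) h) 0 Z M'" proof -
 define q1 where "q1 = pc + length (ccomp B 0 (4 + V) pc (fst s))"
 have c: "code_at p pc (ccomp B 0 (4 + V) pc (fst s))" "code_at p q1 [LoadConst 4 0]" "code_at p (Suc q1) (comp B 1 (4 + V) (Suc q1) (snd s))"
  using code unfolding stage_code_def q1_def by (auto simp: Let_def code_at_append code_at_Cons code_at_Nil)
 have len: "pc + length (stage_code B V pc s) = Suc q1 + length (comp B 1 (4 + V) (Suc q1) (snd s))"
  unfolding stage_code_def q1_def by (simp add: Let_def)
 have sizes: "wf_cmd V 0 (fst s)" "wf_tm V 1 (snd s)" "4 + V + ctemps (fst s) <= B" "4 + V + temps (snd s) <= B" "1 <= V"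
  using sz unfolding stage_size_def by auto
 let ?h = "run I 0 Z (fst s) h"
 obtain M1 where M1: "runs p I (ccost (bound I) (fst s)) pc M q1 M1" "rel B I ?h 0 Z M1"
  using ccomp_correct[OF sizes(1) le0 order_refl sizes(3) c(1) r] unfolding q1_def by (rule clandsE)
 let ?M2 = "M1(4 := 0)"
 have s2: "runs p I 1 q1 M1 (Suc q1) ?M2" using c(2) by (intro reachI[where k = 1]) (auto simp: code_at_Cons)
 have r2: "rel B I ?h 1 (%_. 0) ?M2" using M1(2) sizes(4,5) unfolding rel_def by auto
 obtain M3 where M3: "runs p I (cost (bound I) (snd s)) (Suc q1) ?M2 (Suc q1 + length (comp B 1 (4 + V) (Suc q1) (snd s))) M3"
  "M3 (4 + V) = int (eval I ?h 1 (%_. 0) (snd s))" "keeps V B 1 (4 + V) ?M2 M3"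
  using comp_correct[OF sizes(2,5) order_refl sizes(4) c(3) r2] by (rule landsE)
 have "rel B I ?h 0 Z M3" using keeps_rel[OF M3(3) r2] M1(2) unfolding rel_def by auto
 moreover have "runs p I (stage_cost (bound I) s) pc M (pc + length (stage_code B V pc s)) M3"
  unfolding stage_cost_def len using reach_trans[OF reach_trans[OF M1(1) s2] M3(1)] .
 ultimately show ?thesis using M3(2) by blast
qed

context lang
begin

lemma stage_exists:
 assumes "expr (%_ _ _. True) 1 (%I Z. f I)"
 shows "EX s B V. stage_size B V s & (ALL I h Z. good I --> eval I (run I 0 Z (fst s) h) 1 (%_. 0) (snd s) = f I)"
proof -
 have "prog []" unfolding prog_def holds_def by (auto intro: exI[of _ Skip])
 from exprE[OF assms this order_refl] obtain L t where L: "prog L" "yields (%_ _ _. True) 1 L t (%I Z. f I)" by blast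
 then obtain V where t: "prog L" "wf_tm V 1 t" "!!I h Z. good I ==> okenv 1 I Z ==> holds I h L ==> eval I h 1 Z t = f I"
  unfolding yields_def by blast
 obtain c V' where c: "wf_cmd V' 0 c" "!!I Z h. good I ==> holds I (run I 0 Z c h) L" using t(1) unfolding prog_def by blast
 have "EX B V. stage_size B V (c, t)" by (rule ex_stage_size[of "V + V'"]) (use wf_tm_mono[OF t(2)] wf_cmd_mono[OF c(1)] in auto)
 moreover have "ALL I h Z. good I --> eval I (run I 0 Z (fst (c, t)) h) 1 (%_. 0) (snd (c, t)) = f I"
  using t(3)[OF _ _ c(2)] good_pos unfolding okenv_def by simp
 ultimately show ?thesis by blast
qed

end

text \<open>Three stages: the first two compute the loop bound of the next one.\<close>

definition machine :: "nat => nat => cmd \<times> tm => cmd \<times> tm => cmd \<times> tm => program" where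
 "machine B V s1 s2 s3 = (let d = 4 + V; P = [LoadConst 3 1, Add 3 3 2, JumpPos 3 4, Reject, LoadConst 3 5, Add 3 3 0, Add 3 3 1, Add 3 3 2];
  P1 = P @ stage_code B V 8 s1 @ [LoadConst 3 0, Add 3 3 d];
  P2 = P1 @ stage_code B V (length P1) s2 @ [LoadConst 3 0, Add 3 3 d];
  P3 = P2 @ stage_code B V (length P2) s3
  in P3 @ [JumpPos d (length P3 + 2), Reject, Accept])"

definition inst :: "nat => nat => nat => nat => rat list => inst" where
 "inst n1 n2 k m cs = ((%_. 0)(0 := n1, 1 := n2, 2 := k, 3 := m), cs)"

lemma inst_simps: "fst (inst n1 n2 k m cs) 0 = n1" "fst (inst n1 n2 k m cs) 1 = n2" "fst (inst n1 n2 k m cs) (Suc 0) = n2"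
 "fst (inst n1 n2 k m cs) 2 = k" "fst (inst n1 n2 k m cs) 3 = m" "snd (inst n1 n2 k m cs) = cs" unfolding inst_def by auto

lemma rel_inst: "rel B (inst n1 n2 k m cs) h 0 Z M <-> M 0 = int n1 & M 1 = int n2 & M 2 = int k & M 3 = int m & (ALL a. M (B + a) = int (h a))"
proof -
 have "(ALL i<4. P i) <-> P 0 & P 1 & P 2 & P (3::nat)" for P by (auto simp: numeral_eq_Suc less_Suc_eq)
 thus ?thesis unfolding rel_def by (simp add: inst_simps)
qed

lemma machine_reject:
 assumes "k < 0"
 shows "halts_within (machine B V s1 s2 s3) cs (input_registers ws1 ws2 k) False 4"
proof -
 let ?p = "machine B V s1 s2 s3"
 have "code_at ?p 0 ([LoadConst 3 1, Add 3 3 2, JumpPos 3 4, Reject] @ drop 4 ?p)"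
  unfolding code_at_def machine_def Let_def by (auto simp: nth_append nth_Cons')
 hence c: "code_at ?p 0 [LoadConst 3 1, Add 3 3 2, JumpPos 3 4, Reject]" unfolding code_at_append by blast
 have "(step ?p cs ^^ 4) (Running 0 (input_registers ws1 ws2 k)) = Halted False" using c assms by (simp add: exec_simps input_registers_def)
 thus ?thesis unfolding halts_within_def by (intro exI[of _ 4]) simp
qed

lemma machine_correct:
 assumes sz: "stage_size B V s1" "stage_size B V s2" "stage_size B V s3"
  and f1: "!!h Z. eval I0 (run I0 0 Z (fst s1) h) 1 (%_. 0) (snd s1) = m1"
  and f2: "!!h Z. eval I1 (run I1 0 Z (fst s2) h) 1 (%_. 0) (snd s2) = m2"
  and f3: "!!h Z. eval I2 (run I2 0 Z (fst s3) h) 1 (%_. 0) (snd s3) = of_bool b"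
  and I: "I0 = inst n1 n2 k (n1 + n2 + k + 5) cs" "I1 = inst n1 n2 k m1 cs" "I2 = inst n1 n2 k m2 cs"
  and M: "M 0 = int n1" "M 1 = int n2" "M 2 = int k" "!!r. 3 < r ==> M r = 0"
 shows "EX t <= stage_cost (n1 + n2 + k + 5) s1 + stage_cost m1 s2 + stage_cost m2 s3 + 13.
  (step (machine B V s1 s2 s3) cs ^^ t) (Running 0 M) = Halted b" proof - let ?p = "machine B V s1 s2 s3" and ?d = "4 + V" and ?m0 = "n1 + n2 + k + 5"
 define P where "P = [LoadConst 3 1, Add 3 3 2, JumpPos 3 4, Reject, LoadConst 3 5, Add 3 3 0, Add 3 3 1, Add 3 3 2]"
 define P1 where "P1 = P @ stage_code B V 8 s1 @ [LoadConst 3 0, Add 3 3 ?d]"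
 define P2 where "P2 = P1 @ stage_code B V (length P1) s2 @ [LoadConst 3 0, Add 3 3 ?d]"
 define P3 where "P3 = P2 @ stage_code B V (length P2) s3"
 have p: "?p = P3 @ [JumpPos ?d (length P3 + 2), Reject, Accept]" unfolding machine_def Let_def P_def P1_def P2_def P3_def by simp
 define q1 where "q1 = 8 + length (stage_code B V 8 s1)"
 define q2 where "q2 = length P1 + length (stage_code B V (length P1) s2)"
 have lP: "length P = 8" unfolding P_def by simp
 have len: "length P1 = Suc (Suc q1)" "length P2 = Suc (Suc q2)" unfolding P1_def P2_def q1_def q2_def using lP by auto
 have "code_at ?p 0 ?p" unfolding code_at_def by simp
 hence "code_at ?p 0 (P3 @ [JumpPos ?d (length P3 + 2), Reject, Accept])" unfolding p .
 hence c3: "code_at ?p 0 P3" "code_at ?p (length P3) [JumpPos ?d (length P3 + 2), Reject, Accept]" unfolding code_at_append by auto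
 from c3(1) have c2: "code_at ?p 0 P2" "code_at ?p (length P2) (stage_code B V (length P2) s3)" unfolding P3_def code_at_append by auto
 from c2(1) have c1: "code_at ?p 0 P1" "code_at ?p (length P1) (stage_code B V (length P1) s2)" "code_at ?p q2 [LoadConst 3 0, Add 3 3 ?d]"
  unfolding P2_def code_at_append q2_def by auto
 from c1(1) have c0: "code_at ?p 0 P" "code_at ?p 8 (stage_code B V 8 s1)" "code_at ?p q1 [LoadConst 3 0, Add 3 3 ?d]"
  unfolding P1_def code_at_append q1_def lP by auto
 have BV: "4 + V <= B" "0 < V" using sz(1) unfolding stage_size_def by auto
 let ?M0 = "M(3 := int ?m0)"
 have r0: "reach ?p cs 7 (Running 0 M) (Running 8 ?M0)"
  using c0(1) M(1-3) unfolding P_def by (intro reachI[where k = 7]) (auto simp: exec_simps)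
 have rel0: "rel B I0 (%_. 0) 0 (%_. 0) ?M0" unfolding I rel_inst using M BV by auto
 have setm: "EX M''. reach ?p cs 2 (Running q M') (Running (Suc (Suc q)) M'') & rel B (inst n1 n2 k m' cs) h 0 Z M''"
  if c: "code_at ?p q [LoadConst 3 0, Add 3 3 ?d]" and M': "M' ?d = int m'" "rel B (inst n1 n2 k m cs) h 0 Z M'" for q M' m m' h Z
 proof -
  have "reach ?p cs 2 (Running q M') (Running (Suc (Suc q)) (M'(3 := int m')))"
  using c M'(1) by (intro reachI[where k = 2]) (auto simp: exec_simps)
  moreover have "rel B (inst n1 n2 k m' cs) h 0 Z (M'(3 := int m'))" using M'(2) BV unfolding rel_inst by auto
  ultimately show ?thesis by blast
 qed
 have stage: "EX M' h'. reach ?p cs (stage_cost m s) (Running pc M) (Running (pc + length (stage_code B V pc s)) M') &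
  M' ?d = int y & rel B I h' 0 (%_. 0) M'" if "stage_size B V s" "code_at ?p pc (stage_code B V pc s)" "rel B I h 0 (%_. 0) M"
  "!!h Z. eval I (run I 0 Z (fst s) h) 1 (%_. 0) (snd s) = y" "snd I = cs" "bound I = m"
  for s pc h M y m and I :: inst using run_stage[OF that(1-3)] unfolding that(4-6) by blast
 have i: "snd I0 = cs" "snd I1 = cs" "snd I2 = cs" "bound I0 = ?m0" "bound I1 = m1" "bound I2 = m2" unfolding I inst_simps by (rule refl)+
 obtain M1 h1 where M1: "reach ?p cs (stage_cost ?m0 s1) (Running 8 ?M0) (Running q1 M1)" "M1 ?d = int m1" "rel B I0 h1 0 (%_. 0) M1"
  using stage[OF sz(1) c0(2) rel0 f1 i(1,4)] unfolding q1_def by blast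
 obtain M1' where M1': "reach ?p cs 2 (Running q1 M1) (Running (length P1) M1')" "rel B I1 h1 0 (%_. 0) M1'"
  using setm[where M' = M1, OF c0(3) M1(2) M1(3)[unfolded I]] unfolding I len by blast
 obtain M2 h2 where M2: "reach ?p cs (stage_cost m1 s2) (Running (length P1) M1') (Running q2 M2)" "M2 ?d = int m2" "rel B I1 h2 0 (%_. 0) M2"
  using stage[OF sz(2) c1(2) M1'(2) f2 i(2,5)] unfolding q2_def by blast
 obtain M2' where M2': "reach ?p cs 2 (Running q2 M2) (Running (length P2) M2')" "rel B I2 h2 0 (%_. 0) M2'"
  using setm[where M' = M2, OF c1(3) M2(2) M2(3)[unfolded I]] unfolding I len by blast
 have l3: "length P2 + length (stage_code B V (length P2) s3) = length P3" unfolding P3_def by simp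
 obtain M3 where M3: "reach ?p cs (stage_cost m2 s3) (Running (length P2) M2') (Running (length P3) M3)" "M3 ?d = int (of_bool b)"
  using stage[OF sz(3) c2(2) M2'(2) f3 i(3,6)] unfolding l3 by blast
 have fin: "reach ?p cs 2 (Running (length P3) M3) (Halted b)" using c3(2) M3(2) by (intro reachI[where k = 2]) (auto simp: exec_simps)
 \<comment> \<open>The constant 13 is made of 7 steps of preparation, 2 for each of the two new loop
   bounds and 2 for the verdict.\<close>
 have "reach ?p cs (stage_cost ?m0 s1 + stage_cost m1 s2 + stage_cost m2 s3 + 13) (Running 0 M) (Halted b)"
  using reach_trans[OF reach_trans[OF reach_trans[OF reach_trans[OF reach_trans[OF reach_trans[OF r0 M1(1)] M1'(1)] M2(1)] M2'(1)] M3(1)] fin]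
  by (rule reach_le) simp
 thus ?thesis unfolding reach_def by blast
qed


text \<open>The machine can only compare cells, so a coordinate is replaced by the number of points
  with a smaller one. Cell \<open>z + z + d\<close> holds coordinate \<open>d\<close> of point
  \<open>z\<close>.\<close>

definition ranks :: "rat list => nat => nat => nat => nat" where
 "ranks cs N d z = card {z'. z' < N & cell cs (int (z' + z' + d)) < cell cs (int (z + z + d))}"

lemma ranks_less: "z < N ==> ranks cs N d z < N"
proof -
 assume z: "z < N"
 have "{z'. z' < N & cell cs (int (z' + z' + d)) < cell cs (int (z + z + d))} \<subset> {..<N}" using z by auto
 hence "ranks cs N d z < card {..<N}" unfolding ranks_def by (intro psubset_card_mono) auto
 thus ?thesis by simp
qed

lemma points_ranks: "points N (ranks cs N)" by unfold_locales (rule ranks_less)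

section \<open>From rational coordinates to ranks\<close>

lemma length_input_cells: "length (input_cells ws1 ws2) = 2 * length (ws1 @ ws2)"
proof -
 have "length (concat (map (%(x, y). [x, y]) xs)) = 2 * length xs" for xs :: "point list" by (induction xs) auto
 thus ?thesis unfolding input_cells_def by blast
qed

lemma cell_input:
 assumes "z < length (ws1 @ ws2)"
 shows "cell (input_cells ws1 ws2) (int (z + z)) = fst ((ws1 @ ws2) ! z)"
  and "cell (input_cells ws1 ws2) (int (z + z + 1)) = snd ((ws1 @ ws2) ! z)"
proof -
 have nth: "concat (map (%(x, y). [x, y]) xs) ! (z + z) = fst (xs ! z) & concat (map (%(x, y). [x, y]) xs) ! Suc (z + z) = snd (xs ! z)"
  if "z < length xs" for z and xs :: "point list" using that
 proof (induction xs arbitrary: z)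
  case (Cons p xs)
  thus ?case by (cases p; cases z) auto
 qed simp
 have z: "nat (int (z + z)) = z + z" "nat (int (z + z + 1)) = Suc (z + z)" by auto
 show "cell (input_cells ws1 ws2) (int (z + z)) = fst ((ws1 @ ws2) ! z)"
  unfolding cell_def length_input_cells z using assms nth[OF assms] unfolding input_cells_def by auto
 show "cell (input_cells ws1 ws2) (int (z + z + 1)) = snd ((ws1 @ ws2) ! z)"
  unfolding cell_def length_input_cells z using assms nth[OF assms] unfolding input_cells_def by auto
qed

lemma rank_less_iff:
 fixes c :: "nat => rat"
 assumes "z < N" "w < N"
 shows "card {z'. z' < N & c z' < c z} < card {z'. z' < N & c z' < c w} <-> c z < c w"
proof
 assume lt: "c z < c w"
 have "{z'. z' < N & c z' < c z} \<subset> {z'. z' < N & c z' < c w}" using lt assms by auto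
 thus "card {z'. z' < N & c z' < c z} < card {z'. z' < N & c z' < c w}" by (intro psubset_card_mono) auto
next
 assume lt: "card {z'. z' < N & c z' < c z} < card {z'. z' < N & c z' < c w}"
 show "c z < c w"
 proof (rule ccontr)
  assume "~ ?thesis"
  hence "{z'. z' < N & c z' < c w} <= {z'. z' < N & c z' < c z}" by auto
  hence "card {z'. z' < N & c z' < c w} <= card {z'. z' < N & c z' < c z}" by (intro card_mono) auto
  thus False using lt by simp
 qed
qed

text \<open>A rational line is replaced by the number of points before it.\<close>

lemma position_exists:
 fixes c :: "nat => rat"
 shows "EX a. ALL z<N. ALL w<N. strictly_between (c z) x (c w) --> (card {z'. z' < N & c z' < c z} < a) ~= (card {z'. z' < N & c z' < c w} < a)"
proof -
 define a where "a = card {z'. z' < N & c z' < x}"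
 have below: "card {z'. z' < N & c z' < c z} < a" if "c z < x" "z < N" for z unfolding a_def using that by (intro psubset_card_mono) auto
 have above: "a <= card {z'. z' < N & c z' < c z}" if "x < c z" for z unfolding a_def using that by (intro card_mono) auto
 show ?thesis
 proof (intro exI[of _ a] allI impI)
  fix z w assume zw: "z < N" "w < N" "strictly_between (c z) x (c w)"
  then consider "c z < x" "x < c w" | "c w < x" "x < c z" unfolding strictly_between_def by blast
  thus "(card {z'. z' < N & c z' < c z} < a) ~= (card {z'. z' < N & c z' < c w} < a)"
  proof cases
  case 1
  show ?thesis using below[OF 1(1) zw(1)] above[OF 1(2)] by simp
  next
  case 2
  show ?thesis using below[OF 2(1) zw(2)] above[OF 2(2)] by simp
  qed
 qed
qed

lemma gap_exists:
 fixes S T :: "rat set"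
 assumes "finite S" "finite T" "!!s t. s : S ==> t : T ==> s < t"
 shows "EX x. (ALL s:S. s < x) & (ALL t:T. x < t)"
proof (cases "S = {}")
 case True
 obtain x where "ALL t:T. x < t"
 proof (cases "T = {}")
  case False
  obtain x where "x < Min T" using lt_ex by blast
  thus ?thesis using that assms(2) False by auto
 qed (use that in auto)
 thus ?thesis using True by auto
next
 case False
 show ?thesis
 proof (cases "T = {}")
  case True
  obtain x where "Max S < x" using gt_ex by blast
  thus ?thesis using True assms(1) False by auto
 next
  case T: False
  have "Max S < Min T" using assms False T by (intro assms(3)) auto
  then obtain x where "Max S < x" "x < Min T" using dense by blast
  thus ?thesis using assms False T by auto
 qed
qed

text \<open>Ranks reflect the order of coordinates, so the points below \<open>a\<close> in rank
  precede the others, and density of the rationals provides a line between them.\<close>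

lemma line_exists:
 fixes c :: "nat => rat"
 shows "EX x. ALL z<N. ALL w<N. (card {z'. z' < N & c z' < c z} < a) ~= (card {z'. z' < N & c z' < c w} < a) --> strictly_between (c z) x (c w)"
proof -
 let ?r = "%z. card {z'. z' < N & c z' < c z}"
 have "EX x. (ALL s:c ` {z. z < N & ?r z < a}. s < x) & (ALL t:c ` {z. z < N & ~ ?r z < a}. x < t)"
 proof (rule gap_exists)
  fix s t assume "s : c ` {z. z < N & ?r z < a}" "t : c ` {z. z < N & ~ ?r z < a}"
  then obtain z w where "z < N" "w < N" "s = c z" "t = c w" "?r z < a" "~ ?r w < a" by blast
  thus "s < t" using rank_less_iff[of z N w c] by auto
 qed auto
 then obtain x where x0: "ALL s:c ` {z. z < N & ?r z < a}. s < x" "ALL t:c ` {z. z < N & ~ ?r z < a}. x < t" by (elim exE conjE)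
 have x: "c z < x" if "z < N" "?r z < a" for z using x0(1) that by simp
 have x': "x < c z" if "z < N" "~ ?r z < a" for z using x0(2) that by simp
 show ?thesis
 proof (intro exI[of _ x] allI impI)
  fix z w assume zw: "z < N" "w < N" "(?r z < a) ~= (?r w < a)"
  show "strictly_between (c z) x (c w)"
  proof (cases "?r z < a")
  case True
  thus ?thesis using x[OF zw(1)] x'[OF zw(2)] zw(3) unfolding strictly_between_def by blast
  next
  case False
  thus ?thesis using x[OF zw(2)] x'[OF zw(1)] zw(3) unfolding strictly_between_def by blast
  qed
 qed
qed

theorem optimal_discretization_iff:
 assumes k: "0 <= k"
 shows "optimal_discretization (set ws1) (set ws2) k <->
  points.solvable (length ws1 + length ws2) (nat k) (ranks (input_cells ws1 ws2) (length ws1 + length ws2)) (%z. z < length ws1)" proof -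
 define N where "N = length ws1 + length ws2"
 define c where "c d z = cell (input_cells ws1 ws2) (int (z + z + d))" for d z
 interpret points N "nat k" "ranks (input_cells ws1 ws2) N" "%z. z < length ws1" by (rule points_ranks)
 have r: "ranks (input_cells ws1 ws2) N d z = card {z'. z' < N & c d z' < c d z}" for d z unfolding ranks_def c_def by simp
 have pt: "(ws1 @ ws2) ! z = (c 0 z, c 1 z)" if "z < N" for z
  using cell_input[of z ws1 ws2] that unfolding N_def c_def by (simp add: prod_eq_iff)
 have P1: "p : set ws1 <-> (EX z<length ws1. p = (c 0 z, c 1 z))" for p
 proof -
  have "ws1 ! z = (c 0 z, c 1 z)" if "z < length ws1" for z using pt[of z] that unfolding N_def by (simp add: nth_append)
  thus ?thesis unfolding in_set_conv_nth by (metis (no_types))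
 qed
 have P2: "p : set ws2 <-> (EX z<N. ~ z < length ws1 & p = (c 0 z, c 1 z))" for p
 proof -
  have e: "ws2 ! z = (c 0 (length ws1 + z), c 1 (length ws1 + z))" if "z < length ws2" for z
  using pt[of "length ws1 + z"] that unfolding N_def by (simp add: nth_append)
  show ?thesis
  proof
  assume "p : set ws2"
  then obtain z where "z < length ws2" "p = ws2 ! z" by (auto simp: in_set_conv_nth)
  thus "EX z<N. ~ z < length ws1 & p = (c 0 z, c 1 z)" using e unfolding N_def by (intro exI[of _ "length ws1 + z"]) auto
  next
  assume "EX z<N. ~ z < length ws1 & p = (c 0 z, c 1 z)"
  then obtain z where z: "z < N" "~ z < length ws1" "p = (c 0 z, c 1 z)" by blast
  hence "z - length ws1 < length ws2" unfolding N_def by auto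
  thus "p : set ws2" using e[of "z - length ws1"] z by (auto simp: in_set_conv_nth intro!: exI[of _ "z - length ws1"])
  qed
 qed
 have sp: "separation (set ws1) (set ws2) X Y <-> (ALL z<N. ALL w<N. z < length ws1 & ~ w < length ws1 -->
  (EX x:X. strictly_between (c 0 z) x (c 0 w)) \<or> (EX y:Y. strictly_between (c 1 z) y (c 1 w)))" for X Y proof
  assume s: "separation (set ws1) (set ws2) X Y"
  show "ALL z<N. ALL w<N. z < length ws1 & ~ w < length ws1 -->
  (EX x:X. strictly_between (c 0 z) x (c 0 w)) \<or> (EX y:Y. strictly_between (c 1 z) y (c 1 w))" proof (intro allI impI)
  fix z w assume zw: "z < N" "w < N" "z < length ws1 & ~ w < length ws1"
  have "(c 0 z, c 1 z) : set ws1" "(c 0 w, c 1 w) : set ws2" unfolding P1 P2 using zw by blast+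
  thus "(EX x:X. strictly_between (c 0 z) x (c 0 w)) \<or> (EX y:Y. strictly_between (c 1 z) y (c 1 w))"
  using s unfolding separation_def by blast
  qed
 next
  assume s: "ALL z<N. ALL w<N. z < length ws1 & ~ w < length ws1 -->
  (EX x:X. strictly_between (c 0 z) x (c 0 w)) \<or> (EX y:Y. strictly_between (c 1 z) y (c 1 w))"
  show "separation (set ws1) (set ws2) X Y" unfolding separation_def
  proof (safe)
  fix x1 y1 x2 y2 assume "(x1, y1) : set ws1" "(x2, y2) : set ws2" and n: "~ (EX y:Y. strictly_between y1 y y2)"
  then obtain z w where "z < length ws1" "x1 = c 0 z" "y1 = c 1 z" "w < N" "~ w < length ws1" "x2 = c 0 w" "y2 = c 1 w"
  unfolding P1 P2 by blast
  moreover from this have "z < N" unfolding N_def by simp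
  ultimately show "EX x:X. strictly_between x1 x x2" using s n by blast
  qed
 qed
 show ?thesis unfolding N_def[symmetric]
 proof
  assume "optimal_discretization (set ws1) (set ws2) k"
  then obtain X Y where XY: "finite X" "finite Y" "separation (set ws1) (set ws2) X Y" "int (card X) + int (card Y) <= k"
  unfolding optimal_discretization_def by blast
  have "EX a. ALL z<N. ALL w<N. strictly_between (c d z) x (c d w) --> sep d a z w" for d x unfolding sep_def r by (rule position_exists)
  note ex = this
  define f where "f d x = (SOME a. ALL z<N. ALL w<N. strictly_between (c d z) x (c d w) --> sep d a z w)" for d x
  have "ALL z<N. ALL w<N. strictly_between (c d z) x (c d w) --> sep d (f d x) z w" for d x unfolding f_def by (rule someI_ex) (rule ex)
  hence f: "!!d x z w. z < N ==> w < N ==> strictly_between (c d z) x (c d w) ==> sep d (f d x) z w" by blast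
  have cd: "card (f 0 ` X) + card (f 1 ` Y) <= nat k"
  using card_image_le[OF XY(1), of "f 0"] card_image_le[OF XY(2), of "f 1"] XY(4) by linarith
  have sq: "(EX a:f 0 ` X. sep 0 a z w) \<or> (EX a:f 1 ` Y. sep 1 a z w)"
  if "z < N" "w < N" "z < length ws1 & ~ w < length ws1" for z w
  proof -
  have "(EX x:X. strictly_between (c 0 z) x (c 0 w)) \<or> (EX y:Y. strictly_between (c 1 z) y (c 1 w))"
  using XY(3)[unfolded sp] that by blast
  thus ?thesis using f[OF that(1,2)] by (elim disjE bexE) blast+
  qed
  have fin: "finite (f 0 ` X)" "finite (f 1 ` Y)" using XY by auto
  show solvable unfolding solvable_def
  by (rule exI[of _ "f 0 ` X"], rule exI[of _ "f 1 ` Y"], intro conjI fin cd allI impI sq; (elim conjE)?; assumption)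
 next
  assume solvable
  then obtain X Y where XY: "finite X & finite Y & card X + card Y <= nat k &
  (ALL z<N. ALL w<N. z < length ws1 & ~ w < length ws1 --> (EX a:X. sep 0 a z w) \<or> (EX a:Y. sep 1 a z w))" unfolding solvable_def by (elim exE)
  have "EX x. ALL z<N. ALL w<N. sep d a z w --> strictly_between (c d z) x (c d w)" for d a unfolding sep_def r by (rule line_exists)
  note ex = this
  define g where "g d a = (SOME x. ALL z<N. ALL w<N. sep d a z w --> strictly_between (c d z) x (c d w))" for d a
  have "ALL z<N. ALL w<N. sep d a z w --> strictly_between (c d z) (g d a) (c d w)" for d a unfolding g_def by (rule someI_ex) (rule ex)
  hence g: "!!d a z w. z < N ==> w < N ==> sep d a z w ==> strictly_between (c d z) (g d a) (c d w)" by blast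
  have fin: "finite X" "finite Y" using XY by auto
  have cd: "int (card (g 0 ` X)) + int (card (g 1 ` Y)) <= k"
  using card_image_le[OF fin(1), of "g 0"] card_image_le[OF fin(2), of "g 1"] XY k by linarith
  have "separation (set ws1) (set ws2) (g 0 ` X) (g 1 ` Y)" unfolding sp using XY g by blast
  thus "optimal_discretization (set ws1) (set ws2) k" unfolding optimal_discretization_def using cd fin by blast
 qed
qed


section \<open>The algorithm as a definable function\<close>

definition NN :: "inst => nat" where
 "NN I = fst I 0 + fst I 1"

definition kk :: "inst => nat" where
 "kk I = fst I 2"

definition rk :: "inst => nat => nat => nat" where
 "rk I = ranks (snd I) (NN I)"

definition rd :: "inst => nat => bool" where
 "rd I z <-> z < fst I 0"

lemma pts: "points (NN I) (rk I)" unfolding rk_def by (rule points_ranks)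

lemma width_pos: "20 <= width k" unfolding width_def by simp

lemma base_gt_1: "1 < base k" unfolding base_def by (rule one_less_power) auto

lemma less_guesses: "x < 9 * width k * width k ==> base k ^ x < guesses k"
 unfolding guesses_def by (intro power_strict_increasing) (auto intro: base_gt_1[unfolded One_nat_def])

lemma base_bounds: "k + 5 <= base k" "3125 <= base k"
proof -
 have "(k + 5) ^ 1 <= (k + 5) ^ 12" by (rule power_increasing) auto
 thus "k + 5 <= base k" unfolding base_def by simp
 have "(5::nat) ^ 5 <= (k + 5) ^ 5" by (rule power_mono) auto
 also have "... <= (k + 5) ^ 12" by (rule power_increasing) auto
 finally show "3125 <= base k" unfolding base_def by simp
qed

lemma exp_less_guesses: "9 * width k * width k < guesses k"
proof -
 have "9 * width k * width k < 2 ^ (9 * width k * width k)" by (rule less_exp)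
 also have "... <= guesses k" unfolding guesses_def using base_gt_1[of k] by (intro power_mono) auto
 finally show ?thesis .
qed

context lang
begin

lemma expr_bif:
 assumes "pred q n c" "pred q n P" "pred q n Q"
 shows "pred q n (%I Z. if c I Z then P I Z else Q I Z)" by (rule expr_cong[OF expr_if[OF assms]]) simp

text \<open>Recursions and substitutions accept only arguments shown to be below the bound; clipping
  with default 0 turns any value into one.\<close>

lemma bexpr_clip: "expr q n a ==> bexpr q n (%I Z. if a I Z < bound I then a I Z else 0)"
 by (rule bexprI) (auto intro!: expr_if expr_less expr_const expr_input dest: expr_pos good_pos)

lemma expr_even:
 assumes a: "expr q n a"
 shows "pred q n (%I Z. EX v<bound I. a I Z = v + v)"
proof (rule expr_ex_less)
 show "expr q n (%I Z. bound I)" using expr_pos[OF a] by (intro expr_input) auto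
 show "pred q n' (%I Z. a I Z = x I Z + x I Z)" if "n <= n'" "bexpr q n' x" for n' x
  by (rule expr_eq[OF expr_mono[OF a that(1)] expr_add[OF bexpr_expr[OF that(2)] bexpr_expr[OF that(2)]]])
qed simp

lemma expr_pow:
 assumes a: "!!q n. 0 < n ==> expr q n (%I Z. a I)" "!!I. good I ==> a I <= bound I" and i: "bexpr q n i"
 shows "expr q n (%I Z. a I ^ i I Z)"
proof -
 have "expr q n (%I Z. (%I i xs. a I ^ i) I (i I Z) (map (%b. b I Z) []))"
 proof (rule expr_rec[where F = "%I i xs. a I ^ i" and r = 0 and B = "%_ _. 1" and S = "%I i xs prev. a I * prev []"])
  fix q n i as and prev :: "inst => (nat => nat) => nat list => nat"
  assume n: "0 < n" and p: "!!n' bs. n <= n' ==> length bs = 0 ==> ALL b:set bs. bexpr q n' b ==> expr q n' (%I Z. prev I Z (map (%b. b I Z) bs))"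
  have "expr q n (%I Z. prev I Z [])" using p[of n "[]"] by simp
  thus "expr q n (%I Z. a I * prev I Z [])" by (intro expr_mult a n)
 qed (use i expr_const[of _ _ 1] in auto)
 thus ?thesis by simp
qed

lemma expr_pow_const:
 assumes a: "expr q n a" "!!I Z. good I ==> okenv n I Z ==> a I Z <= bound I"
 shows "expr q n (%I Z. a I Z ^ j)"
proof (induction j)
 case 0
 thus ?case using expr_const[OF expr_pos[OF a(1)], of q 1] by simp
next
 case (Suc j)
 thus ?case using expr_mult[OF a] by simp
qed

lemma expr_NN: "0 < n ==> expr q n (%I Z. NN I)" unfolding NN_def by (intro expr_add expr_input) auto

lemma expr_kk: "0 < n ==> expr q n (%I Z. kk I)" unfolding kk_def by (intro expr_input) auto

text \<open>The values of a scan are bounded by the stage, so that their parity can be tested with a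
 bounded quantifier.\<close>

lemma scan_le: "scan P v <= Suc v" by (induction v) auto

lemma even_bounded: "x <= m ==> 0 < m ==> (EX v<m. x = v + v) <-> even (x :: nat)"
proof
 assume a: "x <= m" "0 < m" "even x"
 then obtain y where "x = y + y" by (metis mult_2 evenE)
 thus "EX v<m. x = v + v" using a by (intro exI[of _ y]) auto
qed auto

lemma expr_scan:
 assumes r: "r <= 7"
  and P: "!!q n v as. 0 < n ==> bexpr q n v ==> length as = r ==> ALL a:set as. bexpr q n a ==>
  pred q n (%I Z. P I (map (%a. a I Z) as) True (v I Z))"
  and P': "!!q n v as. 0 < n ==> bexpr q n v ==> length as = r ==> ALL a:set as. bexpr q n a ==>
  pred q n (%I Z. P I (map (%a. a I Z) as) False (v I Z))" and v: "bexpr q n v" and as: "length as = r" "ALL a:set as. bexpr q n a"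
 shows "expr q n (%I Z. scan (P I (map (%a. a I Z) as)) (v I Z))"
proof -
 let ?ev = "%I x. EX v<bound I. x = v + v"
 let ?S = "%I i xs prev. if P I xs True i & ?ev I (prev xs) then Suc (prev xs)
  else if P I xs False i & (~ ?ev I (prev xs) \<or> prev xs = 0) then (if prev xs = 0 then 2 else Suc (prev xs)) else prev xs" show ?thesis
 proof (rule expr_rec[where F = "%I i xs. scan (P I xs) i" and r = r and B = "%_ _. 0" and S = ?S])
  fix q n i as and prev :: "inst => (nat => nat) => nat list => nat"
  assume a: "0 < n" "bexpr q n i" "length as = r" "ALL a:set as. bexpr q n a"
  and p: "!!n' bs. n <= n' ==> length bs = r ==> ALL b:set bs. bexpr q n' b ==> expr q n' (%I Z. prev I Z (map (%b. b I Z) bs))"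
  have pe: "expr q n (%I Z. prev I Z (map (%b. b I Z) as))" by (rule p[OF order_refl a(3,4)])
  show "expr q n (%I Z. ?S I (i I Z) (map (%a. a I Z) as) (prev I Z))"
  by (intro expr_if expr_and expr_or expr_not expr_Suc expr_eq expr_const expr_even P[OF a] P'[OF a] pe a(1))
 next
  fix I i xs assume "Suc i < bound I"
  hence "?ev I (scan (P I xs) i) <-> even (scan (P I xs) i)" using scan_le[of "P I xs" i] by (intro even_bounded) auto
  thus "scan (P I xs) (Suc i) = ?S I i xs (%xs. scan (P I xs) i)" by auto
 qed (use expr_const[of _ _ 0] v as r in auto)
qed

end

section \<open>Definability of the decision procedure\<close>

locale algo = lang +
 assumes big: "good I ==> bound I = guesses (kk I) * (NN I + 2)"
begin

interpretation g: guess "NN I" "kk I" "rk I" "rd I" "guess_digit (kk I) w 0 0 0"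
 "%l. guess_digit (kk I) w 1 l 0" "%l. guess_digit (kk I) w 2 l 0" "%m. guess_digit (kk I) w 3 m 0"
 "%t u. guess_digit (kk I) w 4 t u = 1" "guess_digit (kk I) w 5" "guess_digit (kk I) w 6"
 "guess_digit (kk I) w 7" "guess_digit (kk I) w 8" for I w by (intro guess.intro layout.intro pts)

interpretation c: csp "kk I + 4" "Suc (NN I)" "base (kk I)" "g.E2 I w" for I w by (rule g.csp_E2)

declare One_nat_def[simp del]

text \<open>Definability proofs follow the shape of the definitions by backward resolution:
  \<open>ex\<close> builds expressions, \<open>bnd\<close> keeps quantifiers within the loop bound,
  and \<open>mono\<close> passes to more variables.\<close>

named_theorems ex and bnd and mono

lemma guesses_bound: "good I ==> guesses (kk I) <= bound I" and NN_bound: "good I ==> NN I + 2 <= bound I"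
 using exp_less_guesses[of "kk I"] mult_le_mono1[of 1 "guesses (kk I)" "NN I + 2"] big[of I] by auto

lemma base_bound: "good I ==> x < 9 * width (kk I) * width (kk I) ==> base (kk I) ^ x < bound I"
 using less_guesses guesses_bound less_le_trans by blast

lemma width_large: "3 * (k + 4) < 9 * width k * width k"
proof -
 have "3 * (k + 4) < 9 * width k" unfolding width_def by simp
 also have "... <= 9 * width k * width k" using width_pos[of k] by simp
 finally show ?thesis .
qed

lemma [bnd]:
 assumes "good I"
 shows "NN I <= bound I" "NN I < bound I" "Suc (NN I) <= bound I" "kk I + 4 <= bound I" "bound I <= bound I"
  "base (kk I) <= bound I" "base (kk I) ^ (3 * (kk I + 4)) <= bound I" "(kk I + 4) * Suc (NN I) < bound I"
  "guess_digit (kk I) w j l i < bound I" "guess_digit (kk I) w j l i <= bound I" "guesses (kk I) <= bound I"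
  "kk I + 5 <= bound I" "3 <= bound I" "kk I + 4 < bound I" "3 * (kk I + 4) < bound I"
proof -
 have b: "base (kk I) < bound I" using base_bound[OF assms, of 1] width_large[of "kk I"] by simp
 show "NN I <= bound I" "NN I < bound I" "Suc (NN I) <= bound I" "bound I <= bound I" using NN_bound[OF assms] by auto
 show k: "kk I + 5 <= bound I" "kk I + 4 <= bound I" "base (kk I) <= bound I" "3 <= bound I" "kk I + 4 < bound I" using b base_bounds[of "kk I"] by auto
 show "3 * (kk I + 4) < bound I" using width_large[of "kk I"] exp_less_guesses[of "kk I"] guesses_bound[OF assms] by linarith
 show "base (kk I) ^ (3 * (kk I + 4)) <= bound I" using base_bound[OF assms width_large] by simp
 show "guesses (kk I) <= bound I" by (rule guesses_bound[OF assms])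
 have "kk I + 4 <= guesses (kk I)" using exp_less_guesses[of "kk I"] width_large[of "kk I"] by simp
 hence "(kk I + 4) * Suc (NN I) <= guesses (kk I) * Suc (NN I)" by (rule mult_le_mono1)
 also have "... < bound I" using exp_less_guesses[of "kk I"] by (simp add: big[OF assms])
 finally show "(kk I + 4) * Suc (NN I) < bound I" .
 have "guess_digit (kk I) w j l i < base (kk I)" using base_gt_1[of "kk I"] unfolding guess_digit_def digit_def by simp
 thus "guess_digit (kk I) w j l i < bound I" "guess_digit (kk I) w j l i <= bound I" using b by auto
qed

lemma rk_bounds[bnd]: "good I ==> rk I d z < bound I" "good I ==> Suc (rk I d z) < bound I"
proof -
 assume g: "good I"
 have "rk I d z <= card {..<NN I}" unfolding rk_def ranks_def by (intro card_mono) auto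
 thus "rk I d z < bound I" "Suc (rk I d z) < bound I" using NN_bound[OF g] by auto
qed

lemma bexpr_pos: "bexpr q n f ==> n <= n' ==> 0 < n'" using expr_pos bexpr_expr by fastforce

lemma bexpr_nth: "ALL a:set as. bexpr q n a ==> n <= n' ==> i < length as ==> bexpr q n' (as ! i)" using bexpr_mono nth_mem by blast

lemmas [mono] = bexpr_pos bexpr_mono

lemmas [ex] = expr_const expr_input expr_add expr_diff expr_less expr_cell expr_Suc expr_not expr_and expr_or expr_imp
 expr_iff expr_le expr_eq expr_if expr_ex_less expr_all_less expr_ex_le expr_all_le expr_sum_less expr_card expr_mult
 expr_bif expr_NN expr_kk

lemma bexpr_small[ex]: "0 < n ==> c < 3125 ==> bexpr q n (%I Z. c)"
proof (rule bexprI[OF expr_const])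
 fix I assume "c < 3125" "good I"
 moreover have "base (kk I) <= bound I" using \<open>good I\<close> by (rule bnd)
 ultimately show "c < bound I" using base_bounds(2)[of "kk I"] by simp
qed

lemma bexpr_diff[ex]: "bexpr q n a ==> expr q n b ==> bexpr q n (%I Z. a I Z - b I Z)"
 by (rule bexprI, erule expr_diff[OF bexpr_expr]) (simp_all add: bexpr_less less_imp_diff_less)

lemma expr_rk[ex]: "expr q n d ==> expr q n z ==> expr q n (%I Z. rk I (d I Z) (z I Z))" unfolding rk_def ranks_def
 by (frule expr_pos, (assumption | rule ex | rule bnd | (erule expr_mono, linarith) | rule bexpr_expr | linarith)+)

lemma bexpr_rk[ex]: "expr q n d ==> expr q n z ==> bexpr q n (%I Z. rk I (d I Z) (z I Z))"
 "expr q n d ==> expr q n z ==> bexpr q n (%I Z. Suc (rk I (d I Z) (z I Z)))" by (rule bexprI, (assumption | rule ex | rule bnd)+)+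

lemma expr_rd[ex]: "expr q n z ==> pred q n (%I Z. rd I (z I Z))" unfolding rd_def by (frule expr_pos, (assumption | rule ex | simp)+)

lemma expr_base[ex]: "0 < n ==> expr q n (%I Z. base (kk I))"
 unfolding base_def by (rule expr_pow_const, (assumption | rule ex | rule bnd)+)

lemma expr_base_pow: "bexpr q n i ==> expr q n (%I Z. base (kk I) ^ i I Z)" by (rule expr_pow, (assumption | rule ex | rule bnd)+)

lemma div_card: "0 < y ==> w < m ==> w div y = card {v. v < m & Suc v * y <= (w :: nat)}"
proof -
 assume y: "0 < y" "w < m"
 have "v < m & Suc v * y <= w <-> v < w div y" for v using less_eq_div_iff_mult_less_eq[OF y(1), of "Suc v" w] div_le_dividend[of w y] y(2)
  by (metis Suc_le_eq le_less_trans less_trans)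
 thus ?thesis by simp
qed

text \<open>A quotient is the number of positive multiples of the divisor up to the dividend, and
  the remainder follows by subtraction.\<close>

lemma expr_digit:
 assumes w: "bexpr q n w" and i: "bexpr q n i"
 shows "expr q n (%I Z. digit (base (kk I)) (w I Z) (i I Z))"
proof -
 have div: "bexpr q n (%I Z. w I Z div y I Z)" if y: "expr q n y" "!!I Z. good I ==> 0 < y I Z" "bexpr q n w" for y w
 proof (rule bexprI, rule expr_cong)
  show "expr q n (%I Z. card {v. v < bound I & Suc v * y I Z <= w I Z})"
  by (insert y(1,3), (assumption | rule ex | rule bnd | linarith | (erule bexpr_pos, linarith) | (erule expr_mono, assumption) |
  (rule Suc_leI, erule bexpr_less, assumption, assumption) | (erule bexpr_mono, linarith) | simp | rule bexpr_expr)+)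
  show "card {v. v < bound I & Suc v * y I Z <= w I Z} = w I Z div y I Z" if "good I" "okenv n I Z" for I Z
  using div_card[OF y(2)[OF that(1)] bexpr_less[OF y(3) that]] by simp
  show "w I Z div y I Z < bound I" if "good I" "okenv n I Z" for I Z using bexpr_less[OF y(3) that] by (meson div_le_dividend le_less_trans)
 qed
 have b: "0 < base k" "0 < base k ^ j" for k j using base_gt_1[of k] by auto
 have n: "0 < n" using w by (rule bexpr_pos) simp
 have d: "bexpr q n (%I Z. w I Z div base (kk I) ^ i I Z)" by (rule div[OF expr_base_pow[OF i] b(2) w])
 have "expr q n (%I Z. w I Z div base (kk I) ^ i I Z - base (kk I) * (w I Z div base (kk I) ^ i I Z div base (kk I)))"
  by (insert d div[OF expr_base[OF n] b(1) d] n, (assumption | rule expr_diff expr_mult expr_base bnd | rule bexpr_expr)+)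
 thus ?thesis unfolding digit_def by (rule expr_cong) (simp only: minus_mult_div_eq_mod)
qed

lemma width_bounds: "good I ==> 9 * width (kk I) * width (kk I) < bound I" "good I ==> 9 * width (kk I) <= bound I"
proof -
 assume g: "good I"
 show *: "9 * width (kk I) * width (kk I) < bound I" using exp_less_guesses guesses_bound[OF g] less_le_trans by blast
 have "9 * width (kk I) <= 9 * width (kk I) * width (kk I)" using width_pos[of "kk I"] by simp
 thus "9 * width (kk I) <= bound I" using * by linarith
qed

lemma const_le: "good I ==> j <= 9 ==> j <= bound I" using width_bounds(2) width_pos[of "kk I"] by fastforce

lemma expr_width: "0 < n ==> expr q n (%I Z. width (kk I))"
 unfolding width_def by (intro expr_mult expr_const expr_add expr_kk const_le) simp_all

lemma expr_guess_digit[ex]: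
 assumes w: "bexpr q n w" and l: "expr q n l" and i: "expr q n i" and j: "j < 9"
 shows "expr q n (%I Z. guess_digit (kk I) (w I Z) j (l I Z) (i I Z))"
proof -
 have n: "0 < n" using w by (rule bexpr_pos) simp
 note W = expr_width[OF n]
 let ?W = "%I. width (kk I)"
 let ?c = "%I x. if x < ?W I then x else 0"
 have c: "expr q n (%I Z. ?c I (x I Z))" if "expr q n x" for x by (intro expr_if expr_less that W expr_const n)
 have le: "j * ?W I + ?c I x < 9 * ?W I" "(j * ?W I + ?c I x) * ?W I + ?c I y < 9 * ?W I * ?W I" for x y I
 proof -
  have lt: "a * w + b < m * w" if "a < m" "b < w" for a b m w :: nat using mult_le_mono1[of "Suc a" m w] that by simp
  have "0 < ?W I" using width_pos[of "kk I"] by simp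
  thus "j * ?W I + ?c I x < 9 * ?W I" "(j * ?W I + ?c I x) * ?W I + ?c I y < 9 * ?W I * ?W I" by (auto intro!: lt j)
 qed
 have e: "bexpr q n (%I Z. (j * ?W I + ?c I (l I Z)) * ?W I + ?c I (i I Z))"
 proof (intro bexprI expr_add expr_mult expr_const c W l i n)
  fix I :: inst assume g: "good I"
  show "j <= bound I" using g j by (simp add: const_le)
  show "(j * ?W I + ?c I (l I Z)) * ?W I + ?c I (i I Z) < bound I" for Z using le(2) width_bounds(1)[OF g] less_trans by blast
  show "j * ?W I + ?c I (l I Z) <= bound I" for Z using le(1) width_bounds(2)[OF g] by (meson less_imp_le less_le_trans)
 qed
 show ?thesis by (rule expr_cong[OF expr_if[OF expr_and[OF expr_less[OF l W] expr_less[OF i W]] expr_digit[OF w e] expr_const[of _ _ 0]]])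
  (use n in "auto simp: guess_digit_def")
qed

lemma bexpr_guess_digit[ex]:
 "bexpr q n w ==> expr q n l ==> expr q n i ==> j < 9 ==> bexpr q n (%I Z. guess_digit (kk I) (w I Z) j (l I Z) (i I Z))"
 by (rule bexprI, erule expr_guess_digit) (assumption | rule bnd)+

lemmas [ex] = bexpr_clip

lemma bexpr_NN[ex]: "0 < n ==> bexpr q n (%I Z. NN I)" by (rule bexprI, (assumption | rule ex bnd)+)

lemma expr_rec1:
 assumes step: "!!q n i a p. bexpr q n i ==> bexpr q n a ==> expr q n p ==> expr q n (%I Z. S I (i I Z) (a I Z) (p I Z))"
  and F: "!!I a. F I a 0 = 0" "!!I a i. Suc i < bound I ==> F I a (Suc i) = S I i a (F I a i)"
  and a: "bexpr q n a" and i: "bexpr q n i"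
 shows "expr q n (%I Z. F I (a I Z) (i I Z))"
proof -
 have "expr q n (%I Z. (%I i xs. F I (hd xs) i) I (i I Z) (map (%a. a I Z) [a]))"
 proof (rule expr_rec[where F = "%I i xs. F I (hd xs) i" and r = 1 and B = "%_ _. 0" and S = "%I i xs p. S I i (hd xs) (p [hd xs])"])
  fix q n i as and p :: "inst => (nat => nat) => nat list => nat"
  assume as: "bexpr q n i" "length as = 1" "ALL a:set as. bexpr q n a"
  and p: "!!n' bs. n <= n' ==> length bs = 1 ==> ALL b:set bs. bexpr q n' b ==> expr q n' (%I Z. p I Z (map (%b. b I Z) bs))"
  obtain a where [simp]: "as = [a]" using as(2) by (cases as) auto
  show "expr q n (%I Z. S I (i I Z) (hd (map (%a. a I Z) as)) (p I Z [hd (map (%a. a I Z) as)]))"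
  using step[OF as(1) _ p[of n as], of a] as by simp
 qed (use F a i expr_const[of _ _ 0] in auto)
 thus ?thesis by simp
qed

text \<open>\<open>P1\<close> and its companions abbreviate closure rules: the predicate is
  definable as soon as its arguments are definable and below the bound.\<close>

definition "P1 f <-> (ALL q n a. bexpr q n a --> pred q n (%I Z. f I (a I Z)))"
definition "P3 f <-> (ALL q n a b c. bexpr q n a --> bexpr q n b --> bexpr q n c --> pred q n (%I Z. f I (a I Z) (b I Z) (c I Z)))"
definition "P4 f <-> (ALL q n a b c d. bexpr q n a --> bexpr q n b --> bexpr q n c --> bexpr q n d --> pred q n (%I Z. f I (a I Z) (b I Z) (c I Z) (d I Z)))"
definition "P5 f <-> (ALL q n a b c d u. bexpr q n a --> bexpr q n b --> bexpr q n c --> bexpr q n d --> bexpr q n u --> pred q n (%I Z. f I (a I Z) (b I Z) (c I Z) (d I Z) (u I Z)))"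
definition "P6 f <-> (ALL q n a b c d u v. bexpr q n a --> bexpr q n b --> bexpr q n c --> bexpr q n d --> bexpr q n u --> bexpr q n v --> pred q n (%I Z. f I (a I Z) (b I Z) (c I Z) (d I Z) (u I Z) (v I Z)))"
definition "P7 f <-> (ALL q n a b c d u v w. bexpr q n a --> bexpr q n b --> bexpr q n c --> bexpr q n d --> bexpr q n u --> bexpr q n v --> bexpr q n w --> pred q n (%I Z. f I (a I Z) (b I Z) (c I Z) (d I Z) (u I Z) (v I Z) (w I Z)))"

lemmas P1I = P1_def[THEN iffD2, rule_format]
lemmas P1D = P1_def[THEN iffD1, rule_format]
lemmas P3I = P3_def[THEN iffD2, rule_format]
lemmas P3D = P3_def[THEN iffD1, rule_format]
lemmas P4I = P4_def[THEN iffD2, rule_format]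
lemmas P4D = P4_def[THEN iffD1, rule_format]
lemmas P5I = P5_def[THEN iffD2, rule_format]
lemmas P5D = P5_def[THEN iffD1, rule_format]
lemmas P6I = P6_def[THEN iffD2, rule_format]
lemmas P6D = P6_def[THEN iffD1, rule_format]
lemmas P7I = P7_def[THEN iffD2, rule_format]
lemmas P7D = P7_def[THEN iffD1, rule_format]

section \<open>Slabs, strips and constraints as definable functions\<close>

lemma expr_slab[ex]:
 "bexpr q n d ==> bexpr q n s ==> bexpr q n c ==> bexpr q n v ==> pred q n (%I Z. g.slab I (d I Z) (s I Z) (c I Z) e (v I Z))" unfolding g.slab_def
 by (assumption | rule ex bnd | (erule mono, linarith) | linarith | rule bexpr_expr)+

lemma expr_scan_slab[ex]:
 "bexpr q n d ==> bexpr q n s ==> bexpr q n c ==> bexpr q n v ==> expr q n (%I Z. scan (g.slab I (d I Z) (s I Z) (c I Z)) (v I Z))"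
 by (insert expr_scan[where r = 3 and P = "%I xs. g.slab I (xs ! 0) (xs ! 1) (xs ! 2)" and as = "[d, s, c]" and v = v])
  (simp add: bexpr_nth expr_slab)

lemma [THEN P3D, ex]: "P3 g.good"
 by (unfold g.good_def, (rule P3I, (assumption | rule ex bnd | (erule mono, linarith) | linarith | rule bexpr_expr)+))

lemma expr_st: "bexpr q n d ==> bexpr q n v ==> expr q n (%I Z. g.st I (d I Z) (v I Z))"
proof (rule expr_rec1[where F = "%I. g.st I" and S = "%I i d s.
  if g.good I d (if s < bound I then s else 0) (if Suc i < bound I then Suc i else 0) then s else Suc i"])
 show "g.st I d (Suc i) = (if g.good I d (if g.st I d i < bound I then g.st I d i else 0)
  (if Suc i < bound I then Suc i else 0) then g.st I d i else Suc i)" if "Suc i < bound I" for I d i using that g.st_le[of I d i] by simp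
qed (simp | assumption | rule ex bnd | (erule mono, linarith) | linarith | rule bexpr_expr)+

lemma bexpr_st[ex]: "bexpr q n d ==> bexpr q n v ==> bexpr q n (%I Z. g.st I (d I Z) (v I Z))"
 by (rule bexprI) (simp_all add: expr_st le_less_trans[OF g.st_le bexpr_less])

lemma expr_cc[ex]: "bexpr q n d ==> bexpr q n v ==> expr q n (%I Z. g.cc I (d I Z) (v I Z))"
 by (rule expr_rec1[where F = "%I. g.cc I" and S = "%I v d c. c + (if g.st I d (if Suc v < bound I then Suc v else 0) = Suc v then 1 else 0)"])
  (assumption | rule ex bnd | (erule mono, linarith) | linarith | rule bexpr_expr | simp)+

lemma expr_band[ex]: "bexpr q n d ==> bexpr q n c ==> bexpr q n v ==> pred q n (%I Z. g.band I (d I Z) (c I Z) e (v I Z))" unfolding g.band_def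
 by (assumption | rule ex bnd | (erule mono, linarith) | linarith | rule bexpr_expr)+

lemma expr_scan_band[ex]: "bexpr q n d ==> bexpr q n c ==> bexpr q n v ==> expr q n (%I Z. scan (g.band I (d I Z) (c I Z)) (v I Z))"
 by (insert expr_scan[where r = 2 and P = "%I xs. g.band I (xs ! 0) (xs ! 1)" and as = "[d, c]" and v = v])
  (simp add: bexpr_nth expr_band)

text \<open>Whether a scan changes at \<open>v\<close> can be told from its value at
  \<open>v\<close>; this avoids the argument \<open>Suc v\<close>, which may reach the
  bound.\<close>

lemma expr_scan_step:
 assumes P: "pred q n (%I Z. P I Z True (v I Z))" "pred q n (%I Z. P I Z False (v I Z))"
  and s: "expr q n (%I Z. scan (P I Z) (v I Z))" and v: "bexpr q n v"
 shows "pred q n (%I Z. scan (P I Z) (Suc (v I Z)) ~= scan (P I Z) (v I Z))"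
proof (rule expr_cong)
 let ?s = "%I Z. scan (P I Z) (v I Z)" and ?e = "%I x. EX v<bound I. x = v + (v :: nat)"
 show "pred q n (%I Z. P I Z True (v I Z) & ?e I (?s I Z) \<or> P I Z False (v I Z) & (~ ?e I (?s I Z) \<or> ?s I Z = 0))"
  by (intro expr_or expr_and expr_not expr_eq expr_const expr_even P s expr_pos[OF s])
 fix I Z assume g: "good I" "okenv n I Z"
 have "?e I (?s I Z) <-> even (?s I Z)" using scan_le[of "P I Z" "v I Z"] bexpr_less[OF v g] by (intro even_bounded) auto
 thus "of_bool (P I Z True (v I Z) & ?e I (?s I Z) \<or> P I Z False (v I Z) & (~ ?e I (?s I Z) \<or> ?s I Z = 0)) =
  (of_bool (scan (P I Z) (Suc (v I Z)) ~= ?s I Z) :: nat)" by auto qed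

lemma expr_nf[ex]: "bexpr q n d ==> bexpr q n v ==> pred q n (%I Z. g.nf I (d I Z) (v I Z))" unfolding g.nf_def
 by (assumption | rule expr_scan_step ex bnd | (erule bexpr_pos bexpr_mono, linarith) | linarith | rule bexpr_expr)+

lemma expr_ff[ex]: "bexpr q n d ==> bexpr q n v ==> expr q n (%I Z. g.ff I (d I Z) (v I Z))"
 by (rule expr_rec1[where F = "%I. g.ff I" and S = "%I v d f. f + (if g.nf I d (if Suc v < bound I then Suc v else 0) then 1 else 0)"])
  (assumption | rule ex bnd | (erule mono, linarith) | linarith | rule bexpr_expr | simp)+

lemma expr_no_conflict[ex]: "0 < n ==> pred q n (%I Z. g.no_conflict I)" unfolding g.no_conflict_def
 by (assumption | rule ex bnd | (erule mono, linarith) | linarith | rule bexpr_expr)+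

lemma bexpr_if: "pred q n P ==> bexpr q n a ==> bexpr q n b ==>
  bexpr q n (%I Z. if P I Z then a I Z else b I Z)" unfolding bexpr_def by (simp add: expr_if)

lemma bexpr_dir[ex]: "bexpr q n w ==> expr q n l ==> bexpr q n (%I Z. g.dir I (w I Z) (l I Z))" unfolding g.dir_def
 by (rule bexpr_if) (assumption | rule ex bnd | (erule mono, linarith) | linarith | rule bexpr_expr)+

lemma expr_strip[ex]: "bexpr q n w ==> expr q n l ==> pred q n (%I Z. g.strip I (w I Z) (l I Z))" unfolding g.strip_def
 by (assumption | rule ex bnd | (erule mono, linarith) | linarith | rule bexpr_expr)+

lemma [THEN P3D, ex]: "P3 g.active"
 by (unfold g.active_def, (rule P3I, (assumption | rule ex bnd | (erule mono, linarith) | linarith | rule bexpr_expr)+))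

lemma [THEN P5D, ex]: "P5 g.inA" "P5 g.inB"
 by (unfold g.inA_def g.inB_def, (rule P5I, (assumption | rule ex bnd | (erule mono, linarith) | linarith | rule bexpr_expr)+)+)

lemma expr_stP[ex]:
 "bexpr q n w ==> bexpr q n l ==> bexpr q n m ==> bexpr q n a ==> bexpr q n b ==> bexpr q n v ==>
  pred q n (%I Z. g.stP I (w I Z) (l I Z) (m I Z) (a I Z) (b I Z) e (v I Z))" unfolding g.stP_def
 by (assumption | rule ex bnd | (erule mono, linarith) | linarith | rule bexpr_expr)+

lemma expr_lab[ex]:
 "bexpr q n w ==> bexpr q n l ==> bexpr q n m ==> bexpr q n a ==> bexpr q n b ==> bexpr q n z ==>
  expr q n (%I Z. g.lab I (w I Z) (l I Z) (m I Z) (a I Z) (b I Z) (z I Z))" unfolding g.lab_def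
 by (insert expr_scan[where r = 5 and P = "%I xs. g.stP I (xs ! 0) (xs ! Suc 0) (xs ! 2) (xs ! 3) (xs ! 4)" and as = "[w, l, m, a, b]"
  and v = "%I Z. Suc (rk I (g.dir I (w I Z) (m I Z)) (z I Z))"])
  (simp add: bexpr_nth expr_stP bexpr_rk bexpr_expr bexpr_dir del: scan.simps One_nat_def)

lemma [THEN P4D, ex]: "P4 g.nearA" "P4 g.nearB"
 by (unfold g.nearA_def g.nearB_def, (rule P4I, (assumption | rule ex bnd | (erule mono, linarith) | linarith | rule bexpr_expr)+)+)

lemma [THEN P6D, ex]: "P6 g.leadA" "P6 g.leadB"
 by (unfold g.leadA_def g.leadB_def, (rule P6I, (assumption | rule ex bnd | (erule mono, linarith) | linarith | rule bexpr_expr)+)+)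

lemma [THEN P5D, ex]: "P5 g.valid"
 by (unfold g.valid_def, (rule P5I, (assumption | rule ex bnd | (erule mono, linarith) | linarith | rule bexpr_expr)+))

lemma [THEN P3D, ex]: "P3 g.pos_ok"
 by (unfold g.pos_ok_def, (rule P3I, (assumption | rule ex bnd | (erule mono, linarith) | linarith | rule bexpr_expr)+))

lemma [THEN P3D, ex]: "P3 g.allowed"
 by (unfold g.allowed_def, (rule P3I, (assumption | rule ex bnd | (erule mono, linarith) | linarith | rule bexpr_expr)+))

lemma [THEN P5D, ex]: "P5 g.beyond"
 by (unfold g.beyond_def, (rule P5I, (assumption | rule ex bnd | (erule mono, linarith) | linarith | rule bexpr_expr)+))

lemma [THEN P7D, ex]: "P7 g.corner"
 by (unfold g.corner_def, (rule P7I, (assumption | rule ex bnd | (erule mono, linarith) | linarith | rule bexpr_expr)+))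

lemma [THEN P5D, ex]: "P5 g.corners"
 by (unfold g.corners_def, (rule P5I, (assumption | rule ex bnd | (erule mono, linarith) | linarith | rule bexpr_expr)+))

lemma [THEN P5D, ex]: "P5 g.sysA" "P5 g.sysB"
 by (unfold g.sysA_def g.sysB_def, (rule P5I, (assumption | rule ex bnd | (erule mono, linarith) | linarith | rule bexpr_expr)+)+)

lemma [THEN P5D, ex]: "P5 g.systems"
 by (unfold g.systems_def, (rule P5I, (assumption | rule ex bnd | (erule mono, linarith) | linarith | rule bexpr_expr)+))

lemma [THEN P5D, ex]: "P5 g.E"
 by (unfold g.E_def, (rule P5I, (assumption | rule ex bnd | (erule mono, linarith) | linarith | rule bexpr_expr)+))

lemma [THEN P4D, ex]: "P4 g.is_rep"
 by (unfold g.is_rep_def, (rule P4I, (assumption | rule ex bnd | (erule mono, linarith) | linarith | rule bexpr_expr)+))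

lemma [THEN P5D, ex]: "P5 g.E2"
 by (unfold g.E2_def, (rule P5I, (assumption | rule ex bnd | (erule mono, linarith) | linarith | rule bexpr_expr)+))

lemma [THEN P1D, ex]: "P1 g.check"
 by (unfold g.check_def, (rule P1I, (assumption | rule ex bnd | (erule mono, linarith) | linarith | rule bexpr_expr)+))

text \<open>Definable sets of cuts, given through membership; \<open>vexpr\<close> does the same for
  vectors through their entries, which may reach the bound itself because parts are stored shifted
  by \<open>Suc\<close>.\<close>

definition sexpr where
 "sexpr q n C <-> 0 < n & (ALL n'>=n. ALL l s. bexpr q n' l --> bexpr q n' s --> pred q n' (%I Z. (l I Z, s I Z) : C I Z))"

definition vexpr where
 "vexpr q n B <-> 0 < n & (ALL n'>=n. ALL l. bexpr q n' l --> expr q n' (%I Z. B I Z (l I Z)) &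
  (ALL I Z. good I --> okenv n' I Z --> B I Z (l I Z) <= bound I))"

section \<open>Contraction sequence and table as definable functions\<close>

lemma sexpr_mono: "sexpr q n C ==> n <= n' ==> sexpr q n' C" and vexpr_mono: "vexpr q n B ==> n <= n' ==> vexpr q n' B"
 and sexpr_pos: "sexpr q n C ==> n <= n' ==> 0 < n'" and vexpr_pos: "vexpr q n B ==> n <= n' ==> 0 < n'"
 unfolding sexpr_def vexpr_def by (meson less_le_trans le_trans)+

lemma expr_mem[ex]: "bexpr q n l ==> bexpr q n s ==> sexpr q n C ==> pred q n (%I Z. (l I Z, s I Z) : C I Z)" unfolding sexpr_def by blast

lemma expr_vexpr: "vexpr q n B ==> bexpr q n l ==> expr q n (%I Z. B I Z (l I Z))" unfolding vexpr_def by blast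

lemmas [mono] = sexpr_pos sexpr_mono vexpr_pos vexpr_mono

lemma vexpr_le: "vexpr q n B ==> bexpr q n l ==> good I ==> okenv n I Z ==> B I Z (l I Z) <= bound I" unfolding vexpr_def by blast

lemma vexprI:
 assumes "0 < n" "!!n' l. n <= n' ==> bexpr q n' l ==> expr q n' (%I Z. B I Z (l I Z))"
  and "!!n' l I Z. n <= n' ==> bexpr q n' l ==> good I ==> okenv n' I Z ==> B I Z (l I Z) <= bound I"
 shows "vexpr q n B" unfolding vexpr_def using assms by blast

lemma bexpr_vexpr: "vexpr q n B ==> bexpr q n l ==> bexpr q n (%I Z. B I Z (l I Z) - 1)"
proof (rule bexprI, rule expr_diff, erule (1) expr_vexpr)
 assume "bexpr q n l"
 thus "expr q n (%I Z. 1)" by (intro expr_const bexpr_pos[of q n l n]) auto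
 fix I Z assume a: "vexpr q n B" "bexpr q n l" "good I" "okenv n I Z"
 hence "B I Z (l I Z) <= bound I" unfolding vexpr_def by blast
 thus "B I Z (l I Z) - 1 < bound I" using good_pos[OF a(3)] by linarith
qed

lemma expr_pidx[ex]: "sexpr q n C ==> bexpr q n l ==> bexpr q n a ==> expr q n (%I Z. c.pidx (C I Z) (l I Z) (a I Z))"
proof -
 assume a: "sexpr q n C" "bexpr q n l" "bexpr q n a"
 have "expr q n (%I Z. card {v. v < Suc (a I Z) & 0 < v & (l I Z, v) : C I Z})"
  by (insert a, (rule Suc_leI bexpr_less[OF a(3)] | assumption | rule ex bnd | (erule mono, linarith) | linarith | rule bexpr_expr)+)
 thus ?thesis unfolding c.pidx_def by (rule expr_cong) (auto simp: less_Suc_eq_le intro: arg_cong[of _ _ card])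
qed

lemma bex_less: "(EX a:{a. a < n & Q a}. P a) <-> (EX a<n. Q a & P a)" by auto

lemma expr_isl[ex]:
 "sexpr q n C ==> bexpr q n l ==> bexpr q n s ==> pred q n (%I Z. c.isl I (C I Z) (l I Z) (s I Z))" unfolding c.isl_def
 by (assumption | rule ex bnd | (erule mono, linarith) | linarith | rule bexpr_expr)+

lemma expr_someT[ex]:
 "bexpr q n w ==> sexpr q n C ==> bexpr q n l ==> bexpr q n s ==> bexpr q n t ==> bexpr q n u ==>
  pred q n (%I Z. c.someT I (w I Z) (C I Z) (l I Z) (s I Z) (t I Z) (u I Z))"
 unfolding c.someT_def c.part_def c.merged_def c.window_def c.nonconst_def bex_less
 by (assumption | rule ex bnd | (erule mono, linarith) | linarith | rule bexpr_expr)+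

lemma expr_someF[ex]:
 "bexpr q n w ==> sexpr q n C ==> bexpr q n l ==> bexpr q n s ==> bexpr q n t ==> bexpr q n u ==>
  pred q n (%I Z. c.someF I (w I Z) (C I Z) (l I Z) (s I Z) (t I Z) (u I Z))"
 unfolding c.someF_def c.part_def c.merged_def c.window_def c.nonconst_def bex_less
 by (assumption | rule ex bnd | (erule mono, linarith) | linarith | rule bexpr_expr)+

lemma expr_red[ex]:
 "bexpr q n w ==> sexpr q n C ==> bexpr q n l ==> bexpr q n s ==> bexpr q n t ==> bexpr q n u ==>
  pred q n (%I Z. c.red I (w I Z) (C I Z) (l I Z) (s I Z) (t I Z) (u I Z))" unfolding c.red_def
 by (assumption | rule ex bnd | (erule mono, linarith) | linarith | rule bexpr_expr)+

lemma expr_pok[ex]: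
 "bexpr q n w ==> sexpr q n C ==> vexpr q n B ==> pred q n (%I Z. c.pok I (w I Z) (C I Z) (B I Z))" unfolding c.pok_def
 by (assumption | rule expr_vexpr[where B = B] bexpr_vexpr[where B = B] ex bnd | (erule mono, linarith) | linarith | rule bexpr_expr)+

lemma expr_rank[ex]:
 "bexpr q n w ==> sexpr q n C ==> bexpr q n l ==> bexpr q n s ==> bexpr q n t ==> bexpr q n u ==>
  expr q n (%I Z. c.rank I (w I Z) (C I Z) (l I Z) (s I Z) (t I Z) (u I Z))" unfolding c.rank_def
 by (rule less_imp_le, erule (2) bexpr_less | assumption | rule ex bnd | (erule mono, linarith) | linarith | rule bexpr_expr)+

lemma expr_deg[ex]:
 "bexpr q n w ==> sexpr q n C ==> pred q n (%I Z. c.deg I (w I Z) (C I Z))" unfolding c.deg_def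
 by (assumption | rule ex bnd | (erule mono, linarith) | linarith | rule bexpr_expr)+

lemma card_pairs: "card {(t, u). t < K & t ~= l & c.isl I C t u & P t u} = (\<Sum>t<K. card {u. u < Suc (NN I) & t ~= l & c.isl I C t u & P t u})"
proof -
 have "{(t, u). t < K & t ~= l & c.isl I C t u & P t u} =
  (SIGMA t:{..<K}. {u. u < Suc (NN I) & t ~= l & c.isl I C t u & P t u})" by (auto simp: c.isl_def) thus ?thesis by (simp add: card_SigmaI) qed

lemma expr_cost[ex]:
 "bexpr q n w ==> sexpr q n C ==> bexpr q n l ==> bexpr q n s ==> expr q n (%I Z. c.cost I (w I Z) (C I Z) (l I Z) (s I Z))"
 unfolding c.cost_def c.part_def c.merged_def c.window_def c.nonconst_def bex_less card_pairs
 by (assumption | rule ex bnd | (erule mono, linarith) | linarith | rule bexpr_expr)+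

lemma expr_cheap[ex]:
 "bexpr q n w ==> sexpr q n C ==> bexpr q n l ==> bexpr q n s ==> pred q n (%I Z. c.cheap I (w I Z) (C I Z) (l I Z) (s I Z))" unfolding c.cheap_def
 by (assumption | rule ex bnd | (erule mono, linarith) | linarith | rule bexpr_expr)+

lemma expr_pick[ex]:
 "bexpr q n w ==> sexpr q n C ==> bexpr q n l ==> bexpr q n s ==> pred q n (%I Z. c.pick I (w I Z) (C I Z) (l I Z) (s I Z))" unfolding c.pick_def
 by (assumption | rule ex bnd | (erule mono, linarith) | linarith | rule bexpr_expr)+

lemma expr_remove[ex]: "bexpr q n w ==> sexpr q n C ==> bexpr q n l ==> bexpr q n s ==>
  pred q n (%I Z. (l I Z, s I Z) : c.remove I (w I Z) (C I Z))" unfolding c.remove_def mem_Collect_eq split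
 by (assumption | rule ex bnd | (erule mono, linarith) | linarith | rule bexpr_expr)+

lemma expr_all_cuts: "bexpr q n l ==> bexpr q n s ==> pred q n (%I Z. (l I Z, s I Z) : c.all_cuts I)"
 unfolding c.all_cuts_def mem_Collect_eq split by (assumption | rule ex bnd | (erule mono, linarith) | linarith | rule bexpr_expr)+

text \<open>The set of cuts is stored as its characteristic function, and \<open>remove\<close> acts
  on the set decoded from the values of the previous stage.\<close>

lemma expr_cuts:
 assumes "bexpr q n w" "bexpr q n i" "bexpr q n l" "bexpr q n s"
 shows "pred q n (%I Z. (l I Z, s I Z) : c.cuts I (w I Z) (i I Z))"
proof -
 let ?F = "%I i xs. of_bool ((xs ! Suc 0, xs ! 2) : c.cuts I (xs ! 0) i)"
 have "expr q n (%I Z. ?F I (i I Z) (map (%a. a I Z) [w, l, s]))"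
 proof (rule expr_rec[where F = ?F and r = 3 and B = "%I xs. of_bool ((xs ! Suc 0, xs ! 2) : c.all_cuts I)"
  and S = "%I i xs p. of_bool ((xs ! Suc 0, xs ! 2) : c.remove I (xs ! 0) {(l, s). 0 < p [xs ! 0, l, s]})"])
  fix q n as assume as: "length as = 3" "ALL a:set as. bexpr q n a"
  have b: "bexpr q n (as ! 0)" "bexpr q n (as ! Suc 0)" "bexpr q n (as ! 2)" using as by (auto intro: bexpr_nth)
  show "pred q n (%I Z. (map (%a. a I Z) as ! Suc 0, map (%a. a I Z) as ! 2) : c.all_cuts I)" using expr_all_cuts[OF b(2,3)] as(1) by simp
  fix i and p :: "inst => (nat => nat) => nat list => nat"
  assume i: "0 < n" "bexpr q n i"
  and p: "!!n' bs. n <= n' ==> length bs = 3 ==> ALL b:set bs. bexpr q n' b ==> expr q n' (%I Z. p I Z (map (%b. b I Z) bs))"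
  have "expr q n' (%I Z. p I Z [(as ! 0) I Z, l I Z, s I Z])" if "n <= n'" "bexpr q n' l" "bexpr q n' s" for n' l s
  using p[of n' "[as ! 0, l, s]"] bexpr_mono[OF b(1)] that by simp
  hence "sexpr q n (%I Z. {(l, s). 0 < p I Z [(as ! 0) I Z, l, s]})"
  unfolding sexpr_def mem_Collect_eq split using i(1) by (auto intro!: expr_less expr_const)
  from expr_remove[OF b(1) this b(2,3)]
  show "pred q n (%I Z. (map (%a. a I Z) as ! Suc 0, map (%a. a I Z) as ! 2) :
  c.remove I (map (%a. a I Z) as ! 0) {(l, s). 0 < p I Z [map (%a. a I Z) as ! 0, l, s]})" using as(1) by simp qed (use assms in auto)
 thus ?thesis by simp
qed

lemma sexpr_cuts[ex]: "bexpr q n w ==> bexpr q n i ==> sexpr q n (%I Z. c.cuts I (w I Z) (i I Z))"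
 unfolding sexpr_def using expr_cuts bexpr_mono bexpr_pos by blast

text \<open>Entries stay at most the bound, so an entry minus one is a legal argument in the
  recursion.\<close>

lemma vec_le: "s < M ==> Suc (NN I) <= M ==> c.vec I w C l s U j t <= M"
proof (induction j arbitrary: t)
 case (Suc j)
 let ?X = "\<Sum>u<Suc (NN I). if c.isl I C t u & c.red I w C (U (3 * j)) (c.vec I w C l s U j (U (3 * j)) - 1) t u
  & c.rank I w C (U (3 * j)) (c.vec I w C l s U j (U (3 * j)) - 1) t u = U (3 * j + 2) then Suc u else 0"
 have "x <= m" if "x = 0 \<or> (EX u<m. P u & x = Suc u)" for x m :: nat and P using that by auto
 hence "?X <= Suc (NN I)" using c.neighbour_sum_valid .
 hence X: "?X <= M" using Suc.prems(2) by (rule le_trans)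
 have "(if P then x else y) <= M" if "x <= M" "y <= M" for P and x y :: nat using that by simp
 from this[OF X Suc.IH[OF Suc.prems]] show ?case unfolding c.vec.simps .
qed simp

lemma bexpr_digit[ex]: "bexpr q n u ==> expr q n i ==> bexpr q n (%I Z. digit (base (kk I)) (u I Z) (if i I Z < bound I then i I Z else 0))"
proof (rule bexprI[OF expr_digit[OF _ bexpr_clip]])
 fix I x i assume "good I"
 hence "base (kk I) <= bound I" by (rule bnd)
 moreover have "digit (base (kk I)) x i < base (kk I)" using base_gt_1[of "kk I"] unfolding digit_def by simp
 ultimately show "digit (base (kk I)) x i < bound I" by linarith
qed

text \<open>One step of \<open>vec\<close> with the recursive values as plain arguments.\<close>

definition step_vec :: "inst => nat => (nat \<times> nat) set => nat => nat => nat => nat => nat => nat => nat => nat" where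
 "step_vec I w C d0 d1 d2 t x y z = (if t = d1 & t < kk I + 4 & d0 < kk I + 4 & d0 ~= t & x ~= 0 & y = 0
  then \<Sum>u<Suc (NN I). if c.isl I C t u & c.red I w C d0 z t u & c.rank I w C d0 z t u = d2 then Suc u else 0 else y)"

lemma expr_step_vec: "bexpr q n w ==> sexpr q n C ==> bexpr q n d0 ==> bexpr q n d1 ==> bexpr q n d2 ==> bexpr q n t ==>
  expr q n x ==> expr q n y ==> bexpr q n z ==>
  expr q n (%I Z. step_vec I (w I Z) (C I Z) (d0 I Z) (d1 I Z) (d2 I Z) (t I Z) (x I Z) (y I Z) (z I Z))" unfolding step_vec_def
 by (assumption | rule ex bnd | (erule mono, linarith) | linarith | rule bexpr_expr)+

lemma expr_vec:
 assumes "bexpr q n w" "bexpr q n i" "bexpr q n l" "bexpr q n s" "bexpr q n u" "bexpr q n t" "bexpr q n j"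
 shows "expr q n (%I Z. c.vec I (w I Z) (c.cuts I (w I Z) (i I Z)) (l I Z) (s I Z)
  (%x. digit (base (kk I)) (u I Z) (if x < bound I then x else 0)) (j I Z) (t I Z))" proof -
 let ?d = "%I u x. digit (base (kk I)) u (if x < bound I then x else 0)"
 let ?c = "%I x. if x < bound I then x else 0"
 let ?F = "%I j xs. c.vec I (xs ! 0) (c.cuts I (xs ! 0) (xs ! Suc 0)) (xs ! 2) (?c I (xs ! 3)) (?d I (xs ! 4)) j (xs ! 5)"
 let ?p = "%xs p y. p [xs ! 0, xs ! Suc 0, xs ! 2, xs ! 3, xs ! 4, y]"
 let ?B = "%I xs. if xs ! 5 = xs ! 2 then Suc (?c I (xs ! 3)) else 0"
 let ?S = "%I j xs p. step_vec I (xs ! 0) (c.cuts I (xs ! 0) (xs ! Suc 0)) (?d I (xs ! 4) (3 * j)) (?d I (xs ! 4) (3 * j + 1))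
  (?d I (xs ! 4) (3 * j + 2)) (xs ! 5) (?p xs p (?d I (xs ! 4) (3 * j))) (?p xs p (xs ! 5)) (?c I (?p xs p (?d I (xs ! 4) (3 * j)) - 1))"
 have "expr q n (%I Z. ?F I (j I Z) (map (%a. a I Z) [w, i, l, s, u, t]))"
 proof (rule expr_rec[where F = ?F and r = 6 and B = ?B and S = ?S])
  fix q n as assume "length as = 6" and b: "ALL a:set as. bexpr q n a"
  then obtain w i l s u t where as: "as = [w, i, l, s, u, t]" by (auto simp: length_Suc_conv numeral_eq_Suc)
  hence bs: "bexpr q n w" "bexpr q n i" "bexpr q n l" "bexpr q n s" "bexpr q n u" "bexpr q n t" using b by auto
  show "expr q n (%I Z. ?B I (map (%a. a I Z) as))"
  using bs unfolding as by (simp cong: if_cong) (assumption | rule ex bnd | (erule mono, linarith) | linarith | rule bexpr_expr)+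
  fix j and p :: "inst => (nat => nat) => nat list => nat"
  assume i: "0 < n" "bexpr q n j"
  and p: "!!n' bs. n <= n' ==> length bs = 6 ==> ALL b:set bs. bexpr q n' b ==> expr q n' (%I Z. p I Z (map (%b. b I Z) bs))"
  have pe: "expr q n (%I Z. p I Z [w I Z, i I Z, l I Z, s I Z, u I Z, y I Z])" if "bexpr q n y" for y
  using p[of n "[w, i, l, s, u, y]"] bs that by simp
  show "expr q n (%I Z. ?S I (j I Z) (map (%a. a I Z) as) (p I Z))"
  using i bs unfolding as by (simp cong: if_cong) (rule expr_step_vec pe | assumption | rule ex bnd | (erule mono, linarith) | linarith | rule bexpr_expr)+
 next
  fix I :: inst and j xs assume g: "good I"
  define V where "V = c.vec I (xs ! 0) (c.cuts I (xs ! 0) (xs ! Suc 0)) (xs ! 2) (?c I (xs ! 3)) (?d I (xs ! 4)) j"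
  have "V y <= bound I" for y unfolding V_def using good_pos[OF g] bnd(3)[OF g] by (intro vec_le) auto
  hence "V y - 1 < bound I" for y using good_pos[OF g] by (metis diff_less less_numeral_extra(1) linorder_not_less le_less_trans not_gr_zero diff_le_self nat_less_le)
  hence V: "?c I (V y - 1) = V y - 1" for y by simp
  have F: "?F I j [xs ! 0, xs ! Suc 0, xs ! 2, xs ! 3, xs ! 4, y] = V y" for y unfolding V_def by (simp cong: if_cong)
  show "?F I (Suc j) xs = ?S I j xs (?F I j)" unfolding F V step_vec_def c.vec.simps V_def[symmetric] ..
 qed (use assms in "simp_all cong: if_cong")
 thus ?thesis by (rule expr_cong) (simp cong: if_cong add: bexpr_less[OF assms(4)])
qed

lemma vexpr_code:
 assumes "bexpr q n w" "bexpr q n i" "bexpr q n l" "bexpr q n s" "bexpr q n u"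
 shows "vexpr q n (%I Z. c.code I (w I Z) (c.cuts I (w I Z) (i I Z)) (l I Z) (s I Z) (u I Z))" unfolding vexpr_def
proof (intro conjI allI impI)
 show "0 < n" using assms(1) by (rule bexpr_pos) simp
 hence bK: "bexpr q n (%I Z. kk I + 4)" by (intro bexprI expr_add expr_kk expr_const bnd)
 fix n' t assume n: "n <= n'" "bexpr q n' t"
 show "expr q n' (%I Z. c.code I (w I Z) (c.cuts I (w I Z) (i I Z)) (l I Z) (s I Z) (u I Z) (t I Z))"
 proof (rule expr_cong[OF expr_vec[where j = "%I Z. kk I + 4", OF assms[THEN bexpr_mono[OF _ n(1)]] n(2) bexpr_mono[OF bK n(1)]]])
  fix I :: inst assume g: "good I"
  have "3 * (kk I + 4) < bound I" using g by (rule bnd)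
  thus "c.vec I w C l s (%x. digit (base (kk I)) u (if x < bound I then x else 0)) (kk I + 4) t = c.code I w C l s u t" for w C l s u t
  unfolding c.code_def by (intro c.vec_cong) simp
 qed
 show "c.code I (w I Z) (c.cuts I (w I Z) (i I Z)) (l I Z) (s I Z) (u I Z) (t I Z) <= bound I"
  if "good I" "okenv n' I Z" for I Z
  unfolding c.code_def using bexpr_less[OF bexpr_mono[OF assms(4) n(1)] that] bnd(3)[OF that(1)] by (rule vec_le)
qed

lemmas expr_code = expr_vexpr[OF vexpr_code]

lemma vexpr_upd: "vexpr q n B ==> bexpr q n t ==> bexpr q n u ==> vexpr q n (%I Z. (B I Z)(t I Z := Suc (u I Z)))"
 by (rule vexprI) (simp_all add: vexpr_pos[OF _ order_refl] expr_if expr_eq expr_Suc bexpr_expr bexpr_mono expr_vexpr vexpr_mono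
  Suc_leI[OF bexpr_less[OF bexpr_mono]] vexpr_le[OF vexpr_mono])

lemma vexpr_full: "0 < n ==> vexpr q n (%I Z. c.full I)" unfolding c.full_def
 by (rule vexprI) (simp_all add: expr_if expr_less expr_add expr_kk expr_const bexpr_expr Suc_leI good_pos)

lemma expr_subv_code:
 assumes "bexpr q n w" "bexpr q n i" "bexpr q n l" "bexpr q n s" "bexpr q n u" "vexpr q n B"
 shows "pred q n (%I Z. c.subv I (c.code I (w I Z) (c.cuts I (w I Z) (i I Z)) (l I Z) (s I Z) (u I Z)) (B I Z))" unfolding c.subv_def
 by (insert assms, (rule expr_code | assumption | rule expr_vexpr[where B = B] bexpr_vexpr[where B = B] ex bnd | (erule mono, linarith) | linarith | rule bexpr_expr)+)

lemma expr_combine: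
 assumes "bexpr q n w" "bexpr q n i" "vexpr q n B"
  and F: "!!n' l s u. n <= n' ==> bexpr q n' l ==> bexpr q n' s ==> bexpr q n' u ==> pred q n' (%I Z. F I Z (l I Z) (s I Z) (u I Z))"
 shows "pred q n (%I Z. c.combine I (w I Z) (c.cuts I (w I Z) (i I Z)) (base (kk I) ^ (3 * (kk I + 4))) (F I Z) (B I Z))"
proof -
 have W: "expr q n (%I Z. base (kk I) ^ (3 * (kk I + 4)))" if "0 < n" for q n
  using that by (intro expr_base_pow bexprI expr_mult expr_const expr_add expr_kk) (assumption | rule bnd)+
 show ?thesis unfolding c.combine_def
  by (insert assms(1-3), (rule expr_subv_code W F | assumption | rule expr_vexpr[where B = B] bexpr_vexpr[where B = B] ex bnd | (erule mono, linarith) | linarith | rule bexpr_expr)+)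
qed

definition step_tab :: "inst => nat => nat => nat => (nat => nat => nat => bool) => nat => nat => nat => bool" where
 "step_tab I w i i' F l s u <-> (let W = base (kk I) ^ (3 * (kk I + 4)); C = c.cuts I w i; D = c.code I w (c.cuts I w i') l s u in
  c.combine I w C W F D \<or> (EX t<kk I + 4. EX u<Suc (NN I). EX p<Suc (NN I). c.pick I w C t u & c.isl I C t p &
  Suc (c.pidx C t p) = c.pidx C t u & D t = Suc p & c.combine I w C W F (D(t := Suc u))))"

lemma expr_step_tab:
 assumes "bexpr q n w" "bexpr q n i" "bexpr q n i'" "bexpr q n l" "bexpr q n s" "bexpr q n u"
  and F: "!!n' l s u. n <= n' ==> bexpr q n' l ==> bexpr q n' s ==> bexpr q n' u ==> pred q n' (%I Z. F I Z (l I Z) (s I Z) (u I Z))"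
 shows "pred q n (%I Z. step_tab I (w I Z) (i I Z) (i' I Z) (F I Z) (l I Z) (s I Z) (u I Z))" unfolding step_tab_def Let_def
 by (insert assms(1-6), (rule expr_combine vexpr_upd vexpr_code expr_code F | assumption | rule ex bnd | (erule mono, linarith) | linarith | rule bexpr_expr | (erule (1) order_trans))+)

lemma expr_tab:
 assumes "bexpr q n w" "bexpr q n i" "bexpr q n l" "bexpr q n s" "bexpr q n u"
 shows "pred q n (%I Z. c.tab I (w I Z) (base (kk I) ^ (3 * (kk I + 4))) (i I Z) (l I Z) (s I Z) (u I Z))"
proof -
 let ?W = "%I. base (kk I) ^ (3 * (kk I + 4))"
 let ?F = "%I i xs. of_bool (c.tab I (xs ! 0) (?W I) i (xs ! Suc 0) (xs ! 2) (xs ! 3))"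
 let ?B = "%I xs. of_bool (c.pok I (xs ! 0) (c.cuts I (xs ! 0) 0) (c.code I (xs ! 0) (c.cuts I (xs ! 0) 0) (xs ! Suc 0) (xs ! 2) (xs ! 3)))"
 let ?c = "%I x. if x < bound I then x else 0"
 let ?S = "%I i xs p. of_bool (step_tab I (xs ! 0) i (?c I (Suc i)) (%l s u. 0 < p [xs ! 0, l, s, u]) (xs ! Suc 0) (xs ! 2) (xs ! 3))"
 have "expr q n (%I Z. ?F I (i I Z) (map (%a. a I Z) [w, l, s, u]))"
 proof (rule expr_rec[where F = ?F and r = 4 and B = ?B and S = ?S])
  fix q n as assume n: "0 < n" and "length as = 4" and b: "ALL a:set as. bexpr q n a"
  then obtain w l s u where as: "as = [w, l, s, u]" by (auto simp: length_Suc_conv numeral_eq_Suc)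
  hence bs: "bexpr q n w" "bexpr q n l" "bexpr q n s" "bexpr q n u" using b by auto
  show "expr q n (%I Z. ?B I (map (%a. a I Z) as))"
  using bs n unfolding as by (simp cong: if_cong del: c.cuts.simps) (rule vexpr_code | assumption | rule ex bnd | (erule mono, linarith) | linarith | rule bexpr_expr)+
  fix i and p :: "inst => (nat => nat) => nat list => nat"
  assume i: "bexpr q n i"
  and p: "!!n' bs. n <= n' ==> length bs = 4 ==> ALL b:set bs. bexpr q n' b ==> expr q n' (%I Z. p I Z (map (%b. b I Z) bs))"
  have pe: "expr q n' (%I Z. p I Z [w I Z, l I Z, s I Z, u I Z])" if "n <= n'" "bexpr q n' l" "bexpr q n' s" "bexpr q n' u" for n' l s u
  using p[of n' "[w, l, s, u]"] bexpr_mono[OF bs(1)] that by simp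
  show "expr q n (%I Z. ?S I (i I Z) (map (%a. a I Z) as) (p I Z))"
  using i bs n unfolding as by (simp cong: if_cong) (rule expr_step_tab pe | assumption | rule ex bnd | (erule mono, linarith) | linarith | rule bexpr_expr)+
 qed (use assms in "auto simp: step_tab_def c.update_def Let_def cong: if_cong")
 thus ?thesis by simp
qed

lemma expr_accepting[ex]:
 "bexpr q n w ==> pred q n (%I Z. c.accepting I (w I Z))"
proof -
 assume w: "bexpr q n w"
 have Kn: "expr q n' (%I Z. (kk I + 4) * Suc (NN I))" if "0 < n'" for n' using that by (intro expr_mult ex bnd)
 have bKn: "bexpr q n' (%I Z. (kk I + 4) * Suc (NN I))" if "n <= n'" for n' using bexpr_pos[OF w that] by (intro bexprI Kn bnd)
 show ?thesis unfolding c.accepting_def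
  by (insert w, (rule expr_combine vexpr_full expr_tab Kn bKn | assumption | rule ex bnd | (erule mono, linarith) | linarith | rule bexpr_expr)+)
qed

lemma expr_accepted:
 "bexpr q n w ==> pred q n (%I Z. g.accepted I (w I Z) (base (kk I)))" unfolding g.accepted_def
 by (assumption | rule ex bnd | (erule mono, linarith) | linarith | rule bexpr_expr)+

theorem expr_solvable: "0 < n ==> pred q n (%I Z. points.solvable (NN I) (kk I) (rk I) (rd I))" unfolding points.solvable_iff[OF pts]
proof (rule expr_ex_less)
 assume n: "0 < n"
 have "bexpr q n (%I Z. 9 * width (kk I) * width (kk I))"
  by (intro bexprI expr_mult expr_const expr_width n) (auto intro: const_le width_bounds)
 thus "expr q n (%I Z. guesses (kk I))" unfolding guesses_def by (rule expr_base_pow)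
qed (rule expr_accepted bnd, assumption)+

end


section \<open>The running time\<close>

text \<open>The number of guesses is a power whose base and exponent must not exceed the loop bound
  when it is computed. The 13th power of the first bound is enough: the base is
  \<open>(k + 5) ^ 12\<close>, and \<open>exponent_less\<close> covers the exponent.\<close>

lemma stage1: "EX s B V. stage_size B V s & (ALL I h Z. bound I = NN I + kk I + 5 --> eval I (run I 0 Z (fst s) h) 1 (%_. 0) (snd s) = bound I ^ 13)"
proof -
 interpret lang "%I. bound I = NN I + kk I + 5" by unfold_locales simp
 show ?thesis by (intro stage_exists expr_power) simp
qed

lemma exponent_less: "9 * width k * width k < (k + 5) ^ 13"
proof -
 have "9 * width k * width k = 225 * ((k + 4) * (k + 4))" unfolding width_def by (simp add: algebra_simps)
 also have "... < 5 ^ 4 * ((k + 5) * (k + 5))" by (intro mult_less_le_imp_less mult_le_mono) auto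
 also have "... <= (k + 5) ^ 4 * (k + 5) ^ 2" by (intro mult_le_mono power_mono) (auto simp: power2_eq_square)
 also have "... = (k + 5) ^ 6" by (simp add: power_add[symmetric])
 also have "... <= (k + 5) ^ 13" by (intro power_increasing) auto
 finally show ?thesis .
qed

lemma stage2: "EX s B V. stage_size B V s & (ALL I h Z. bound I = (NN I + kk I + 5) ^ 13 -->
  eval I (run I 0 Z (fst s) h) 1 (%_. 0) (snd s) = guesses (kk I) * (NN I + 2))" proof - let ?good = "%I. bound I = (NN I + kk I + 5) ^ 13"
 interpret lang ?good by unfold_locales simp
 have pow: "(kk I + 5) ^ j <= bound I" if "?good I" "j <= 13" for I j
 proof -
  have "(kk I + 5) ^ j <= (NN I + kk I + 5) ^ j" by (intro power_mono) auto
  also have "... <= bound I" unfolding that(1) using that(2) by (intro power_increasing) auto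
  finally show ?thesis .
 qed
 have W: "9 * width (kk I) * width (kk I) < bound I" if "?good I" for I using exponent_less pow[OF that order_refl] less_le_trans by blast
 have W9: "9 * width (kk I) <= bound I" if "?good I" for I
 proof -
  have "9 * width (kk I) <= 9 * width (kk I) * width (kk I)" using width_pos[of "kk I"] by simp
  thus ?thesis using W[OF that] by linarith
 qed
 have c: "j <= bound I" if "?good I" "j <= 9" for I j using W9[OF that(1)] width_pos[of "kk I"] that(2) by linarith
 have N: "NN I + 2 <= bound I" if "?good I" for I using that self_le_power[of "NN I + kk I + 5" 13] by linarith
 have base: "expr q n (%I Z. base (kk I))" if "0 < n" for q n
  unfolding base_def using that pow[of _ 1] by (intro expr_pow_const expr_add expr_kk expr_const) auto
 have "expr q n (%I Z. width (kk I))" if "0 < n" for q n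
  unfolding width_def using that by (intro expr_mult expr_const expr_add expr_kk c) auto
 hence "bexpr q n (%I Z. 9 * width (kk I) * width (kk I))" if "0 < n" for q n using that by (intro bexprI expr_mult expr_const W W9 c) auto
 hence "expr (%_ _ _. True) 1 (%I Z. (NN I + 2) * base (kk I) ^ (9 * width (kk I) * width (kk I)))"
  using pow[of _ 12] by (intro expr_mult expr_add expr_NN expr_const expr_pow base N) (auto simp: base_def)
 thus ?thesis unfolding guesses_def by (subst mult.commute) (rule stage_exists)
qed

lemma guesses_pos: "0 < guesses k" using exp_less_guesses by (rule le_less_trans[OF zero_le])

lemma stage3: "EX s B V. stage_size B V s & (ALL I h Z. bound I = guesses (kk I) * (NN I + 2) -->
  eval I (run I 0 Z (fst s) h) 1 (%_. 0) (snd s) = of_bool (points.solvable (NN I) (kk I) (rk I) (rd I)))" proof -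
 interpret algo "%I. bound I = guesses (kk I) * (NN I + 2)" by unfold_locales (simp_all add: guesses_pos)
 show ?thesis by (intro stage_exists expr_solvable) simp
qed

declare [[coercion_enabled = true]]

text \<open>Exponent of \<open>k + 5\<close> in a common bound for the three loop bounds: the number
  of guesses contributes \<open>12 * (9 * width k * width k)\<close>, the polynomial loop bound of
  the second stage 13.\<close>

definition growth :: "nat => nat" where
 "growth k = 12 * (9 * width k * width k) + 13"

lemma growth_bigo: "(%k. real (c * growth k) * log 2 (real (k + 5))) : O(%k. real k ^ 2 * log 2 (real k))"
proof (rule bigoI, rule eventually_at_top_linorderI)
 fix k :: nat assume k: "5 <= k"
 have "growth k = 2700 * ((k + 4) * (k + 4)) + 13" unfolding growth_def width_def by (simp add: algebra_simps)
 also have "... <= 2700 * ((2 * k) * (2 * k)) + 13 * (k * k)" using k by (intro add_mono mult_le_mono) auto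
 also have "... = 10813 * k ^ 2" by (simp add: power2_eq_square)
 finally have g: "real (growth k) <= 10813 * real k ^ 2" using of_nat_mono by fastforce
 have "k + 5 <= 5 * k" using k by simp
 also have "... <= k ^ 2" using k by (simp add: power2_eq_square)
 finally have "real (k + 5) <= real k ^ 2" by (metis of_nat_le_iff of_nat_power)
 hence "log 2 (real (k + 5)) <= log 2 (real k ^ 2)" using k by (intro log_mono) auto
 also have "... = 2 * log 2 (real k)" using k by (simp add: log_nat_power)
 finally have l: "log 2 (real (k + 5)) <= 2 * log 2 (real k)" .
 have "real (c * growth k) * log 2 (real (k + 5)) <= (real c * (10813 * real k ^ 2)) * (2 * log 2 (real k))"
  unfolding of_nat_mult using g l k by (intro mult_mono) auto
 moreover have "0 <= real (c * growth k) * log 2 (real (k + 5))" by simp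
 ultimately show "norm (real (c * growth k) * log 2 (real (k + 5))) <= real (c * 21626) * norm (real k ^ 2 * log 2 (real k))"
  using k by (simp add: mult.assoc mult.left_commute)
qed

lemma shift_power_bigo: "(%n. C * real (n + 2) ^ d) : O(%n. real n ^ d)"
proof (rule bigoI, rule eventually_at_top_linorderI)
 fix n :: nat assume n: "2 <= n"
 have "real (n + 2) ^ d <= (2 * real n) ^ d" using n by (intro power_mono) auto
 hence "\<bar>C\<bar> * real (n + 2) ^ d <= \<bar>C\<bar> * (2 * real n) ^ d" by (rule mult_left_mono) simp
 thus "norm (C * real (n + 2) ^ d) <= (\<bar>C\<bar> * 2 ^ d) * norm (real n ^ d)" by (simp add: abs_mult power_mult_distrib)
qed

theorem theorem1:
  shows "\<exists>(p :: program) (f :: nat \<Rightarrow> real) (g :: nat \<Rightarrow> real) (d :: nat).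
           f \<in> O(\<lambda>k. real k ^ 2 * log 2 (real k)) \<and>
           g \<in> O(\<lambda>n. real n ^ d) \<and>
           solves_optimal_discretization p (\<lambda>k n. 2 powr f k * g n)"
proof -
 define ev where "ev s I h Z = eval I (run I 0 Z (fst s) h) 1 (%_. 0) (snd s)" for s h Z and I :: inst
 obtain s1 B1 V1 where s1: "stage_size B1 V1 s1"
  and ev1: "!!I h Z. bound I = NN I + kk I + 5 ==> ev s1 I h Z = bound I ^ 13" unfolding ev_def using stage1 by blast
 obtain s2 B2 V2 where s2: "stage_size B2 V2 s2"
  and ev2: "!!I h Z. bound I = (NN I + kk I + 5) ^ 13 ==> ev s2 I h Z = guesses (kk I) * (NN I + 2)" unfolding ev_def using stage2 by blast
 obtain s3 B3 V3 where s3: "stage_size B3 V3 s3" and ev3: "!!I h Z. bound I = guesses (kk I) * (NN I + 2) ==>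
  ev s3 I h Z = of_bool (points.solvable (NN I) (kk I) (rk I) (rd I))" unfolding ev_def using stage3 by blast define V where "V = V1 + V2 + V3"
 define B where "B = B1 + B2 + B3 + V"
 have sz: "stage_size B V s1" "stage_size B V s2" "stage_size B V s3"
  using stage_size_mono[OF s1, of V B] stage_size_mono[OF s2, of V B] stage_size_mono[OF s3, of V B] unfolding B_def V_def by auto
 define p where "p = machine B V s1 s2 s3"
 define P where "P m = stage_cost m s1 + stage_cost m s2 + stage_cost m s3 + 13" for m
 have "poly_bound P" unfolding P_def by (intro poly_bound_add poly_bound_stage poly_bound_const)
 then obtain D where D: "P m <= D * (m + 2) ^ D" for m unfolding poly_bound_def by blast
 define f where "f k = real (D * growth k) * log 2 (real (k + 5))" for k
 \<comment> \<open>The factor 3 stands for the three stages, and \<open>2 ^ D\<close> comes from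
   \<open>m + 2 <= 2 * M\<close> for loop bounds \<open>m <= M\<close>.\<close>
 define g where "g n = real (3 * D * 2 ^ D) * real (n + 2) ^ (13 * D)" for n
 have "f : O(%k. real k ^ 2 * log 2 (real k))" unfolding f_def by (rule growth_bigo)
 moreover have "g : O(%n. real n ^ (13 * D))" unfolding g_def by (rule shift_power_bigo)
 moreover have "solves_optimal_discretization p (%k n. 2 powr f k * g n)" unfolding solves_optimal_discretization_def
 proof (intro allI impI, elim conjE)
  fix W1 W2 :: "point set" and k :: int and ws1 ws2 :: "point list"
  assume W: "distinct ws1" "set ws1 = W1" "distinct ws2" "set ws2 = W2"
  define N where "N = length ws1 + length ws2"
  have N: "card W1 + card W2 = N" unfolding N_def using W distinct_card by metis
  define M where "M = (nat k + 5) ^ growth (nat k) * (N + 2) ^ 13"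
  have pos: "(nat k + 5) ^ j > 0" "(N + 2) ^ j > 0" for j by auto
  have "2 powr f (nat k) = real ((nat k + 5) ^ (growth (nat k) * D))"
  proof -
  have "2 powr f (nat k) = real (nat k + 5) powr real (D * growth (nat k))" unfolding f_def by (simp add: powr_def log_def)
  thus ?thesis by (subst (asm) powr_realpow) (auto simp: mult.commute)
  qed
  hence T: "2 powr f (nat k) * g N = real (3 * D * (2 * M) ^ D)"
  unfolding g_def M_def by (simp add: power_mult_distrib power_mult[symmetric])
  have "1 <= (nat k + 5) ^ growth (nat k)" "2 <= (N + 2) ^ 13" using self_le_power[of "N + 2" 13] le_trans[of 2 "N + 2"] by simp_all
  hence M2: "2 <= M" unfolding M_def by (metis mult_le_mono mult_1)
  have cost: "stage_cost m0 s1 + stage_cost m1 s2 + stage_cost m2 s3 + 13 <= 3 * D * (2 * M) ^ D"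
  if "m0 <= M" "m1 <= M" "m2 <= M" for m0 m1 m2
  proof -
  have "D * (m + 2) ^ D <= D * (2 * M) ^ D" if "m <= M" for m using M2 that by (intro mult_le_mono2 power_mono) auto
  hence "P m <= D * (2 * M) ^ D" if "m <= M" for m using D[of m] that le_trans by blast
  from this[OF that(1)] this[OF that(2)] this[OF that(3)] show ?thesis unfolding P_def by simp
  qed
  show "halts_within p (input_cells ws1 ws2) (input_registers ws1 ws2 k) (optimal_discretization W1 W2 k) (2 powr f (nat k) * g (card W1 + card W2))"
  proof (cases "k < 0")
  case True
  have "~ optimal_discretization W1 W2 k" using True unfolding optimal_discretization_def by auto
  moreover have "4 <= 3 * D * (2 * M) ^ D" using cost[of 0 0 0] by simp
  ultimately show ?thesis unfolding N T
  using machine_reject[OF True, of B V s1 s2 s3 "input_cells ws1 ws2" ws1 ws2] unfolding p_def halts_within_def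
  by (simp add: of_nat_le_iff del: of_nat_mult of_nat_power) (meson le_trans of_nat_le_iff)
  next
  case False
  let ?cs = "input_cells ws1 ws2" and ?n1 = "length ws1" and ?n2 = "length ws2"
  let ?m0 = "?n1 + ?n2 + nat k + 5"
  define m1 where "m1 = ?m0 ^ 13"
  define m2 where "m2 = guesses (nat k) * (N + 2)"
  let ?i = "%m. inst ?n1 ?n2 (nat k) m ?cs"
  have i: "NN (?i m) = N" "kk (?i m) = nat k" "rk (?i m) = ranks ?cs N" "rd (?i m) = (%z. z < ?n1)" "bound (?i m) = m" for m
  unfolding NN_def kk_def rk_def rd_def inst_simps N_def by auto
  have b: "optimal_discretization W1 W2 k <-> points.solvable N (nat k) (ranks ?cs N) (%z. z < ?n1)"
  using optimal_discretization_iff[of k ws1 ws2] False W(2,4) unfolding N_def by simp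
  have "m1 <= ((nat k + 5) * (N + 2)) ^ 13" unfolding m1_def by (rule power_mono) (simp_all add: N_def algebra_simps)
  also have "... <= M" unfolding M_def power_mult_distrib growth_def by (intro mult_le_mono power_increasing) auto
  finally have "m1 <= M" .
  moreover have "?m0 <= m1" unfolding m1_def by (rule self_le_power) auto
  moreover have "m2 <= M" unfolding m2_def M_def growth_def guesses_def base_def power_mult[symmetric]
  by (intro mult_le_mono power_increasing self_le_power) auto
  ultimately have le: "?m0 <= M" "m1 <= M" "m2 <= M" by auto
  have "EX t <= stage_cost ?m0 s1 + stage_cost m1 s2 + stage_cost m2 s3 + 13.
  (step p ?cs ^^ t) (Running 0 (input_registers ws1 ws2 k)) = Halted (optimal_discretization W1 W2 k)" unfolding p_def
  proof (rule machine_correct[OF sz])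
  show "eval (?i ?m0) (run (?i ?m0) 0 Z (fst s1) h) 1 (%_. 0) (snd s1) = m1" for h Z
  using ev1[of "?i ?m0" h Z] unfolding ev_def i m1_def N_def by simp
  show "eval (?i m1) (run (?i m1) 0 Z (fst s2) h) 1 (%_. 0) (snd s2) = m2" for h Z
  using ev2[of "?i m1" h Z] unfolding ev_def i m1_def m2_def N_def by simp
  show "eval (?i m2) (run (?i m2) 0 Z (fst s3) h) 1 (%_. 0) (snd s3) = of_bool (optimal_discretization W1 W2 k)" for h Z
  using ev3[of "?i m2" h Z] unfolding ev_def i b m2_def by simp
  qed (use False in "auto simp: input_registers_def")
  then obtain t where "t <= 3 * D * (2 * M) ^ D"
  "(step p ?cs ^^ t) (Running 0 (input_registers ws1 ws2 k)) = Halted (optimal_discretization W1 W2 k)" using cost[OF le] le_trans by blast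
  thus ?thesis unfolding N T halts_within_def by (intro exI[of _ t] conjI) (simp_all only: of_nat_le_iff)
  qed
 qed
 ultimately show ?thesis by blast
qed

end
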